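(* Let $k$ be a field and let $\Lambda$ be a finite-dimensional split indecomposable weakly symmetric $k$-algebra with radical cube zero. Let $S_1,\dots,S_r$ be representatives of the isomorphism classes of simple left $\Lambda$-modules and let $\lambda$ be the spectral radius of the matrix $E=(\dim_k\operatorname{Ext}^1_\Lambda(S_i,S_j))_{1\le i,j\le r}$. If $\lambda>2$, then the only thick subcategories of $\operatorname{mod}\Lambda$ containing $\Lambda$ are $\operatorname{add}\Lambda$ and $\operatorname{mod}\Lambda$.
   Context: $\operatorname{mod}\Lambda$ is the category of finitely generated left $\Lambda$-modules and $\operatorname{add}\Lambda$ its subcategory of projective modules. $\Lambda$ is split if $\Lambda/\operatorname{rad}\Lambda\cong\prod_{i=1}^rM_{n_i}(k)$ as $k$-algebras; weakly symmetric if ${}_\Lambda\Lambda$ is injective and the socle and top of every indecomposable projective left $\Lambda$-module are isomorphic; of radical cube zero if $(\operatorname{rad}\Lambda)^3=0$; indecomposable if it is not a product of two nonzero algebras. The spectral radius is the maximum absolute value of the eigenvalues. A (full, isomorphism-closed) subcategory of $\operatorname{mod}\Lambda$ is thick if it is closed under direct summands and, for every short exact sequence, if two of the three terms belong to it then so does the third. *)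

theory Defs
  imports
    "HOL-Algebra.QuotRing"
    "HOL-Algebra.Ideal_Product"
    "Jordan_Normal_Form.Missing_VectorSpace"
    "Jordan_Normal_Form.Spectral_Radius"
begin

text \<open>
  The locale \<open>Module.module\<close> of HOL-Algebra requires a commutative ring of scalars and
  \<open>Module.algebra\<close> a commutative algebra; the two locales below drop commutativity
  and reuse the record \<open>module\<close>. When that record carries a mere module, its fields
  \<open>mult\<close> and \<open>one\<close> are meaningless.
\<close>

locale left_module = R?: ring R + M?: abelian_group M
  for R :: "('a, 'c) ring_scheme" (structure) and M :: "('a, 'm) module" (structure) +
  assumes smult_closed:
      "\<lbrakk>a \<in> carrier R; x \<in> carrier M\<rbrakk> \<Longrightarrow> a \<odot>\<^bsub>M\<^esub> x \<in> carrier M"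
    and smult_l_distr:
      "\<lbrakk>a \<in> carrier R; b \<in> carrier R; x \<in> carrier M\<rbrakk> \<Longrightarrow>
        (a \<oplus>\<^bsub>R\<^esub> b) \<odot>\<^bsub>M\<^esub> x = a \<odot>\<^bsub>M\<^esub> x \<oplus>\<^bsub>M\<^esub> b \<odot>\<^bsub>M\<^esub> x"
    and smult_r_distr:
      "\<lbrakk>a \<in> carrier R; x \<in> carrier M; y \<in> carrier M\<rbrakk> \<Longrightarrow>
        a \<odot>\<^bsub>M\<^esub> (x \<oplus>\<^bsub>M\<^esub> y) = a \<odot>\<^bsub>M\<^esub> x \<oplus>\<^bsub>M\<^esub> a \<odot>\<^bsub>M\<^esub> y"
    and smult_assoc1:
      "\<lbrakk>a \<in> carrier R; b \<in> carrier R; x \<in> carrier M\<rbrakk> \<Longrightarrow>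
        (a \<otimes>\<^bsub>R\<^esub> b) \<odot>\<^bsub>M\<^esub> x = a \<odot>\<^bsub>M\<^esub> (b \<odot>\<^bsub>M\<^esub> x)"
    and smult_one:
      "x \<in> carrier M \<Longrightarrow> \<one>\<^bsub>R\<^esub> \<odot>\<^bsub>M\<^esub> x = x"

locale k_algebra = Vec: vectorspace K A + Alg: ring A
  for K :: "('k, 'c) ring_scheme" and A :: "('k, 'a, 'd) module_scheme" (structure) +
  assumes smult_mult_left:
      "\<lbrakk>c \<in> carrier K; x \<in> carrier A; y \<in> carrier A\<rbrakk> \<Longrightarrow>
        (c \<odot>\<^bsub>A\<^esub> x) \<otimes>\<^bsub>A\<^esub> y = c \<odot>\<^bsub>A\<^esub> (x \<otimes>\<^bsub>A\<^esub> y)"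
    and smult_mult_right:
      "\<lbrakk>c \<in> carrier K; x \<in> carrier A; y \<in> carrier A\<rbrakk> \<Longrightarrow>
        x \<otimes>\<^bsub>A\<^esub> (c \<odot>\<^bsub>A\<^esub> y) = c \<odot>\<^bsub>A\<^esub> (x \<otimes>\<^bsub>A\<^esub> y)"


section \<open>Constructions on modules and algebras\<close>

definition module_iso ::
    "('a, 'c) ring_scheme \<Rightarrow> ('a, 'm) module \<Rightarrow> ('a, 'n) module \<Rightarrow> bool" where
  "module_iso R M N \<longleftrightarrow> (\<exists>f \<in> module_hom R M N. bij_betw f (carrier M) (carrier N))"

definition algebra_iso ::
    "('k, 'c) ring_scheme \<Rightarrow> ('k, 'a) module \<Rightarrow> ('k, 'b) module \<Rightarrow> bool" where
  "algebra_iso K A B \<longleftrightarrow>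
     (\<exists>h \<in> ring_iso A B. \<forall>c \<in> carrier K. \<forall>x \<in> carrier A. h (c \<odot>\<^bsub>A\<^esub> x) = c \<odot>\<^bsub>B\<^esub> h x)"

definition regular_module :: "('a, 'c) ring_scheme \<Rightarrow> ('a, 'a) module" where
  "regular_module R =
     \<lparr>carrier = carrier R, monoid.mult = monoid.mult R, one = one R, zero = zero R, add = add R,
      smult = monoid.mult R\<rparr>"

text \<open>Componentwise product: the product of two algebras, and the direct sum of two modules.\<close>

definition direct_prod ::
    "('r, 'a) module \<Rightarrow> ('r, 'b) module \<Rightarrow> ('r, 'a \<times> 'b) module" where
  "direct_prod A B =
     \<lparr>carrier = carrier A \<times> carrier B,
      monoid.mult = (\<lambda>(x, y) (x', y'). (x \<otimes>\<^bsub>A\<^esub> x', y \<otimes>\<^bsub>B\<^esub> y')),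
      one = (\<one>\<^bsub>A\<^esub>, \<one>\<^bsub>B\<^esub>),
      zero = (\<zero>\<^bsub>A\<^esub>, \<zero>\<^bsub>B\<^esub>),
      add = (\<lambda>(x, y) (x', y'). (x \<oplus>\<^bsub>A\<^esub> x', y \<oplus>\<^bsub>B\<^esub> y')),
      smult = (\<lambda>c (x, y). (c \<odot>\<^bsub>A\<^esub> x, c \<odot>\<^bsub>B\<^esub> y))\<rparr>"

definition prod_algebra ::
    "'i set \<Rightarrow> ('i \<Rightarrow> ('k, 'a) module) \<Rightarrow> ('k, 'i \<Rightarrow> 'a) module" where
  "prod_algebra I A =
     \<lparr>carrier = (\<Pi>\<^sub>E i\<in>I. carrier (A i)),
      monoid.mult = (\<lambda>x y. \<lambda>i\<in>I. x i \<otimes>\<^bsub>A i\<^esub> y i),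
      one = (\<lambda>i\<in>I. \<one>\<^bsub>A i\<^esub>),
      zero = (\<lambda>i\<in>I. \<zero>\<^bsub>A i\<^esub>),
      add = (\<lambda>x y. \<lambda>i\<in>I. x i \<oplus>\<^bsub>A i\<^esub> y i),
      smult = (\<lambda>c x. \<lambda>i\<in>I. c \<odot>\<^bsub>A i\<^esub> x i)\<rparr>"

definition matrix_algebra ::
    "('k, 'c) ring_scheme \<Rightarrow> nat \<Rightarrow> ('k, nat \<times> nat \<Rightarrow> 'k) module" where
  "matrix_algebra K n =
     \<lparr>carrier = {..<n} \<times> {..<n} \<rightarrow>\<^sub>E carrier K,
      monoid.mult = (\<lambda>A B. \<lambda>(i, j) \<in> {..<n} \<times> {..<n}. finsum K (\<lambda>l. A (i, l) \<otimes>\<^bsub>K\<^esub> B (l, j)) {..<n}),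
      one = (\<lambda>(i, j) \<in> {..<n} \<times> {..<n}. if i = j then \<one>\<^bsub>K\<^esub> else \<zero>\<^bsub>K\<^esub>),
      zero = (\<lambda>ij \<in> {..<n} \<times> {..<n}. \<zero>\<^bsub>K\<^esub>),
      add = (\<lambda>A B. \<lambda>ij \<in> {..<n} \<times> {..<n}. A ij \<oplus>\<^bsub>K\<^esub> B ij),
      smult = (\<lambda>c A. \<lambda>ij \<in> {..<n} \<times> {..<n}. c \<otimes>\<^bsub>K\<^esub> A ij)\<rparr>"

text \<open>
  The quotient by a submodule or, when \<open>N\<close> is a two-sided ideal of an algebra, the quotient
  algebra: \<open>FactRing\<close> together with the induced scalar multiplication.
\<close>

definition quot_module :: "('r, 'm) module \<Rightarrow> 'm set \<Rightarrow> ('r, 'm set) module" where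
  "quot_module M N = ring.extend (M Quot N)
     (module.fields (\<lambda>r X. \<Union>x\<in>X. N +>\<^bsub>M\<^esub> (r \<odot>\<^bsub>M\<^esub> x)))"


section \<open>Submodules, socle and radical\<close>

definition zero_module :: "('r, 'm) module \<Rightarrow> bool" where
  "zero_module M \<longleftrightarrow> carrier M = {\<zero>\<^bsub>M\<^esub>}"

text \<open>\<open>Module.submodule\<close>, unlike \<open>LinearCombinations.submodule\<close>, does not assume
  commutative scalars.\<close>

definition submodule_generated :: "('a, 'c) ring_scheme \<Rightarrow> ('a, 'm) module \<Rightarrow> 'm set \<Rightarrow> 'm set" where
  "submodule_generated R M A = \<Inter> {N. Module.submodule N R M \<and> A \<subseteq> N}"

definition finitely_generated :: "('a, 'c) ring_scheme \<Rightarrow> ('a, 'm) module \<Rightarrow> bool" where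
  "finitely_generated R M \<longleftrightarrow>
     (\<exists>A. finite A \<and> A \<subseteq> carrier M \<and> submodule_generated R M A = carrier M)"

definition simple_module :: "('a, 'c) ring_scheme \<Rightarrow> ('a, 'm) module \<Rightarrow> bool" where
  "simple_module R M \<longleftrightarrow> left_module R M \<and> \<not> zero_module M \<and>
     (\<forall>N. Module.submodule N R M \<longrightarrow> N = {\<zero>\<^bsub>M\<^esub>} \<or> N = carrier M)"

definition maximal_submodule :: "('a, 'c) ring_scheme \<Rightarrow> ('a, 'm) module \<Rightarrow> 'm set \<Rightarrow> bool" where
  "maximal_submodule R M N \<longleftrightarrow> Module.submodule N R M \<and> N \<noteq> carrier M \<and>
     (\<forall>N'. Module.submodule N' R M \<and> N \<subseteq> N' \<longrightarrow> N' = N \<or> N' = carrier M)"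

definition radical :: "('a, 'c) ring_scheme \<Rightarrow> ('a, 'm) module \<Rightarrow> 'm set" where
  "radical R M = carrier M \<inter> \<Inter> {N. maximal_submodule R M N}"

definition socle :: "('a, 'c) ring_scheme \<Rightarrow> ('a, 'm) module \<Rightarrow> 'm set" where
  "socle R M = submodule_generated R M
     (\<Union> {N. Module.submodule N R M \<and> simple_module R (M\<lparr>carrier := N\<rparr>)})"

definition jacobson_radical :: "('a, 'c) ring_scheme \<Rightarrow> 'a set" where
  "jacobson_radical R = radical R (regular_module R)"


section \<open>The module category\<close>

text \<open>
  A collection of modules has to live in one type. Over a ring with elements in \<open>'a\<close> we take
  modules whose elements are lists over \<open>'a\<close>: by \<open>fg_module_representable\<close> at the end
  of this theory, every finitely generated module, over whatever type, is isomorphic to one of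
  these. Full isomorphism-closed subcategories are represented by their sets of objects.
\<close>

definition fg_modules :: "('a, 'c) ring_scheme \<Rightarrow> ('a, 'a list) module set" where
  "fg_modules R = {M. left_module R M \<and> finitely_generated R M}"

text \<open>
  In the next two definitions the test modules \<open>A\<close> and \<open>B\<close> range over the above universe only.
  Nothing is lost: by Baer's criterion inclusions of left ideals suffice to test injectivity, and
  a finitely generated module is projective as soon as it has the lifting property for a
  surjection from a finitely generated free module.
\<close>

definition injective_module :: "('a, 'c) ring_scheme \<Rightarrow> ('a, 'm) module \<Rightarrow> bool" where
  "injective_module R I \<longleftrightarrow> left_module R I \<and>
     (\<forall>(A :: ('a, 'a list) module) (B :: ('a, 'a list) module) i f.
        left_module R A \<and> left_module R B \<and>
        i \<in> module_hom R A B \<and> inj_on i (carrier A) \<and> f \<in> module_hom R A I \<longrightarrow>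
        (\<exists>g \<in> module_hom R B I. \<forall>x \<in> carrier A. g (i x) = f x))"

definition projective_module :: "('a, 'c) ring_scheme \<Rightarrow> ('a, 'm) module \<Rightarrow> bool" where
  "projective_module R P \<longleftrightarrow> left_module R P \<and>
     (\<forall>(A :: ('a, 'a list) module) (B :: ('a, 'a list) module) p f.
        left_module R A \<and> left_module R B \<and>
        p \<in> module_hom R A B \<and> p ` carrier A = carrier B \<and> f \<in> module_hom R P B \<longrightarrow>
        (\<exists>g \<in> module_hom R P A. \<forall>x \<in> carrier P. p (g x) = f x))"

definition fg_projectives :: "('a, 'c) ring_scheme \<Rightarrow> ('a, 'a list) module set" where
  "fg_projectives R = {P \<in> fg_modules R. projective_module R P}"

definition indecomposable_module :: "('a, 'c) ring_scheme \<Rightarrow> ('a, 'a list) module \<Rightarrow> bool" where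
  "indecomposable_module R M \<longleftrightarrow> left_module R M \<and> \<not> zero_module M \<and>
     (\<forall>(A :: ('a, 'a list) module) (B :: ('a, 'a list) module).
        left_module R A \<and> left_module R B \<and> module_iso R M (direct_prod A B) \<longrightarrow>
        zero_module A \<or> zero_module B)"

definition short_exact ::
    "('a, 'c) ring_scheme \<Rightarrow> ('a, 'l) module \<Rightarrow> ('l \<Rightarrow> 'm) \<Rightarrow> ('a, 'm) module \<Rightarrow>
     ('m \<Rightarrow> 'n) \<Rightarrow> ('a, 'n) module \<Rightarrow> bool" where
  "short_exact R L f M g N \<longleftrightarrow>
     f \<in> module_hom R L M \<and> g \<in> module_hom R M N \<and>
     inj_on f (carrier L) \<and> f ` carrier L = a_kernel M N g \<and> g ` carrier M = carrier N"

definition thick_subcategory ::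
    "('a, 'c) ring_scheme \<Rightarrow> ('a, 'a list) module set \<Rightarrow> bool" where
  "thick_subcategory R C \<longleftrightarrow>
     C \<subseteq> fg_modules R \<and>
     (\<forall>M \<in> C. \<forall>N \<in> fg_modules R. module_iso R M N \<longrightarrow> N \<in> C) \<and>
     (\<forall>M \<in> C. \<forall>A \<in> fg_modules R. \<forall>B \<in> fg_modules R.
        module_iso R M (direct_prod A B) \<longrightarrow> A \<in> C) \<and>
     (\<forall>L \<in> fg_modules R. \<forall>M \<in> fg_modules R. \<forall>N \<in> fg_modules R. \<forall>f g.
        short_exact R L f M g N \<longrightarrow>
          (L \<in> C \<and> M \<in> C \<longrightarrow> N \<in> C) \<and>
          (L \<in> C \<and> N \<in> C \<longrightarrow> M \<in> C) \<and>
          (M \<in> C \<and> N \<in> C \<longrightarrow> L \<in> C))"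

text \<open>The regular module itself does not live in the universe, but its isomorphic copies do.\<close>

definition contains_regular ::
    "('a, 'c) ring_scheme \<Rightarrow> ('a, 'a list) module set \<Rightarrow> bool" where
  "contains_regular R C \<longleftrightarrow> (\<exists>M \<in> C. module_iso R (regular_module R) M)"

definition simple_representatives ::
    "('a, 'c) ring_scheme \<Rightarrow> nat \<Rightarrow> (nat \<Rightarrow> ('a, 'a list) module) \<Rightarrow> bool" where
  "simple_representatives R r S \<longleftrightarrow>
     (\<forall>i < r. simple_module R (S i)) \<and>
     (\<forall>i < r. \<forall>j < r. module_iso R (S i) (S j) \<longrightarrow> i = j) \<and>
     (\<forall>M :: ('a, 'a list) module. simple_module R M \<longrightarrow> (\<exists>i < r. module_iso R M (S i)))"


section \<open>Extension groups\<close>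

text \<open>The scalars act on \<open>Hom\<close> through the ring homomorphism sending \<open>c\<close> to
  \<open>c \<odot> \<one>\<close>; functions are extensional so that equality of maps is equality on the carrier.\<close>

definition Hom_space ::
    "('k, 'a) module \<Rightarrow> ('a, 'm) module \<Rightarrow> ('a, 'n) module \<Rightarrow> ('k, 'm \<Rightarrow> 'n) module" where
  "Hom_space \<Lambda> M N =
     \<lparr>carrier = module_hom \<Lambda> M N \<inter> extensional (carrier M),
      monoid.mult = undefined,
      one = undefined,
      zero = (\<lambda>x \<in> carrier M. \<zero>\<^bsub>N\<^esub>),
      add = (\<lambda>f g. \<lambda>x \<in> carrier M. f x \<oplus>\<^bsub>N\<^esub> g x),
      smult = (\<lambda>c f. \<lambda>x \<in> carrier M. (c \<odot>\<^bsub>\<Lambda>\<^esub> \<one>\<^bsub>\<Lambda>\<^esub>) \<odot>\<^bsub>N\<^esub> f x)\<rparr>"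

text \<open>\<open>d 0\<close> is the augmentation \<open>P 0 \<rightarrow> M\<close>, and \<open>d (Suc n)\<close> the differential
  \<open>P (Suc n) \<rightarrow> P n\<close>.\<close>

definition projective_resolution ::
    "('a, 'c) ring_scheme \<Rightarrow> ('a, 'a list) module \<Rightarrow> (nat \<Rightarrow> ('a, 'a list) module) \<Rightarrow>
     (nat \<Rightarrow> 'a list \<Rightarrow> 'a list) \<Rightarrow> bool" where
  "projective_resolution R M P d \<longleftrightarrow>
     (\<forall>n. P n \<in> fg_projectives R) \<and>
     d 0 \<in> module_hom R (P 0) M \<and> d 0 ` carrier (P 0) = carrier M \<and>
     (\<forall>n. d (Suc n) \<in> module_hom R (P (Suc n)) (P n)) \<and>
     d (Suc 0) ` carrier (P (Suc 0)) = a_kernel (P 0) M (d 0) \<and>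
     (\<forall>n. d (Suc (Suc n)) ` carrier (P (Suc (Suc n))) = a_kernel (P (Suc n)) (P n) (d (Suc n)))"

definition Ext_cocycles ::
    "('k, 'a) module \<Rightarrow> (nat \<Rightarrow> ('a, 'a list) module) \<Rightarrow> (nat \<Rightarrow> 'a list \<Rightarrow> 'a list) \<Rightarrow>
     nat \<Rightarrow> ('a, 'n) module \<Rightarrow> ('a list \<Rightarrow> 'n) set" where
  "Ext_cocycles \<Lambda> P d n N =
     {f \<in> carrier (Hom_space \<Lambda> (P n) N). \<forall>x \<in> carrier (P (Suc n)). f (d (Suc n) x) = \<zero>\<^bsub>N\<^esub>}"

definition Ext_coboundaries ::
    "('k, 'a) module \<Rightarrow> (nat \<Rightarrow> ('a, 'a list) module) \<Rightarrow> (nat \<Rightarrow> 'a list \<Rightarrow> 'a list) \<Rightarrow>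
     nat \<Rightarrow> ('a, 'n) module \<Rightarrow> ('a list \<Rightarrow> 'n) set" where
  "Ext_coboundaries \<Lambda> P d n N =
     (case n of
        0 \<Rightarrow> {\<zero>\<^bsub>Hom_space \<Lambda> (P 0) N\<^esub>}
      | Suc m \<Rightarrow> (\<lambda>g. \<lambda>x \<in> carrier (P n). g (d n x)) ` carrier (Hom_space \<Lambda> (P m) N))"

text \<open>
  \<open>Ext \<Lambda> n M N\<close> is the \<open>n\<close>-th right derived functor of \<open>Hom(-, N)\<close> at \<open>M\<close>, as a vector
  space over the base field: the \<open>n\<close>-th cohomology of \<open>Hom(P, N)\<close> for a chosen resolution \<open>P\<close> of
  \<open>M\<close> by finitely generated projectives. It is meant for finitely generated \<open>M\<close> over a
  finite-dimensional algebra, where such resolutions exist and the choice is immaterial up to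
  isomorphism.
\<close>

definition Ext ::
    "('k, 'a) module \<Rightarrow> nat \<Rightarrow> ('a, 'a list) module \<Rightarrow> ('a, 'n) module \<Rightarrow>
     ('k, ('a list \<Rightarrow> 'n) set) module" where
  "Ext \<Lambda> n M N =
     (let (P, d) = (SOME (P, d). projective_resolution \<Lambda> M P d) in
        quot_module ((Hom_space \<Lambda> (P n) N)\<lparr>carrier := Ext_cocycles \<Lambda> P d n N\<rparr>)
          (Ext_coboundaries \<Lambda> P d n N))"

definition ext_matrix ::
    "('k, 'c) ring_scheme \<Rightarrow> ('k, 'a) module \<Rightarrow> nat \<Rightarrow> (nat \<Rightarrow> ('a, 'a list) module) \<Rightarrow>
     complex mat" where
  "ext_matrix K \<Lambda> r S =
     mat r r (\<lambda>(i, j). of_nat (vectorspace.dim K (Ext \<Lambda> 1 (S i) (S j))))"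


section \<open>Classes of algebras\<close>

definition split_algebra :: "('k, 'c) ring_scheme \<Rightarrow> ('k, 'a) module \<Rightarrow> bool" where
  "split_algebra K \<Lambda> \<longleftrightarrow>
     (\<exists>ns :: nat list. (\<forall>n \<in> set ns. n \<ge> 1) \<and>
        algebra_iso K (quot_module \<Lambda> (jacobson_radical \<Lambda>))
          (prod_algebra {..<length ns} (\<lambda>i. matrix_algebra K (ns ! i))))"

text \<open>The factors can be taken over the type \<open>'a\<close>, since each factor of a product
  decomposition of \<open>\<Lambda>\<close> embeds into \<open>\<Lambda>\<close>.\<close>

definition indecomposable_algebra :: "('k, 'c) ring_scheme \<Rightarrow> ('k, 'a) module \<Rightarrow> bool" where
  "indecomposable_algebra K \<Lambda> \<longleftrightarrow>
     \<not> (\<exists>(A :: ('k, 'a) module) (B :: ('k, 'a) module).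
          k_algebra K A \<and> k_algebra K B \<and> \<not> zero_module A \<and> \<not> zero_module B \<and>
          algebra_iso K \<Lambda> (direct_prod A B))"

definition weakly_symmetric :: "('a, 'c) ring_scheme \<Rightarrow> bool" where
  "weakly_symmetric R \<longleftrightarrow>
     injective_module R (regular_module R) \<and>
     (\<forall>P \<in> fg_projectives R. indecomposable_module R P \<longrightarrow>
        module_iso R (P\<lparr>carrier := socle R P\<rparr>) (quot_module P (radical R P)))"

definition radical_cube_zero :: "('a, 'c) ring_scheme \<Rightarrow> bool" where
  "radical_cube_zero R \<longleftrightarrow>
     ideal_prod R (ideal_prod R (jacobson_radical R) (jacobson_radical R)) (jacobson_radical R)
       = {\<zero>\<^bsub>R\<^esub>}"


section \<open>The universe contains all finitely generated modules\<close>

primrec list_comb :: "('a, 'm) module \<Rightarrow> 'm list \<Rightarrow> 'a list \<Rightarrow> 'm" where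
  "list_comb M [] rs = \<zero>\<^bsub>M\<^esub>"
| "list_comb M (x # xs) rs = hd rs \<odot>\<^bsub>M\<^esub> x \<oplus>\<^bsub>M\<^esub> list_comb M xs (tl rs)"


lemma (in left_module) smult_zero:
  assumes "a \<in> carrier R"
  shows "a \<odot>\<^bsub>M\<^esub> \<zero>\<^bsub>M\<^esub> = \<zero>\<^bsub>M\<^esub>"
  using assms smult_r_distr[of a "\<zero>\<^bsub>M\<^esub>" "\<zero>\<^bsub>M\<^esub>"]
    M.add.l_cancel_one'[of "a \<odot>\<^bsub>M\<^esub> \<zero>\<^bsub>M\<^esub>" "a \<odot>\<^bsub>M\<^esub> \<zero>\<^bsub>M\<^esub>"]
  by (simp add: smult_closed)

lemma (in left_module) zero_smult:
  assumes "x \<in> carrier M"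
  shows "\<zero>\<^bsub>R\<^esub> \<odot>\<^bsub>M\<^esub> x = \<zero>\<^bsub>M\<^esub>"
  using assms smult_l_distr[of "\<zero>\<^bsub>R\<^esub>" "\<zero>\<^bsub>R\<^esub>" x]
    M.add.l_cancel_one'[of "\<zero>\<^bsub>R\<^esub> \<odot>\<^bsub>M\<^esub> x" "\<zero>\<^bsub>R\<^esub> \<odot>\<^bsub>M\<^esub> x"]
  by (simp add: smult_closed)

lemma (in left_module) minus_one_smult:
  assumes "x \<in> carrier M"
  shows "(\<ominus>\<^bsub>R\<^esub> \<one>\<^bsub>R\<^esub>) \<odot>\<^bsub>M\<^esub> x = \<ominus>\<^bsub>M\<^esub> x"
proof -
  have "(\<ominus>\<^bsub>R\<^esub> \<one>\<^bsub>R\<^esub>) \<odot>\<^bsub>M\<^esub> x \<oplus>\<^bsub>M\<^esub> x = \<zero>\<^bsub>M\<^esub>"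
    using assms smult_l_distr[of "\<ominus>\<^bsub>R\<^esub> \<one>\<^bsub>R\<^esub>" "\<one>\<^bsub>R\<^esub>" x]
    by (simp add: smult_one zero_smult R.l_neg)
  then show ?thesis
    using assms by (intro M.minus_equality[symmetric]) (simp_all add: smult_closed)
qed

lemma (in left_module) left_submoduleI:
  assumes "H \<subseteq> carrier M" "\<zero>\<^bsub>M\<^esub> \<in> H"
    and "\<And>a b. a \<in> H \<Longrightarrow> b \<in> H \<Longrightarrow> a \<oplus>\<^bsub>M\<^esub> b \<in> H"
    and sm: "\<And>a x. a \<in> carrier R \<Longrightarrow> x \<in> H \<Longrightarrow> a \<odot>\<^bsub>M\<^esub> x \<in> H"
  shows "Module.submodule H R M"
proof -
  have "\<ominus>\<^bsub>M\<^esub> x \<in> H" if "x \<in> H" for x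
    using sm[of "\<ominus>\<^bsub>R\<^esub> \<one>\<^bsub>R\<^esub>" x] that assms(1) minus_one_smult[of x]
    by (auto simp: subset_iff)
  then show ?thesis
    using assms unfolding Module.submodule_def submodule_axioms_def
    by (auto intro!: subgroup.intro simp: a_inv_def)
qed

context left_module
begin

lemma list_comb_closed:
  assumes "set xs \<subseteq> carrier M" "length rs = length xs" "set rs \<subseteq> carrier R"
  shows "list_comb M xs rs \<in> carrier M"
  using assms
proof (induction xs arbitrary: rs)
  case (Cons x xs)
  then show ?case by (cases rs) (auto simp: smult_closed)
qed simp

lemma list_comb_add:
  assumes "set xs \<subseteq> carrier M" "length rs = length xs" "set rs \<subseteq> carrier R"
    "length ss = length xs" "set ss \<subseteq> carrier R"
  shows "list_comb M xs (map2 (add R) rs ss) = list_comb M xs rs \<oplus>\<^bsub>M\<^esub> list_comb M xs ss"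
  using assms
proof (induction xs arbitrary: rs ss)
  case (Cons x xs)
  then obtain a as b bs where "rs = a # as" "ss = b # bs"
    by (metis length_Suc_conv list.size(4) One_nat_def add_Suc_right add_0_right)
  with Cons show ?case
    using list_comb_closed[of xs as] list_comb_closed[of xs bs]
    by (simp add: smult_l_distr smult_closed M.a_ac)
qed simp

lemma list_comb_smult:
  assumes "set xs \<subseteq> carrier M" "length rs = length xs" "set rs \<subseteq> carrier R" "c \<in> carrier R"
  shows "list_comb M xs (map (monoid.mult R c) rs) = c \<odot>\<^bsub>M\<^esub> list_comb M xs rs"
  using assms
proof (induction xs arbitrary: rs)
  case Nil
  then show ?case by (simp add: smult_zero)
next
  case (Cons x xs)
  then obtain a as where "rs = a # as"
    by (metis length_Suc_conv list.size(4) One_nat_def add_Suc_right add_0_right)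
  with Cons show ?case
    using list_comb_closed[of xs as]
    by (simp add: smult_r_distr smult_closed smult_assoc1)
qed

lemma list_comb_zero:
  assumes "set xs \<subseteq> carrier M"
  shows "list_comb M xs (replicate (length xs) \<zero>\<^bsub>R\<^esub>) = \<zero>\<^bsub>M\<^esub>"
  using assms by (induction xs) (auto simp: zero_smult)

lemma list_comb_generator:
  assumes "set xs \<subseteq> carrier M" "x \<in> set xs"
  shows "\<exists>rs. length rs = length xs \<and> set rs \<subseteq> carrier R \<and> list_comb M xs rs = x"
  using assms
proof (induction xs)
  case (Cons y xs)
  show ?case
  proof (cases "x = y")
    case True
    show ?thesis
      using Cons.prems True
      by (intro exI[of _ "\<one>\<^bsub>R\<^esub> # replicate (length xs) \<zero>\<^bsub>R\<^esub>"])
        (auto simp: list_comb_zero smult_one set_replicate_conv_if)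
  next
    case False
    then obtain rs where "length rs = length xs" "set rs \<subseteq> carrier R" "list_comb M xs rs = x"
      using Cons by auto
    then show ?thesis
      using Cons.prems
      by (intro exI[of _ "\<zero>\<^bsub>R\<^esub> # rs"]) (auto simp: zero_smult)
  qed
qed simp

lemma list_comb_surj:
  assumes "finitely_generated R M"
  shows "\<exists>xs. set xs \<subseteq> carrier M \<and>
    (\<forall>x \<in> carrier M. \<exists>rs. length rs = length xs \<and> set rs \<subseteq> carrier R \<and> list_comb M xs rs = x)"
proof -
  obtain A where A: "finite A" "A \<subseteq> carrier M" "submodule_generated R M A = carrier M"
    using assms by (auto simp: finitely_generated_def)
  obtain xs where xs: "set xs = A"
    using finite_list[OF A(1)] by blast
  define H where
    "H = {x. \<exists>rs. length rs = length xs \<and> set rs \<subseteq> carrier R \<and> list_comb M xs rs = x}"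
  have xsM: "set xs \<subseteq> carrier M"
    using xs A by simp
  have "Module.submodule H R M"
  proof (rule left_submoduleI)
    show "H \<subseteq> carrier M"
      using xsM by (auto simp: H_def list_comb_closed)
    show "\<zero>\<^bsub>M\<^esub> \<in> H"
      unfolding H_def using list_comb_zero[OF xsM]
      by (intro CollectI exI[of _ "replicate (length xs) \<zero>\<^bsub>R\<^esub>"]) auto
    show "a \<oplus>\<^bsub>M\<^esub> b \<in> H" if ab: "a \<in> H" "b \<in> H" for a b
    proof -
      obtain rs ss where rs: "length rs = length xs" "set rs \<subseteq> carrier R" "list_comb M xs rs = a"
        and ss: "length ss = length xs" "set ss \<subseteq> carrier R" "list_comb M xs ss = b"
        using ab by (auto simp: H_def)
      have "set (map2 (add R) rs ss) \<subseteq> carrier R"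
        using rs(2) ss(2) by (force dest: set_zip_leftD set_zip_rightD)
      then show ?thesis
        unfolding H_def using list_comb_add[OF xsM rs(1,2) ss(1,2)] rs ss
        by (intro CollectI exI[of _ "map2 (add R) rs ss"]) auto
    qed
    show "a \<odot>\<^bsub>M\<^esub> x \<in> H" if a: "a \<in> carrier R" and x: "x \<in> H" for a x
    proof -
      obtain rs where rs: "length rs = length xs" "set rs \<subseteq> carrier R" "list_comb M xs rs = x"
        using x by (auto simp: H_def)
      then show ?thesis
        unfolding H_def using list_comb_smult[OF xsM rs(1,2) a] a
        by (intro CollectI exI[of _ "map (monoid.mult R a) rs"]) auto
    qed
  qed
  moreover have "A \<subseteq> H"
    unfolding H_def using list_comb_generator[OF xsM] xs by auto
  ultimately have "carrier M \<subseteq> H"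
    using A(3) by (auto simp: submodule_generated_def)
  then show ?thesis
    using xsM by (auto simp: H_def)
qed

end

theorem fg_module_representable:
  fixes R :: "('a, 'c) ring_scheme" and M :: "('a, 'm) module"
  assumes "left_module R M" "finitely_generated R M"
  shows "\<exists>N :: ('a, 'a list) module. left_module R N \<and> module_iso R M N"
proof -
  interpret left_module R M by fact
  obtain xs where xs: "\<And>x. x \<in> carrier M \<Longrightarrow> \<exists>rs. list_comb M xs rs = x"
    using list_comb_surj[OF assms(2)] by blast
  define d where "d = list_comb M xs"
  define e where "e x = (SOME rs. d rs = x)" for x
  have de: "d (e x) = x" if "x \<in> carrier M" for x
    unfolding e_def using someI_ex[of "\<lambda>rs. d rs = x"] xs[OF that] by (auto simp: d_def)
  define N :: "('a, 'a list) module" where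
    "N = \<lparr>carrier = e ` carrier M, monoid.mult = undefined, one = undefined, zero = e \<zero>\<^bsub>M\<^esub>,
       add = (\<lambda>u v. e (d u \<oplus>\<^bsub>M\<^esub> d v)), smult = (\<lambda>r u. e (r \<odot>\<^bsub>M\<^esub> d u))\<rparr>"
  have "abelian_group N"
  proof (rule abelian_groupI)
    show "\<exists>y\<in>carrier N. y \<oplus>\<^bsub>N\<^esub> x = \<zero>\<^bsub>N\<^esub>" if "x \<in> carrier N" for x
      using that by (auto simp: N_def de M.l_neg intro!: bexI[of _ "\<ominus>\<^bsub>M\<^esub> _"])
  qed (auto simp: N_def de M.a_ac)
  then have N: "left_module R N"
    using R.ring_axioms
    by (auto intro!: left_module.intro left_module_axioms.intro
        simp: N_def de smult_closed smult_l_distr smult_r_distr smult_assoc1 smult_one)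
  have "inj_on e (carrier M)"
    by (rule inj_on_inverseI[of _ d]) (rule de)
  then have "bij_betw e (carrier M) (carrier N)"
    by (simp add: bij_betw_def N_def)
  moreover have "e \<in> module_hom R M N"
    by (auto simp: module_hom_def N_def de)
  ultimately show ?thesis
    using N by (auto simp: module_iso_def)
qed

end

theory Submission
  imports Defs
begin

text \<open>
  Let \<open>C\<close> be thick, contain \<open>\<Lambda>\<close> and contain a nonprojective module. A nonprojective module in \<open>C\<close> of
  least dimension has Loewy length two, since otherwise an indecomposable (projective-injective)
  summand splits off. If no simple module lies in \<open>C\<close>, every \<open>M\<close> of Loewy length two in \<open>C\<close> has
  equal socle and radical and is described by the dimension vectors \<open>a\<close>, \<open>b\<close> of its top and its
  radical; syzygies and cosyzygies act on the pairs \<open>(a, b)\<close> by \<open>(E a - b, a)\<close> and \<open>(b, E b - a)\<close>,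
  so the pairs of the syzygies form a two-sided sequence with
  \<open>a (n + 1) + a (n - 1) = E (a n)\<close>. As \<open>E\<close> is symmetric with spectral radius above two, this
  sequence grows exponentially in both directions, and \<open>a 0 \<bullet> a m > a 1 \<bullet> a (m - 1)\<close> for some
  \<open>m \<ge> 1\<close>. For \<open>M\<close> of least dimension and \<open>Y\<close> its \<open>m\<close>-th syzygy, counting parameters gives a nonzero
  map \<open>M \<rightarrow> Y\<close> whose cokernel is a summand of its cone and hence in \<open>C\<close>. Its image is then in \<open>C\<close> as
  well, so the map is injective by minimality, and the pairs of \<open>Y\<close> dominate those of \<open>M\<close> along all
  cosyzygies, contradicting the growth for \<open>n \<rightarrow> -\<infinity>\<close>. So \<open>C\<close> contains a simple module, hence all of them
  by connectedness of the quiver, hence all modules. Here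
  \<open>E i j\<close> counts arrows of the quiver; it bounds the dimension of \<open>Ext\<close>, which is all that the
  hypothesis on the spectral radius requires.
\<close>

\<comment> \<open>The obstacle is that \<open>C\<close> is closed under cones but not under kernels
  and cokernels, so a map found by counting says nothing about \<open>C\<close> by itself. The maps
  used are therefore strict: an image that lies in the socle of the target is already the image of a
  socle element. Strictness splits the cokernel off the cone, and it makes 0 -> M -> Y -> Q -> 0
  exact on socles as well, so the pair of \<open>Q\<close> is the difference of those of
  \<open>Y\<close> and \<open>M\<close>. As \<open>Q\<close> lies in \<open>C\<close>, its
  cosyzygies have pairs too, and their nonnegativity is the domination. Strictness is bought by
  sending the generators of \<open>M\<close> into complements of the socle of \<open>Y\<close>: this
  leaves a 0 . a m unknowns against a 1 . a (m - 1) linear conditions, and the difference of the two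
  numbers depends only on \<open>m\<close>, not on where in the sequence one starts. The field is
  arbitrary; splitness enters through the corners of primitive idempotents, which are K modulo the
  radical. The bound 2 enters twice: it makes the weights of the sequence strictly convex, and it
  excludes projectives of Loewy length at most two.\<close>
syntax "_index" :: "logic => index" ("\<^sub>_" [1000])

abbreviation car :: "('a, 'b) partial_object_scheme => 'a set" where "car == carrier"

section \<open>Integer sequences with \<open>a (n + 1) + a (n - 1) = E (a n)\<close>\<close>

text \<open>First differences grow by at least \<open>\<eta>\<close> at each step, so after a
  possibly negative start they exceed 1 and the sequence passes every bound. The lower limit
  \<open>k0\<close> is kept because the bounds to be contradicted hold only from some index
  on.\<close>

lemma unbounded_of_convex:
 fixes \<beta> :: "nat => real"
 assumes "\<eta> > 0" and conv: "!!k. \<beta> (Suc (Suc k)) - \<beta> (Suc k) >= \<beta> (Suc k) - \<beta> k + \<eta>"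
 shows "\<exists>k\<ge>k0. \<beta> k > B"
proof -
 have d: "\<beta> (Suc k) - \<beta> k >= \<beta> 1 - \<beta> 0 + real k * \<eta>" for k
 proof (induction k)
  case (Suc k)
  then show ?case using conv[of k] by (simp add: algebra_simps)
 qed simp
 obtain K0 :: nat where K0: "real K0 * \<eta> >= 1 - (\<beta> 1 - \<beta> 0)"
  using ex_less_of_nat_mult[OF assms(1), of "1 - (\<beta> 1 - \<beta> 0)"] by (auto intro: less_imp_le)
 define K where "K = max K0 k0"
 have "real K * \<eta> >= 1 - (\<beta> 1 - \<beta> 0)"
  using K0 assms(1) by (smt (verit) K_def max.cobounded1 mult_right_mono of_nat_le_iff)
 then have step: "\<beta> (Suc k) >= \<beta> k + 1" if "k >= K" for k
  using d[of k] that assms(1) by (smt (verit) mult_right_mono of_nat_le_iff)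
 have lin: "\<beta> (K + n) >= \<beta> K + real n" for n
 proof (induction n)
  case (Suc n)
  then show ?case using step[of "K + n"] by simp
 qed simp
 obtain n :: nat where "real n > B - \<beta> K"
  using reals_Archimedean2 by blast
 then show ?thesis
  using lin[of n] by (intro exI[of _ "K + n"]) (auto simp: K_def)
qed

text \<open>A connected graph with multiplicities. Connectedness is phrased through nonempty sets
  closed under neighbours: this is the form that a block decomposition of the algebra refutes, and
  every use of it below is a closure argument.\<close>

locale adjacency_form =
 fixes r :: nat and E :: "nat => nat => nat"
 assumes sym: "i < r ==> j < r ==> E i j = E j i"
  and connected: "T <= {..<r} ==> T ~= {} ==> (!!i j. i:T ==> j < r ==> E i j ~= 0 ==> j:T) ==>
   T = {..<r}"
begin

definition Eop :: "(nat => nat) => nat => nat" where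
 "Eop x i = (\<Sum>j<r. E i j * x j)"

definition dot :: "(nat => nat) => (nat => nat) => nat" where
 "dot x y = (\<Sum>i<r. x i * y i)"

lemma Eop_add: "Eop (%i. x i + y i) = (%i. Eop x i + Eop y i)"
 by (auto simp: Eop_def sum.distrib algebra_simps)

lemma Eop_pow_add: "(Eop ^^ s) (%i. x i + y i) = (%i. (Eop ^^ s) x i + (Eop ^^ s) y i)"
 by (induction s) (auto simp: Eop_add)

lemma dot_add_right: "dot x (%i. y i + z i) = dot x y + dot x z"
 by (auto simp: dot_def sum.distrib algebra_simps)

lemma dot_add_left: "dot (%i. y i + z i) x = dot y x + dot z x"
 by (auto simp: dot_def sum.distrib algebra_simps)

lemma dot_Eop: "dot (Eop x) y = dot x (Eop y)"
proof -
 have "dot (Eop x) y = (\<Sum>i<r. \<Sum>j<r. E i j * x j * y i)"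
  by (auto simp: dot_def Eop_def sum_distrib_right)
 also have "\<dots> = (\<Sum>j<r. \<Sum>i<r. E i j * x j * y i)"
  by (rule sum.swap)
 also have "\<dots> = dot x (Eop y)"
  by (auto simp: dot_def Eop_def sum_distrib_left sym intro!: sum.cong)
 finally show ?thesis .
qed

text \<open>A walk of length \<open>s\<close> from \<open>j\<close> to \<open>i\<close> makes
  \<open>x j\<close> one of the summands of the iterated sum, uniformly in \<open>x\<close>. The
  endpoints of such walks form a set closed under neighbours.\<close>

lemma reach: "i < r ==> j < r ==> EX s. ALL x. x j <= (Eop ^^ s) x i"
proof -
 assume ij: "i < r" "j < r"
 define T where "T = {i. i < r & (EX s. ALL x. x j <= (Eop ^^ s) x i)}"
 have "T = {..<r}"
 proof (rule connected)
  have "ALL x. x j <= (Eop ^^ 0) x j" by simp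
  then show "T ~= {}"
   using ij unfolding T_def by blast
  fix i i' assume "i:T" "i' < r" "E i i' ~= 0"
  then obtain s where s: "!!x. x j <= (Eop ^^ s) x i" and ir: "i < r"
   by (auto simp: T_def)
  have "x j <= (Eop ^^ Suc s) x i'" for x
  proof -
   have "x j <= E i' i * (Eop ^^ s) x i"
    using s[of x] \<open>E i i' ~= 0\<close> sym[OF ir \<open>i' < r\<close>]
    by (metis One_nat_def Suc_leI bot_nat_0.not_eq_extremum le_trans mult.left_neutral mult_le_mono1)
   also have "\<dots> <= (\<Sum>l<r. E i' l * (Eop ^^ s) x l)"
    using ir by (intro member_le_sum) auto
   finally show ?thesis by (simp add: Eop_def)
  qed
  then show "i':T" using \<open>i' < r\<close> unfolding T_def by blast
 qed (auto simp: T_def)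
 then show ?thesis using ij by (auto simp: T_def)
qed

text \<open>Among the nonnegative subeigenvectors one with largest support is taken. Adding its
  image under \<open>E\<close> would enlarge the support at every neighbour, so the support is
  closed and hence everything.\<close>

lemma positive_subeigenvector:
 fixes w :: "nat => real"
 assumes "!!i. i < r ==> w i >= 0" "EX i<r. w i > 0" "!!i. i < r ==> \<rho> * w i <= (\<Sum>j<r. real (E i j) * w j)"
 shows "EX w. (ALL i<r. w i > 0) & (ALL i<r. \<rho> * w i <= (\<Sum>j<r. real (E i j) * w j))"
proof -
 define P where "P w \<longleftrightarrow> (ALL i<r. w i >= 0) & (EX i<r. w i > 0) & (ALL i<r. \<rho> * w i <= (\<Sum>j<r. real (E i j) * w j))"
  for w :: "nat => real"
 define N where "N w = card {i. i < r & w i > 0}" for w :: "nat => real"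
 have "EX x. P x & (ALL y. P y --> N y <= N x)"
 proof -
  have "P w" using assms by (auto simp: P_def)
  moreover have "N y <= r" for y
   by (auto simp: N_def intro!: card_mono[of "{..<r}", simplified])
  ultimately show ?thesis
   using ex_has_greatest_nat[of P w N "Suc r"] by (auto simp: less_Suc_eq_le)
 qed
 then obtain u where u: "P u" and max: "!!w'. P w' ==> N w' <= N u" by blast
 have ge: "u i >= 0" if "i < r" for i using u that by (auto simp: P_def)
 define T where "T = {i. i < r & u i > 0}"
 \<comment> \<open>This is \<open>I + E\<close> applied to \<open>u\<close>; it commutes with
   \<open>E\<close>, so the subeigenvector inequality survives.\<close>
 define u' where "u' i = u i + (\<Sum>j<r. real (E i j) * u j)" for i
 have Eu: "(\<Sum>j<r. real (E i j) * u j) >= 0" for i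
  using ge by (auto intro!: sum_nonneg)
 have "P u'"
 proof -
  have "\<rho> * u' i <= (\<Sum>j<r. real (E i j) * u' j)" if "i < r" for i
  proof -
   have "(\<Sum>j<r. real (E i j) * u' j) = (\<Sum>j<r. real (E i j) * u j) +
     (\<Sum>j<r. real (E i j) * (\<Sum>l<r. real (E j l) * u l))"
    by (simp add: u'_def algebra_simps sum.distrib)
   also have "\<dots> >= \<rho> * u i + (\<Sum>j<r. real (E i j) * (\<rho> * u j))"
    using u that by (intro add_mono sum_mono mult_left_mono) (auto simp: P_def)
   finally show ?thesis
    by (simp add: u'_def algebra_simps sum_distrib_left)
  qed
  then show ?thesis
   using u Eu ge by (auto simp: P_def u'_def add_pos_nonneg add_nonneg_nonneg)
 qed
 then have le: "card {i. i < r & u' i > 0} <= card T"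
  using max by (auto simp: N_def T_def)
 have sub: "T <= {i. i < r & u' i > 0}"
  using Eu by (auto simp: T_def u'_def add_pos_nonneg)
 have eq: "T = {i. i < r & u' i > 0}"
  by (rule card_seteq[OF _ sub le]) auto
 have "T = {..<r}"
 proof (rule connected)
  show "T ~= {}" using u by (auto simp: P_def T_def)
  fix i j assume i: "i:T" and j: "j < r" "E i j ~= 0"
  then have ji: "i < r" "E j i ~= 0" "u i > 0" using sym[of i j] by (auto simp: T_def)
  have "0 < real (E j i) * u i" using ji by simp
  also have "\<dots> <= (\<Sum>l<r. real (E j l) * u l)"
   using ji ge by (intro member_le_sum) auto
  finally have "u' j > 0" using ge[OF j(1)] by (simp add: u'_def add_nonneg_pos)
  then show "j:T" using eq j by simp
 qed (auto simp: T_def)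
 then show ?thesis
  using u by (intro exI[of _ u]) (auto simp: P_def T_def)
qed

end

text \<open>\<open>a n\<close> will be the dimension vector of the top of the n-th syzygy and
  \<open>a (n - 1)\<close> that of its radical; negative \<open>n\<close> stand for cosyzygies. The
  vector \<open>w\<close> is a positive left test vector coming from the spectral radius.\<close>

locale wave_sequence = adjacency_form +
 fixes w :: "nat => real" and \<rho> :: real and a :: "int => nat => nat"
 assumes w_pos: "i < r ==> w i > 0"
  and w_sub: "i < r ==> \<rho> * w i <= (\<Sum>j<r. real (E i j) * w j)"
  and large: "\<rho> > 2"
  and wave: "i < r ==> a (n + 1) i + a (n - 1) i = Eop (a n) i"
  and nonzero: "EX i<r. a n i ~= 0"
begin

definition weight :: "int => real" where
 "weight n = (\<Sum>i<r. w i * real (a n i))"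

text \<open>The recursion is paired with \<open>w\<close>, and \<open>E\<close> is moved onto
  \<open>w\<close> by symmetry.\<close>

lemma weight_wave: "weight (n + 1) + weight (n - 1) >= \<rho> * weight n"
proof -
 have "weight (n + 1) + weight (n - 1) = (\<Sum>i<r. w i * real (a (n + 1) i + a (n - 1) i))"
  by (simp add: weight_def sum.distrib algebra_simps)
 also have "\<dots> = (\<Sum>i<r. w i * real (Eop (a n) i))"
  using wave by (intro sum.cong) auto
 also have "\<dots> = (\<Sum>i<r. \<Sum>j<r. real (E i j) * w i * real (a n j))"
  by (simp add: Eop_def sum_distrib_left algebra_simps)
 also have "\<dots> = (\<Sum>j<r. \<Sum>i<r. real (E i j) * w i * real (a n j))"
  by (rule sum.swap)
 also have "\<dots> = (\<Sum>j<r. (\<Sum>i<r. real (E j i) * w i) * real (a n j))"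
  by (auto simp: sum_distrib_right sym intro!: sum.cong)
 also have "\<dots> >= (\<Sum>j<r. \<rho> * w j * real (a n j))"
  using w_sub by (intro sum_mono mult_right_mono) auto
 finally show ?thesis
  by (simp add: weight_def sum_distrib_left algebra_simps)
qed

text \<open>Each \<open>a n\<close> is a nonzero vector of natural numbers, so every weight is at
  least the smallest entry of \<open>w\<close>. With \<open>\<rho> > 2\<close> the second
  differences are then bounded below by a positive constant, in either direction of time.\<close>

lemma weight_unbounded: "\<exists>k\<ge>k0. weight (- int k) > B"
proof -
 obtain i0 where "i0 < r" using nonzero by blast
 define \<epsilon> where "\<epsilon> = Min (w ` {..<r})"
 have eps: "\<epsilon> > 0" "!!i. i < r ==> \<epsilon> <= w i"
  using \<open>i0 < r\<close> w_pos by (auto simp: \<epsilon>_def) (subst Min_gr_iff; auto)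
 have wge: "weight n >= \<epsilon>" for n
 proof -
  obtain i where i: "i < r" "a n i ~= 0" using nonzero by blast
  have "\<epsilon> * 1 <= w i * real (a n i)"
   using i eps less_imp_le[OF w_pos[OF i(1)]] by (intro mult_mono) auto
  also have "\<dots> <= weight n"
   unfolding weight_def using i w_pos by (intro member_le_sum) (auto intro!: mult_nonneg_nonneg intro: less_imp_le)
  finally show ?thesis by simp
 qed
 show ?thesis
 proof (rule unbounded_of_convex[where \<eta> = "(\<rho> - 2) * \<epsilon>"])
  show "(\<rho> - 2) * \<epsilon> > 0" using eps large by simp
  fix k
  have "weight (- int (Suc k) + 1) + weight (- int (Suc k) - 1) >= \<rho> * weight (- int (Suc k))"
   by (rule weight_wave)
  moreover have "(\<rho> - 2) * weight (- int (Suc k)) >= (\<rho> - 2) * \<epsilon>"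
   using wge large by (intro mult_left_mono) auto
  moreover have "- int (Suc k) + 1 = - int k" "- int (Suc k) - 1 = - int (Suc (Suc k))" by auto
  ultimately show "weight (- int (Suc (Suc k))) - weight (- int (Suc k))
    >= weight (- int (Suc k)) - weight (- int k) + (\<rho> - 2) * \<epsilon>"
   by (simp add: algebra_simps)
 qed
qed

text \<open>Otherwise the weight at \<open>- k\<close> is at most the weight at
  \<open>m - k\<close>. Steps of length \<open>m\<close> lead into the window from 0 to
  \<open>m\<close>, so all weights at negative indices would be bounded.\<close>

lemma shift_not_increasing:
 assumes "m >= 1"
 shows "EX k i. i < r & a (m - int k) i < a (- int k) i"
proof (rule ccontr)
 assume "~ ?thesis"
 then have ge: "a (- int k) i <= a (m - int k) i" if "i < r" for k i
  using that by (meson not_less)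
 have wle: "weight (- int k) <= weight (m - int k)" for k
  unfolding weight_def using ge w_pos
  by (intro sum_mono mult_left_mono) (auto intro: less_imp_le)
 define B where "B = (\<Sum>j\<in>{0..m}. \<bar>weight j\<bar>)"
 have B: "weight j <= B" if "j:{0..m}" for j
  using that member_le_sum[of j "{0..m}" "%j. \<bar>weight j\<bar>"] unfolding B_def by auto
 have "weight (- int k) <= B" for k
 proof (induction k rule: less_induct)
  case (less k)
  show ?case
  proof (cases "m >= int k")
   case True
   then show ?thesis using wle[of k] B[of "m - int k"] assms by auto
  next
   case False
   then have "m - int k = - int (nat (int k - m))" "nat (int k - m) < k" using assms by auto
   then show ?thesis using wle[of k] less[of "nat (int k - m)"] by simp
  qed
 qed
 moreover obtain k where "weight (- int k) > B" using weight_unbounded by blast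
 ultimately show False by (meson not_less)
qed

lemma dot_wave:
 "dot (a (i + 1)) (a j) + dot (a (i - 1)) (a j) = dot (a i) (a (j + 1)) + dot (a i) (a (j - 1))"
proof -
 have "dot (a (i + 1)) (a j) + dot (a (i - 1)) (a j) = dot (Eop (a i)) (a j)"
  by (subst dot_add_left[symmetric]) (auto simp: dot_def wave)
 also have "\<dots> = dot (a i) (Eop (a j))" by (rule dot_Eop)
 also have "\<dots> = dot (a i) (a (j + 1)) + dot (a i) (a (j - 1))"
  by (subst dot_add_right[symmetric]) (auto simp: dot_def wave)
 finally show ?thesis .
qed

text \<open>Moving both indices by one changes nothing, by \<open>dot_wave\<close>. A sign known at
  position 0 for a given \<open>m\<close> therefore holds at every position.\<close>

lemma dot_shift:
 "int (dot (a i) (a (i + m))) - int (dot (a (i + 1)) (a (i + m - 1))) =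
  int (dot (a 0) (a m)) - int (dot (a 1) (a (m - 1)))"
proof -
 define D where "D i = int (dot (a i) (a (i + m))) - int (dot (a (i + 1)) (a (i + m - 1)))" for i
 have step: "D (i - 1) = D i" for i
 proof -
  have "int (dot (a (i + 1)) (a (i + m - 1))) + int (dot (a (i - 1)) (a (i + m - 1))) =
    int (dot (a i) (a (i + m))) + int (dot (a i) (a (i + m - 2)))"
   using dot_wave[of i "i + m - 1"] by (simp flip: of_nat_add add: algebra_simps)
  then show ?thesis by (simp add: D_def algebra_simps)
 qed
 have "D i = D 0"
 proof (induction i rule: int_induct[of _ 0])
  case (step1 i) then show ?case using step[of "i + 1"] by simp
 next
  case (step2 i) then show ?case using step[of i] by simp
 qed simp
 then show ?thesis by (simp add: D_def)
qed

text \<open>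
 If the claim fails, \<open>a (- k) \<bullet> a (k + l)\<close> is eventually decreasing in \<open>k\<close>, so by
 connectedness all products \<open>a (- k) i * a k j\<close> stay bounded.
\<close>

lemma pairing_positive: "\<exists>m\<ge>1. dot (a 0) (a m) > dot (a 1) (a (m - 1))"
proof (rule ccontr)
 assume "~ ?thesis"
 then have D: "dot (a 0) (a m) <= dot (a 1) (a (m - 1))" if "m >= 1" for m
  using that by (meson not_less)
 \<comment> \<open>This is \<open>D\<close> for the gap \<open>2 * int k + 2 + l\<close>,
   transported to the starting index \<open>- int (Suc k)\<close>; the side condition says that the
   gap is at least 1.\<close>
 have dec: "dot (a (- int (Suc k))) (a (int (Suc k) + l)) <= dot (a (- int k)) (a (int k + l))"
  if "2 * int k + l >= -1" for k l
  using dot_shift[of "- int (Suc k)" "2 * int k + 2 + l"] D[of "2 * int k + 2 + l"] that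
  by (simp add: algebra_simps)
 \<comment> \<open>Each application of \<open>Eop\<close> splits the offset \<open>l\<close> into
   \<open>l + 1\<close> and \<open>l - 1\<close> by the recursion, so the bounds for
   \<open>s\<close> add up to one for \<open>Suc s\<close>. This is why the offset is
   generalised.\<close>
 have "EX \<kappa> k0. \<forall>k\<ge>k0. dot (a (- int k)) ((Eop ^^ s) (a (int k + l))) <= \<kappa>" for s l
 proof (induction s arbitrary: l)
  case 0
  define k0 where "k0 = nat \<bar>l\<bar>"
  have "dot (a (- int k)) (a (int k + l)) <= dot (a (- int k0)) (a (int k0 + l))" if "k >= k0" for k
   using that
  proof (induction k rule: dec_induct)
   case (step k)
   have "- 1 <= 2 * int k + l" using step.hyps by (auto simp: k0_def)
   then show ?case using step.IH dec[of k l] by linarith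
  qed simp
  then show ?case by auto
 next
  case (Suc s)
  obtain \<kappa>1 k1 where 1: "!!k. k >= k1 ==> dot (a (- int k)) ((Eop ^^ s) (a (int k + (l + 1)))) <= \<kappa>1"
   using Suc[of "l + 1"] by blast
  obtain \<kappa>2 k2 where 2: "!!k. k >= k2 ==> dot (a (- int k)) ((Eop ^^ s) (a (int k + (l - 1)))) <= \<kappa>2"
   using Suc[of "l - 1"] by blast
  \<comment> \<open>The recursion holds only for indices below \<open>r\<close>, and iterates of
    \<open>Eop\<close> see only these.\<close>
  have cong: "(Eop ^^ t) x i = (Eop ^^ t) y i" if "!!i. i < r ==> x i = y i" "i < r" for t x y i
   using that(2)
  proof (induction t arbitrary: i)
   case 0 then show ?case using that by simp
  next
   case (Suc t)
   have "Eop ((Eop ^^ t) x) i = Eop ((Eop ^^ t) y) i"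
    unfolding Eop_def[of "(Eop ^^ t) _"] by (intro sum.cong) (auto simp: Suc)
   then show ?case by simp
  qed
  have "dot (a (- int k)) ((Eop ^^ Suc s) (a (int k + l))) <= \<kappa>1 + \<kappa>2" if "k >= max k1 k2" for k
  proof -
   have "dot (a (- int k)) ((Eop ^^ Suc s) (a (int k + l))) =
     dot (a (- int k)) ((Eop ^^ s) (%i. a (int k + l + 1) i + a (int k + l - 1) i))"
    unfolding dot_def funpow_Suc_right o_def
    by (intro sum.cong arg_cong2[where f = times] cong refl) (auto simp: wave)
   also have "\<dots> = dot (a (- int k)) ((Eop ^^ s) (a (int k + (l + 1)))) +
     dot (a (- int k)) ((Eop ^^ s) (a (int k + (l - 1))))"
    unfolding Eop_pow_add dot_add_right by (simp add: algebra_simps)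
   finally show ?thesis using 1[of k] 2[of k] that by simp
  qed
  then show ?case by blast
 qed
 from this[of _ 0] have bd: "EX \<kappa> k0. \<forall>k\<ge>k0. dot (a (- int k)) ((Eop ^^ s) (a (int k))) <= \<kappa>" for s
  by simp
 \<comment> \<open>A walk from \<open>j\<close> to \<open>i\<close> hides the single product
   \<open>a (- int k) i * a (int k) j\<close> inside a pairing that was just bounded.\<close>
 have "EX \<kappa> k0. \<forall>k\<ge>k0. a (- int k) i * a (int k) j <= \<kappa>" if ij: "i < r" "j < r" for i j
 proof -
  obtain s where s: "!!x. x j <= (Eop ^^ s) x i" using reach[OF ij] by blast
  obtain \<kappa> k0 where k: "!!k. k >= k0 ==> dot (a (- int k)) ((Eop ^^ s) (a (int k))) <= \<kappa>"
   using bd by blast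
  have "a (- int k) i * a (int k) j <= \<kappa>" if "k >= k0" for k
  proof -
   have "a (- int k) i * a (int k) j <= a (- int k) i * (Eop ^^ s) (a (int k)) i"
    using s by simp
   also have "\<dots> <= dot (a (- int k)) ((Eop ^^ s) (a (int k)))"
    unfolding dot_def using ij by (intro member_le_sum) auto
   finally show ?thesis using k[OF that] by simp
  qed
  then show ?thesis by blast
 qed
 then obtain \<kappa> k0 where kk: "!!i j k. i < r ==> j < r ==> k >= k0 i j ==> a (- int k) i * a (int k) j <= \<kappa> i j"
  by metis
 define \<kappa>' where "\<kappa>' = (\<Sum>i<r. \<Sum>j<r. \<kappa> i j)"
 define k' where "k' = (\<Sum>i<r. \<Sum>j<r. k0 i j)"
 have le1: "f i j <= (\<Sum>i<r. \<Sum>j<r. f i j)" if "i < r" "j < r" for i j and f :: "nat => nat => nat"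
  using that member_le_sum[of j "{..<r}" "f i"] member_le_sum[of i "{..<r}" "%i. \<Sum>j<r. f i j"]
  by (auto intro: order_trans)
 \<comment> \<open>Some coordinate of \<open>a (int k)\<close> is at least 1, so a bound on all
   products bounds each coordinate at negative indices.\<close>
 have bdd: "a (- int k) i <= \<kappa>'" if "k >= k'" "i < r" for k i
 proof -
  obtain j where j: "j < r" "a (int k) j ~= 0" using nonzero by blast
  have "a (- int k) i <= a (- int k) i * a (int k) j" using j by simp
  also have "\<dots> <= \<kappa> i j"
   using kk[OF that(2) j(1)] that le1[of i j k0] j by (simp add: k'_def)
  also have "\<dots> <= \<kappa>'" using le1[of i j \<kappa>] that j by (simp add: \<kappa>'_def)
  finally show ?thesis .
 qed
 obtain k where k: "k >= k'" "weight (- int k) > (\<Sum>i<r. w i * real \<kappa>')"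
  using weight_unbounded by blast
 moreover have "weight (- int k) <= (\<Sum>i<r. w i * real \<kappa>')"
  unfolding weight_def using bdd k w_pos
  by (intro sum_mono mult_left_mono) (auto intro: less_imp_le)
 ultimately show False by simp
qed

end

text \<open>The moduli of an eigenvector for an eigenvalue of maximal modulus.\<close>

lemma spectral_radius_subeigenvector:
 fixes F :: "nat => nat => nat"
 assumes "r > 0" and "spectral_radius (mat r r (%(i, j). of_nat (F i j))) = \<rho>"
 shows "EX w :: nat => real. (ALL i<r. w i >= 0) & (EX i<r. w i > 0) &
  (ALL i<r. \<rho> * w i <= (\<Sum>j<r. real (F i j) * w j))"
proof -
 define A :: "complex mat" where "A = mat r r (%(i, j). of_nat (F i j))"
 have A: "A:carrier_mat r r" by (simp add: A_def)
 have "\<rho>:norm ` spectrum A"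
  using spectral_radius_mem_max(1)[OF A assms(1)] assms(2) by (simp add: A_def)
 then obtain \<mu> v where mu: "\<rho> = norm \<mu>" "eigenvector A v \<mu>"
  by (auto simp: spectrum_def eigenvalue_def)
 then have v: "v:carrier_vec r" "v ~= 0\<^sub>v r" "A *\<^sub>v v = \<mu> \<cdot>\<^sub>v v"
  using A by (auto simp: eigenvector_def)
 define w where "w i = norm (v $ i)" for i
 have "\<rho> * w i <= (\<Sum>j<r. real (F i j) * w j)" if "i < r" for i
 proof -
  have "\<mu> * v $ i = (A *\<^sub>v v) $ i" using v that by simp
  also have "\<dots> = (\<Sum>j<r. of_nat (F i j) * v $ j)"
   using that v(1) by (auto simp: A_def scalar_prod_def lessThan_atLeast0 intro!: sum.cong)
  finally have "norm (\<mu> * v $ i) <= (\<Sum>j<r. norm (of_nat (F i j) * v $ j))"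
   by (simp add: norm_sum)
  then show ?thesis by (simp add: mu w_def norm_mult)
 qed
 moreover have "EX i<r. w i > 0"
 proof (rule ccontr)
  assume "~ ?thesis"
  then have "v = 0\<^sub>v r" using v(1) by (intro eq_vecI) (auto simp: w_def)
  then show False using v by simp
 qed
 ultimately show ?thesis by (intro exI[of _ w]) (auto simp: w_def)
qed

section \<open>Left modules\<close>

declare (in left_module) smult_closed [simp, intro] smult_zero [simp] zero_smult [simp] smult_one [simp]

lemma (in abelian_group) minus_eq_zero_iff:
 "x:car G ==> y:car G ==> x \<ominus> y = \<zero> \<longleftrightarrow> x = y"
 by (auto simp: a_minus_def r_neg) (metis a_inv_closed minus_equality minus_minus)

lemma (in abelian_group) add_minus_cancel:
 "x:car G ==> y:car G ==> (x \<ominus> y) \<oplus> y = x"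
 by (simp add: a_minus_def a_assoc l_neg)

lemma (in abelian_group) minus_add_cancel:
 "x:car G ==> y:car G ==> (x \<oplus> y) \<ominus> y = x"
 by (simp add: a_minus_def a_assoc r_neg)

lemma lmod_ring: "left_module R M ==> ring R"
 by (rule left_module.axioms(1))

lemma (in left_module) subm_iff:
 "Module.submodule N R M \<longleftrightarrow> N <= car M & \<zero>\<^sub>M:N & (ALL x:N. ALL y:N. x \<oplus>\<^sub>M y:N) &
   (ALL a:car R. ALL x:N. a \<odot>\<^sub>M x:N)"
 (is "?L \<longleftrightarrow> ?R")
proof
 assume ?L
 then interpret Module.submodule N R M .
 show ?R
  using subset one_closed m_closed smult_closed by auto
qed (auto intro!: left_submoduleI)

lemma (in left_module) subm_neg:
 assumes "Module.submodule N R M" "x:N"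
 shows "\<ominus>\<^sub>M x:N"
proof -
 have "x:car M" "(\<ominus>\<^sub>R \<one>\<^sub>R) \<odot>\<^sub>M x:N"
  using assms unfolding subm_iff by auto
 then show ?thesis by (simp add: minus_one_smult)
qed

lemma (in left_module) subm_minus:
 assumes "Module.submodule N R M" "x:N" "y:N"
 shows "x \<ominus>\<^sub>M y:N"
 using assms subm_neg[OF assms(1)] unfolding subm_iff by (auto simp: a_minus_def)

lemma (in left_module) smult_minus:
 assumes "a:car R" "x:car M" "y:car M"
 shows "a \<odot>\<^sub>M (x \<ominus>\<^sub>M y) = a \<odot>\<^sub>M x \<ominus>\<^sub>M a \<odot>\<^sub>M y"
proof -
 have "a \<odot>\<^sub>M (x \<ominus>\<^sub>M y) \<oplus>\<^sub>M a \<odot>\<^sub>M y = a \<odot>\<^sub>M x"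
  using assms by (simp add: smult_r_distr[symmetric] a_minus_def M.a_assoc M.l_neg)
 then show ?thesis
  using assms by (metis smult_closed M.minus_add_cancel M.minus_closed)
qed

lemma (in left_module) minus_smult:
 assumes "a:car R" "b:car R" "x:car M"
 shows "(a \<ominus>\<^sub>R b) \<odot>\<^sub>M x = a \<odot>\<^sub>M x \<ominus>\<^sub>M b \<odot>\<^sub>M x"
proof -
 have "(a \<ominus>\<^sub>R b) \<odot>\<^sub>M x \<oplus>\<^sub>M b \<odot>\<^sub>M x = a \<odot>\<^sub>M x"
  using assms by (simp add: smult_l_distr[symmetric] a_minus_def R.a_assoc R.l_neg)
 then show ?thesis
  using assms by (metis smult_closed M.minus_add_cancel R.minus_closed)
qed

lemma (in left_module) carrier_subm: "Module.submodule (car M) R M"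
 by (simp add: subm_iff)

lemma (in left_module) zero_subm: "Module.submodule {\<zero>\<^sub>M} R M"
 by (simp add: subm_iff)

lemma (in left_module) subm_Int:
 "Module.submodule N R M ==> Module.submodule N' R M ==> Module.submodule (N \<inter> N') R M"
 by (auto simp: subm_iff)

text \<open>All module axioms descend along a surjection that respects the operations. This builds
  the quotient module, and with the identity it changes the record that carries a structure.\<close>

lemma lmod_image:
 fixes M :: "('a, 'm) module" and Q :: "('a, 'q) module"
 assumes "left_module R M" and car: "car Q = p ` car M" and z: "\<zero>\<^sub>Q = p \<zero>\<^sub>M"
  and add: "!!x y. x:car M ==> y:car M ==> p x \<oplus>\<^sub>Q p y = p (x \<oplus>\<^sub>M y)"
  and sm: "!!a x. a:car R ==> x:car M ==> a \<odot>\<^sub>Q p x = p (a \<odot>\<^sub>M x)"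
 shows "left_module R Q" "p:module_hom R M Q"
proof -
 interpret M: left_module R M by fact
 have "abelian_group Q"
 proof (rule abelian_groupI)
  fix x assume "x:car Q"
  then obtain u where u: "u:car M" "x = p u" using car by auto
  then show "EX y:car Q. y \<oplus>\<^sub>Q x = \<zero>\<^sub>Q"
   by (intro bexI[of _ "p (\<ominus>\<^sub>M u)"]) (auto simp: car add z M.l_neg)
 qed (auto simp: car add z M.a_ac)
 then show "left_module R Q"
  using M.R.ring_axioms
  by (auto intro!: left_module.intro left_module_axioms.intro
    simp: car add sm M.smult_l_distr M.smult_r_distr M.smult_assoc1)
 show "p:module_hom R M Q"
  by (auto simp: module_hom_def car add sm)
qed

lemma lmod_sub:
 assumes "left_module R M" "Module.submodule N R M"
 shows "left_module R (M(|carrier := N|))"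
proof -
 interpret M: left_module R M by fact
 have N: "N <= car M" "\<zero>\<^sub>M:N" "!!x y. x:N ==> y:N ==> x \<oplus>\<^sub>M y:N"
  "!!a x. a:car R ==> x:N ==> a \<odot>\<^sub>M x:N"
  using assms(2) unfolding M.subm_iff by auto
 have "abelian_group (M(|carrier := N|))"
 proof (rule abelian_groupI)
  fix x assume "x:car (M(|carrier := N|))"
  then show "EX y:car (M(|carrier := N|)). y \<oplus>\<^sub>(M(|carrier := N|)) x = \<zero>\<^sub>(M(|carrier := N|))"
   using N M.subm_neg[OF assms(2)]
   by (intro bexI[of _ "\<ominus>\<^sub>M x"]) (auto simp: M.l_neg subset_iff)
 qed (use N in \<open>auto simp: M.a_ac subset_iff\<close>)
 then show ?thesis
  using M.R.ring_axioms N
  by (auto intro!: left_module.intro left_module_axioms.intro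
    simp: subset_iff M.smult_l_distr M.smult_r_distr M.smult_assoc1)
qed

lemma subm_sub_iff:
 assumes "left_module R M" "Module.submodule N R M"
 shows "Module.submodule N' R (M(|carrier := N|)) \<longleftrightarrow> Module.submodule N' R M & N' <= N"
proof -
 interpret M: left_module R M by fact
 interpret N: left_module R "M(|carrier := N|)" by (rule lmod_sub) fact+
 show ?thesis
  using assms(2) unfolding M.subm_iff N.subm_iff by auto
qed

subsection \<open>Homomorphisms\<close>

lemma module_homI:
 assumes "!!x. x:car M ==> f x:car N"
  "!!x y. x:car M ==> y:car M ==> f (x \<oplus>\<^sub>M y) = f x \<oplus>\<^sub>N f y"
  "!!a x. a:car R ==> x:car M ==> f (a \<odot>\<^sub>M x) = a \<odot>\<^sub>N f x"
 shows "f:module_hom R M N"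
 using assms by (auto simp: module_hom_def)

lemma homD:
 assumes "f:module_hom R M N"
 shows "x:car M ==> f x:car N"
  "x:car M ==> y:car M ==> f (x \<oplus>\<^sub>M y) = f x \<oplus>\<^sub>N f y"
  "a:car R ==> x:car M ==> f (a \<odot>\<^sub>M x) = a \<odot>\<^sub>N f x"
 using assms by (auto simp: module_hom_def)

lemma hom_zero:
 assumes "left_module R M" "left_module R N" "f:module_hom R M N"
 shows "f \<zero>\<^sub>M = \<zero>\<^sub>N"
proof -
 interpret M: left_module R M by fact
 interpret N: left_module R N by fact
 have "f (\<zero>\<^sub>R \<odot>\<^sub>M \<zero>\<^sub>M) = \<zero>\<^sub>R \<odot>\<^sub>N f \<zero>\<^sub>M"
  using assms(3) by (intro homD(3)) auto
 then show ?thesis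
  using homD(1)[OF assms(3)] by simp
qed

lemma hom_neg:
 assumes "left_module R M" "left_module R N" "f:module_hom R M N" "x:car M"
 shows "f (\<ominus>\<^sub>M x) = \<ominus>\<^sub>N f x"
proof -
 interpret M: left_module R M by fact
 interpret N: left_module R N by fact
 have "f ((\<ominus>\<^sub>R \<one>\<^sub>R) \<odot>\<^sub>M x) = (\<ominus>\<^sub>R \<one>\<^sub>R) \<odot>\<^sub>N f x"
  using assms by (intro homD(3)) auto
 then show ?thesis
  using homD(1)[OF assms(3)] assms(4) by (simp add: M.minus_one_smult N.minus_one_smult)
qed

lemma hom_minus:
 assumes "left_module R M" "left_module R N" "f:module_hom R M N" "x:car M" "y:car M"
 shows "f (x \<ominus>\<^sub>M y) = f x \<ominus>\<^sub>N f y"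
proof -
 interpret M: left_module R M by fact
 show ?thesis
  using assms homD[OF assms(3)] hom_neg[OF assms(1-3)] by (simp add: a_minus_def)
qed

lemma hom_comp:
 "f:module_hom R L M ==> g:module_hom R M N ==> (%x. g (f x)):module_hom R L N"
 by (auto simp: module_hom_def Pi_def)

lemma hom_id: "(%x. x):module_hom R M M"
 by (auto simp: module_hom_def)

lemma hom_zero_map:
 assumes "left_module R N"
 shows "(%x. \<zero>\<^sub>N):module_hom R M N"
proof -
 interpret N: left_module R N by fact
 show ?thesis by (auto simp: module_hom_def)
qed

lemma hom_add:
 assumes "left_module R M" "left_module R N" "f:module_hom R M N" "g:module_hom R M N"
 shows "(%x. f x \<oplus>\<^sub>N g x):module_hom R M N"
proof -
 interpret M: left_module R M by fact
 interpret N: left_module R N by fact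
 show ?thesis
  using homD[OF assms(3)] homD[OF assms(4)]
  by (auto intro!: module_homI simp: N.smult_r_distr N.a_ac)
qed

lemma hom_diff:
 assumes "left_module R M" "left_module R N" "f:module_hom R M N" "g:module_hom R M N"
 shows "(%x. f x \<ominus>\<^sub>N g x):module_hom R M N"
proof -
 interpret M: left_module R M by fact
 interpret N: left_module R N by fact
 have "(f x \<oplus>\<^sub>N f y) \<ominus>\<^sub>N (g x \<oplus>\<^sub>N g y) = (f x \<ominus>\<^sub>N g x) \<oplus>\<^sub>N (f y \<ominus>\<^sub>N g y)"
  if "x:car M" "y:car M" for x y
  using that homD[OF assms(3)] homD[OF assms(4)]
  by (simp add: a_minus_def N.minus_add N.a_ac)
 then show ?thesis
  using homD[OF assms(3)] homD[OF assms(4)]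
  by (auto intro!: module_homI simp: N.smult_minus)
qed

lemma hom_sub_domain:
 "f:module_hom R M N ==> U <= car M ==> f:module_hom R (M(|carrier := U|)) N"
 by (auto simp: module_hom_def subset_iff)

lemma hom_sub_codomain:
 "f:module_hom R M N ==> (!!x. x:car M ==> f x:V) ==> f:module_hom R M (N(|carrier := V|))"
 by (auto simp: module_hom_def)

lemma hom_incl: "U <= car M ==> (%x. x):module_hom R (M(|carrier := U|)) M"
 by (auto simp: module_hom_def)

lemma a_kernel_eq: "a_kernel M N f = {x:car M. f x = \<zero>\<^sub>N}"
 by (simp add: a_kernel_def')

lemma subm_vimage:
 assumes "left_module R M" "left_module R N" "f:module_hom R M N" "Module.submodule V R N"
 shows "Module.submodule {x:car M. f x:V} R M"
proof -
 interpret M: left_module R M by fact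
 interpret N: left_module R N by fact
 show ?thesis
  using assms(4) hom_zero[OF assms(1-3)] homD[OF assms(3)]
  unfolding M.subm_iff N.subm_iff by auto
qed

lemma subm_kernel:
 assumes "left_module R M" "left_module R N" "f:module_hom R M N"
 shows "Module.submodule {x:car M. f x = \<zero>\<^sub>N} R M"
 using subm_vimage[OF assms left_module.zero_subm[OF assms(2)]] by simp

lemma subm_image:
 assumes "left_module R M" "left_module R N" "f:module_hom R M N" "Module.submodule U R M"
 shows "Module.submodule (f ` U) R N"
proof -
 interpret M: left_module R M by fact
 interpret N: left_module R N by fact
 have U: "U <= car M" "\<zero>\<^sub>M:U" "!!x y. x:U ==> y:U ==> x \<oplus>\<^sub>M y:U"
  "!!a x. a:car R ==> x:U ==> a \<odot>\<^sub>M x:U"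
  using assms(4) unfolding M.subm_iff by auto
 note f = homD[OF assms(3)]
 show ?thesis unfolding N.subm_iff
 proof (intro conjI ballI)
  show "f ` U <= car N" using U f by auto
  show "\<zero>\<^sub>N:f ` U" using U hom_zero[OF assms(1-3)] by (metis imageI)
  show "x \<oplus>\<^sub>N y:f ` U" if xy: "x:f ` U" "y:f ` U" for x y
  proof -
   obtain u v where uv: "u:U" "v:U" "x = f u" "y = f v" using xy by auto
   then have "x \<oplus>\<^sub>N y = f (u \<oplus>\<^sub>M v)" using f(2)[of u v] subsetD[OF U(1)] by auto
   then show ?thesis using U uv by auto
  qed
  show "a \<odot>\<^sub>N x:f ` U" if xy: "a:car R" "x:f ` U" for a x
  proof -
   obtain u where uv: "u:U" "x = f u" using xy by auto
   then have "a \<odot>\<^sub>N x = f (a \<odot>\<^sub>M u)" using f(3)[of a u] subsetD[OF U(1)] xy by auto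
   then show ?thesis using U uv xy by auto
  qed
 qed
qed

lemma hom_inj_iff:
 assumes "left_module R M" "left_module R N" "f:module_hom R M N"
 shows "inj_on f (car M) \<longleftrightarrow> (ALL x:car M. f x = \<zero>\<^sub>N --> x = \<zero>\<^sub>M)"
proof -
 interpret M: left_module R M by fact
 interpret N: left_module R N by fact
 show ?thesis
 proof
  assume "inj_on f (car M)"
  then show "ALL x:car M. f x = \<zero>\<^sub>N --> x = \<zero>\<^sub>M"
   using hom_zero[OF assms] by (metis M.zero_closed inj_onD)
 next
  assume ker: "ALL x:car M. f x = \<zero>\<^sub>N --> x = \<zero>\<^sub>M"
  show "inj_on f (car M)"
  proof (rule inj_onI)
   fix x y assume xy: "x:car M" "y:car M" "f x = f y"
   then have "f (x \<ominus>\<^sub>M y) = \<zero>\<^sub>N"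
    using hom_minus[OF assms xy(1,2)] homD(1)[OF assms(3)] by (simp add: N.minus_eq_zero_iff)
   then have "x \<ominus>\<^sub>M y = \<zero>\<^sub>M" using ker xy by simp
   then show "x = y" using xy M.minus_eq_zero_iff by simp
  qed
 qed
qed

text \<open>Two preimages of a point differ by an element of the kernel of \<open>p\<close>, so
  \<open>f\<close> may be evaluated at any of them. Nearly all maps out of quotients and out of sums
  of submodules are obtained in this way.\<close>

lemma hom_factor:
 assumes "left_module R M" "left_module R Q" "left_module R N"
  and p: "p:module_hom R M Q" "p ` car M = car Q"
  and f: "f:module_hom R M N" and ker: "!!x. x:car M ==> p x = \<zero>\<^sub>Q ==> f x = \<zero>\<^sub>N"
 shows "EX g:module_hom R Q N. ALL x:car M. g (p x) = f x"
proof -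
 interpret M: left_module R M by fact
 interpret N: left_module R N by fact
 interpret Q: left_module R Q by fact
 define g where "g q = f (inv_into (car M) p q)" for q
 have gp: "g (p x) = f x" if x: "x:car M" for x
 proof -
  define y where "y = inv_into (car M) p (p x)"
  have y: "y:car M" "p y = p x"
   unfolding y_def using x by (auto intro: inv_into_into f_inv_into_f)
  then have "f (y \<ominus>\<^sub>M x) = \<zero>\<^sub>N"
   using x hom_minus[OF assms(1,2) p(1)] homD(1)[OF p(1)]
   by (intro ker) (auto simp: Q.minus_eq_zero_iff)
  then show ?thesis
   using x y hom_minus[OF assms(1,3) f] homD(1)[OF f]
   by (simp add: N.minus_eq_zero_iff g_def y_def)
 qed
 have "g:module_hom R Q N"
 proof (rule module_homI)
  fix x assume "x:car Q"
  then obtain u where u: "u:car M" "x = p u" using p by auto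
  then show "g x:car N" using gp homD[OF f] by auto
  fix a assume "a:car R"
  then show "g (a \<odot>\<^sub>Q x) = a \<odot>\<^sub>N g x"
   using u gp[of u] gp[of "a \<odot>\<^sub>M u"] homD[OF f] homD[OF p(1)] by auto
 next
  fix x y assume "x:car Q" "y:car Q"
  then obtain u v where u: "u:car M" "x = p u" "v:car M" "y = p v"
   using p by (metis imageE)
  then show "g (x \<oplus>\<^sub>Q y) = g x \<oplus>\<^sub>N g y"
   using u gp[of u] gp[of v] gp[of "u \<oplus>\<^sub>M v"] homD[OF f] homD[OF p(1)] by auto
 qed
 then show ?thesis using gp by blast
qed

subsection \<open>Isomorphisms\<close>

lemma module_isoI:
 assumes "left_module R M" "left_module R N" "f:module_hom R M N"
  "!!x. x:car M ==> f x = \<zero>\<^sub>N ==> x = \<zero>\<^sub>M" "f ` car M = car N"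
 shows "module_iso R M N"
 using assms hom_inj_iff[OF assms(1-3)] unfolding module_iso_def bij_betw_def by blast

lemma module_iso_refl: "module_iso R M M"
 unfolding module_iso_def using hom_id by (intro bexI[of _ "%x. x"]) (auto simp: bij_betw_def)

lemma inv_hom:
 assumes "left_module R M" "f:module_hom R M N" "bij_betw f (car M) (car N)"
 shows "inv_into (car M) f:module_hom R N M"
proof -
 interpret M: left_module R M by fact
 note f = homD[OF assms(2)]
 have inv: "inv_into (car M) f (f x) = x" if "x:car M" for x
  using that assms(3) by (simp add: bij_betw_def)
 have car: "car N = f ` car M" using assms(3) by (simp add: bij_betw_def)
 show ?thesis
 proof (rule module_homI)
  fix x assume "x:car N"
  then obtain u where u: "u:car M" "x = f u" using car by auto
  then show "inv_into (car M) f x:car M" using inv by auto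
  fix a assume a: "a:car R"
  then show "inv_into (car M) f (a \<odot>\<^sub>N x) = a \<odot>\<^sub>M inv_into (car M) f x"
   using u inv[of u] inv[of "a \<odot>\<^sub>M u"] f by auto
 next
  fix x y assume "x:car N" "y:car N"
  then obtain u v where u: "u:car M" "x = f u" "v:car M" "y = f v" using car by auto
  then show "inv_into (car M) f (x \<oplus>\<^sub>N y) = inv_into (car M) f x \<oplus>\<^sub>M inv_into (car M) f y"
   using u inv[of u] inv[of v] inv[of "u \<oplus>\<^sub>M v"] f by auto
 qed
qed

lemma module_iso_sym: "left_module R M ==> module_iso R M N ==> module_iso R N M"
 unfolding module_iso_def by (meson inv_hom bij_betw_inv_into)

lemma module_iso_trans: "module_iso R L M ==> module_iso R M N ==> module_iso R L N"
 unfolding module_iso_def using hom_comp bij_betw_trans[unfolded o_def] by blast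

lemma module_isoE:
 assumes "module_iso R M N" "left_module R M"
 obtains f g where "f:module_hom R M N" "g:module_hom R N M"
  "!!x. x:car M ==> g (f x) = x" "!!y. y:car N ==> f (g y) = y"
proof -
 obtain f where f: "f:module_hom R M N" "bij_betw f (car M) (car N)"
  using assms by (auto simp: module_iso_def)
 show thesis
  by (rule that[OF f(1) inv_hom[OF assms(2) f]]) (use f(2) in \<open>auto simp: bij_betw_def f_inv_into_f\<close>)
qed

lemma module_isoI':
 assumes "f:module_hom R M N" "g:module_hom R N M"
  "!!x. x:car M ==> g (f x) = x" "!!y. y:car N ==> f (g y) = y"
 shows "module_iso R M N"
 unfolding module_iso_def using assms(1)
 by (intro bexI[of _ f] bij_betw_byWitness[of _ g]) (use assms homD(1) in \<open>fastforce+\<close>)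

subsection \<open>Quotients and products\<close>

definition cmap :: "('a, 'm) module => 'm set => 'm => 'm set" where
 "cmap M N x = N +>\<^sub>M x"

lemma quot_module:
 assumes "left_module R M" "Module.submodule N R M"
 shows "left_module R (quot_module M N)" "cmap M N:module_hom R M (quot_module M N)"
  "cmap M N ` car M = car (quot_module M N)"
  "!!x. x:car M ==> cmap M N x = \<zero>\<^sub>(quot_module M N) \<longleftrightarrow> x:N"
proof -
 interpret M: left_module R M by fact
 have N: "N <= car M" "\<zero>\<^sub>M:N" "!!x y. x:N ==> y:N ==> x \<oplus>\<^sub>M y:N"
  "!!a x. a:car R ==> x:N ==> a \<odot>\<^sub>M x:N"
  using assms(2) unfolding M.subm_iff by auto
 have sg: "subgroup N (add_monoid M)" using assms(2) by (simp add: Module.submodule_def)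
 interpret N: abelian_subgroup N M
  by (intro abelian_subgroupI3 additive_subgroupI sg M.abelian_group_axioms)
 have flds: "car (quot_module M N) = a_rcosets\<^bsub>M\<^esub> N" "\<zero>\<^sub>(quot_module M N) = N"
  "add (quot_module M N) = set_add M"
  "smult (quot_module M N) = (%r X. \<Union>x\<in>X. N +>\<^sub>M (r \<odot>\<^sub>M x))"
  by (simp_all add: quot_module_def FactRing_def ring.extend_def module.fields_def)
 have car: "car (quot_module M N) = cmap M N ` car M"
  by (auto simp: flds A_RCOSETS_def' cmap_def)
 have z: "\<zero>\<^sub>(quot_module M N) = cmap M N \<zero>\<^sub>M"
  using N by (simp add: flds cmap_def)
 have add: "cmap M N x \<oplus>\<^sub>(quot_module M N) cmap M N y = cmap M N (x \<oplus>\<^sub>M y)"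
  if "x:car M" "y:car M" for x y
  using that by (simp add: flds cmap_def N.a_rcos_sum)
 have eq: "cmap M N x = cmap M N y" if "x:cmap M N y" "y:car M" for x y
  using that M.a_repr_independence[OF _ _ sg, of x y] by (simp add: cmap_def)
 \<comment> \<open>The scalar multiple of a coset is a union over its representatives; all of them
   give the same coset, and there is at least one, so the union collapses.\<close>
 have sm: "a \<odot>\<^sub>(quot_module M N) cmap M N x = cmap M N (a \<odot>\<^sub>M x)"
  if a: "a:car R" "x:car M" for a x
 proof -
  have "cmap M N (a \<odot>\<^sub>M u) = cmap M N (a \<odot>\<^sub>M x)" if u: "u:cmap M N x" for u
  proof -
   obtain n where n: "n:N" "u = n \<oplus>\<^sub>M x"
    using u unfolding cmap_def a_r_coset_def' by auto
   have "a \<odot>\<^sub>M u = a \<odot>\<^sub>M n \<oplus>\<^sub>M a \<odot>\<^sub>M x"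
    using n a N by (auto simp: M.smult_r_distr)
   then have "a \<odot>\<^sub>M u:cmap M N (a \<odot>\<^sub>M x)"
    using N(4)[OF a(1) n(1)] unfolding cmap_def a_r_coset_def' by blast
   then show ?thesis using a by (intro eq) auto
  qed
  moreover have "x:cmap M N x"
   using N(2) a(2) unfolding cmap_def a_r_coset_def' by force
  ultimately have "(\<Union>u\<in>cmap M N x. cmap M N (a \<odot>\<^sub>M u)) = cmap M N (a \<odot>\<^sub>M x)"
   by blast
  then show ?thesis by (simp add: flds cmap_def)
 qed
 show "left_module R (quot_module M N)" "cmap M N:module_hom R M (quot_module M N)"
  using lmod_image[OF assms(1) car z add sm] by auto
 show "cmap M N ` car M = car (quot_module M N)" using car by simp
 show "cmap M N x = \<zero>\<^sub>(quot_module M N) \<longleftrightarrow> x:N" if "x:car M" for x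
  unfolding flds cmap_def using M.a_coset_join1[OF _ that sg] M.a_coset_join2[OF that sg] by (rule iffI)
qed

lemma direct_prod_simps [simp]:
 "car (direct_prod A B) = car A \<times> car B" "\<zero>\<^sub>(direct_prod A B) = (\<zero>\<^sub>A, \<zero>\<^sub>B)"
 "(x, y) \<oplus>\<^sub>(direct_prod A B) (x', y') = (x \<oplus>\<^sub>A x', y \<oplus>\<^sub>B y')"
 "c \<odot>\<^sub>(direct_prod A B) (x, y) = (c \<odot>\<^sub>A x, c \<odot>\<^sub>B y)"
 by (simp_all add: direct_prod_def)

lemma lmod_prod:
 assumes "left_module R A" "left_module R B"
 shows "left_module R (direct_prod A B)"
proof -
 interpret A: left_module R A by fact
 interpret B: left_module R B by fact
 have "abelian_group (direct_prod A B)"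
 proof (rule abelian_groupI)
  fix x assume "x:car (direct_prod A B)"
  then show "EX y:car (direct_prod A B). y \<oplus>\<^sub>(direct_prod A B) x = \<zero>\<^sub>(direct_prod A B)"
   by (intro bexI[of _ "(\<ominus>\<^sub>A fst x, \<ominus>\<^sub>B snd x)"]) (auto simp: A.l_neg B.l_neg)
 qed (auto simp: A.a_ac B.a_ac)
 then show ?thesis
  using A.R.ring_axioms
  by (auto intro!: left_module.intro left_module_axioms.intro
    simp: A.smult_l_distr A.smult_r_distr A.smult_assoc1 B.smult_l_distr B.smult_r_distr B.smult_assoc1)
qed

lemma hom_fst: "fst:module_hom R (direct_prod A B) A"
 by (auto simp: module_hom_def)

lemma hom_snd: "snd:module_hom R (direct_prod A B) B"
 by (auto simp: module_hom_def)

lemma hom_pair: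
 "f:module_hom R M A ==> g:module_hom R M B ==> (%x. (f x, g x)):module_hom R M (direct_prod A B)"
 by (auto simp: module_hom_def)

lemma direct_prod_iso_cong:
 assumes "module_iso R A A'" "module_iso R B B'" "left_module R A" "left_module R B"
 shows "module_iso R (direct_prod A B) (direct_prod A' B')"
proof -
 obtain f g where f: "f:module_hom R A A'" "g:module_hom R A' A"
  "!!x. x:car A ==> g (f x) = x" "!!y. y:car A' ==> f (g y) = y"
  using module_isoE[OF assms(1,3)] by blast
 obtain h k where h: "h:module_hom R B B'" "k:module_hom R B' B"
  "!!x. x:car B ==> k (h x) = x" "!!y. y:car B' ==> h (k y) = y"
  using module_isoE[OF assms(2,4)] by blast
 show ?thesis
 proof (rule module_isoI')
  show "(%x. (f (fst x), h (snd x))):module_hom R (direct_prod A B) (direct_prod A' B')"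
   by (intro hom_pair hom_comp[OF hom_fst] hom_comp[OF hom_snd] f h)
  show "(%x. (g (fst x), k (snd x))):module_hom R (direct_prod A' B') (direct_prod A B)"
   by (intro hom_pair hom_comp[OF hom_fst] hom_comp[OF hom_snd] f h)
 qed (use f h in auto)
qed

text \<open>The idempotent \<open>\<sigma>\<close> after \<open>\<rho>\<close> splits
  \<open>Z\<close>, with \<open>z\<close> going to its value under \<open>\<rho>\<close> and the
  remainder. Closure under summands is stated for direct products, and this produces one from a
  retraction.\<close>

lemma retract_iso:
 assumes "left_module R Z" "left_module R Q"
  "\<sigma>:module_hom R Q Z" "\<rho>:module_hom R Z Q" "!!x. x:car Q ==> \<rho> (\<sigma> x) = x"
 shows "module_iso R Z (direct_prod Q (Z(|carrier := {z:car Z. \<rho> z = \<zero>\<^sub>Q}|)))"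
proof -
 interpret Z: left_module R Z by fact
 interpret Q: left_module R Q by fact
 note s = homD[OF assms(3)] and r = homD[OF assms(4)]
 let ?K = "{z:car Z. \<rho> z = \<zero>\<^sub>Q}"
 have sr: "(%z. \<sigma> (\<rho> z)):module_hom R Z Z" by (rule hom_comp[OF assms(4,3)])
 have h: "(%z. z \<ominus>\<^sub>Z \<sigma> (\<rho> z)):module_hom R Z (Z(|carrier := ?K|))"
 proof (rule hom_sub_codomain[OF hom_diff[OF assms(1,1) hom_id sr]])
  fix z assume z: "z:car Z"
  then show "z \<ominus>\<^sub>Z \<sigma> (\<rho> z):?K"
   using s(1)[OF r(1)[OF z]] hom_minus[OF assms(1,2,4)] assms(5) r(1)[OF z]
   by (auto simp: Q.minus_eq_zero_iff)
 qed
 show ?thesis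
 proof (rule module_isoI')
  show "(%z. (\<rho> z, z \<ominus>\<^sub>Z \<sigma> (\<rho> z))):module_hom R Z (direct_prod Q (Z(|carrier := ?K|)))"
   by (intro hom_pair assms(4) h)
  have "(%x. snd x \<oplus>\<^sub>Z \<sigma> (fst x)):module_hom R (direct_prod Q Z) Z"
   by (intro hom_add lmod_prod assms hom_snd hom_comp[OF hom_fst])
  then show "(%x. snd x \<oplus>\<^sub>Z \<sigma> (fst x)):module_hom R (direct_prod Q (Z(|carrier := ?K|))) Z"
   by (auto simp: module_hom_def)
  show "snd (\<rho> x, x \<ominus>\<^sub>Z \<sigma> (\<rho> x)) \<oplus>\<^sub>Z \<sigma> (fst (\<rho> x, x \<ominus>\<^sub>Z \<sigma> (\<rho> x))) = x" if "x:car Z" for x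
   using that s(1)[OF r(1)[OF that]] by (simp add: Z.add_minus_cancel)
  fix y assume "y:car (direct_prod Q (Z(|carrier := ?K|)))"
  then obtain q z where y: "y = (q, z)" "q:car Q" "z:car Z" "\<rho> z = \<zero>\<^sub>Q" by auto
  then have "\<rho> (z \<oplus>\<^sub>Z \<sigma> q) = q" using r s assms(5) by auto
  then show "(\<rho> (snd y \<oplus>\<^sub>Z \<sigma> (fst y)), snd y \<oplus>\<^sub>Z \<sigma> (fst y) \<ominus>\<^sub>Z \<sigma> (\<rho> (snd y \<oplus>\<^sub>Z \<sigma> (fst y)))) = y"
   using y s by (auto simp: Z.minus_add_cancel)
 qed
qed

subsection \<open>Generated submodules, the regular module and lists\<close>

lemma (in left_module) submodule_generated:
 assumes "A <= car M"
 shows "Module.submodule (submodule_generated R M A) R M" "A <= submodule_generated R M A"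
 using assms carrier_subm unfolding submodule_generated_def
 by (auto intro!: left_submoduleI simp: subm_iff)

lemma submodule_generated_least:
 "Module.submodule N R M ==> A <= N ==> submodule_generated R M A <= N"
 by (auto simp: submodule_generated_def)

lemma regular_module_simps [simp]:
 "car (regular_module R) = car R" "\<zero>\<^sub>(regular_module R) = \<zero>\<^sub>R"
 "add (regular_module R) = add R" "smult (regular_module R) = monoid.mult R"
 by (simp_all add: regular_module_def)

lemma lmod_regular:
 assumes "ring R"
 shows "left_module R (regular_module R)"
proof -
 interpret R: ring R by fact
 have "abelian_group (regular_module R)"
 proof (rule abelian_groupI)
  fix x assume "x:car (regular_module R)"
  then show "EX y:car (regular_module R). y \<oplus>\<^sub>(regular_module R) x = \<zero>\<^sub>(regular_module R)"
   by (intro bexI[of _ "\<ominus>\<^sub>R x"]) (auto simp: R.l_neg)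
 qed (auto simp: R.a_ac)
 then show ?thesis
  using R.ring_axioms
  by (auto intro!: left_module.intro left_module_axioms.intro simp: R.l_distr R.r_distr R.m_assoc)
qed

lemma (in left_module) hom_smult:
 assumes "m:car M"
 shows "(%x. x \<odot>\<^sub>M m):module_hom R (regular_module R) M"
 using assms by (auto intro!: module_homI simp: smult_l_distr smult_assoc1)

text \<open>The power of \<open>M\<close> as lists of length \<open>n\<close>: applied to the
  regular module it lands in the universe of modules whose elements are lists over the
  algebra.\<close>

definition list_module :: "('a, 'm) module => nat => ('a, 'm list) module" where
 "list_module M n = (|carrier = {xs. length xs = n & set xs <= car M}, monoid.mult = undefined,
   one = undefined, zero = replicate n \<zero>\<^sub>M, add = map2 (add M), smult = (%c. map (smult M c))|)"

lemma list_module_simps [simp]: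
 "car (list_module M n) = {xs. length xs = n & set xs <= car M}"
 "\<zero>\<^sub>(list_module M n) = replicate n \<zero>\<^sub>M"
 "add (list_module M n) = map2 (add M)" "smult (list_module M n) = (%c. map (smult M c))"
 by (simp_all add: list_module_def)

lemma lmod_list:
 assumes "left_module R M"
 shows "left_module R (list_module M n)"
proof -
 interpret M: left_module R M by fact
 have c: "xs ! i:car M" if "set xs <= car M" "i < length xs" for xs i
  using that by (auto simp: subset_iff)
 have cl: "set (map2 (add M) xs ys) <= car M" if "set xs <= car M" "set ys <= car M" for xs ys
  using that by (force dest: set_zip_leftD set_zip_rightD)
 have "abelian_group (list_module M n)"
 proof (rule abelian_groupI)
  fix x assume "x:car (list_module M n)"
  then show "EX y:car (list_module M n). y \<oplus>\<^sub>(list_module M n) x = \<zero>\<^sub>(list_module M n)"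
   by (intro bexI[of _ "map (%x. \<ominus>\<^sub>M x) x"]) (auto intro!: nth_equalityI simp: c M.l_neg)
 next
  fix x y assume "x:car (list_module M n)" "y:car (list_module M n)"
  then show "x \<oplus>\<^sub>(list_module M n) y:car (list_module M n)"
   using cl[of x y] by simp
 qed (auto intro!: nth_equalityI simp: c M.a_ac)
 then show ?thesis
  using M.R.ring_axioms
  by (auto intro!: left_module.intro left_module_axioms.intro nth_equalityI
    intro: M.smult_closed simp: subset_iff c M.smult_l_distr M.smult_r_distr M.smult_assoc1)
qed

lemma (in left_module) hom_list_comb:
 assumes "set ms <= car M" "length ms = n"
 shows "list_comb M ms:module_hom R (list_module (regular_module R) n) M"
 using assms by (auto intro!: module_homI simp: list_comb_closed list_comb_add list_comb_smult)

lemma finitely_generated_image: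
 assumes "left_module R M" "left_module R Q" "p:module_hom R M Q" "p ` car M = car Q"
  "finitely_generated R M"
 shows "finitely_generated R Q"
proof -
 interpret Q: left_module R Q by fact
 obtain A where A: "finite A" "A <= car M" "submodule_generated R M A = car M"
  using assms(5) by (auto simp: finitely_generated_def)
 have pA: "p ` A <= car Q" using A assms(4) by auto
 have "car Q <= N" if N: "Module.submodule N R Q" "p ` A <= N" for N
 proof -
  have "submodule_generated R M A <= {x:car M. p x:N}"
   using A N by (intro submodule_generated_least subm_vimage[OF assms(1-3)]) auto
  then have "p ` car M <= N" using A(3) by auto
  then show ?thesis using assms(4) by simp
 qed
 then have "submodule_generated R Q (p ` A) = car Q"
  using Q.carrier_subm pA unfolding submodule_generated_def by auto
 then show ?thesis
  using A(1) pA unfolding finitely_generated_def by blast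
qed

lemma fg_module_representable':
 fixes M :: "('a, 'm) module"
 assumes "left_module R M" "finitely_generated R M"
 obtains N :: "('a, 'a list) module" where "N:fg_modules R" "module_iso R M N"
proof -
 obtain N :: "('a, 'a list) module" where N: "left_module R N" "module_iso R M N"
  using fg_module_representable[OF assms] by blast
 then obtain f where "f:module_hom R M N" "f ` car M = car N"
  by (auto simp: module_iso_def bij_betw_def)
 then have "finitely_generated R N"
  using finitely_generated_image[OF assms(1) N(1)] assms by blast
 then show thesis using N that by (simp add: fg_modules_def)
qed

section \<open>Dimensions\<close>

lemma vectorspace_iff_left_module:
 fixes V :: "('k, 'v) module"
 assumes "field K"
 shows "vectorspace K V \<longleftrightarrow> left_module K V"
proof
 interpret K: field K by fact
 assume "vectorspace K V"
 then interpret V: vectorspace K V .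
 show "left_module K V"
  by unfold_locales (auto simp: V.smult_l_distr V.smult_r_distr V.smult_assoc1)
next
 interpret K: field K by fact
 assume "left_module K V"
 then interpret V: left_module K V .
 show "vectorspace K V"
  by (intro vectorspace.intro moduleI K.is_cring assms V.M.abelian_group_axioms)
   (auto simp: V.smult_l_distr V.smult_r_distr V.smult_assoc1)
qed

locale vspace = field K + left_module K V for K :: "('k, 'c) ring_scheme" (structure) and V :: "('k, 'v) module"
begin

lemma vectorspace: "vectorspace K V"
 using vectorspace_iff_left_module[OF field_axioms] left_module_axioms by blast

lemma vspace_sub: "Module.submodule U K V ==> vspace K (V(|carrier := U|))"
 by (intro vspace.intro field_axioms lmod_sub left_module_axioms)

lemma subm_LC: "Module.submodule U K V \<longleftrightarrow> LinearCombinations.submodule K U V"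
 using vectorspace unfolding subm_iff LinearCombinations.submodule_def vectorspace_def
 by (auto simp: subset_iff)

lemma span_subm: "A <= car V ==> Module.submodule (module.span K V A) K V"
 unfolding subm_LC using vectorspace by (simp add: vectorspace_def module.span_is_submodule)

lemma span_subset: "A <= car V ==> A <= module.span K V A"
 using vectorspace by (simp add: vectorspace_def module.in_own_span)

lemma span_least: "Module.submodule U K V ==> A <= U ==> module.span K V A <= U"
 unfolding subm_LC using vectorspace by (simp add: vectorspace_def module.span_is_subset)

lemma span_eq_carrier:
 assumes "A <= car V"
 shows "module.span K V A = car V \<longleftrightarrow> (ALL U. Module.submodule U K V & A <= U --> U = car V)"
 using span_subm[OF assms] span_subset[OF assms] span_least[of _ A]
 by (metis subm_iff subset_antisym)

lemma dim_le:
 assumes "finite A" "A <= car V" "!!U. Module.submodule U K V ==> A <= U ==> U = car V"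
 shows "vectorspace.dim K V <= card A" "vectorspace.fin_dim K V"
proof -
 interpret v: vectorspace K V by (rule vectorspace)
 have "v.gen_set A" using span_eq_carrier assms by blast
 then show "v.dim <= card A" "v.fin_dim"
  using assms v.gen_ge_dim[of A] by (auto simp: v.fin_dim_def)
qed

lemma dim_eq_0:
 assumes "vectorspace.fin_dim K V" "vectorspace.dim K V = 0"
 shows "car V = {\<zero>\<^sub>V}"
proof -
 interpret v: vectorspace K V by (rule vectorspace)
 have "EX n A. finite A & card A = n & A <= car V & v.gen_set A"
  using assms(1) unfolding v.fin_dim_def by blast
 from LeastI_ex[OF this] have "EX A. finite A & card A = v.dim & A <= car V & v.gen_set A"
  unfolding v.dim_def .
 then obtain A where "finite A" "card A = 0" "v.gen_set A" unfolding assms(2) by blast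
 then have "v.gen_set {}" by simp
 then show ?thesis using span_eq_carrier[of "{}"] zero_subm by auto
qed

text \<open>Independent subsets of \<open>U\<close> stay independent in \<open>V\<close> and so have
  bounded size; a maximal one is finite and spans \<open>U\<close>.\<close>

lemma fin_dim_sub:
 assumes "vectorspace.fin_dim K V" "Module.submodule U K V"
 shows "vectorspace.fin_dim K (V(|carrier := U|))"
proof -
 interpret v: vectorspace K V by (rule vectorspace)
 interpret U: vspace K "V(|carrier := U|)" by (rule vspace_sub[OF assms(2)])
 interpret u: vectorspace K "V(|carrier := U|)" by (rule U.vectorspace)
 have sub: "LinearCombinations.submodule K U V" "U <= car V"
  using iffD1[OF subm_LC assms(2)] iffD1[OF subm_iff assms(2)] by simp_all
 define P where "P S \<longleftrightarrow> S <= U & u.lin_indpt S" for S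
 have "EX A. finite A & maximal A P"
 proof (rule maximal_exists)
  fix S assume "P S"
  then have "S <= car V" "v.lin_indpt S"
   using sub v.span_li_not_depend(2)[OF _ sub(1), of S] by (auto simp: P_def)
  then show "finite S & card S <= v.dim"
   using v.li_le_dim[OF assms(1)] by blast
 next
  show "P {}" by (auto simp: P_def u.lin_dep_def)
 qed
 then obtain A where A: "finite A" "maximal A P" by blast
 then have "maximal A (%S. S <= car (V(|carrier := U|)) & u.lin_indpt S)"
  by (simp add: P_def[abs_def])
 then have "u.gen_set A" by (rule u.max_li_is_gen)
 then show ?thesis using A by (auto simp: u.fin_dim_def maximal_def P_def)
qed

lemma rank_nullity:
 assumes "vectorspace.fin_dim K V" "left_module K W" "f:module_hom K V W"
 shows "vectorspace.dim K V = vectorspace.dim K (W(|carrier := f ` car V|)) +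
  vectorspace.dim K (V(|carrier := {v:car V. f v = \<zero>\<^sub>W}|))"
proof -
 interpret v: vectorspace K V by (rule vectorspace)
 interpret w: vectorspace K W using assms(2) vectorspace_iff_left_module[OF field_axioms] by blast
 interpret linear_map K V W f
  using assms(3) by (intro linear_map.intro mod_hom.intro mod_hom_axioms.intro) unfold_locales
 show ?thesis using rank_nullity[OF assms(1)] by (simp add: im_def ker_def)
qed

lemma dim_quot:
 assumes "vectorspace.fin_dim K V" "Module.submodule U K V"
 shows "vectorspace.dim K V = vectorspace.dim K (quot_module V U) + vectorspace.dim K (V(|carrier := U|))"
  "vectorspace.fin_dim K (quot_module V U)"
proof -
 note q = quot_module[OF left_module_axioms assms(2)]
 have sub: "U <= car V" using iffD1[OF subm_iff assms(2)] by simp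
 have "{v:car V. cmap V U v = \<zero>\<^sub>(quot_module V U)} = U"
  using q(4) sub by auto
 moreover have "(quot_module V U)(|carrier := cmap V U ` car V|) = quot_module V U"
  using q(3) by simp
 ultimately show "vectorspace.dim K V = vectorspace.dim K (quot_module V U) + vectorspace.dim K (V(|carrier := U|))"
  using rank_nullity[OF assms(1) q(1,2)] by simp
 interpret v: vectorspace K V by (rule vectorspace)
 interpret q: vspace K "quot_module V U" by (intro vspace.intro field_axioms q(1))
 obtain A where A: "finite A" "A <= car V" "v.gen_set A"
  using assms(1) by (auto simp: v.fin_dim_def)
 show "vectorspace.fin_dim K (quot_module V U)"
 proof (rule q.dim_le(2))
  show "finite (cmap V U ` A)" "cmap V U ` A <= car (quot_module V U)"
   using A q(3) by auto
  fix T assume T: "Module.submodule T K (quot_module V U)" "cmap V U ` A <= T"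
  have "{v:car V. cmap V U v:T} = car V"
   using A T subm_vimage[OF left_module_axioms q(1,2) T(1)] span_eq_carrier[OF A(2)]
   by blast
  then have "cmap V U ` car V <= T" by auto
  then have "car (quot_module V U) <= T" using q(3) by simp
  then show "T = car (quot_module V U)" using T(1) unfolding q.subm_iff by blast
 qed
qed

lemma dim_sub_le:
 assumes "vectorspace.fin_dim K V" "Module.submodule U K V"
 shows "vectorspace.dim K (V(|carrier := U|)) <= vectorspace.dim K V"
 using dim_quot[OF assms] by simp

lemma dim_sub_eq:
 assumes "vectorspace.fin_dim K V" "Module.submodule U K V"
  "vectorspace.dim K (V(|carrier := U|)) = vectorspace.dim K V"
 shows "U = car V"
proof -
 note q = quot_module[OF left_module_axioms assms(2)]
 interpret q: vspace K "quot_module V U" by (intro vspace.intro field_axioms q(1))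
 have "car (quot_module V U) = {\<zero>\<^sub>(quot_module V U)}"
  using dim_quot[OF assms(1,2)] assms(3) by (intro q.dim_eq_0) auto
 then have "x:U" if "x:car V" for x
  using q(4)[OF that] imageI[OF that, of "cmap V U"] unfolding q(3) by simp
 then show ?thesis using assms(2) unfolding subm_iff by blast
qed

lemma dim_zero: "vectorspace.dim K (V(|carrier := {\<zero>\<^sub>V}|)) = 0"
proof -
 interpret z: vspace K "V(|carrier := {\<zero>\<^sub>V}|)" by (rule vspace_sub[OF zero_subm])
 have "vectorspace.dim K (V(|carrier := {\<zero>\<^sub>V}|)) <= card ({} :: 'v set)"
  by (rule z.dim_le(1)) (auto simp: z.subm_iff)
 then show ?thesis by simp
qed

lemma dim_iso:
 assumes "vectorspace.fin_dim K V" "left_module K W" "f:module_hom K V W"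
  "!!x. x:car V ==> f x = \<zero>\<^sub>W ==> x = \<zero>\<^sub>V"
 shows "vectorspace.dim K (W(|carrier := f ` car V|)) = vectorspace.dim K V"
proof -
 have "{v:car V. f v = \<zero>\<^sub>W} = {\<zero>\<^sub>V}"
  using assms(4) hom_zero[OF left_module_axioms assms(2,3)] by auto
 then show ?thesis using rank_nullity[OF assms(1-3)] dim_zero by simp
qed

lemma dim_line:
 assumes "v:car V" "v ~= \<zero>\<^sub>V" "car V = {c \<odot>\<^sub>V v |c. c:car K}"
 shows "vectorspace.dim K V = 1"
proof -
 interpret v: vectorspace K V by (rule vectorspace)
 have "v.gen_set {v}"
  using span_eq_carrier[of "{v}"] assms by (auto simp: subm_iff)
 then show ?thesis using assms by (intro v.dim1I) auto
qed

text \<open>\<open>A\<close> has the greatest dimension among subspaces meeting \<open>U\<close>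
  trivially. If \<open>v\<close> were outside \<open>A + U\<close>, adjoining its line would still
  meet \<open>U\<close> trivially, because a nonzero coefficient of \<open>v\<close> could be
  inverted to put \<open>v\<close> into \<open>A + U\<close>.\<close>

lemma complement:
 assumes "vectorspace.fin_dim K V" "Module.submodule U K V"
 obtains A where "Module.submodule A K V" "A \<inter> U = {\<zero>\<^sub>V}"
  "!!v. v:car V ==> EX a:A. EX u:U. v = a \<oplus>\<^sub>V u"
  "vectorspace.dim K V = vectorspace.dim K (V(|carrier := A|)) + vectorspace.dim K (V(|carrier := U|))"
proof -
 define d where "d A = vectorspace.dim K (V(|carrier := A|))" for A
 define P where "P A \<longleftrightarrow> Module.submodule A K V & A \<inter> U = {\<zero>\<^sub>V}" for A
 have U: "U <= car V" "\<zero>\<^sub>V:U" "!!x y. x:U ==> y:U ==> x \<oplus>\<^sub>V y:U"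
  "!!a x. a:car K ==> x:U ==> a \<odot>\<^sub>V x:U"
  using assms(2) unfolding subm_iff by auto
 have "EX x. P x & (ALL y. P y --> d y <= d x)"
 proof (rule ex_has_greatest_nat[of P "{\<zero>\<^sub>V}" d "Suc (vectorspace.dim K V)"])
  show "P {\<zero>\<^sub>V}" using zero_subm U by (auto simp: P_def)
  show "ALL y. P y --> d y < Suc (vectorspace.dim K V)"
   using dim_sub_le[OF assms(1)] by (auto simp: P_def d_def less_Suc_eq_le)
 qed
 then obtain A where A: "P A" and max: "!!B. P B ==> d B <= d A" by blast
 have As: "A <= car V" "\<zero>\<^sub>V:A" "!!x y. x:A ==> y:A ==> x \<oplus>\<^sub>V y:A"
  "!!a x. a:car K ==> x:A ==> a \<odot>\<^sub>V x:A" "A \<inter> U = {\<zero>\<^sub>V}"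
  using A unfolding P_def subm_iff by auto
 have sum: "EX a:A. EX u:U. v = a \<oplus>\<^sub>V u" if v: "v:car V" for v
 proof (rule ccontr)
  assume no: "~ ?thesis"
  define B where "B = {a \<oplus>\<^sub>V c \<odot>\<^sub>V v |a c. a:A & c:car K}"
  have "Module.submodule B K V"
  proof (rule left_submoduleI)
   show "B <= car V" using v As by (auto simp: B_def)
   have "\<zero>\<^sub>V = \<zero>\<^sub>V \<oplus>\<^sub>V \<zero> \<odot>\<^sub>V v" using v by simp
   then show "\<zero>\<^sub>V:B" using As unfolding B_def by blast
   fix x y assume "x:B" "y:B"
   then obtain a c b e where x: "a:A" "c:car K" "x = a \<oplus>\<^sub>V c \<odot>\<^sub>V v"
    and y: "b:A" "e:car K" "y = b \<oplus>\<^sub>V e \<odot>\<^sub>V v" unfolding B_def by blast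
   have "x \<oplus>\<^sub>V y = (a \<oplus>\<^sub>V b) \<oplus>\<^sub>V (c \<oplus> e) \<odot>\<^sub>V v"
    using x y v subsetD[OF As(1)] by (simp add: smult_l_distr M.a_ac)
   then show "x \<oplus>\<^sub>V y:B" using x y As(3) unfolding B_def by blast
  next
   fix c x assume c: "c:car K" and "x:B"
   then obtain b e where y: "b:A" "e:car K" "x = b \<oplus>\<^sub>V e \<odot>\<^sub>V v" unfolding B_def by blast
   have "c \<odot>\<^sub>V x = c \<odot>\<^sub>V b \<oplus>\<^sub>V (c \<otimes> e) \<odot>\<^sub>V v"
    using y v c subsetD[OF As(1)] by (simp add: smult_r_distr smult_assoc1)
   then show "c \<odot>\<^sub>V x:B" using y c As(4) unfolding B_def by blast
  qed
  moreover have "x = \<zero>\<^sub>V" if x: "x:B" "x:U" for x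
  proof -
   obtain a c where ac: "a:A" "c:car K" "x = a \<oplus>\<^sub>V c \<odot>\<^sub>V v"
    using x unfolding B_def by blast
   have aV: "a:car V" "x:car V" using ac As x U by auto
   have "c = \<zero>"
   proof (rule ccontr)
    assume "c ~= \<zero>"
    then have ci: "inv c:car K" "inv c \<otimes> c = \<one>" using ac field_Units by auto
    have "c \<odot>\<^sub>V v = \<ominus>\<^sub>V a \<oplus>\<^sub>V x" using ac aV v by (simp add: M.r_neg1)
    then have "v = inv c \<odot>\<^sub>V (\<ominus>\<^sub>V a \<oplus>\<^sub>V x)"
     using ci ac v by (metis smult_assoc1 smult_one)
    then have "v = inv c \<odot>\<^sub>V (\<ominus>\<^sub>V a) \<oplus>\<^sub>V inv c \<odot>\<^sub>V x"
     using ci aV by (simp add: smult_r_distr)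
    moreover have "inv c \<odot>\<^sub>V (\<ominus>\<^sub>V a):A" "inv c \<odot>\<^sub>V x:U"
     using ci ac x A As(4) U(4) subm_neg[of A a] by (auto simp: P_def)
    ultimately show False using no by blast
   qed
   then have "x = a" using ac v aV by simp
   then show ?thesis using ac x As(5) by blast
  qed
  moreover have "A <= B"
  proof
   fix a assume a: "a:A"
   then have "a = a \<oplus>\<^sub>V \<zero> \<odot>\<^sub>V v" using v As by auto
   then show "a:B" using a unfolding B_def by blast
  qed
  ultimately have B: "P B" "A <= B" "Module.submodule B K V" using U As by (auto simp: P_def)
  interpret B: vspace K "V(|carrier := B|)" by (rule vspace_sub[OF B(3)])
  have sA: "Module.submodule A K (V(|carrier := B|))"
   using subm_sub_iff[OF left_module_axioms B(3)] A B by (auto simp: P_def)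
  have "d A <= d B"
   using B.dim_sub_le[OF fin_dim_sub[OF assms(1) B(3)] sA] by (simp add: d_def)
  then have "d A = d B" using max[OF B(1)] by simp
  then have "A = B"
   using B.dim_sub_eq[OF fin_dim_sub[OF assms(1) B(3)] sA] by (simp add: d_def)
  moreover have "v:B"
  proof -
   have "v = \<zero>\<^sub>V \<oplus>\<^sub>V \<one> \<odot>\<^sub>V v" using v by simp
   then show ?thesis using As unfolding B_def by blast
  qed
  moreover have "v = v \<oplus>\<^sub>V \<zero>\<^sub>V" using v by simp
  ultimately show False using no U(2) by blast
 qed
 have Asub: "Module.submodule A K V" using A by (simp add: P_def)
 interpret A: vspace K "V(|carrier := A|)" by (rule vspace_sub[OF Asub])
 note q = quot_module[OF left_module_axioms assms(2)]
 have h: "cmap V U:module_hom K (V(|carrier := A|)) (quot_module V U)"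
  using q(2) As(1) by (rule hom_sub_domain)
 have im: "cmap V U ` A = car (quot_module V U)"
 proof -
  have "cmap V U v:cmap V U ` A" if v: "v:car V" for v
  proof -
   obtain a u where au: "a:A" "u:U" "v = a \<oplus>\<^sub>V u" using sum[OF v] by blast
   interpret Q: left_module K "quot_module V U" by (rule q(1))
   have "cmap V U v = cmap V U a \<oplus>\<^sub>(quot_module V U) cmap V U u"
    using au subsetD[OF As(1)] subsetD[OF U(1)] homD(2)[OF q(2), of a u] by simp
   also have "cmap V U u = \<zero>\<^sub>(quot_module V U)" using au subsetD[OF U(1)] q(4)[of u] by simp
   finally show ?thesis using au As homD(1)[OF q(2)] by (auto simp: subset_iff)
  qed
  then have "cmap V U ` A = cmap V U ` car V" using As(1) by auto
  then show ?thesis using q(3) by simp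
 qed
 have "vectorspace.dim K ((quot_module V U)(|carrier := cmap V U ` car (V(|carrier := A|))|)) = d A"
  unfolding d_def
 proof (rule A.dim_iso[OF fin_dim_sub[OF assms(1) Asub] q(1) h])
  fix x assume "x:car (V(|carrier := A|))" "cmap V U x = \<zero>\<^sub>(quot_module V U)"
  then have "x:A \<inter> U" using q(4)[of x] As(1) by auto
  then show "x = \<zero>\<^sub>(V(|carrier := A|))" using As(5) by simp
 qed
 then have "vectorspace.dim K (quot_module V U) = d A"
  using im by simp
 then show thesis
  using that[OF Asub As(5) sum] dim_quot(1)[OF assms] by (simp add: d_def)
qed

end

text \<open>Each functional costs one generator: pass to its kernel, and add one vector on which it
  does not vanish. Dimensions are thus bounded by finding enough functionals, which serves both the
  Cartan matrix and the extension groups.\<close>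

lemma generators_of_functionals:
 fixes V :: "('k, 'v) module"
 assumes "field K" "left_module K V" "Module.submodule W K V"
  "!!\<theta>. \<theta>:set ts ==> \<theta>:module_hom K V (regular_module K)"
  "!!x. x:car V ==> (!!\<theta>. \<theta>:set ts ==> \<theta> x = \<zero>\<^sub>K) ==> x:W"
 shows "EX A. finite A & card A <= length ts & A <= car V &
  (ALL U. Module.submodule U K V & W <= U & A <= U --> U = car V)"
 using assms(2-)
proof (induction ts arbitrary: V W)
 case Nil
 interpret V: left_module K V by fact
 have "car V <= W" using Nil(4) by auto
 then show ?case by (intro exI[of _ "{}"]) (auto simp: V.subm_iff)
next
 case (Cons \<theta> ts)
 interpret K: field K by fact
 interpret V: left_module K V by fact
 interpret KK: left_module K "regular_module K" by (rule lmod_regular[OF K.ring_axioms])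
 have \<theta>: "\<theta>:module_hom K V (regular_module K)" using Cons by simp
 define V' where "V' = {x:car V. \<theta> x = \<zero>\<^sub>K}"
 have V': "Module.submodule V' K V"
  using subm_kernel[OF V.left_module_axioms KK.left_module_axioms \<theta>] by (simp add: V'_def)
 have lV': "left_module K (V(|carrier := V'|))" by (rule lmod_sub[OF V.left_module_axioms V'])
 have sub: "V' <= car V" by (auto simp: V'_def)
 have "EX A. finite A & card A <= length ts & A <= car (V(|carrier := V'|)) &
  (ALL U. Module.submodule U K (V(|carrier := V'|)) & W \<inter> V' <= U & A <= U --> U = car (V(|carrier := V'|)))"
 proof (rule Cons.IH[OF lV'])
  show "Module.submodule (W \<inter> V') K (V(|carrier := V'|))"
   using subm_sub_iff[OF V.left_module_axioms V'] V.subm_Int[OF Cons.prems(2) V'] by auto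
  show "\<theta>':module_hom K (V(|carrier := V'|)) (regular_module K)" if "\<theta>':set ts" for \<theta>'
   using that Cons.prems(3)[of \<theta>'] sub by (intro hom_sub_domain) auto
  show "x:W \<inter> V'" if "x:car (V(|carrier := V'|))" "!!\<theta>. \<theta>:set ts ==> \<theta> x = \<zero>\<^sub>K" for x
   using that Cons.prems(4)[of x] by (auto simp: V'_def)
 qed
 then obtain A where A: "finite A" "card A <= length ts" "A <= V'"
  and gen: "!!U. Module.submodule U K (V(|carrier := V'|)) ==> W \<inter> V' <= U ==> A <= U ==> U = V'"
  by auto
 have V'U: "V' <= U" if "Module.submodule U K V" "W <= U" "A <= U" for U
 proof -
  have "U \<inter> V' = V'"
   using that A subm_sub_iff[OF V.left_module_axioms V'] V.subm_Int[OF that(1) V']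
   by (intro gen) auto
  then show ?thesis by auto
 qed
 show ?case
 proof (cases "V' = car V")
  case True
  then have "U = car V" if "Module.submodule U K V" "W <= U" "A <= U" for U
   using V'U[OF that] that(1) unfolding V.subm_iff by blast
  then show ?thesis using A sub by (intro exI[of _ A]) auto
 next
  case False
  then obtain v where v: "v:car V" "\<theta> v ~= \<zero>\<^sub>K" by (auto simp: V'_def)
  have tv: "\<theta> v:car K" using homD(1)[OF \<theta> v(1)] by simp
  have "U = car V" if U: "Module.submodule U K V" "W <= U" "insert v A <= U" for U
  proof -
   have "x:U" if x: "x:car V" for x
   proof -
    have tx: "\<theta> x:car K" using homD(1)[OF \<theta> x] by simp
    define c where "c = \<theta> x \<otimes>\<^sub>K inv\<^bsub>K\<^esub> \<theta> v"
    have c: "c:car K" "c \<otimes>\<^sub>K \<theta> v = \<theta> x"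
     using v tv tx K.field_Units by (auto simp: c_def K.m_assoc)
    have "\<theta> (x \<ominus>\<^sub>V c \<odot>\<^sub>V v) = \<theta> x \<ominus>\<^sub>(regular_module K) \<theta> (c \<odot>\<^sub>V v)"
     using x c v by (intro hom_minus[OF V.left_module_axioms KK.left_module_axioms \<theta>]) auto
    also have "\<theta> (c \<odot>\<^sub>V v) = \<theta> x" using homD(3)[OF \<theta>] c v by simp
    also have "\<theta> x \<ominus>\<^sub>(regular_module K) \<theta> x = \<zero>\<^sub>K"
     using KK.M.minus_eq_zero_iff[of "\<theta> x" "\<theta> x"] tx by simp
    finally have "x \<ominus>\<^sub>V c \<odot>\<^sub>V v:V'" using x c v by (simp add: V'_def)
    then have "x \<ominus>\<^sub>V c \<odot>\<^sub>V v:U" using V'U[OF U(1,2)] U by auto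
    moreover have "c \<odot>\<^sub>V v:U" using U c unfolding V.subm_iff by auto
    ultimately have "(x \<ominus>\<^sub>V c \<odot>\<^sub>V v) \<oplus>\<^sub>V c \<odot>\<^sub>V v:U" using U unfolding V.subm_iff by blast
    then show ?thesis using x c v by (simp add: V.M.add_minus_cancel)
   qed
   then show ?thesis using U(1) unfolding V.subm_iff by blast
  qed
  then show ?thesis
   using A v sub by (intro exI[of _ "insert v A"]) (auto simp: card_insert_if)
 qed
qed

lemma dim_quot_le_functionals:
 fixes V :: "('k, 'v) module"
 assumes "field K" "left_module K V" "Module.submodule W K V"
  "!!\<theta>. \<theta>:set ts ==> \<theta>:module_hom K V (regular_module K)"
  "!!x. x:car V ==> (!!\<theta>. \<theta>:set ts ==> \<theta> x = \<zero>\<^sub>K) ==> x:W"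
 shows "vectorspace.dim K (quot_module V W) <= length ts"
proof -
 obtain A where A: "finite A" "card A <= length ts" "A <= car V"
  and gen0: "ALL U. Module.submodule U K V & W <= U & A <= U --> U = car V"
  using generators_of_functionals[OF assms(1-3), of ts] assms(4,5) by metis
 have gen: "U = car V" if "Module.submodule U K V" "W <= U" "A <= U" for U
  using gen0 that by simp
 note q = quot_module[OF assms(2,3)]
 interpret V: left_module K V by fact
 interpret q: vspace K "quot_module V W" by (intro vspace.intro assms(1) q(1))
 have "vectorspace.dim K (quot_module V W) <= card (cmap V W ` A)"
 proof (rule q.dim_le(1))
  show "finite (cmap V W ` A)" "cmap V W ` A <= car (quot_module V W)"
   using A q(3) by auto
  fix T assume T: "Module.submodule T K (quot_module V W)" "cmap V W ` A <= T"
  have "{v:car V. cmap V W v:T} = car V"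
  proof (rule gen[OF subm_vimage[OF assms(2) q(1,2) T(1)]])
   show "W <= {v:car V. cmap V W v:T}"
   proof
    fix w assume "w:W"
    then have "w:car V" using iffD1[OF V.subm_iff assms(3)] by auto
    then show "w:{v:car V. cmap V W v:T}"
     using q(4)[of w] iffD1[OF q.subm_iff T(1)] \<open>w:W\<close> by simp
   qed
  qed (use T A in auto)
  then have "cmap V W ` car V <= T" by auto
  then have "car (quot_module V W) <= T" using q(3) by simp
  then show "T = car (quot_module V W)" using T(1) unfolding q.subm_iff by blast
 qed
 also have "\<dots> <= length ts" using card_image_le[OF A(1)] A(2) by (rule order_trans)
 finally show ?thesis .
qed

lemma (in vspace) span_eqD:
 assumes "module.span K V A = car V" "A <= car V" "Module.submodule U K V" "A <= U"
 shows "U = car V"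
 using span_least[OF assms(3,4)] assms(1) iffD1[OF subm_iff assms(3)] by blast

lemma (in vspace) fin_dim_extension:
 assumes "left_module K W" "vectorspace.fin_dim K W" "f:module_hom K V W" "f ` car V = car W"
  "vectorspace.fin_dim K (V(|carrier := {v:car V. f v = \<zero>\<^sub>W}|))"
 shows "vectorspace.fin_dim K V"
proof -
 let ?N = "{v:car V. f v = \<zero>\<^sub>W}"
 have N: "Module.submodule ?N K V" by (rule subm_kernel[OF left_module_axioms assms(1,3)])
 interpret W: vspace K W by (intro vspace.intro field_axioms assms(1))
 interpret N: vspace K "V(|carrier := ?N|)" by (rule vspace_sub[OF N])
 interpret w: vectorspace K W by (rule W.vectorspace)
 interpret n: vectorspace K "V(|carrier := ?N|)" by (rule N.vectorspace)
 obtain A where A: "finite A" "A <= ?N" "n.gen_set A"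
  using assms(5) by (auto simp: n.fin_dim_def)
 obtain B where B: "finite B" "B <= car W" "w.gen_set B"
  using assms(2) by (auto simp: w.fin_dim_def)
 define g where "g = inv_into (car V) f"
 have g: "g b:car V" "f (g b) = b" if "b:car W" for b
  using that assms(4) unfolding g_def by (auto intro: inv_into_into f_inv_into_f)
 show ?thesis
 proof (rule dim_le(2))
  show "finite (A \<union> g ` B)" "A \<union> g ` B <= car V" using A B g by auto
  fix U assume U: "Module.submodule U K V" "A \<union> g ` B <= U"
  have "Module.submodule (U \<inter> ?N) K (V(|carrier := ?N|))"
   using subm_sub_iff[OF left_module_axioms N] subm_Int[OF U(1) N] by auto
  then have "U \<inter> ?N = ?N"
   using N.span_eqD[of A "U \<inter> ?N"] A U(2) by auto
  then have kU: "?N <= U" by auto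
  have "b:f ` U" if "b:B" for b
  proof -
   have "g b:U" "b = f (g b)" using that U(2) B(2) g by auto
   then show ?thesis by blast
  qed
  then have "B <= f ` U" by auto
  then have "f ` U = car W"
   by (rule W.span_eqD[OF B(3,2) subm_image[OF left_module_axioms assms(1,3) U(1)]])
  have "v:U" if v: "v:car V" for v
  proof -
   have "f v:f ` U" using v \<open>f ` U = car W\<close> homD(1)[OF assms(3) v] by simp
   then obtain u where u: "u:U" "f u = f v" by auto
   then have uV: "u:car V" using iffD1[OF subm_iff U(1)] by auto
   then have "f (v \<ominus>\<^sub>V u) = \<zero>\<^sub>W"
    using hom_minus[OF left_module_axioms assms(1,3) v uV] u homD(1)[OF assms(3) v]
    by (simp add: W.M.minus_eq_zero_iff)
   then have "v \<ominus>\<^sub>V u:U" using kU v uV by auto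
   then have "(v \<ominus>\<^sub>V u) \<oplus>\<^sub>V u:U" using u iffD1[OF subm_iff U(1)] by blast
   then show ?thesis using v uV by (simp add: M.add_minus_cancel)
  qed
  then show "U = car V" using iffD1[OF subm_iff U(1)] by blast
 qed
qed

lemma (in vspace) fin_dim_image:
 assumes "vectorspace.fin_dim K V" "left_module K W" "f:module_hom K V W" "f ` car V = car W"
 shows "vectorspace.fin_dim K W"
proof -
 interpret v: vectorspace K V by (rule vectorspace)
 interpret W: vspace K W by (intro vspace.intro field_axioms assms(2))
 have "EX A. finite A & A <= car V & v.gen_set A"
  using assms(1) unfolding v.fin_dim_def .
 then obtain A where A: "finite A" "A <= car V" "v.gen_set A"
  by (elim exE conjE)
 show ?thesis
 proof (rule W.dim_le(2))
  show "finite (f ` A)" "f ` A <= car W" using A assms(4) by auto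
  fix T assume T: "Module.submodule T K W" "f ` A <= T"
  have "A <= {v:car V. f v:T}" using A T by auto
  then have "{v:car V. f v:T} = car V"
   by (rule span_eqD[OF A(3,2) subm_vimage[OF left_module_axioms assms(2,3) T(1)]])
  then have "f ` car V <= T" by auto
  then show "T = car W" using iffD1[OF W.subm_iff T(1)] assms(4) by auto
 qed
qed

section \<open>Modules over a finite-dimensional algebra\<close>

locale fd_algebra = k_algebra K \<Lambda> for K :: "'k ring" and \<Lambda> :: "('k, 'a) module" (structure) +
 assumes fin_dim: "vectorspace.fin_dim K \<Lambda>"
begin

abbreviation lmod :: "('a, 'm) module => bool" where "lmod M == left_module \<Lambda> M"
abbreviation subm :: "'m set => ('a, 'm) module => bool" where "subm U M == Module.submodule U \<Lambda> M"
abbreviation mhom :: "('a, 'm) module => ('a, 'n) module => ('m => 'n) set" where "mhom M N == module_hom \<Lambda> M N"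
abbreviation reg :: "('a, 'a) module" where "reg == regular_module \<Lambda>"

definition emb :: "'k => 'a" where
 "emb c = c \<odot>\<^sub>\<Lambda> \<one>\<^sub>\<Lambda>"

definition KV :: "('a, 'm) module => ('k, 'm) module" where
 "KV M = (|carrier = car M, monoid.mult = undefined, one = undefined, zero = zero M, add = add M,
   smult = (%c x. emb c \<odot>\<^sub>M x)|)"

text \<open>The subspace is an argument of its own, so that subspaces and submodules of one module
  are compared without changing the module.\<close>

definition kdim :: "('a, 'm) module => 'm set => nat" where
 "kdim M U = vectorspace.dim K ((KV M)(|carrier := U|))"

text \<open>Replaces \<open>fg_modules\<close> for elements of any type: quotients, products and
  submodules of left ideals are then handled without first moving them into the universe. The two
  agree there by \<open>fg_modules_iff\<close>.\<close>

definition fdm :: "('a, 'm) module => bool" where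
 "fdm M \<longleftrightarrow> lmod M & vectorspace.fin_dim K (KV M)"

lemma field_K: "field K" by (rule Vec.field_axioms)

lemma ring_\<Lambda>: "ring \<Lambda>" by (rule Alg.ring_axioms)

lemma lmod_K: "left_module K \<Lambda>"
 using vectorspace_iff_left_module[OF field_K] Vec.vectorspace_axioms by blast

lemma emb_closed [simp, intro]: "c:car K ==> emb c:car \<Lambda>"
 by (simp add: emb_def)

lemma emb_mult_left: "c:car K ==> x:car \<Lambda> ==> emb c \<otimes> x = c \<odot> x"
 by (simp add: emb_def smult_mult_left)

lemma emb_mult_right: "c:car K ==> x:car \<Lambda> ==> x \<otimes> emb c = c \<odot> x"
 by (simp add: emb_def smult_mult_right)

lemma emb_commute: "c:car K ==> x:car \<Lambda> ==> emb c \<otimes> x = x \<otimes> emb c"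
 by (simp add: emb_mult_left emb_mult_right)

lemma emb_add: "c:car K ==> d:car K ==> emb (c \<oplus>\<^sub>K d) = emb c \<oplus> emb d"
 by (simp add: emb_def Vec.smult_l_distr)

lemma emb_mult: "c:car K ==> d:car K ==> emb (c \<otimes>\<^sub>K d) = emb c \<otimes> emb d"
 by (simp add: emb_mult_left) (simp add: emb_def Vec.smult_assoc1)

lemma emb_one: "emb \<one>\<^sub>K = \<one>"
 by (simp add: emb_def)

lemma emb_zero: "emb \<zero>\<^sub>K = \<zero>"
 by (simp add: emb_def)

lemma emb_inv: "c:car K ==> c ~= \<zero>\<^sub>K ==> inv\<^bsub>K\<^esub> c:car K & emb (inv\<^bsub>K\<^esub> c) \<otimes> emb c = \<one>"
 using Vec.field_Units by (simp add: emb_mult[symmetric] emb_one)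

lemma KV_simps [simp]:
 "car (KV M) = car M" "\<zero>\<^sub>(KV M) = \<zero>\<^sub>M" "add (KV M) = add M" "c \<odot>\<^sub>(KV M) x = emb c \<odot>\<^sub>M x"
 by (simp_all add: KV_def)

lemma KV_sub [simp]: "KV (M(|carrier := N|)) = (KV M)(|carrier := N|)"
 by (simp add: KV_def)

lemma kdim_sub [simp]: "kdim (M(|carrier := N|)) U = kdim M U"
 by (simp add: kdim_def)

lemma lmod_KV:
 assumes "lmod M"
 shows "left_module K (KV M)"
proof -
 interpret M: left_module \<Lambda> M by fact
 have "abelian_group (KV M)"
 proof (rule abelian_groupI)
  fix x assume "x:car (KV M)"
  then show "EX y:car (KV M). y \<oplus>\<^sub>(KV M) x = \<zero>\<^sub>(KV M)"
   by (intro bexI[of _ "\<ominus>\<^sub>M x"]) (auto simp: M.M.l_neg)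
 qed (auto simp: M.M.a_ac)
 then show ?thesis
  using Vec.field_axioms Vec.ring_axioms
  by (auto intro!: left_module.intro left_module_axioms.intro
    simp: emb_add emb_mult emb_one M.smult_l_distr M.smult_r_distr M.smult_assoc1)
qed

lemma vspace_KV: "lmod M ==> vspace K (KV M)"
 by (intro vspace.intro field_K lmod_KV)

lemma hom_KV: "f:mhom M N ==> f:module_hom K (KV M) (KV N)"
 by (auto simp: module_hom_def)

lemma subm_KV:
 assumes "lmod M" "subm N M"
 shows "Module.submodule N K (KV M)"
proof -
 interpret M: left_module \<Lambda> M by fact
 interpret KM: left_module K "KV M" by (rule lmod_KV[OF assms(1)])
 show ?thesis using assms(2) unfolding M.subm_iff KM.subm_iff by auto
qed

lemma fdmD: "fdm M ==> lmod M" "fdm M ==> vectorspace.fin_dim K (KV M)"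
 by (auto simp: fdm_def)

lemma fdm_sub:
 assumes "fdm M" "subm N M"
 shows "fdm (M(|carrier := N|))"
 using assms lmod_sub vspace.fin_dim_sub[OF vspace_KV _ subm_KV]
 unfolding fdm_def KV_sub by blast

lemma fdm_image:
 assumes "fdm M" "lmod Q" "p:mhom M Q" "p ` car M = car Q"
 shows "fdm Q"
 using assms vspace.fin_dim_image[OF vspace_KV _ lmod_KV hom_KV, of M Q p]
 by (simp add: fdm_def)

lemma fdm_quot:
 assumes "fdm M" "subm N M"
 shows "fdm (quot_module M N)"
 using fdm_image[OF assms(1) quot_module(1,2,3)] fdmD assms by blast

lemma fdm_iso: "fdm M ==> lmod N ==> module_iso \<Lambda> M N ==> fdm N"
 by (auto simp: module_iso_def bij_betw_def intro: fdm_image)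

lemma fdm_extension:
 assumes "lmod M" "fdm Q" "p:mhom M Q" "p ` car M = car Q"
  "fdm (M(|carrier := {x:car M. p x = \<zero>\<^sub>Q}|))"
 shows "fdm M"
 using assms vspace.fin_dim_extension[OF vspace_KV lmod_KV _ hom_KV, of M Q p]
 by (simp add: fdm_def)

lemma lmod_reg: "lmod reg"
 by (rule lmod_regular[OF ring_\<Lambda>])

lemma fdm_regular: "fdm reg"
proof -
 interpret V: vspace K \<Lambda> by (intro vspace.intro field_K lmod_K)
 have "(%x. x):module_hom K \<Lambda> (KV reg)"
  by (auto intro!: module_homI simp: emb_mult_left)
 then show ?thesis
  using V.fin_dim_image[OF fin_dim lmod_KV[OF lmod_reg]] lmod_reg
  by (simp add: fdm_def)
qed

lemma fdm_direct_prod: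
 assumes "fdm A" "fdm B"
 shows "fdm (direct_prod A B)"
proof -
 interpret A: left_module \<Lambda> A using assms by (rule_tac fdmD)
 interpret B: left_module \<Lambda> B using assms by (rule_tac fdmD)
 let ?P = "direct_prod A B"
 have P: "lmod ?P" using lmod_prod A.left_module_axioms B.left_module_axioms .
 have K: "subm {x:car ?P. snd x = \<zero>\<^sub>B} ?P"
  by (rule subm_kernel[OF P B.left_module_axioms hom_snd])
 show ?thesis
 proof (rule fdm_extension[OF P assms(2) hom_snd])
  have "(%a. (a, \<zero>\<^sub>B)):mhom A ?P"
   by (intro hom_pair hom_id hom_zero_map B.left_module_axioms)
  then have "(%a. (a, \<zero>\<^sub>B)):mhom A (?P(|carrier := {x:car ?P. snd x = \<zero>\<^sub>B}|))"
   by (rule hom_sub_codomain) auto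
  then show "fdm (?P(|carrier := {x:car ?P. snd x = \<zero>\<^sub>B}|))"
   by (rule fdm_image[OF assms(1) lmod_sub[OF P K]]) force
 qed force
qed

lemma hom_tl: "tl:module_hom R (list_module M (Suc n)) (list_module M n)"
proof -
 have tl: "tl (map2 f xs ys) = map2 f (tl xs) (tl ys)" if "length xs = Suc n" "length ys = Suc n" for f xs ys
  using that by (cases xs; cases ys) auto
 have st: "set (tl xs) <= A" if "set xs <= A" for xs and A
  using that by (cases xs) auto
 show ?thesis by (rule module_homI) (simp_all add: map_tl tl st)
qed

lemma hom_Cons_zero:
 assumes "left_module R M"
 shows "(%x. x # replicate n \<zero>\<^sub>M):module_hom R M (list_module M (Suc n))"
proof -
 interpret M: left_module R M by fact
 show ?thesis by (auto intro!: module_homI simp: zip_replicate)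
qed

lemma fdm_list:
 assumes "fdm M"
 shows "fdm (list_module M n)"
proof (induction n)
 case 0
 interpret M: left_module \<Lambda> M using assms by (rule_tac fdmD)
 have "(%x. []):mhom M (list_module M 0)" by (auto intro!: module_homI)
 then show ?case
  by (rule fdm_image[OF assms lmod_list[OF M.left_module_axioms]]) auto
next
 case (Suc n)
 interpret M: left_module \<Lambda> M using assms by (rule_tac fdmD)
 let ?P = "list_module M (Suc n)"
 let ?N = "{x:car ?P. tl x = \<zero>\<^sub>(list_module M n)}"
 have P: "lmod ?P" by (rule lmod_list[OF M.left_module_axioms])
 have K: "subm ?N ?P"
  by (rule subm_kernel[OF P lmod_list[OF M.left_module_axioms] hom_tl])
 have h: "(%x. x # replicate n \<zero>\<^sub>M):mhom M (?P(|carrier := ?N|))"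
  by (rule hom_sub_codomain[OF hom_Cons_zero[OF M.left_module_axioms]]) auto
 have "xs:(%x. x # replicate n \<zero>\<^sub>M) ` car M" if "xs:?N" for xs
  using that by (cases xs) auto
 then have "(%x. x # replicate n \<zero>\<^sub>M) ` car M = car (?P(|carrier := ?N|))"
  using homD(1)[OF h] by auto
 then have fN: "fdm (?P(|carrier := ?N|))"
  by (rule fdm_image[OF assms lmod_sub[OF P K] h])
 have "xs:tl ` car ?P" if "xs:car (list_module M n)" for xs
  using that by (intro image_eqI[of _ _ "\<zero>\<^sub>M # xs"]) auto
 then have "tl ` car ?P = car (list_module M n)"
  using homD(1)[OF hom_tl[of \<Lambda> M n]] by blast
 then show ?case
  by (rule fdm_extension[OF P Suc hom_tl _ fN])
qed

lemma fdm_iff_fg: "lmod M ==> fdm M \<longleftrightarrow> finitely_generated \<Lambda> M"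
proof
 assume "lmod M" "finitely_generated \<Lambda> M"
 interpret M: left_module \<Lambda> M by fact
 obtain xs where xs: "set xs <= car M"
  "!!x. x:car M ==> EX rs. length rs = length xs & set rs <= car \<Lambda> & list_comb M xs rs = x"
  using M.list_comb_surj[OF \<open>finitely_generated \<Lambda> M\<close>] by blast
 have h: "list_comb M xs:mhom (list_module reg (length xs)) M"
  by (rule M.hom_list_comb[OF xs(1) refl])
 have "list_comb M xs ` car (list_module reg (length xs)) = car M"
  using xs(2) homD(1)[OF h] by (fastforce simp: image_iff)
 then show "fdm M"
  by (rule fdm_image[OF fdm_list[OF fdm_regular] M.left_module_axioms h])
next
 assume M: "lmod M" and "fdm M"
 interpret M: left_module \<Lambda> M by fact
 interpret V: vspace K "KV M" by (rule vspace_KV[OF M])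
 interpret v: vectorspace K "KV M" by (rule V.vectorspace)
 obtain A where A: "finite A" "A <= car M" "v.gen_set A"
  using fdmD(2)[OF \<open>fdm M\<close>] by (auto simp: v.fin_dim_def)
 have "submodule_generated \<Lambda> M A = car M"
  using V.span_eqD[OF A(3) _ subm_KV[OF M M.submodule_generated(1)[OF A(2)]]
   M.submodule_generated(2)[OF A(2)]] A(2) by simp
 then show "finitely_generated \<Lambda> M" using A by (auto simp: finitely_generated_def)
qed

lemma fg_modules_iff: "M:fg_modules \<Lambda> \<longleftrightarrow> fdm M"
 using fdm_iff_fg fdmD(1) by (auto simp: fg_modules_def)

lemma fdm_representable:
 fixes M :: "('a, 'm) module"
 assumes "fdm M"
 obtains N :: "('a, 'a list) module" where "N:fg_modules \<Lambda>" "module_iso \<Lambda> M N"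
 using fg_module_representable'[OF fdmD(1)[OF assms]] assms fdm_iff_fg[OF fdmD(1)[OF assms]] by blast

subsection \<open>Dimensions of subspaces\<close>

abbreviation ksub :: "('a, 'm) module => 'm set => bool" where
 "ksub M U == Module.submodule U K (KV M)"

lemma kdim_hom:
 assumes "fdm M" "lmod N" "f:module_hom K (KV M) (KV N)" "ksub M U"
 shows "kdim M U = kdim N (f ` U) + kdim M {u:U. f u = \<zero>\<^sub>N}"
proof -
 interpret V: vspace K "KV M" by (rule vspace_KV[OF fdmD(1)[OF assms(1)]])
 interpret U: vspace K "(KV M)(|carrier := U|)" by (rule V.vspace_sub[OF assms(4)])
 have "U <= car M" using iffD1[OF V.subm_iff assms(4)] by simp
 then have "f:module_hom K ((KV M)(|carrier := U|)) (KV N)"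
  by (intro hom_sub_domain[OF assms(3)]) simp
 from U.rank_nullity[OF V.fin_dim_sub[OF fdmD(2)[OF assms(1)] assms(4)] lmod_KV[OF assms(2)] this]
 show ?thesis by (simp add: kdim_def)
qed

lemma
 assumes "fdm M" "ksub M U" "ksub M U'" "U <= U'"
 shows kdim_mono: "kdim M U <= kdim M U'" and kdim_eq: "kdim M U = kdim M U' ==> U = U'"
proof -
 interpret V: vspace K "KV M" by (rule vspace_KV[OF fdmD(1)[OF assms(1)]])
 interpret U: vspace K "(KV M)(|carrier := U'|)" by (rule V.vspace_sub[OF assms(3)])
 have fd: "vectorspace.fin_dim K ((KV M)(|carrier := U'|))"
  by (rule V.fin_dim_sub[OF fdmD(2)[OF assms(1)] assms(3)])
 have "Module.submodule U K ((KV M)(|carrier := U'|))"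
  using subm_sub_iff[OF V.left_module_axioms assms(3)] assms by simp
 from U.dim_sub_le[OF fd this] U.dim_sub_eq[OF fd this]
 show "kdim M U <= kdim M U'" "kdim M U = kdim M U' ==> U = U'"
  by (simp_all add: kdim_def)
qed

lemma kdim_zero:
 assumes "lmod M"
 shows "kdim M {\<zero>\<^sub>M} = 0"
 using vspace.dim_zero[OF vspace_KV[OF assms]] by (simp add: kdim_def)

lemma kdim_inj:
 assumes "fdm M" "lmod N" "f:module_hom K (KV M) (KV N)" "ksub M U"
  "!!u. u:U ==> f u = \<zero>\<^sub>N ==> u = \<zero>\<^sub>M"
 shows "kdim N (f ` U) = kdim M U"
proof -
 interpret V: vspace K "KV M" by (rule vspace_KV[OF fdmD(1)[OF assms(1)]])
 have "\<zero>\<^sub>M:U" using iffD1[OF V.subm_iff assms(4)] by simp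
 moreover have "f \<zero>\<^sub>M = \<zero>\<^sub>N"
  using hom_zero[OF V.left_module_axioms lmod_KV[OF assms(2)] assms(3)] by simp
 ultimately have "{u:U. f u = \<zero>\<^sub>N} = {\<zero>\<^sub>M}" using assms(5) by blast
 then show ?thesis using kdim_hom[OF assms(1-4)] kdim_zero[OF fdmD(1)[OF assms(1)]] by simp
qed

lemma kdim_pos:
 assumes "fdm M" "ksub M U" "kdim M U = 0"
 shows "U = {\<zero>\<^sub>M}"
proof -
 interpret V: vspace K "KV M" by (rule vspace_KV[OF fdmD(1)[OF assms(1)]])
 have "\<zero>\<^sub>M:U" using iffD1[OF V.subm_iff assms(2)] by simp
 then show ?thesis
  using kdim_eq[OF assms(1) _ assms(2), of "{\<zero>\<^sub>M}"] V.zero_subm assms(3)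
   kdim_zero[OF fdmD(1)[OF assms(1)]] by auto
qed

lemma kdim_line:
 assumes "lmod M" "v:car M" "v ~= \<zero>\<^sub>M"
 shows "ksub M {emb c \<odot>\<^sub>M v |c. c:car K}" "kdim M {emb c \<odot>\<^sub>M v |c. c:car K} = 1"
proof -
 interpret V: vspace K "KV M" by (rule vspace_KV[OF assms(1)])
 let ?U = "{emb c \<odot>\<^sub>M v |c. c:car K}"
 have "?U = (%c. c \<odot>\<^sub>(KV M) v) ` car (regular_module K)" by auto
 moreover have "Module.submodule ((%c. c \<odot>\<^sub>(KV M) v) ` car (regular_module K)) K (KV M)"
  using assms(2)
  by (intro subm_image[OF lmod_regular[OF lmod_ring[OF V.left_module_axioms]] V.left_module_axioms V.hom_smult]
    left_module.carrier_subm lmod_regular lmod_ring[OF V.left_module_axioms]) simp_all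
 ultimately show U: "ksub M ?U" by simp
 interpret U: vspace K "(KV M)(|carrier := ?U|)" by (rule V.vspace_sub[OF U])
 have "v = emb \<one>\<^sub>K \<odot>\<^sub>M v" using V.smult_one[of v] assms by simp
 then have "v:?U" using Vec.one_closed by blast
 then show "kdim M ?U = 1"
  unfolding kdim_def using assms by (intro U.dim_line[of v]) auto
qed

lemma kdim_complement:
 assumes "fdm M" "ksub M U" "ksub M U'" "U <= U'"
 obtains A where "ksub M A" "A <= U'" "A \<inter> U = {\<zero>\<^sub>M}"
  "!!v. v:U' ==> EX a:A. EX u:U. v = a \<oplus>\<^sub>M u" "kdim M U' = kdim M A + kdim M U"
proof -
 interpret V: vspace K "KV M" by (rule vspace_KV[OF fdmD(1)[OF assms(1)]])
 interpret U: vspace K "(KV M)(|carrier := U'|)" by (rule V.vspace_sub[OF assms(3)])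
 note sub = subm_sub_iff[OF V.left_module_axioms assms(3)]
 show thesis
 proof (rule U.complement[OF V.fin_dim_sub[OF fdmD(2)[OF assms(1)] assms(3)], of U])
  show "Module.submodule U K ((KV M)(|carrier := U'|))" using sub assms by simp
 qed (rule that, auto simp: sub kdim_def)
qed

lemma ksub_idem:
 assumes "lmod M" "subm N M" "e:car \<Lambda>"
 shows "ksub M {x:N. e \<odot>\<^sub>M x = x}"
proof -
 interpret M: left_module \<Lambda> M by fact
 interpret V: vspace K "KV M" by (rule vspace_KV[OF assms(1)])
 have "e \<odot>\<^sub>M (emb c \<odot>\<^sub>M x) = emb c \<odot>\<^sub>M (e \<odot>\<^sub>M x)" if "c:car K" "x:car M" for c x
  using that assms(3) by (simp add: M.smult_assoc1[symmetric] emb_commute)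
 then show ?thesis
  using iffD1[OF M.subm_iff assms(2)] assms(3)
  by (auto simp: V.subm_iff M.smult_r_distr subset_iff)
qed

text \<open>The dimension of \<open>e N\<close>, written through fixed points. For the idempotents
  chosen later it is the multiplicity of the corresponding simple module in
  \<open>N\<close>.\<close>

definition edim :: "('a, 'm) module => 'a => 'm set => nat" where
 "edim M e N = kdim M {x:N. e \<odot>\<^sub>M x = x}"

lemma edim_sub [simp]: "edim (M(|carrier := N|)) e U = edim M e U"
 by (simp add: edim_def)

text \<open>Passing to the part fixed by an idempotent is exact: a preimage \<open>x\<close> of a
  fixed point may be replaced by \<open>e\<close> times \<open>x\<close>.\<close>

lemma edim_hom:
 assumes "fdm M" "lmod Q" "f:mhom M Q" "subm N M"
  and e: "e:car \<Lambda>" "e \<otimes> e = e"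
 shows "edim M e N = edim Q e (f ` N) + edim M e {x:N. f x = \<zero>\<^sub>Q}"
proof -
 interpret M: left_module \<Lambda> M using fdmD(1)[OF assms(1)] .
 note N = iffD1[OF M.subm_iff assms(4)]
 have "f ` {x:N. e \<odot>\<^sub>M x = x} = {y:f ` N. e \<odot>\<^sub>Q y = y}"
 proof (intro equalityI subsetI)
  fix y assume "y:{y:f ` N. e \<odot>\<^sub>Q y = y}"
  then obtain x where x: "x:N" "y = f x" "e \<odot>\<^sub>Q f x = f x" by auto
  then have "x:car M" using N by auto
  then have "f (e \<odot>\<^sub>M x) = y" "e \<odot>\<^sub>M (e \<odot>\<^sub>M x) = e \<odot>\<^sub>M x"
   using x e homD(3)[OF assms(3) e(1)] by (simp_all add: M.smult_assoc1[symmetric])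
  then show "y:f ` {x:N. e \<odot>\<^sub>M x = x}" using x N e by blast
 next
  fix y assume "y:f ` {x:N. e \<odot>\<^sub>M x = x}"
  then obtain x where x: "x:N" "y = f x" "e \<odot>\<^sub>M x = x" by auto
  then have "e \<odot>\<^sub>Q y = y" using homD(3)[OF assms(3) e(1), of x] N by auto
  then show "y:{y:f ` N. e \<odot>\<^sub>Q y = y}" using x by simp
 qed
 moreover have "{u:{x:N. e \<odot>\<^sub>M x = x}. f u = \<zero>\<^sub>Q} = {x:{x:N. f x = \<zero>\<^sub>Q}. e \<odot>\<^sub>M x = x}" by auto
 ultimately show ?thesis
  unfolding edim_def using kdim_hom[OF assms(1,2) hom_KV[OF assms(3)] ksub_idem[OF fdmD(1)[OF assms(1)] assms(4) e(1)]]
  by simp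
qed

lemma edim_inj:
 assumes "fdm M" "lmod Q" "f:mhom M Q" "subm N M"
  "e:car \<Lambda>" "e \<otimes> e = e" "!!x. x:N ==> f x = \<zero>\<^sub>Q ==> x = \<zero>\<^sub>M"
 shows "edim Q e (f ` N) = edim M e N"
proof -
 interpret M: left_module \<Lambda> M using fdmD(1)[OF assms(1)] .
 have "\<zero>\<^sub>M:N" using iffD1[OF M.subm_iff assms(4)] by simp
 then have "{x:N. f x = \<zero>\<^sub>Q} = {\<zero>\<^sub>M}"
  using assms(7) hom_zero[OF M.left_module_axioms assms(2,3)] by blast
 moreover have "{x:{\<zero>\<^sub>M}. e \<odot>\<^sub>M x = x} = {\<zero>\<^sub>M}" using assms(5) by auto
 then have "edim M e {\<zero>\<^sub>M} = 0" using kdim_zero[OF M.left_module_axioms] by (simp add: edim_def)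
 ultimately show ?thesis using edim_hom[OF assms(1-6)] by simp
qed

lemma edim_mono:
 assumes "fdm M" "subm N M" "subm N' M" "N <= N'" "e:car \<Lambda>"
 shows "edim M e N <= edim M e N'"
  "edim M e N = edim M e N' ==> {x:N. e \<odot>\<^sub>M x = x} = {x:N'. e \<odot>\<^sub>M x = x}"
proof -
 let ?e = "%N. {x:N. e \<odot>\<^sub>M x = x}"
 have "ksub M (?e N)" "ksub M (?e N')" "?e N <= ?e N'"
  using assms ksub_idem[OF fdmD(1)[OF assms(1)]] by auto
 then show "edim M e N <= edim M e N'" "edim M e N = edim M e N' ==> ?e N = ?e N'"
  using kdim_mono[OF assms(1)] kdim_eq[OF assms(1)] by (simp_all add: edim_def)
qed

end

section \<open>The radical and idempotents\<close>

text \<open>One Newton step \<open>x \<mapsto> 3 x\<^sup>2 - 2 x\<^sup>3\<close> towards an idempotent, with error \<open>n = x\<^sup>2 - x\<close>.\<close>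

lemma (in ring) idem_step:
 assumes [simp]: "x:car R" "n:car R" and xx: "x \<otimes> x = x \<oplus> n"
 shows "x \<otimes> n = n \<otimes> x"
  "(x \<oplus> n \<ominus> x \<otimes> n \<ominus> x \<otimes> n) \<otimes> (x \<oplus> n \<ominus> x \<otimes> n \<ominus> x \<otimes> n) =
   (x \<oplus> n \<ominus> x \<otimes> n \<ominus> x \<otimes> n) \<oplus>
   (n \<otimes> n \<otimes> n \<oplus> n \<otimes> n \<otimes> n \<oplus> n \<otimes> n \<otimes> n \<oplus> n \<otimes> n \<otimes> n \<ominus> n \<otimes> n \<ominus> n \<otimes> n \<ominus> n \<otimes> n)"
proof -
 have n: "n = x \<otimes> x \<ominus> x" using xx by (metis assms(1,2) minus_add_cancel a_comm)
 show xn: "x \<otimes> n = n \<otimes> x"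
  unfolding n by (simp add: minus_eq l_distr r_distr l_minus r_minus m_assoc)
 define u where "u = x \<otimes> n"
 define m where "m = n \<otimes> n"
 define t where "t = n \<otimes> n \<otimes> n"
 define v where "v = x \<otimes> m"
 have [simp]: "u:car R" "m:car R" "t:car R" "v:car R"
  by (simp_all add: u_def m_def t_def v_def)
 have e: "x \<otimes> n = u" "n \<otimes> x = u" "n \<otimes> n = m" "m \<otimes> n = t" using xn by (simp_all add: u_def m_def t_def)
 have xu: "x \<otimes> u = u \<oplus> m"
 proof -
  have "x \<otimes> u = (x \<otimes> x) \<otimes> n" unfolding u_def by (rule m_assoc[symmetric]) simp_all
  then show ?thesis by (simp add: xx l_distr e)
 qed
 have ux: "u \<otimes> x = u \<oplus> m"
 proof -
  have "u \<otimes> x = x \<otimes> (n \<otimes> x)" unfolding u_def by (rule m_assoc) simp_all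
  then show ?thesis by (simp add: xu e)
 qed
 have un: "u \<otimes> n = v" by (simp add: u_def v_def m_def m_assoc)
 have nu: "n \<otimes> u = v" 
 proof -
  have "n \<otimes> u = (n \<otimes> x) \<otimes> n" unfolding u_def by (rule m_assoc[symmetric]) simp_all
  then show ?thesis by (simp add: un e)
 qed
 have uu: "u \<otimes> u = v \<oplus> t"
 proof -
  have "u \<otimes> u = (u \<otimes> x) \<otimes> n" unfolding u_def by (simp add: m_assoc)
  then have "u \<otimes> u = (x \<otimes> u) \<otimes> n" by (simp add: ux xu)
  also have "\<dots> = v \<oplus> t" by (simp add: xu l_distr un e)
  finally show ?thesis .
 qed
 have "(x \<oplus> n \<ominus> u \<ominus> u) \<otimes> (x \<oplus> n \<ominus> u \<ominus> u) = (x \<oplus> n \<ominus> u \<ominus> u) \<oplus> (t \<oplus> t \<oplus> t \<oplus> t \<ominus> m \<ominus> m \<ominus> m)"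
 proof -
  \<comment> \<open>The elements \<open>u\<close>, \<open>m\<close>, \<open>v\<close> and their
    negatives become atoms linked only by the relations \<open>z\<close>, so the noncommutative
    expansion turns into cancellation in a commutative group.\<close>
  define a1 where "a1 = u" define a2 where "a2 = \<ominus> u"
  define b1 where "b1 = m" define b2 where "b2 = \<ominus> m"
  define c1 where "c1 = v" define c2 where "c2 = \<ominus> v"
  have [simp]: "a1:car R" "a2:car R" "b1:car R" "b2:car R"
   "c1:car R" "c2:car R"
   by (simp_all add: a1_def a2_def b1_def b2_def c1_def c2_def)
  have p: "x \<otimes> a2 = a2 \<oplus> b2" "a2 \<otimes> x = a2 \<oplus> b2" "n \<otimes> a2 = c2" "a2 \<otimes> n = c2" "a2 \<otimes> a2 = c1 \<oplus> t"
   "x \<otimes> n = a1" "n \<otimes> x = a1" "n \<otimes> n = b1"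
   by (simp_all add: a1_def a2_def b1_def b2_def c1_def c2_def r_minus l_minus xu ux nu un uu e minus_add)
  have z: "a1 \<oplus> a2 = \<zero>" "b1 \<oplus> b2 = \<zero>" "c1 \<oplus> c2 = \<zero>"
   by (simp_all add: a1_def a2_def b1_def b2_def c1_def c2_def r_neg)
  have z': "a1 \<oplus> (a2 \<oplus> w) = w" "b1 \<oplus> (b2 \<oplus> w) = w" "c1 \<oplus> (c2 \<oplus> w) = w" if "w:car R" for w
   using that by (simp_all add: a_assoc[symmetric] z)
  have "(x \<oplus> n \<oplus> a2 \<oplus> a2) \<otimes> (x \<oplus> n \<oplus> a2 \<oplus> a2) = (x \<oplus> n \<oplus> a2 \<oplus> a2) \<oplus> (t \<oplus> t \<oplus> t \<oplus> t \<oplus> b2 \<oplus> b2 \<oplus> b2)"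
   by (simp add: l_distr r_distr p xx) (simp add: a_ac z z')
  then show ?thesis by (simp add: a2_def b2_def minus_eq)
 qed
 then show "(x \<oplus> n \<ominus> x \<otimes> n \<ominus> x \<otimes> n) \<otimes> (x \<oplus> n \<ominus> x \<otimes> n \<ominus> x \<otimes> n) =
   (x \<oplus> n \<ominus> x \<otimes> n \<ominus> x \<otimes> n) \<oplus>
   (n \<otimes> n \<otimes> n \<oplus> n \<otimes> n \<otimes> n \<oplus> n \<otimes> n \<otimes> n \<oplus> n \<otimes> n \<otimes> n \<ominus> n \<otimes> n \<ominus> n \<otimes> n \<ominus> n \<otimes> n)"
  by (simp add: e)
qed

text \<open>Two Newton steps are enough. The first error lies in \<open>J\<close>; the second is a
  combination of its square and cube and has square zero, since products of three elements of
  \<open>J\<close> vanish; the third is zero.\<close>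

lemma (in ring) idempotent_lift:
 assumes "ideal J R" and cube: "!!x y z. x:J ==> y:J ==> z:J ==> x \<otimes> y \<otimes> z = \<zero>"
  and x: "x:car R" "x \<otimes> x \<ominus> x:J"
 obtains e where "e:car R" "e \<otimes> e = e" "e \<ominus> x:J"
proof -
 interpret J: ideal J R by fact
 have Jm: "a \<ominus> b:J" if "a:J" "b:J" for a b using that by (simp add: minus_eq)
 define n where "n = x \<otimes> x \<ominus> x"
 have n: "n:J" "n:car R" using x J.Icarr by (auto simp: n_def)
 have xx: "x \<otimes> x = x \<oplus> n" using x by (simp add: n_def minus_eq a_comm[of x] a_assoc l_neg)
 define x1 where "x1 = x \<oplus> n \<ominus> x \<otimes> n \<ominus> x \<otimes> n"
 define n1 where "n1 = n \<otimes> n \<otimes> n \<oplus> n \<otimes> n \<otimes> n \<oplus> n \<otimes> n \<otimes> n \<oplus> n \<otimes> n \<otimes> n \<ominus> n \<otimes> n \<ominus> n \<otimes> n \<ominus> n \<otimes> n"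
 have x1: "x1:car R" using x n by (simp add: x1_def)
 have n1: "n1:J" "n1:car R"
 proof -
  show "n1:J" unfolding n1_def using n J.I_l_closed[of n n] J.I_r_closed[of "n \<otimes> n" n] by (simp add: Jm)
  then show "n1:car R" by (rule J.Icarr)
 qed
 have xx1: "x1 \<otimes> x1 = x1 \<oplus> n1"
  unfolding x1_def n1_def by (rule idem_step(2)[OF x(1) n(2) xx])
 have m0: "n \<otimes> n \<otimes> (n \<otimes> n) = \<zero>"
  using n cube[OF n(1) n(1) n(1)] by (simp add: m_assoc[symmetric])
 have "n1 \<otimes> n1 = \<zero>"
  unfolding n1_def using cube[OF n(1) n(1) n(1)] n
  by (simp add: minus_eq l_distr r_distr l_minus r_minus m0)
 then have nn1: "n1 \<otimes> n1 = \<zero>" .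
 define e where "e = x1 \<oplus> n1 \<ominus> x1 \<otimes> n1 \<ominus> x1 \<otimes> n1"
 have e: "e:car R" using x1 n1 by (simp add: e_def)
 have "e \<otimes> e = e"
  using idem_step(2)[OF x1 n1(2) xx1, folded e_def] x1 n1 e by (simp add: nn1 minus_eq)
 moreover have "e \<ominus> x:J"
 proof -
  have "e \<ominus> x1 = n1 \<ominus> x1 \<otimes> n1 \<ominus> x1 \<otimes> n1"
   using x1 n1 by (simp add: e_def minus_eq a_ac r_neg2 r_neg1)
  then have 1: "e \<ominus> x1:J" using x1 n1 J.I_l_closed[OF n1(1) x1] by (simp add: Jm)
  have "x1 \<ominus> x = n \<ominus> x \<otimes> n \<ominus> x \<otimes> n"
   using x n by (simp add: x1_def minus_eq a_ac r_neg2 r_neg1)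
  then have 2: "x1 \<ominus> x:J" using x n J.I_l_closed[OF n(1) x(1)] by (simp add: Jm)
  have "e \<ominus> x = (e \<ominus> x1) \<oplus> (x1 \<ominus> x)"
   using e x1 x by (simp add: minus_eq a_assoc r_neg2 r_neg1)
  then show ?thesis using 1 2 by simp
 qed
 ultimately show thesis using that e by blast
qed

lemma a_inv_regular [simp]: "\<ominus>\<^sub>(regular_module R) x = \<ominus>\<^sub>R x"
 by (simp add: a_inv_def m_inv_def)

lemma a_minus_regular [simp]: "x \<ominus>\<^sub>(regular_module R) y = x \<ominus>\<^sub>R y"
 by (simp add: a_minus_def)

lemma simple_iso:
 assumes "simple_module R M" "left_module R N" "module_iso R M N"
 shows "simple_module R N"
proof -
 have M: "left_module R M" "~ zero_module M" "!!U. Module.submodule U R M ==> U = {\<zero>\<^sub>M} \<or> U = car M"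
  using assms(1) by (auto simp: simple_module_def)
 obtain f g where fg: "f:module_hom R M N" "g:module_hom R N M"
  "!!x. x:car M ==> g (f x) = x" "!!y. y:car N ==> f (g y) = y"
  using module_isoE[OF assms(3) M(1)] by blast
 note f = homD(1)[OF fg(1)] and g = homD(1)[OF fg(2)]
 have f0: "f \<zero>\<^sub>M = \<zero>\<^sub>N" by (rule hom_zero[OF M(1) assms(2) fg(1)])
 have "~ zero_module N"
 proof
  assume "zero_module N"
  then have "x = \<zero>\<^sub>M" if "x:car M" for x
   using that fg f f0 left_module.subm_iff[OF M(1)] hom_zero[OF assms(2) M(1) fg(2)]
   by (metis singletonD zero_module_def)
  then show False
   using M(2) left_module.zero_subm[OF M(1)] left_module.subm_iff[OF M(1)]
   by (auto simp: zero_module_def)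
 qed
 moreover have "U = {\<zero>\<^sub>N} \<or> U = car N" if U: "Module.submodule U R N" for U
 proof -
  have sub: "U <= car N" using iffD1[OF left_module.subm_iff[OF assms(2)] U] by auto
  have "Module.submodule (g ` U) R M" by (rule subm_image[OF assms(2) M(1) fg(2) U])
  then consider "g ` U = {\<zero>\<^sub>M}" | "g ` U = car M" using M(3) by blast
  moreover have "U = f ` g ` U"
   using sub fg(4) by (force simp: image_image subset_iff)
  ultimately show ?thesis
  proof cases
   case 1 then show ?thesis using \<open>U = f ` g ` U\<close> f0 by simp
  next
   case 2
   have "car N <= f ` car M" using fg(4) g by (metis imageI subsetI)
   then have "U = car N" using \<open>U = f ` g ` U\<close> 2 sub by (metis subset_antisym)
   then show ?thesis by simp
  qed
 qed
 ultimately show ?thesis using assms(2) by (auto simp: simple_module_def)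
qed

section \<open>The Jacobson radical through simple modules\<close>

context fd_algebra
begin

lemmas a_ac_\<Lambda> = abelian_monoid.a_ac[OF abelian_group.axioms(1)[OF ring.is_abelian_group[OF ring_\<Lambda>]]]
lemmas add_minus_cancel_\<Lambda> = abelian_group.add_minus_cancel[OF ring.is_abelian_group[OF ring_\<Lambda>]]
lemmas minus_eq_zero_iff_\<Lambda> = abelian_group.minus_eq_zero_iff[OF ring.is_abelian_group[OF ring_\<Lambda>]]
lemmas a_closed_\<Lambda> = abelian_monoid.a_closed[OF abelian_group.axioms(1)[OF ring.is_abelian_group[OF ring_\<Lambda>]]]
lemmas minus_add_cancel_\<Lambda> = abelian_group.minus_add_cancel[OF ring.is_abelian_group[OF ring_\<Lambda>]]
lemmas minus_mult = left_module.minus_smult[OF lmod_reg, simplified]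
lemmas mult_minus = left_module.smult_minus[OF lmod_reg, simplified]

definition J :: "'a set" where "J = jacobson_radical \<Lambda>"

definition cyc :: "('a, 'm) module => 'm => 'm set" where
 "cyc M m = (%x. x \<odot>\<^sub>M m) ` car \<Lambda>"

abbreviation lideal :: "'a set => bool" where
 "lideal N == subm N reg"

lemma lideal_iff:
 "lideal N \<longleftrightarrow> N <= car \<Lambda> & \<zero>:N & (ALL x:N. ALL y:N. x \<oplus> y:N) &
  (ALL a:car \<Lambda>. ALL x:N. a \<otimes> x:N)"
 using left_module.subm_iff[OF lmod_reg] by simp

lemma
 assumes "lmod M" "m:car M"
 shows cyc_subm: "subm (cyc M m) M" and cyc_self: "m:cyc M m"
  and cyc_hom: "(%x. x \<odot>\<^sub>M m):mhom reg M"
proof -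
 interpret M: left_module \<Lambda> M by fact
 show h: "(%x. x \<odot>\<^sub>M m):mhom reg M" by (rule M.hom_smult[OF assms(2)])
 show "subm (cyc M m) M"
  using subm_image[OF lmod_reg assms(1) h left_module.carrier_subm[OF lmod_reg]]
  by (simp add: cyc_def)
 have "m = \<one> \<odot>\<^sub>M m" using assms by simp
 then show "m:cyc M m" unfolding cyc_def by blast
qed

lemma cyc_least:
 assumes "lmod M" "subm N M" "m:N"
 shows "cyc M m <= N"
 using iffD1[OF left_module.subm_iff[OF assms(1)] assms(2)] assms(3) by (auto simp: cyc_def)

lemma maximal_lideal:
 assumes "maximal_submodule \<Lambda> reg N"
 shows "lideal N" "N ~= car \<Lambda>" "!!N'. lideal N' ==> N <= N' ==> N' = N \<or> N' = car \<Lambda>"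
 using assms by (auto simp: maximal_submodule_def)

lemma J_iff: "x:J \<longleftrightarrow> x:car \<Lambda> & (ALL N. maximal_submodule \<Lambda> reg N --> x:N)"
 by (auto simp: J_def jacobson_radical_def radical_def)

lemma J_lideal: "lideal J"
proof -
 note N = iffD1[OF lideal_iff maximal_lideal(1)]
 show ?thesis
  unfolding lideal_iff
 proof (intro conjI ballI)
  show "J <= car \<Lambda>" "\<zero>:J" using N by (auto simp: J_iff)
  show "x \<oplus> y:J" if "x:J" "y:J" for x y
   using that N unfolding J_iff by (meson a_closed_\<Lambda>)
  show "a \<otimes> x:J" if "a:car \<Lambda>" "x:J" for a x
   using that N unfolding J_iff by (meson Alg.m_closed)
 qed
qed

text \<open>If \<open>N\<close> is a maximal left ideal and \<open>a\<close> lies outside it, the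
  elements carried into \<open>N\<close> by right multiplication with \<open>a\<close> form a
  maximal left ideal again, and \<open>x\<close> belongs to it.\<close>

lemma J_right:
 assumes "x:J" "a:car \<Lambda>"
 shows "x \<otimes> a:J"
 unfolding J_iff
proof (intro conjI allI impI)
 have x: "x:car \<Lambda>" using assms by (simp add: J_iff)
 then show "x \<otimes> a:car \<Lambda>" using assms by simp
 fix N assume max: "maximal_submodule \<Lambda> reg N"
 note N = iffD1[OF lideal_iff maximal_lideal(1)[OF max]]
 show "x \<otimes> a:N"
 proof (cases "a:N")
  case True then show ?thesis using N x by blast
 next
  case False
  define Na where "Na = {y:car \<Lambda>. y \<otimes> a:N}"
  have "maximal_submodule \<Lambda> reg Na"
   unfolding maximal_submodule_def
  proof (intro conjI allI impI)
   show "lideal Na"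
    unfolding lideal_iff Na_def using N assms(2) by (auto simp: Alg.l_distr Alg.m_assoc)
   have "\<one> ~: Na" using False assms(2) by (simp add: Na_def)
   then show "Na ~= car reg" by auto
   fix N' assume N': "lideal N' & Na <= N'"
   then have N'D: "N' <= car \<Lambda>" "\<zero>:N'" "!!x y. x:N' ==> y:N' ==> x \<oplus> y:N'"
    "!!a x. a:car \<Lambda> ==> x:N' ==> a \<otimes> x:N'"
    unfolding lideal_iff by auto
   show "N' = Na \<or> N' = car reg"
   proof (cases "N' = Na")
    case False
    then obtain b where b: "b:N'" "b \<otimes> a ~: N" using N' N'D(1) by (auto simp: Na_def)
    \<comment> \<open>\<open>N + N' a\<close> properly contains \<open>N\<close>, so it is
      everything. Writing \<open>t \<otimes> a\<close> in it puts \<open>t \<ominus> y\<close> into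
      \<open>Na\<close> for some \<open>y\<close> in \<open>N'\<close>, and hence \<open>t\<close>
      into \<open>N'\<close>.\<close>
    define T where "T = {n \<oplus> y \<otimes> a |n y. n:N & y:N'}"
    have T: "lideal T"
     unfolding lideal_iff
    proof (intro conjI ballI)
     show "T <= car \<Lambda>" using N N'D(1) assms(2) by (auto simp: T_def)
     have "\<zero> = \<zero> \<oplus> \<zero> \<otimes> a" using assms(2) by simp
     then show "\<zero>:T" using N N'D(2) unfolding T_def by blast
     fix u assume "u:T"
     then obtain n y where u: "n:N" "y:N'" "u = n \<oplus> y \<otimes> a" unfolding T_def by blast
     then have uc: "n:car \<Lambda>" "y:car \<Lambda>" using N N'D by auto
     { fix v assume "v:T"
      then obtain n' y' where v: "n':N" "y':N'" "v = n' \<oplus> y' \<otimes> a" unfolding T_def by blast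
      then have vc: "n':car \<Lambda>" "y':car \<Lambda>" using N N'D by auto
      have "u \<oplus> v = (n \<oplus> n') \<oplus> (y \<oplus> y') \<otimes> a"
       using u v uc vc assms(2) by (simp add: Alg.l_distr a_ac_\<Lambda>)
      then show "u \<oplus> v:T" using u v N N'D unfolding T_def by blast }
     fix c assume c: "c:car \<Lambda>"
     have "c \<otimes> u = (c \<otimes> n) \<oplus> (c \<otimes> y) \<otimes> a"
      using u uc c assms(2) by (simp add: Alg.r_distr Alg.m_assoc)
     then show "c \<otimes> u:T" using u c N N'D unfolding T_def by blast
    qed
    have "N <= T"
    proof
     fix n assume n: "n:N"
     then have "n = n \<oplus> \<zero> \<otimes> a" using N assms(2) by auto
     then show "n:T" using n N'D(2) unfolding T_def by blast
    qed
    moreover have "b \<otimes> a:T"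
    proof -
     have "b \<otimes> a = \<zero> \<oplus> b \<otimes> a" using b N'D assms(2) by auto
     then show ?thesis using b N unfolding T_def by blast
    qed
    ultimately have T_all: "T = car \<Lambda>" using maximal_lideal(3)[OF max T] b by auto
    have "t:N'" if t: "t:car \<Lambda>" for t
    proof -
     have "t \<otimes> a:T" using T_all t assms(2) by simp
     then obtain n y where ny: "n:N" "y:N'" "t \<otimes> a = n \<oplus> y \<otimes> a" unfolding T_def by blast
     then have c: "n:car \<Lambda>" "y:car \<Lambda>" using N N'D by auto
     have "(t \<ominus> y) \<otimes> a = n"
      using ny(3) c t assms(2) by (simp add: minus_mult minus_add_cancel_\<Lambda>)
     then have "t \<ominus> y:Na" using c t ny by (simp add: Na_def)
     then have "(t \<ominus> y) \<oplus> y:N'" using N' N'D ny by blast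
     then show ?thesis using c t by (simp add: add_minus_cancel_\<Lambda>)
    qed
    then show ?thesis using N'D by auto
   qed simp
  qed
  then have "x:Na" using assms(1) by (simp add: J_iff)
  then show ?thesis by (simp add: Na_def)
 qed
qed

lemma J_sub: "x:J ==> x:car \<Lambda>"
 by (simp add: J_iff)

lemma J_left: "a:car \<Lambda> ==> x:J ==> a \<otimes> x:J"
 using J_lideal by (simp add: lideal_iff)

lemma J_zero: "\<zero>:J"
 using J_lideal by (simp add: lideal_iff)

lemma J_add: "x:J ==> y:J ==> x \<oplus> y:J"
 using J_lideal by (simp add: lideal_iff)

lemma ideal_J: "ideal J \<Lambda>"
proof (rule idealI[OF ring_\<Lambda>])
 show "subgroup J (add_monoid \<Lambda>)"
  using J_lideal by (simp add: Module.submodule_def subgroup_def m_inv_def)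
qed (auto intro: J_left J_right)

lemma J_minus: "x:J ==> y:J ==> x \<ominus> y:J"
 using left_module.subm_minus[OF lmod_reg J_lideal]
 by (simp add: a_minus_def)

lemma simpleD:
 assumes "simple_module \<Lambda> S"
 shows "lmod S" "car S ~= {\<zero>\<^sub>S}" "!!U. subm U S ==> U = {\<zero>\<^sub>S} \<or> U = car S"
 using assms by (auto simp: simple_module_def zero_module_def)

lemma simple_cyc:
 assumes "simple_module \<Lambda> S" "s:car S" "s ~= \<zero>\<^sub>S"
 shows "cyc S s = car S"
 using simpleD(3)[OF assms(1) cyc_subm[OF simpleD(1)[OF assms(1)] assms(2)]]
  cyc_self[OF simpleD(1)[OF assms(1)] assms(2)] assms(3) by auto

text \<open>A simple module is generated by any nonzero \<open>s\<close>, so the annihilator of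
  \<open>s\<close> is a maximal left ideal and contains \<open>J\<close>.\<close>

lemma simple_kill:
 assumes "simple_module \<Lambda> S" "s:car S" "x:J"
 shows "x \<odot>\<^sub>S s = \<zero>\<^sub>S"
proof (cases "s = \<zero>\<^sub>S")
 case True
 interpret S: left_module \<Lambda> S by (rule simpleD(1)[OF assms(1)])
 show ?thesis using True J_sub[OF assms(3)] by simp
next
 case False
 interpret S: left_module \<Lambda> S by (rule simpleD(1)[OF assms(1)])
 define N where "N = {y:car reg. y \<odot>\<^sub>S s = \<zero>\<^sub>S}"
 have "maximal_submodule \<Lambda> reg N"
  unfolding maximal_submodule_def
 proof (intro conjI allI impI)
  show "lideal N" unfolding N_def
   by (rule subm_kernel[OF lmod_reg S.left_module_axioms cyc_hom[OF S.left_module_axioms assms(2)]])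
  have "\<one> ~: N" using False assms(2) by (simp add: N_def)
  then show "N ~= car reg" by auto
  fix N' assume N': "lideal N' & N <= N'"
  note N'D = iffD1[OF lideal_iff conjunct1[OF N']]
  have "subm ((%y. y \<odot>\<^sub>S s) ` N') S"
   using N' by (intro subm_image[OF lmod_reg S.left_module_axioms cyc_hom[OF S.left_module_axioms assms(2)]]) simp
  then consider "(%y. y \<odot>\<^sub>S s) ` N' = {\<zero>\<^sub>S}" | "(%y. y \<odot>\<^sub>S s) ` N' = car S"
   using simpleD(3)[OF assms(1)] by blast
  then show "N' = N \<or> N' = car reg"
  proof cases
   case 1
   then have "N' <= N" using N'D by (auto simp: N_def)
   then show ?thesis using N' by auto
  next
   case 2
   then obtain y where y: "y:N'" "y \<odot>\<^sub>S s = s" using assms(2) by (metis imageE)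
   then have yc: "y:car \<Lambda>" using N'D by auto
   then have "\<one> \<ominus> y:N" using y assms(2)
    by (simp add: N_def S.minus_smult S.M.minus_eq_zero_iff)
   then have "(\<one> \<ominus> y) \<oplus> y:N'" using N' N'D y by blast
   then have "\<one>:N'" using yc by (simp add: add_minus_cancel_\<Lambda>)
   then have "a:N'" if "a:car \<Lambda>" for a using N'D that by (metis Alg.r_one)
   then show ?thesis using N'D by auto
  qed
 qed
 then have "x:N" using assms(3) by (simp add: J_iff)
 then show ?thesis by (simp add: N_def)
qed

text \<open>The given representatives classify only simple modules in the universe. A simple module
  of any type is cyclic, hence finite-dimensional, and has a copy there.\<close>

lemma simple_transfer:
 fixes M :: "('a, 'm) module"
 assumes "simple_module \<Lambda> M"
 obtains N :: "('a, 'a list) module" where "simple_module \<Lambda> N" "module_iso \<Lambda> M N"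
proof -
 note M = simpleD[OF assms]
 obtain s where s: "s:car M" "s ~= \<zero>\<^sub>M"
  using M(2) left_module.subm_iff[OF M(1)] left_module.zero_subm[OF M(1)] by auto
 have "fdm M"
  using simple_cyc[OF assms s] fdm_image[OF fdm_regular M(1) cyc_hom[OF M(1) s(1)]]
  by (simp add: cyc_def)
 then obtain N :: "('a, 'a list) module" where N: "N:fg_modules \<Lambda>" "module_iso \<Lambda> M N"
  by (rule fdm_representable)
 have "simple_module \<Lambda> N"
  using N by (intro simple_iso[OF assms]) (auto simp: fg_modules_def)
 then show thesis using N that by blast
qed

text \<open>Converse of \<open>simple_kill\<close>. A maximal left ideal \<open>N\<close> gives a
  simple quotient with a copy in the universe; an element that annihilates the class of 1 lies in
  \<open>N\<close>.\<close>

lemma J_detect: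
 assumes "x:car \<Lambda>"
  "!!S :: ('a, 'a list) module. simple_module \<Lambda> S ==> (ALL s:car S. x \<odot>\<^sub>S s = \<zero>\<^sub>S)"
 shows "x:J"
 unfolding J_iff
proof (intro conjI allI impI assms(1))
 fix N assume max: "maximal_submodule \<Lambda> reg N"
 note N = maximal_lideal[OF max]
 let ?Q = "quot_module reg N"
 let ?p = "cmap reg N"
 note q = quot_module[OF lmod_reg N(1)]
 have "simple_module \<Lambda> ?Q"
  unfolding simple_module_def zero_module_def
 proof (intro conjI allI impI q(1) notI)
  assume z: "car ?Q = {\<zero>\<^sub>?Q}"
  have "x:N" if "x:car \<Lambda>" for x
   using q(4)[of x] imageI[of x "car reg" ?p] that unfolding q(3) z by simp
  then show False using N(1,2) unfolding lideal_iff by blast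
 next
  fix U assume U: "subm U ?Q"
  note UD = iffD1[OF left_module.subm_iff[OF q(1)] U]
  let ?V = "{y:car reg. ?p y:U}"
  have V: "lideal ?V" by (rule subm_vimage[OF lmod_reg q(1,2) U])
  have "N <= ?V"
  proof
   fix y assume "y:N"
   then have "y:car reg" using N(1) unfolding lideal_iff by auto
   then show "y:?V" using q(4)[of y] UD \<open>y:N\<close> by simp
  qed
  then consider "?V = N" | "?V = car \<Lambda>" using N(3)[OF V] by blast
  then show "U = {\<zero>\<^sub>?Q} \<or> U = car ?Q"
  proof cases
   case 1
   have "u = \<zero>\<^sub>?Q" if "u:U" for u
   proof -
    have "u:?p ` car reg" using that UD unfolding q(3) by auto
    then obtain y where y: "y:car reg" "u = ?p y" by auto
    then have "y:N" using that 1 by auto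
    then show ?thesis using y q(4) by simp
   qed
   then show ?thesis using UD by auto
  next
   case 2
   then have "?p ` car reg <= U" by auto
   then show ?thesis using UD unfolding q(3) by auto
  qed
 qed
 then obtain S :: "('a, 'a list) module" where S: "simple_module \<Lambda> S" "module_iso \<Lambda> ?Q S"
  by (rule simple_transfer)
 obtain f g where fg: "f:mhom ?Q S" "g:mhom S ?Q"
  "!!x. x:car ?Q ==> g (f x) = x" "!!y. y:car S ==> f (g y) = y"
  using module_isoE[OF S(2) q(1)] by blast
 have px: "?p y:car ?Q" if "y:car \<Lambda>" for y using homD(1)[OF q(2)] that by simp
 have "f (?p (x \<otimes> \<one>)) = x \<odot>\<^sub>S f (?p \<one>)"
  using homD(3)[OF q(2), of x \<one>] homD(3)[OF fg(1) _ px, of x \<one>] assms(1) by simp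
 also have "\<dots> = \<zero>\<^sub>S" using assms(2)[OF S(1)] homD(1)[OF fg(1) px[OF Alg.one_closed]] by simp
 finally have "f (?p x) = \<zero>\<^sub>S" using assms(1) by simp
 then have "?p x = \<zero>\<^sub>?Q"
  using fg(3)[OF px[OF assms(1)]] hom_zero[OF simpleD(1)[OF S(1)] q(1) fg(2)] by simp
 then show "x:N" using q(4) assms(1) by simp
qed

lemma simple_subm_exists:
 assumes "fdm M" "car M ~= {\<zero>\<^sub>M}"
 obtains T where "subm T M" "simple_module \<Lambda> (M(|carrier := T|))" "T ~= {\<zero>\<^sub>M}"
proof -
 note lm = fdmD(1)[OF assms(1)]
 define P where "P T \<longleftrightarrow> subm T M & T ~= {\<zero>\<^sub>M}" for T
 have "P (car M)" using assms(2) left_module.carrier_subm[OF lm] by (simp add: P_def)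
 then obtain T where T: "P T" "!!U. P U ==> kdim M T <= kdim M U"
  using arg_min_nat_lemma[of P "car M" "kdim M"] by blast
 have Ts: "subm T M" using T by (simp add: P_def)
 have "simple_module \<Lambda> (M(|carrier := T|))"
  unfolding simple_module_def
 proof (intro conjI allI impI lmod_sub[OF lm Ts])
  show "~ zero_module (M(|carrier := T|))" using T by (simp add: zero_module_def P_def)
  fix U assume "subm U (M(|carrier := T|))"
  then have U: "subm U M" "U <= T" using subm_sub_iff[OF lm Ts] by auto
  show "U = {\<zero>\<^sub>(M(|carrier := T|))} \<or> U = car (M(|carrier := T|))"
  proof (cases "U = {\<zero>\<^sub>M}")
   case False
   then have "kdim M T <= kdim M U" using T(2) U by (simp add: P_def)
   moreover have "kdim M U <= kdim M T"
    by (rule kdim_mono[OF assms(1) subm_KV[OF lm U(1)] subm_KV[OF lm Ts] U(2)])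
   ultimately have "U = T"
    using kdim_eq[OF assms(1) subm_KV[OF lm U(1)] subm_KV[OF lm Ts] U(2)] by simp
   then show ?thesis by simp
  qed simp
 qed
 then show thesis using that[OF Ts] T by (simp add: P_def)
qed

end

subsection \<open>Idempotents of a split algebra\<close>

locale matrix_product = field K for K :: "'k ring" (structure) + fixes L :: nat and ns :: "nat => nat"
begin

abbreviation MP :: "('k, nat => nat \<times> nat => 'k) module" where
 "MP == prod_algebra {..<L} (%i. matrix_algebra K (ns i))"

text \<open>Elements of the product are nested extensional functions. Building them from plain
  entries reduces equations to equations of entries within range.\<close>

definition mk :: "(nat => nat => nat => 'k) => nat => nat \<times> nat => 'k" where
 "mk f = (\<lambda>m\<in>{..<L}. \<lambda>(i, j)\<in>{..<ns m} \<times> {..<ns m}. f m i j)"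

definition unit :: "nat => nat => nat => nat => nat \<times> nat => 'k" where
 "unit l p q = mk (%m i j. if m = l & i = p & j = q then \<one> else \<zero>)"

text \<open>The partial sum of the diagonal matrix units that precede position \<open>p\<close> of
  block \<open>l\<close> in lexicographic order; it runs from zero to the identity and gains one
  unit per step.\<close>

definition diag :: "nat => nat => nat => nat \<times> nat => 'k" where
 "diag l p = mk (%m i j. if i = j & (m < l \<or> m = l & i < p) then \<one> else \<zero>)"

lemma mk_closed:
 assumes "!!m i j. m < L ==> i < ns m ==> j < ns m ==> f m i j:car K"
 shows "mk f:car MP"
 using assms by (auto simp: mk_def prod_algebra_def matrix_algebra_def PiE_def extensional_def split: if_splits)

lemma mk_cong:
 assumes "!!m i j. m < L ==> i < ns m ==> j < ns m ==> f m i j = g m i j"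
 shows "mk f = mk g"
 unfolding mk_def using assms by (intro restrict_ext) auto

lemma mk_eta:
 assumes "A:car MP"
 shows "A = mk (%m i j. A m (i, j))"
proof
 fix m
 show "A m = mk (%m i j. A m (i, j)) m"
 proof (cases "m < L")
  case True
  then have "A m:{..<ns m} \<times> {..<ns m} \<rightarrow>\<^sub>E car K"
   using assms by (auto simp: prod_algebra_def matrix_algebra_def)
  then show ?thesis
   using True by (auto simp: mk_def fun_eq_iff restrict_def PiE_def extensional_def)
 next
  case False
  then show ?thesis using assms by (auto simp: mk_def prod_algebra_def PiE_def extensional_def)
 qed
qed

lemma entry_closed: "A:car MP ==> m < L ==> i < ns m ==> j < ns m ==> A m (i, j):car K"
 by (auto simp: prod_algebra_def matrix_algebra_def PiE_def Pi_def)

lemma mk_mult: "mk f \<otimes>\<^sub>MP mk g = mk (%m i j. finsum K (%s. if s < ns m then f m i s \<otimes> g m s j else \<zero>) {..<ns m})"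
 if cl: "!!m i j. m < L ==> i < ns m ==> j < ns m ==> f m i j:car K"
  "!!m i j. m < L ==> i < ns m ==> j < ns m ==> g m i j:car K"
proof -
 have "finsum K (%s. mk f m (i, s) \<otimes> mk g m (s, j)) {..<ns m} =
   finsum K (%s. if s < ns m then f m i s \<otimes> g m s j else \<zero>) {..<ns m}"
  if m: "m < L" "i < ns m" "j < ns m" for m i j
  using m by (intro finsum_cong') (auto simp: mk_def cl)
 then show ?thesis
  by (auto simp: prod_algebra_def matrix_algebra_def mk_def intro!: restrict_ext)
qed

lemma mk_add: "mk f \<oplus>\<^sub>MP mk g = mk (%m i j. f m i j \<oplus> g m i j)"
 by (auto simp: prod_algebra_def matrix_algebra_def mk_def intro!: restrict_ext)

lemma mk_smult: "c \<odot>\<^sub>MP mk g = mk (%m i j. c \<otimes> g m i j)"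
 by (auto simp: prod_algebra_def matrix_algebra_def mk_def intro!: restrict_ext)

lemma mk_one: "\<one>\<^sub>MP = mk (%m i j. if i = j then \<one> else \<zero>)"
 by (auto simp: prod_algebra_def matrix_algebra_def mk_def intro!: restrict_ext)

lemma mk_zero: "\<zero>\<^sub>MP = mk (%m i j. \<zero>)"
 by (auto simp: prod_algebra_def matrix_algebra_def mk_def intro!: restrict_ext)

lemma unit_closed: "unit l p q:car MP"
 unfolding unit_def by (rule mk_closed) auto

lemma finsum_single:
 fixes s0 n :: nat
 assumes "s0 < n" "!!s. s < n ==> s ~= s0 ==> f s = \<zero>" "f s0:car K"
 shows "finsum K f {..<n} = f s0"
proof -
 have "finsum K f {..<n} = finsum K (%s. if s0 = s then f s else \<zero>) {..<n}"
  using assms by (intro finsum_cong') auto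
 also have "\<dots> = f s0"
 proof (rule finsum_singleton)
  have "f s:car K" if "s < n" for s
   using assms(2)[OF that] assms(3) by (cases "s = s0") auto
  then show "f:{..<n} \<rightarrow> car K" by auto
 qed (use assms in auto)
 finally show ?thesis .
qed

lemma unit_mult_left:
 assumes "A:car MP" "q < ns l"
 shows "unit l p q \<otimes>\<^sub>MP A = mk (%m i j. if m = l & i = p then A l (q, j) else \<zero>)"
proof -
 have "unit l p q \<otimes>\<^sub>MP mk (%m i j. A m (i, j)) = mk (%m i j. if m = l & i = p then A l (q, j) else \<zero>)"
  unfolding unit_def
 proof (subst mk_mult)
  show "mk (%m i j. \<Oplus>s\<in>{..<ns m}. if s < ns m then (if m = l & i = p & s = q then \<one> else \<zero>) \<otimes> A m (s, j) else \<zero>) =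
   mk (%m i j. if m = l & i = p then A l (q, j) else \<zero>)"
  proof (rule mk_cong)
   fix m i j assume m: "m < L" "i < ns m" "j < ns m"
   let ?f = "%s. if s < ns m then (if m = l & i = p & s = q then \<one> else \<zero>) \<otimes> A m (s, j) else \<zero>"
   show "finsum K ?f {..<ns m} = (if m = l & i = p then A l (q, j) else \<zero>)"
   proof (cases "m = l & i = p")
    case True
    then have "finsum K ?f {..<ns m} = ?f q"
     using m assms entry_closed[OF assms(1) m(1)] by (intro finsum_single) auto
    then show ?thesis using True m assms entry_closed[OF assms(1) m(1)] by auto
   next
    case False
    then have "finsum K ?f {..<ns m} = finsum K (%s. \<zero>) {..<ns m}"
     using m entry_closed[OF assms(1) m(1)] by (intro finsum_cong') auto
    then show ?thesis using False by auto
   qed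
  qed
 qed (use entry_closed[OF assms(1)] in auto)
 then show ?thesis using mk_eta[OF assms(1)] by simp
qed

lemma unit_mult_right:
 assumes "A:car MP" "p < ns l"
 shows "A \<otimes>\<^sub>MP unit l p q = mk (%m i j. if m = l & j = q then A l (i, p) else \<zero>)"
proof -
 have "mk (%m i j. A m (i, j)) \<otimes>\<^sub>MP unit l p q = mk (%m i j. if m = l & j = q then A l (i, p) else \<zero>)"
  unfolding unit_def
 proof (subst mk_mult)
  show "mk (%m i j. \<Oplus>s\<in>{..<ns m}. if s < ns m then A m (i, s) \<otimes> (if m = l & s = p & j = q then \<one> else \<zero>) else \<zero>) =
   mk (%m i j. if m = l & j = q then A l (i, p) else \<zero>)"
  proof (rule mk_cong)
   fix m i j assume m: "m < L" "i < ns m" "j < ns m"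
   let ?f = "%s. if s < ns m then A m (i, s) \<otimes> (if m = l & s = p & j = q then \<one> else \<zero>) else \<zero>"
   show "finsum K ?f {..<ns m} = (if m = l & j = q then A l (i, p) else \<zero>)"
   proof (cases "m = l & j = q")
    case True
    then have "finsum K ?f {..<ns m} = ?f p"
     using m assms entry_closed[OF assms(1) m(1)] by (intro finsum_single) auto
    then show ?thesis using True m assms entry_closed[OF assms(1) m(1)] by auto
   next
    case False
    then have "finsum K ?f {..<ns m} = finsum K (%s. \<zero>) {..<ns m}"
     using m entry_closed[OF assms(1) m(1)] by (intro finsum_cong') auto
    then show ?thesis using False by auto
   qed
  qed
 qed (use entry_closed[OF assms(1)] in auto)
 then show ?thesis using mk_eta[OF assms(1)] by simp
qed

lemma mk_entry: "m < L ==> i < ns m ==> j < ns m ==> mk f m (i, j) = f m i j"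
 by (simp add: mk_def)

lemma unit_mult_unit: "l < L ==> q < ns l ==> p < ns l ==> s < ns l ==> unit l p q \<otimes>\<^sub>MP unit l q s = unit l p s"
 by (subst unit_mult_left[OF unit_closed]) (auto simp: unit_def mk_entry intro!: mk_cong)

lemma unit_corner:
 assumes "A:car MP" "l < L" "p < ns l"
 shows "unit l p p \<otimes>\<^sub>MP A \<otimes>\<^sub>MP unit l p p = A l (p, p) \<odot>\<^sub>MP unit l p p"
proof -
 let ?B = "mk (%m i j. if m = l & i = p then A l (p, j) else \<zero>)"
 have B: "?B:car MP"
  using entry_closed[OF assms(1,2)] assms(3) by (intro mk_closed) auto
 have "?B \<otimes>\<^sub>MP unit l p p = mk (%m i j. if m = l & j = p then ?B l (i, p) else \<zero>)"
  by (rule unit_mult_right[OF B assms(3)])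
 also have "\<dots> = mk (%m i j. A l (p, p) \<otimes> (if m = l & i = p & j = p then \<one> else \<zero>))"
  using assms entry_closed[OF assms(1,2)] by (intro mk_cong) (auto simp: mk_entry)
 finally show ?thesis
  unfolding unit_mult_left[OF assms(1,3)] by (simp add: unit_def mk_smult)
qed

text \<open>The unit at \<open>(p, p)\<close> is the unit at \<open>(0, 0)\<close> multiplied by
  matrix units from both sides, and the identity is the sum of all of these.\<close>

lemma one_in_ideal:
 assumes closed: "!!x y. x:Q ==> y:Q ==> x \<oplus>\<^sub>MP y:Q" and zero: "\<zero>\<^sub>MP:Q"
  and l: "!!x y. x:Q ==> y:car MP ==> x \<otimes>\<^sub>MP y:Q"
  and r: "!!x y. x:Q ==> y:car MP ==> y \<otimes>\<^sub>MP x:Q"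
  and gen: "!!l. l < L ==> unit l 0 0:Q" and pos: "!!l. l < L ==> ns l > 0"
 shows "\<one>\<^sub>MP:Q"
proof -
 have u: "unit l p p:Q" if "l < L" "p < ns l" for l p
 proof -
  have "unit l p 0 \<otimes>\<^sub>MP unit l 0 0:Q" using r[OF gen[OF that(1)] unit_closed] .
  then have "unit l p 0:Q"
   using that pos[OF that(1)] by (simp add: unit_mult_unit)
  then have "unit l p 0 \<otimes>\<^sub>MP unit l 0 p:Q" using l unit_closed by blast
  then show ?thesis using that pos[OF that(1)] by (simp add: unit_mult_unit)
 qed
 have "p <= ns l --> diag l p:Q" if "diag l 0:Q" "l < L" for l p
 proof (induction p)
  case 0 then show ?case using that by simp
 next
  case (Suc p)
  have "diag l (Suc p) = diag l p \<oplus>\<^sub>MP unit l p p"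
   by (auto simp: diag_def unit_def mk_add intro!: mk_cong)
  then show ?case using Suc closed u[OF that(2), of p] by (auto simp: Suc_le_eq)
 qed
 then have step: "diag l (ns l):Q" if "diag l 0:Q" "l < L" for l using that by blast
 have D: "l <= L --> diag l 0:Q" for l
 proof (induction l)
  case 0
  have "diag 0 0 = \<zero>\<^sub>MP" by (auto simp: diag_def mk_zero intro!: mk_cong)
  then show ?case using zero by simp
 next
  case (Suc l)
  have "diag (Suc l) 0 = diag l (ns l)" by (auto simp: diag_def less_Suc_eq intro!: mk_cong)
  then show ?case using Suc step[of l] by (auto simp: Suc_le_eq)
 qed
 have "diag L 0 = \<one>\<^sub>MP" by (auto simp: diag_def mk_one intro!: mk_cong)
 then show ?thesis using D[of L] by simp
qed

end

locale rad3_algebra = fd_algebra +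
 assumes split: "split_algebra K \<Lambda>" and cube: "radical_cube_zero \<Lambda>"
begin

lemma J_cube:
 assumes "x:J" "y:J" "z:J"
 shows "x \<otimes> y \<otimes> z = \<zero>"
proof -
 have "x \<otimes> y \<otimes> z:ideal_prod \<Lambda> (ideal_prod \<Lambda> (jacobson_radical \<Lambda>) (jacobson_radical \<Lambda>)) (jacobson_radical \<Lambda>)"
  using assms by (auto simp: J_def intro!: ideal_prod.prod)
 then show ?thesis using cube by (simp add: radical_cube_zero_def)
qed

text \<open>The first diagonal unit of each block is lifted to an idempotent. The elements that
  annihilate \<open>S\<close> form a two-sided ideal; if all lifts belonged to it, its image would
  contain 1, and 1 would act on \<open>S\<close> as an element of \<open>J\<close>, that is, as
  zero. The corner condition is the corresponding fact for matrices, where the corner of a diagonal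
  unit is the ground field.\<close>

lemma primitive_idempotent:
 assumes S: "simple_module \<Lambda> S"
 obtains e where "e:car \<Lambda>" "e \<otimes> e = e" "EX s:car S. e \<odot>\<^sub>S s ~= \<zero>\<^sub>S"
  "!!x. x:car \<Lambda> ==> EX c:car K. e \<otimes> x \<otimes> e \<ominus> emb c \<otimes> e:J"
proof -
 interpret K: field K by (rule field_K)
 interpret S: left_module \<Lambda> S by (rule simpleD(1)[OF S])
 interpret JI: ideal J \<Lambda> by (rule ideal_J)
 obtain nl h where nl: "!!n. n:set nl ==> n >= 1"
  and h0: "h:ring_iso (quot_module \<Lambda> (jacobson_radical \<Lambda>)) (prod_algebra {..<length nl} (%i. matrix_algebra K (nl ! i)))"
  and hK0: "!!c x. c:car K ==> x:car (quot_module \<Lambda> (jacobson_radical \<Lambda>)) ==>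
   h (c \<odot>\<^sub>(quot_module \<Lambda> (jacobson_radical \<Lambda>)) x) = c \<odot>\<^sub>(prod_algebra {..<length nl} (%i. matrix_algebra K (nl ! i))) h x"
  using split unfolding split_algebra_def algebra_iso_def by blast
 define L where "L = length nl"
 interpret P: matrix_product K L "%i. nl ! i" by unfold_locales
 let ?Q = "quot_module \<Lambda> J"
 have h: "h:ring_iso ?Q P.MP" and hK: "!!c x. c:car K ==> x:car ?Q ==> h (c \<odot>\<^sub>?Q x) = c \<odot>\<^sub>(P.MP) h x"
  using h0 hK0 by (simp_all add: J_def L_def)
 have JK: "Module.submodule J K \<Lambda>"
  using J_lideal unfolding lideal_iff left_module.subm_iff[OF lmod_K]
  by (auto simp: emb_mult_left[symmetric])
 note q = quot_module[OF lmod_K JK]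
 define \<pi> where "\<pi> x = h (cmap \<Lambda> J x)" for x
 have hd: "!!x y. x:car ?Q ==> y:car ?Q ==> h (x \<otimes>\<^sub>?Q y) = h x \<otimes>\<^sub>(P.MP) h y"
  "!!x y. x:car ?Q ==> y:car ?Q ==> h (x \<oplus>\<^sub>?Q y) = h x \<oplus>\<^sub>(P.MP) h y"
  "h \<one>\<^sub>?Q = \<one>\<^sub>(P.MP)" "inj_on h (car ?Q)" "h ` car ?Q = car P.MP"
  using h ring_hom_mult[of h ?Q P.MP] ring_hom_add[of h ?Q P.MP] ring_hom_one[of h ?Q P.MP]
  by (simp_all add: ring_iso_def bij_betw_def)
 have cQ: "cmap \<Lambda> J x:car ?Q" if "x:car \<Lambda>" for x
  using homD(1)[OF q(2) that] .
 have flds: "monoid.mult ?Q = rcoset_mult \<Lambda> J" "\<one>\<^sub>?Q = J +>\<^sub>\<Lambda> \<one>"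
  by (simp_all add: quot_module_def FactRing_def ring.extend_def module.fields_def)
 have pm: "\<pi> (x \<otimes> y) = \<pi> x \<otimes>\<^sub>(P.MP) \<pi> y" if "x:car \<Lambda>" "y:car \<Lambda>" for x y
 proof -
  have "cmap \<Lambda> J x \<otimes>\<^sub>?Q cmap \<Lambda> J y = cmap \<Lambda> J (x \<otimes> y)"
   using that by (simp add: flds cmap_def JI.rcoset_mult_add)
  then show ?thesis
   using hd(1)[OF cQ[OF that(1)] cQ[OF that(2)]] unfolding \<pi>_def by simp
 qed
 have pa: "\<pi> (x \<oplus> y) = \<pi> x \<oplus>\<^sub>(P.MP) \<pi> y" if "x:car \<Lambda>" "y:car \<Lambda>" for x y
  using hd(2)[OF cQ cQ] that homD(2)[OF q(2)] by (simp add: \<pi>_def)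
 have ps: "\<pi> (c \<odot> x) = c \<odot>\<^sub>(P.MP) \<pi> x" if "c:car K" "x:car \<Lambda>" for c x
  using hK[OF _ cQ] that homD(3)[OF q(2)] by (simp add: \<pi>_def)
 have p1: "\<pi> \<one> = \<one>\<^sub>(P.MP)" using hd(3) by (simp add: \<pi>_def flds cmap_def)
 have pc: "\<pi> x:car P.MP" if "x:car \<Lambda>" for x
  using hd(5) cQ[OF that] by (auto simp: \<pi>_def)
 have psurj: "EX x:car \<Lambda>. \<pi> x = y" if "y:car P.MP" for y
 proof -
  have "y:h ` cmap \<Lambda> J ` car \<Lambda>" using that hd(5) q(3) by simp
  then show ?thesis by (auto simp: \<pi>_def)
 qed
 have peq: "x \<ominus> y:J" if "x:car \<Lambda>" "y:car \<Lambda>" "\<pi> x = \<pi> y" for x y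
 proof -
  have "cmap \<Lambda> J x = cmap \<Lambda> J y"
   using that hd(4) cQ by (auto simp: \<pi>_def inj_on_def)
  then have "cmap \<Lambda> J (x \<ominus> y) = \<zero>\<^sub>?Q"
   using hom_minus[OF lmod_K q(1,2) that(1,2)] cQ[OF that(2)]
    abelian_group.minus_eq_zero_iff[OF left_module.axioms(2)[OF q(1)]] by simp
  then show ?thesis using q(4) that by simp
 qed
 have peq': "\<pi> x = \<pi> y" if "x:car \<Lambda>" "y:car \<Lambda>" "x \<ominus> y:J" for x y
 proof -
  have "cmap \<Lambda> J (x \<ominus> y) = \<zero>\<^sub>?Q" using q(4) that by simp
  then show ?thesis
   using hom_minus[OF lmod_K q(1,2) that(1,2)] cQ that
    abelian_group.minus_eq_zero_iff[OF left_module.axioms(2)[OF q(1)]] by (simp add: \<pi>_def)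
 qed
 have pos: "nl ! l > 0" if "l < L" for l using nl[of "nl ! l"] that by (simp add: L_def)
 have "EX e:car \<Lambda>. e \<otimes> e = e & \<pi> e = P.unit l 0 0" if l: "l < L" for l
 proof -
  obtain x where x: "x:car \<Lambda>" "\<pi> x = P.unit l 0 0" using psurj[OF P.unit_closed] by blast
  have "\<pi> (x \<otimes> x) = \<pi> x" using x pm[of x x] P.unit_mult_unit[OF l pos[OF l] pos[OF l] pos[OF l]] by simp
  then have "x \<otimes> x \<ominus> x:J" using x by (intro peq) auto
  then obtain e where "e:car \<Lambda>" "e \<otimes> e = e" "e \<ominus> x:J"
   using ring.idempotent_lift[OF ring_\<Lambda> ideal_J J_cube x(1)] by blast
  then show ?thesis using peq'[of e x] x by auto
 qed
 then obtain e where e: "!!l. l < L ==> e l:car \<Lambda>" "!!l. l < L ==> e l \<otimes> e l = e l"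
  "!!l. l < L ==> \<pi> (e l) = P.unit l 0 0" by metis
 have "EX l<L. EX s:car S. e l \<odot>\<^sub>S s ~= \<zero>\<^sub>S"
 proof (rule ccontr)
  assume no: "~ ?thesis"
  define N where "N = {x:car \<Lambda>. ALL s:car S. x \<odot>\<^sub>S s = \<zero>\<^sub>S}"
  have "\<one>\<^sub>(P.MP):\<pi> ` N"
  proof (rule P.one_in_ideal[OF _ _ _ _ _ pos])
   fix x assume "x:\<pi> ` N"
   then obtain u where u: "u:N" "x = \<pi> u" by auto
   { fix y assume "y:\<pi> ` N"
    then obtain v where v: "v:N" "y = \<pi> v" by auto
    have "u \<oplus> v:N" using u v by (auto simp: N_def S.smult_l_distr)
    moreover have "x \<oplus>\<^sub>(P.MP) y = \<pi> (u \<oplus> v)" using u v pa by (simp add: N_def)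
    ultimately show "x \<oplus>\<^sub>(P.MP) y:\<pi> ` N" by blast }
   fix y assume "y:car P.MP"
   then obtain v where v: "v:car \<Lambda>" "y = \<pi> v" using psurj by blast
   have "u \<otimes> v:N" "v \<otimes> u:N" using u v by (auto simp: N_def S.smult_assoc1)
   moreover have "x \<otimes>\<^sub>(P.MP) y = \<pi> (u \<otimes> v)" "y \<otimes>\<^sub>(P.MP) x = \<pi> (v \<otimes> u)"
    using u v pm by (simp_all add: N_def)
   ultimately show "x \<otimes>\<^sub>(P.MP) y:\<pi> ` N" "y \<otimes>\<^sub>(P.MP) x:\<pi> ` N" by blast+
  next
   have "\<zero>:N" by (auto simp: N_def)
   \<comment> \<open>The product of matrix algebras has not been shown to be a ring, so the image of
     zero is computed from its entries after writing zero as a multiple by the scalar zero.\<close>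
   have "\<pi> \<zero> = \<pi> (\<zero>\<^sub>K \<odot> \<zero>)" by simp
   also have "\<dots> = \<zero>\<^sub>K \<odot>\<^sub>(P.MP) P.mk (%m i j. \<pi> \<zero> m (i, j))"
    using ps[of "\<zero>\<^sub>K" \<zero>] P.mk_eta[OF pc[of \<zero>]] by simp
   also have "\<dots> = \<zero>\<^sub>(P.MP)"
    using P.entry_closed[OF pc[of \<zero>]] unfolding P.mk_smult P.mk_zero by (intro P.mk_cong) simp
   finally show "\<zero>\<^sub>(P.MP):\<pi> ` N" using \<open>\<zero>:N\<close> by (metis imageI)
  next
   fix l assume l: "l < L"
   have "e l:N" using no l e by (auto simp: N_def)
   then show "P.unit l 0 0:\<pi> ` N" using e(3)[OF l] by (metis imageI)
  qed
  then obtain x where x: "x:N" "\<pi> x = \<pi> \<one>" using p1 by auto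
  then have "\<one> \<ominus> x:J" using peq[of \<one> x] by (auto simp: N_def)
  have "s = \<zero>\<^sub>S" if "s:car S" for s
  proof -
   have "(\<one> \<ominus> x) \<odot>\<^sub>S s = \<one> \<odot>\<^sub>S s \<ominus>\<^sub>S x \<odot>\<^sub>S s"
    using x that by (intro S.minus_smult) (auto simp: N_def)
   then have "(\<one> \<ominus> x) \<odot>\<^sub>S s = s" using x that by (simp add: N_def a_minus_def)
   then show ?thesis using simple_kill[OF S that \<open>\<one> \<ominus> x:J\<close>] by simp
  qed
  then show False using simpleD(2)[OF S] S.M.zero_closed by blast
 qed
 then obtain l where l: "l < L" "EX s:car S. e l \<odot>\<^sub>S s ~= \<zero>\<^sub>S" by blast
 have "EX c:car K. e l \<otimes> x \<otimes> e l \<ominus> emb c \<otimes> e l:J" if x: "x:car \<Lambda>" for x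
 proof -
  have "\<pi> (e l \<otimes> x \<otimes> e l) = \<pi> x l (0, 0) \<odot>\<^sub>(P.MP) P.unit l 0 0"
   using e l x pm P.unit_corner[OF pc[OF x] l(1) pos[OF l(1)]] by simp
  moreover have "\<pi> (emb (\<pi> x l (0, 0)) \<otimes> e l) = \<pi> x l (0, 0) \<odot>\<^sub>(P.MP) P.unit l 0 0"
   using e l ps P.entry_closed[OF pc[OF x] l(1) pos[OF l(1)] pos[OF l(1)]] by (simp add: emb_mult_left)
  ultimately show ?thesis
   using e l x P.entry_closed[OF pc[OF x] l(1) pos[OF l(1)] pos[OF l(1)]]
   by (intro bexI[of _ "\<pi> x l (0, 0)"] peq) auto
 qed
 then show thesis using that e(1,2)[OF l(1)] l by blast
qed

end

section \<open>Simple modules and multiplicities\<close>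

locale split_rad3_algebra = rad3_algebra +
 fixes r :: nat and S :: "nat => ('b, 'b list) module"
 assumes reps: "simple_representatives \<Lambda> r S"
begin

lemma S_simple: "i < r ==> simple_module \<Lambda> (S i)"
 and S_distinct: "i < r ==> j < r ==> module_iso \<Lambda> (S i) (S j) ==> i = j"
 and S_all: "!!M :: ('b, 'b list) module. simple_module \<Lambda> M ==> EX i<r. module_iso \<Lambda> M (S i)"
 using reps by (auto simp: simple_representatives_def)

definition primitive_for :: "('b, 'b list) module => 'b => bool" where
 "primitive_for T u \<longleftrightarrow> u:car \<Lambda> & u \<otimes> u = u & (EX s:car T. u \<odot>\<^sub>T s ~= \<zero>\<^sub>T) &
   (ALL x:car \<Lambda>. EX c:car K. u \<otimes> x \<otimes> u \<ominus> emb c \<otimes> u:J)"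

definition e :: "nat => 'b" where
 "e i = (SOME u. primitive_for (S i) u)"

text \<open>The scalar by which \<open>e i \<otimes> x \<otimes> e i\<close> acts on anything fixed
  by \<open>e i\<close> and killed by \<open>J\<close>. It depends on the algebra alone, and this
  lets different modules be compared.\<close>

definition \<kappa> :: "nat => 'b => 'a" where
 "\<kappa> i x = (SOME c. c:car K & e i \<otimes> x \<otimes> e i \<ominus> emb c \<otimes> e i:J)"

lemma primitive_e:
 assumes "i < r"
 shows "primitive_for (S i) (e i)"
proof -
 obtain u where "primitive_for (S i) u"
  using primitive_idempotent[OF S_simple[OF assms]] by (metis primitive_for_def)
 then show ?thesis unfolding e_def by (rule someI)
qed

lemma
 assumes "i < r"
 shows e_closed [simp]: "e i:car \<Lambda>" and e_idem: "e i \<otimes> e i = e i"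
  and e_nonzero: "EX s:car (S i). e i \<odot>\<^sub>(S i) s ~= \<zero>\<^sub>(S i)"
 using primitive_e[OF assms] by (auto simp: primitive_for_def)

lemma \<kappa>:
 assumes "i < r" "x:car \<Lambda>"
 shows "\<kappa> i x:car K" "e i \<otimes> x \<otimes> e i \<ominus> emb (\<kappa> i x) \<otimes> e i:J"
proof -
 have "EX c. c:car K & e i \<otimes> x \<otimes> e i \<ominus> emb c \<otimes> e i:J"
  using primitive_e[OF assms(1)] assms(2) by (auto simp: primitive_for_def)
 from someI_ex[OF this] show "\<kappa> i x:car K" "e i \<otimes> x \<otimes> e i \<ominus> emb (\<kappa> i x) \<otimes> e i:J"
  by (auto simp: \<kappa>_def)
qed

lemma e_corner:
 assumes "lmod M" "i < r" "x:car \<Lambda>" "u:car M" "e i \<odot>\<^sub>M u = u"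
 shows "EX j:J. e i \<odot>\<^sub>M (x \<odot>\<^sub>M u) = emb (\<kappa> i x) \<odot>\<^sub>M u \<oplus>\<^sub>M j \<odot>\<^sub>M u"
proof -
 interpret M: left_module \<Lambda> M by fact
 define j where "j = e i \<otimes> x \<otimes> e i \<ominus> emb (\<kappa> i x) \<otimes> e i"
 have j: "j:J" "j:car \<Lambda>" using \<kappa>(2)[OF assms(2,3)] J_sub by (auto simp: j_def)
 have c: "\<kappa> i x:car K" by (rule \<kappa>(1)[OF assms(2,3)])
 have "j \<odot>\<^sub>M u = (e i \<otimes> x \<otimes> e i) \<odot>\<^sub>M u \<ominus>\<^sub>M (emb (\<kappa> i x) \<otimes> e i) \<odot>\<^sub>M u"
  unfolding j_def using assms c by (intro M.minus_smult) auto
 also have "(e i \<otimes> x \<otimes> e i) \<odot>\<^sub>M u = e i \<odot>\<^sub>M (x \<odot>\<^sub>M u)"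
  using assms by (simp add: M.smult_assoc1)
 also have "(emb (\<kappa> i x) \<otimes> e i) \<odot>\<^sub>M u = emb (\<kappa> i x) \<odot>\<^sub>M u"
  using assms c by (simp add: M.smult_assoc1)
 finally have "j \<odot>\<^sub>M u \<oplus>\<^sub>M emb (\<kappa> i x) \<odot>\<^sub>M u = e i \<odot>\<^sub>M (x \<odot>\<^sub>M u)"
  using assms c by (simp add: M.M.add_minus_cancel)
 then show ?thesis using j c assms by (metis M.M.a_comm M.smult_closed emb_closed)
qed

text \<open>The socle, in a form that is easier to compute with; \<open>socle_eq_L\<close>
  identifies the two.\<close>

definition L :: "('b, 'm) module => 'm set" where
 "L M = {x:car M. ALL j:J. j \<odot>\<^sub>M x = \<zero>\<^sub>M}"

text \<open>A generator of a simple submodule isomorphic to \<open>S i\<close>, normalised by the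
  idempotent; see \<open>atom_iso\<close>.\<close>

definition atom :: "('b, 'm) module => nat => 'm => bool" where
 "atom M i z \<longleftrightarrow> z:L M & e i \<odot>\<^sub>M z = z & z ~= \<zero>\<^sub>M"

lemma L_subm:
 assumes "lmod M"
 shows "subm (L M) M"
proof -
 interpret M: left_module \<Lambda> M by fact
 have "j \<odot>\<^sub>M (a \<odot>\<^sub>M x) = \<zero>\<^sub>M" if "j:J" "a:car \<Lambda>" "x:L M" for j a x
  using that J_right[OF that(1,2)] J_sub[OF that(1)] by (simp add: L_def M.smult_assoc1[symmetric])
 then show ?thesis
  unfolding M.subm_iff using J_sub by (auto simp: L_def M.smult_r_distr)
qed

lemma L_closed: "x:L M ==> x:car M"
 by (simp add: L_def)

lemma e_corner_atom:
 assumes "lmod M" "i < r" "x:car \<Lambda>" "u:L M" "e i \<odot>\<^sub>M u = u"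
 shows "e i \<odot>\<^sub>M (x \<odot>\<^sub>M u) = emb (\<kappa> i x) \<odot>\<^sub>M u"
proof -
 interpret M: left_module \<Lambda> M by fact
 obtain j where "j:J" "e i \<odot>\<^sub>M (x \<odot>\<^sub>M u) = emb (\<kappa> i x) \<odot>\<^sub>M u \<oplus>\<^sub>M j \<odot>\<^sub>M u"
  using e_corner[OF assms(1-3) L_closed[OF assms(4)] assms(5)] by blast
 then show ?thesis using assms(4) \<kappa>(1)[OF assms(2,3)] by (simp add: L_def)
qed

lemma simple_L: "simple_module \<Lambda> T ==> L T = car T"
 using simple_kill by (auto simp: L_def)

lemma scalar_cancel:
 assumes "lmod M" "c:car K" "z:car M" "emb c \<odot>\<^sub>M z = \<zero>\<^sub>M" "c ~= \<zero>\<^sub>K"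
 shows "z = \<zero>\<^sub>M"
proof -
 interpret M: left_module \<Lambda> M by fact
 have "z = (emb (inv\<^bsub>K\<^esub> c) \<otimes> emb c) \<odot>\<^sub>M z" using emb_inv[OF assms(2,5)] assms(3) by simp
 also have "\<dots> = emb (inv\<^bsub>K\<^esub> c) \<odot>\<^sub>M (emb c \<odot>\<^sub>M z)"
  using emb_inv[OF assms(2,5)] assms(2,3) by (intro M.smult_assoc1) auto
 also have "\<dots> = \<zero>\<^sub>M" using emb_inv[OF assms(2,5)] assms(4) by simp
 finally show ?thesis .
qed

lemma S_atom: "i < r ==> EX s. atom (S i) i s"
proof -
 assume i: "i < r"
 interpret M: left_module \<Lambda> "S i" by (rule simpleD(1)[OF S_simple[OF i]])
 obtain s where "s:car (S i)" "e i \<odot>\<^sub>(S i) s ~= \<zero>\<^sub>(S i)" using e_nonzero[OF i] by blast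
 then show ?thesis
  using i e_idem[OF i] by (intro exI[of _ "e i \<odot>\<^sub>(S i) s"])
   (simp add: atom_def simple_L[OF S_simple] M.smult_assoc1[symmetric])
qed

text \<open>If \<open>x\<close> does not kill \<open>t\<close>, some \<open>y\<close> brings
  \<open>t\<close> back. Then \<open>\<kappa> i (y \<otimes> x)\<close> is a nonzero scalar, and it
  acts in the same way on \<open>s\<close>, so \<open>x\<close> cannot kill
  \<open>s\<close>.\<close>

lemma ann_subset_simple:
 assumes "simple_module \<Lambda> T" "atom T i t" "lmod M" "atom M i s" "i < r"
  and x: "x:car \<Lambda>" "x \<odot>\<^sub>M s = \<zero>\<^sub>M"
 shows "x \<odot>\<^sub>T t = \<zero>\<^sub>T"
proof (rule ccontr)
 assume n: "x \<odot>\<^sub>T t ~= \<zero>\<^sub>T"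
 interpret T: left_module \<Lambda> T by (rule simpleD(1)[OF assms(1)])
 interpret M: left_module \<Lambda> M by fact
 have t: "t:L T" "t:car T" "e i \<odot>\<^sub>T t = t" "t ~= \<zero>\<^sub>T" using assms(2) L_closed by (auto simp: atom_def)
 have s: "s:L M" "s:car M" "e i \<odot>\<^sub>M s = s" "s ~= \<zero>\<^sub>M" using assms(4) L_closed by (auto simp: atom_def)
 have "t:cyc T (x \<odot>\<^sub>T t)" using simple_cyc[OF assms(1) _ n] x t by simp
 then obtain y where y: "y:car \<Lambda>" "t = y \<odot>\<^sub>T (x \<odot>\<^sub>T t)" by (auto simp: cyc_def)
 then have "t = e i \<odot>\<^sub>T ((y \<otimes> x) \<odot>\<^sub>T t)" using t x by (simp add: T.smult_assoc1)
 then have 1: "t = emb (\<kappa> i (y \<otimes> x)) \<odot>\<^sub>T t"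
  using e_corner_atom[OF T.left_module_axioms assms(5) _ t(1,3)] x y by simp
 have c: "\<kappa> i (y \<otimes> x):car K" using \<kappa>(1) assms(5) x y by simp
 have "\<kappa> i (y \<otimes> x) ~= \<zero>\<^sub>K" using 1 t emb_zero by auto
 moreover have "emb (\<kappa> i (y \<otimes> x)) \<odot>\<^sub>M s = \<zero>\<^sub>M"
  using e_corner_atom[OF M.left_module_axioms assms(5) _ s(1,3), of "y \<otimes> x"] x y s assms(5)
  by (simp add: M.smult_assoc1)
 ultimately show False using scalar_cancel[OF M.left_module_axioms c s(2)] s(4) by blast
qed

lemma cyc_iso:
 assumes "lmod M" "z:car M" "lmod T" "t:car T"
  "!!x. x:car \<Lambda> ==> x \<odot>\<^sub>M z = \<zero>\<^sub>M \<longleftrightarrow> x \<odot>\<^sub>T t = \<zero>\<^sub>T"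
 obtains g where "g:mhom (M(|carrier := cyc M z|)) T"
  "!!x. x:car \<Lambda> ==> g (x \<odot>\<^sub>M z) = x \<odot>\<^sub>T t"
  "module_iso \<Lambda> (M(|carrier := cyc M z|)) (T(|carrier := cyc T t|))"
proof -
 note cM = cyc_subm[OF assms(1,2)] and cT = cyc_subm[OF assms(3,4)]
 note lM = lmod_sub[OF assms(1) cM] and lT = lmod_sub[OF assms(3) cT]
 have h: "(%x. x \<odot>\<^sub>M z):mhom reg (M(|carrier := cyc M z|))"
  using cyc_hom[OF assms(1,2)] by (rule hom_sub_codomain) (auto simp: cyc_def)
 obtain g where g: "g:mhom (M(|carrier := cyc M z|)) T"
  "!!x. x:car \<Lambda> ==> g (x \<odot>\<^sub>M z) = x \<odot>\<^sub>T t"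
  using hom_factor[OF lmod_reg lM assms(3) h _ cyc_hom[OF assms(3,4)]] assms(5)
  by (auto simp: cyc_def)
 have "module_iso \<Lambda> (M(|carrier := cyc M z|)) (T(|carrier := cyc T t|))"
 proof (rule module_isoI[OF lM lT])
  show "g:mhom (M(|carrier := cyc M z|)) (T(|carrier := cyc T t|))"
   using g(1) by (rule hom_sub_codomain) (auto simp: cyc_def g(2))
  show "g ` car (M(|carrier := cyc M z|)) = car (T(|carrier := cyc T t|))"
   by (simp add: cyc_def image_image g(2))
 qed (auto simp: cyc_def g(2) assms(5))
 then show thesis using that g by blast
qed

text \<open>A nonzero value would be an atom of type \<open>i\<close> in \<open>S j\<close>. It has
  the same annihilator as an atom of \<open>S i\<close>, so the two simple modules would be
  isomorphic.\<close>

lemma e_kill_S: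
 assumes "i < r" "j < r" "i ~= j" "s:car (S j)"
 shows "e i \<odot>\<^sub>(S j) s = \<zero>\<^sub>(S j)"
proof (rule ccontr)
 assume n: "~ ?thesis"
 interpret M: left_module \<Lambda> "S j" by (rule simpleD(1)[OF S_simple[OF assms(2)]])
 interpret T: left_module \<Lambda> "S i" by (rule simpleD(1)[OF S_simple[OF assms(1)]])
 define z where "z = e i \<odot>\<^sub>(S j) s"
 have z: "atom (S j) i z"
  using n assms e_idem[OF assms(1)]
  by (simp add: z_def atom_def simple_L[OF S_simple] M.smult_assoc1[symmetric])
 obtain t where t: "atom (S i) i t" using S_atom[OF assms(1)] by blast
 have zt: "z:car (S j)" "t:car (S i)" "z ~= \<zero>\<^sub>(S j)" "t ~= \<zero>\<^sub>(S i)"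
  using z t by (auto simp: atom_def L_def)
 obtain g where "module_iso \<Lambda> ((S j)(|carrier := cyc (S j) z|)) ((S i)(|carrier := cyc (S i) t|))"
  using cyc_iso[OF M.left_module_axioms zt(1) T.left_module_axioms zt(2)]
   ann_subset_simple[OF S_simple[OF assms(1)] t M.left_module_axioms z assms(1)]
   ann_subset_simple[OF S_simple[OF assms(2)] z T.left_module_axioms t assms(1)] by metis
 then have "module_iso \<Lambda> (S j) (S i)"
  using simple_cyc[OF S_simple[OF assms(2)] zt(1,3)] simple_cyc[OF S_simple[OF assms(1)] zt(2,4)] by simp
 then show False using S_distinct[OF assms(2,1)] assms(3) by simp
qed

lemma e_kill:
 assumes "i < r" "l < r" "i ~= l" "lmod T" "module_iso \<Lambda> T (S l)" "s:car T"
 shows "e i \<odot>\<^sub>T s = \<zero>\<^sub>T"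
proof -
 obtain f g where fg: "f:mhom T (S l)" "g:mhom (S l) T"
  "!!x. x:car T ==> g (f x) = x"
  using module_isoE[OF assms(5,4)] by metis
 have "e i \<odot>\<^sub>T s = g (e i \<odot>\<^sub>(S l) f s)"
  using homD[OF fg(1)] homD[OF fg(2)] fg(3) assms by simp
 also have "\<dots> = \<zero>\<^sub>T"
  using e_kill_S[OF assms(1-3) homD(1)[OF fg(1) assms(6)]]
   hom_zero[OF simpleD(1)[OF S_simple[OF assms(2)]] assms(4) fg(2)] by simp
 finally show ?thesis .
qed

text \<open>Every simple module is killed: \<open>e j\<close> kills all types except
  \<open>j\<close>, and \<open>e i\<close> kills type \<open>j\<close>.\<close>

lemma e_orth:
 assumes "i < r" "j < r" "i ~= j" "x:car \<Lambda>"
 shows "e i \<otimes> x \<otimes> e j:J"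
proof (rule J_detect)
 show "e i \<otimes> x \<otimes> e j:car \<Lambda>" using assms by simp
 fix T :: "('b, 'b list) module" assume T: "simple_module \<Lambda> T"
 interpret T: left_module \<Lambda> T by (rule simpleD(1)[OF T])
 obtain l where l: "l < r" "module_iso \<Lambda> T (S l)" using S_all[OF T] by blast
 show "ALL s:car T. (e i \<otimes> x \<otimes> e j) \<odot>\<^sub>T s = \<zero>\<^sub>T"
 proof
  fix s assume s: "s:car T"
  show "(e i \<otimes> x \<otimes> e j) \<odot>\<^sub>T s = \<zero>\<^sub>T"
  proof (cases "j = l")
   case True
   then show ?thesis
    using e_kill[OF assms(1) l(1) _ T.left_module_axioms l(2), of "x \<odot>\<^sub>T (e j \<odot>\<^sub>T s)"] assms s
    by (simp add: T.smult_assoc1)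
  next
   case False
   then show ?thesis
    using e_kill[OF assms(2) l(1) False T.left_module_axioms l(2) s] assms s
    by (simp add: T.smult_assoc1)
  qed
 qed
qed

text \<open>There is one idempotent for each isomorphism class, so they need not sum to 1 and do not
  decompose elements. Instead, a simple submodule of the module generated by \<open>x\<close> has
  some type \<open>i\<close>, and \<open>e i\<close> acts nontrivially on it.\<close>

lemma detect:
 assumes "lmod M" "x:car M" "x ~= \<zero>\<^sub>M"
 obtains i y where "i < r" "y:car \<Lambda>" "e i \<odot>\<^sub>M (y \<odot>\<^sub>M x) ~= \<zero>\<^sub>M"
proof -
 let ?N = "M(|carrier := cyc M x|)"
 note c = cyc_subm[OF assms(1,2)]
 note lN = lmod_sub[OF assms(1) c]
 have "(%y. y \<odot>\<^sub>M x):mhom reg ?N"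
  using cyc_hom[OF assms(1,2)] by (rule hom_sub_codomain) (auto simp: cyc_def)
 then have fN: "fdm ?N" by (rule fdm_image[OF fdm_regular lN]) (simp add: cyc_def)
 have "car ?N ~= {\<zero>\<^sub>?N}" using cyc_self[OF assms(1,2)] assms(3) by auto
 then obtain T where T: "subm T ?N" "simple_module \<Lambda> (?N(|carrier := T|))"
  using simple_subm_exists[OF fN] by blast
 then obtain T' :: "('b, 'b list) module" where T': "simple_module \<Lambda> T'" "module_iso \<Lambda> (?N(|carrier := T|)) T'"
  by (rule_tac simple_transfer)
 obtain i where i: "i < r" "module_iso \<Lambda> T' (S i)" using S_all[OF T'(1)] by blast
 have "module_iso \<Lambda> (M(|carrier := T|)) (S i)" using module_iso_trans[OF T'(2) i(2)] by simp
 moreover have lT: "lmod (M(|carrier := T|))" using simpleD(1)[OF T(2)] by simp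
 ultimately obtain f g where fg: "f:mhom (M(|carrier := T|)) (S i)" "g:mhom (S i) (M(|carrier := T|))"
  "!!y. y:car (S i) ==> f (g y) = y"
  using module_isoE by metis
 obtain s where s: "s:car (S i)" "e i \<odot>\<^sub>(S i) s ~= \<zero>\<^sub>(S i)" using e_nonzero[OF i(1)] by blast
 have g: "g s:T" using homD(1)[OF fg(2) s(1)] by simp
 then have "g s:cyc M x" using iffD1[OF left_module.subm_iff[OF lN] T(1)] by auto
 then obtain y where y: "y:car \<Lambda>" "g s = y \<odot>\<^sub>M x" by (auto simp: cyc_def)
 have "f (e i \<odot>\<^sub>M g s) = e i \<odot>\<^sub>(S i) s"
  using homD(3)[OF fg(1), of "e i" "g s"] g i fg(3) s by simp
 moreover have "f \<zero>\<^sub>M = \<zero>\<^sub>(S i)"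
  using hom_zero[OF lT simpleD(1)[OF S_simple[OF i(1)]] fg(1)] by simp
 ultimately have "e i \<odot>\<^sub>M (y \<odot>\<^sub>M x) ~= \<zero>\<^sub>M" using s(2) y(2) by metis
 then show thesis using that i y by blast
qed

lemma subm_detect:
 assumes "lmod M" "subm N M" "x:car M" "x ~: N"
 obtains i y where "i < r" "y:car \<Lambda>" "e i \<odot>\<^sub>M (y \<odot>\<^sub>M x) ~: N"
proof -
 interpret M: left_module \<Lambda> M by fact
 note q = quot_module[OF assms(1,2)]
 let ?p = "cmap M N"
 note p = homD[OF q(2)]
 have "?p x ~= \<zero>\<^sub>(quot_module M N)" using q(4) assms by simp
 then obtain i y where i: "i < r" "y:car \<Lambda>"
  "e i \<odot>\<^sub>(quot_module M N) (y \<odot>\<^sub>(quot_module M N) ?p x) ~= \<zero>\<^sub>(quot_module M N)"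
  using detect[OF q(1) p(1)[OF assms(3)]] by blast
 then have "?p (e i \<odot>\<^sub>M (y \<odot>\<^sub>M x)) ~= \<zero>\<^sub>(quot_module M N)"
  using p assms(3) by simp
 then show thesis using q(4)[of "e i \<odot>\<^sub>M (y \<odot>\<^sub>M x)"] that i assms(3) by auto
qed

lemma e_other:
 assumes "lmod M" "i < r" "l < r" "l ~= i" "x:car \<Lambda>" "u:car M" "e i \<odot>\<^sub>M u = u"
 shows "EX j:J. e l \<odot>\<^sub>M (x \<odot>\<^sub>M u) = j \<odot>\<^sub>M u"
proof -
 interpret M: left_module \<Lambda> M by fact
 have "e l \<odot>\<^sub>M (x \<odot>\<^sub>M u) = (e l \<otimes> x \<otimes> e i) \<odot>\<^sub>M u"
  using assms by (simp add: M.smult_assoc1)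
 then show ?thesis using e_orth[OF assms(3,2,4,5)] by blast
qed

lemma e_smult:
 assumes "lmod M" "i < r" "l < r" "x:car \<Lambda>" "u:car M" "e i \<odot>\<^sub>M u = u"
 obtains c j where "c:car K" "j:J" "e l \<odot>\<^sub>M (x \<odot>\<^sub>M u) = emb c \<odot>\<^sub>M u \<oplus>\<^sub>M j \<odot>\<^sub>M u"
  "l ~= i ==> c = \<zero>\<^sub>K"
proof (cases "l = i")
 case True
 then show thesis using e_corner[OF assms(1,2,4,5,6)] \<kappa>(1)[OF assms(2,4)] that by blast
next
 case False
 interpret M: left_module \<Lambda> M by fact
 interpret F: field K by (rule field_K)
 obtain j where j: "j:J" "e l \<odot>\<^sub>M (x \<odot>\<^sub>M u) = j \<odot>\<^sub>M u"
  using e_other[OF assms(1,2,3) False assms(4-6)] by blast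
 have "e l \<odot>\<^sub>M (x \<odot>\<^sub>M u) = emb \<zero>\<^sub>K \<odot>\<^sub>M u \<oplus>\<^sub>M j \<odot>\<^sub>M u"
  using j J_sub[OF j(1)] assms by (simp add: emb_zero)
 then show thesis using that[of "\<zero>\<^sub>K" j] j by simp
qed

text \<open>The argument of \<open>ann_subset_simple\<close> with \<open>detect\<close> in place of
  simplicity: only the idempotent of type \<open>i\<close> can see a multiple of an atom of that
  type. The annihilator of an atom thus depends on its type alone.\<close>

lemma ann_subset:
 assumes "lmod T" "atom T i t" "lmod M" "atom M i s" "i < r"
  and x: "x:car \<Lambda>" "x \<odot>\<^sub>M s = \<zero>\<^sub>M"
 shows "x \<odot>\<^sub>T t = \<zero>\<^sub>T"
proof (rule ccontr)
 assume n: "x \<odot>\<^sub>T t ~= \<zero>\<^sub>T"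
 interpret T: left_module \<Lambda> T by fact
 interpret M: left_module \<Lambda> M by fact
 have t: "t:L T" "t:car T" "e i \<odot>\<^sub>T t = t" using assms(2) L_closed by (auto simp: atom_def)
 have s: "s:L M" "s:car M" "e i \<odot>\<^sub>M s = s" "s ~= \<zero>\<^sub>M" using assms(4) L_closed by (auto simp: atom_def)
 obtain l y where y: "l < r" "y:car \<Lambda>" "e l \<odot>\<^sub>T (y \<odot>\<^sub>T (x \<odot>\<^sub>T t)) ~= \<zero>\<^sub>T"
  using detect[OF T.left_module_axioms _ n] x t by auto
 then have 1: "e l \<odot>\<^sub>T ((y \<otimes> x) \<odot>\<^sub>T t) ~= \<zero>\<^sub>T" using x t by (simp add: T.smult_assoc1)
 have "l = i"
  using 1 e_other[OF T.left_module_axioms assms(5) y(1) _ _ t(2,3), of "y \<otimes> x"] x y t(1) by (auto simp: L_def)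
 then have 2: "emb (\<kappa> i (y \<otimes> x)) \<odot>\<^sub>T t ~= \<zero>\<^sub>T"
  using 1 e_corner_atom[OF T.left_module_axioms assms(5) _ t(1,3)] x y by simp
 have c: "\<kappa> i (y \<otimes> x):car K" using \<kappa>(1) assms(5) x y by simp
 have "\<kappa> i (y \<otimes> x) ~= \<zero>\<^sub>K" using 2 t emb_zero by auto
 moreover have "emb (\<kappa> i (y \<otimes> x)) \<odot>\<^sub>M s = \<zero>\<^sub>M"
  using e_corner_atom[OF M.left_module_axioms assms(5) _ s(1,3), of "y \<otimes> x"] x y s assms(5)
  by (simp add: M.smult_assoc1)
 ultimately show False using scalar_cancel[OF M.left_module_axioms c s(2)] s(4) by blast
qed

lemma ann_eq:
 assumes "lmod T" "atom T i t" "lmod M" "atom M i s" "i < r" "x:car \<Lambda>"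
 shows "x \<odot>\<^sub>M s = \<zero>\<^sub>M \<longleftrightarrow> x \<odot>\<^sub>T t = \<zero>\<^sub>T"
 using ann_subset[OF assms(1-5)] ann_subset[OF assms(3,4,1,2,5)] assms(6) by blast

lemma atomD:
 assumes "atom M i z"
 shows "z:L M" "z:car M" "e i \<odot>\<^sub>M z = z" "z ~= \<zero>\<^sub>M"
 using assms L_closed by (auto simp: atom_def)

lemma atom_iso:
 assumes "lmod M" "atom M i z" "i < r"
 shows "module_iso \<Lambda> (M(|carrier := cyc M z|)) (S i)" "simple_module \<Lambda> (M(|carrier := cyc M z|))"
proof -
 obtain t where t: "atom (S i) i t" using S_atom[OF assms(3)] by blast
 note lS = simpleD(1)[OF S_simple[OF assms(3)]]
 have "cyc (S i) t = car (S i)"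
  using simple_cyc[OF S_simple[OF assms(3)]] atomD[OF t] by simp
 then have eq: "(S i)(|carrier := cyc (S i) t|) = S i" by simp
 show 1: "module_iso \<Lambda> (M(|carrier := cyc M z|)) (S i)"
  by (rule cyc_iso[OF assms(1) atomD(2)[OF assms(2)] lS atomD(2)[OF t]])
   (use ann_eq[OF lS t assms] eq in auto)
 have lz: "lmod (M(|carrier := cyc M z|))"
  by (rule lmod_sub[OF assms(1) cyc_subm[OF assms(1) atomD(2)[OF assms(2)]]])
 show "simple_module \<Lambda> (M(|carrier := cyc M z|))"
  by (rule simple_iso[OF S_simple[OF assms(3)] lz module_iso_sym[OF lz 1]])
qed

abbreviation dv :: "('b, 'm) module => nat => 'm set => nat" where
 "dv M i N == edim M (e i) N"

lemma dv_cyc_atom: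
 assumes "lmod M" "atom M i z" "i < r" "l < r"
 shows "dv M l (cyc M z) = (if l = i then 1 else 0)"
proof -
 interpret M: left_module \<Lambda> M by fact
 note z = atomD[OF assms(2)]
 have c: "cyc M z <= car M"
  using iffD1[OF M.subm_iff cyc_subm[OF assms(1) z(2)]] by simp
 show ?thesis
 proof (cases "l = i")
  case True
  have "{y:cyc M z. e i \<odot>\<^sub>M y = y} = {emb c \<odot>\<^sub>M z |c. c:car K}"
  proof (intro equalityI subsetI)
   fix y assume "y:{y:cyc M z. e i \<odot>\<^sub>M y = y}"
   then obtain x where "x:car \<Lambda>" "y = e i \<odot>\<^sub>M (x \<odot>\<^sub>M z)" by (auto simp: cyc_def)
   then show "y:{emb c \<odot>\<^sub>M z |c. c:car K}"
    using e_corner_atom[OF assms(1,3) _ z(1,3)] \<kappa>(1)[OF assms(3)] by auto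
  next
   fix y assume "y:{emb c \<odot>\<^sub>M z |c. c:car K}"
   then obtain d where d: "d:car K" "y = emb d \<odot>\<^sub>M z" by auto
   then have "e i \<odot>\<^sub>M y = (e i \<otimes> emb d) \<odot>\<^sub>M z" using assms z by (simp add: M.smult_assoc1)
   also have "\<dots> = (emb d \<otimes> e i) \<odot>\<^sub>M z" using d assms by (simp add: emb_commute)
   also have "\<dots> = y" using d z assms by (simp add: M.smult_assoc1)
   finally show "y:{y:cyc M z. e i \<odot>\<^sub>M y = y}" using d by (auto simp: cyc_def)
  qed
  then show ?thesis using kdim_line(2)[OF assms(1) z(2,4)] True by (simp add: edim_def)
 next
  case False
  have "{y:cyc M z. e l \<odot>\<^sub>M y = y} = {\<zero>\<^sub>M}"
  proof (intro equalityI subsetI)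
   fix y assume "y:{y:cyc M z. e l \<odot>\<^sub>M y = y}"
   then obtain x where x: "x:car \<Lambda>" "y = e l \<odot>\<^sub>M (x \<odot>\<^sub>M z)" by (auto simp: cyc_def)
   then show "y:{\<zero>\<^sub>M}"
    using e_other[OF assms(1,3,4) False x(1) z(2,3)] z(1) by (auto simp: L_def)
  next
   fix y assume "y:{\<zero>\<^sub>M}"
   moreover have "\<zero>\<^sub>M:cyc M z"
    using iffD1[OF M.subm_iff cyc_subm[OF assms(1) z(2)]] by simp
   ultimately show "y:{y:cyc M z. e l \<odot>\<^sub>M y = y}" using assms by simp
  qed
  then show ?thesis using kdim_zero[OF assms(1)] False by (simp add: edim_def)
 qed
qed

text \<open>An element of \<open>N'\<close> outside \<open>N\<close> would yield one fixed by some
  \<open>e i\<close>, and the multiplicity at \<open>i\<close> would grow.\<close>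

lemma dv_eq:
 assumes "fdm M" "subm N M" "subm N' M" "N <= N'"
  "!!i. i < r ==> dv M i N = dv M i N'"
 shows "N = N'"
proof (rule ccontr)
 interpret M: left_module \<Lambda> M using fdmD(1)[OF assms(1)] .
 assume "N ~= N'"
 then obtain x where x: "x:N'" "x ~: N" using assms(4) by auto
 note N' = iffD1[OF M.subm_iff assms(3)]
 have xc: "x:car M" using x N' by auto
 obtain i y where i: "i < r" "y:car \<Lambda>" "e i \<odot>\<^sub>M (y \<odot>\<^sub>M x) ~: N"
  using subm_detect[OF M.left_module_axioms assms(2) xc x(2)] by blast
 have "e i \<odot>\<^sub>M (y \<odot>\<^sub>M x):{x:N'. e i \<odot>\<^sub>M x = x}"
  using i x N' xc e_idem[OF i(1)] M.smult_assoc1[of "e i" "e i" "y \<odot>\<^sub>M x"] by simp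
 then show False
  using edim_mono(2)[OF assms(1-4) e_closed[OF i(1)] assms(5)[OF i(1)]] i(3) by blast
qed

lemma dv_zero:
 assumes "fdm M" "i < r"
 shows "dv M i {\<zero>\<^sub>M} = 0"
proof -
 interpret M: left_module \<Lambda> M using fdmD(1)[OF assms(1)] .
 have "{x:{\<zero>\<^sub>M}. e i \<odot>\<^sub>M x = x} = {\<zero>\<^sub>M}" using assms by auto
 then show ?thesis using kdim_zero[OF M.left_module_axioms] by (simp add: edim_def)
qed

lemma dv_eq_0:
 assumes "fdm M" "subm N M" "!!i. i < r ==> dv M i N = 0"
 shows "N = {\<zero>\<^sub>M}"
proof -
 interpret M: left_module \<Lambda> M using fdmD(1)[OF assms(1)] .
 have "{\<zero>\<^sub>M} = N"
  using iffD1[OF M.subm_iff assms(2)] assms dv_zero[OF assms(1)]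
  by (intro dv_eq[OF assms(1) M.zero_subm assms(2)]) auto
 then show ?thesis by simp
qed

lemma dv_hom:
 assumes "fdm M" "lmod Q" "f:mhom M Q" "subm N M" "i < r"
 shows "dv M i N = dv Q i (f ` N) + dv M i {x:N. f x = \<zero>\<^sub>Q}"
 using edim_hom[OF assms(1-4) e_closed e_idem] assms(5) by blast

lemma dv_inj:
 assumes "fdm M" "lmod Q" "f:mhom M Q" "subm N M" "i < r"
  "!!x. x:N ==> f x = \<zero>\<^sub>Q ==> x = \<zero>\<^sub>M"
 shows "dv Q i (f ` N) = dv M i N"
 using edim_inj[OF assms(1-4) e_closed e_idem assms(6)] assms(5) by blast

lemma dv_mono:
 assumes "fdm M" "subm N M" "subm N' M" "N <= N'" "i < r"
 shows "dv M i N <= dv M i N'"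
 using edim_mono(1)[OF assms(1-4) e_closed[OF assms(5)]] .

text \<open>Multiply by elements of \<open>J\<close> as long as the result is not killed by
  \<open>J\<close>. Since the cube of \<open>J\<close> is zero, at most two factors are
  needed.\<close>

lemma L_nonzero:
 assumes "lmod M" "x:car M" "x ~= \<zero>\<^sub>M"
 obtains y where "y:car \<Lambda>" "y \<odot>\<^sub>M x:L M" "y \<odot>\<^sub>M x ~= \<zero>\<^sub>M"
proof -
 interpret M: left_module \<Lambda> M by fact
 show thesis
 proof (cases "x:L M")
  case True then show thesis using that[of \<one>] assms by simp
 next
  case False
  then obtain j where j: "j:J" "j \<odot>\<^sub>M x ~= \<zero>\<^sub>M" using assms by (auto simp: L_def)
  show thesis
  proof (cases "j \<odot>\<^sub>M x:L M")
   case True then show thesis using that j J_sub by blast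
  next
   case False
   then obtain j' where j': "j':J" "j' \<odot>\<^sub>M (j \<odot>\<^sub>M x) ~= \<zero>\<^sub>M"
    using assms j J_sub by (auto simp: L_def)
   have "j'' \<odot>\<^sub>M ((j' \<otimes> j) \<odot>\<^sub>M x) = \<zero>\<^sub>M" if "j'':J" for j''
    using J_cube[OF that j'(1) j(1)] assms(2) J_sub[OF that] J_sub[OF j(1)] J_sub[OF j'(1)]
    by (simp add: M.smult_assoc1[symmetric] Alg.m_assoc)
   then have "(j' \<otimes> j) \<odot>\<^sub>M x:L M"
    using assms(2) J_sub[OF j(1)] J_sub[OF j'(1)] by (simp add: L_def)
   then show thesis
    using that[of "j' \<otimes> j"] j' J_sub[OF j(1)] J_sub[OF j'(1)] assms(2) by (simp add: M.smult_assoc1)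
  qed
 qed
qed

lemma atom_exists:
 assumes "lmod M" "subm N M" "N ~= {\<zero>\<^sub>M}"
 obtains i z where "i < r" "z:N" "atom M i z"
proof -
 interpret M: left_module \<Lambda> M by fact
 note N = iffD1[OF M.subm_iff assms(2)]
 obtain x where x: "x:N" "x ~= \<zero>\<^sub>M" using assms(3) N by auto
 then have xc: "x:car M" using N by auto
 obtain y where y: "y:car \<Lambda>" "y \<odot>\<^sub>M x:L M" "y \<odot>\<^sub>M x ~= \<zero>\<^sub>M"
  using L_nonzero[OF assms(1) xc x(2)] .
 obtain i w where w: "i < r" "w:car \<Lambda>" "e i \<odot>\<^sub>M (w \<odot>\<^sub>M (y \<odot>\<^sub>M x)) ~= \<zero>\<^sub>M"
  using detect[OF assms(1) L_closed[OF y(2)] y(3)] .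
 note Ls = iffD1[OF M.subm_iff L_subm[OF assms(1)]]
 let ?z = "e i \<odot>\<^sub>M (w \<odot>\<^sub>M (y \<odot>\<^sub>M x))"
 have "e i \<odot>\<^sub>M ?z = (e i \<otimes> e i) \<odot>\<^sub>M (w \<odot>\<^sub>M (y \<odot>\<^sub>M x))"
  using w y xc by (intro M.smult_assoc1[symmetric]) auto
 then have "atom M i ?z"
  using w y xc Ls e_idem[OF w(1)] by (simp add: atom_def)
 moreover have "?z:N" using N w y x by simp
 ultimately show thesis using that w(1) by blast
qed

subsection \<open>Radicals and complements\<close>

definition rad :: "('b, 'm) module => 'm set" where
 "rad M = submodule_generated \<Lambda> M {j \<odot>\<^sub>M x |j x. j:J & x:car M}"

text \<open>Loewy length at most two.\<close>

definition lev2 :: "('b, 'm) module => bool" where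
 "lev2 M \<longleftrightarrow> (ALL j:J. ALL j':J. ALL x:car M. j \<odot>\<^sub>M (j' \<odot>\<^sub>M x) = \<zero>\<^sub>M)"

lemma
 assumes "lmod M"
 shows rad_subm: "subm (rad M) M"
  and radI: "!!j x. j:J ==> x:car M ==> j \<odot>\<^sub>M x:rad M"
proof -
 interpret M: left_module \<Lambda> M by fact
 have "{j \<odot>\<^sub>M x |j x. j:J & x:car M} <= car M" using J_sub by auto
 from M.submodule_generated[OF this]
 show "subm (rad M) M" "!!j x. j:J ==> x:car M ==> j \<odot>\<^sub>M x:rad M"
  by (auto simp: rad_def)
qed

lemma rad_least:
 "subm N M ==> (!!j x. j:J ==> x:car M ==> j \<odot>\<^sub>M x:N) ==> rad M <= N"
 unfolding rad_def by (rule submodule_generated_least) auto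

lemma lev2_rad: "lmod M ==> lev2 M \<longleftrightarrow> rad M <= L M"
proof
 assume M: "lmod M" and "lev2 M"
 then show "rad M <= L M"
  using J_sub left_module.smult_closed[OF M]
  by (intro rad_least L_subm) (auto simp: lev2_def L_def)
next
 assume "lmod M" "rad M <= L M"
 then show "lev2 M" using radI by (fastforce simp: lev2_def L_def)
qed

lemma J_vimage_subm:
 assumes "lmod M" "subm N M"
 shows "subm {x:car M. ALL j:J. j \<odot>\<^sub>M x:N} M"
proof -
 interpret M: left_module \<Lambda> M by fact
 note N = iffD1[OF M.subm_iff assms(2)]
 have "j \<odot>\<^sub>M (a \<odot>\<^sub>M x):N"
  if "j:J" "a:car \<Lambda>" "x:car M" "ALL j:J. j \<odot>\<^sub>M x:N" for j a x
  using that J_right[OF that(1,2)] J_sub[OF that(1)] by (simp add: M.smult_assoc1[symmetric])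
 then show ?thesis
  unfolding M.subm_iff using N J_sub by (auto simp: M.smult_r_distr)
qed

text \<open>Nilpotence does the work. Any submodule that contains both \<open>N\<close> and the
  radical is everything. This applies first to the elements carried into \<open>N\<close> by
  products of two elements of \<open>J\<close>, then to those carried into \<open>N\<close> by
  \<open>J\<close>, and finally to \<open>N\<close>.\<close>

lemma nakayama:
 assumes "lmod M" "subm N M"
  and sum: "!!x. x:car M ==> EX n:N. EX k:rad M. x = n \<oplus>\<^sub>M k"
 shows "N = car M"
proof -
 interpret M: left_module \<Lambda> M by fact
 have all: "A = car M" if A: "subm A M" "N <= A" "rad M <= A" for A
  using sum iffD1[OF M.subm_iff A(1)] A(2,3) by blast
 define A1 where "A1 = {x:car M. ALL j:J. j \<odot>\<^sub>M x:N}"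
 define A2 where "A2 = {x:car M. ALL j:J. j \<odot>\<^sub>M x:A1}"
 note N = iffD1[OF M.subm_iff assms(2)]
 have s1: "subm A1 M" unfolding A1_def by (rule J_vimage_subm[OF assms(1,2)])
 have s2: "subm A2 M" unfolding A2_def by (rule J_vimage_subm[OF assms(1) s1])
 have NA1: "N <= A1" using N J_sub by (auto simp: A1_def)
 have NA2: "N <= A2" using N NA1 J_sub by (auto simp: A2_def)
 have "A2 = car M"
 proof (rule all[OF s2 NA2 rad_least[OF s2]])
  fix j x assume j: "j:J" "x:car M"
  have "j1 \<odot>\<^sub>M (j2 \<odot>\<^sub>M (j \<odot>\<^sub>M x)):N" if "j1:J" "j2:J" for j1 j2
   using J_cube[OF that j(1)] N j that J_sub by (simp add: M.smult_assoc1[symmetric] Alg.m_assoc)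
  then show "j \<odot>\<^sub>M x:A2" using j J_sub by (simp add: A1_def A2_def)
 qed
 then have "A1 = car M"
  by (intro all[OF s1 NA1 rad_least[OF s1]]) (auto simp: A2_def)
 then show ?thesis
  by (intro all[OF assms(2) _ rad_least[OF assms(2)]]) (auto simp: A1_def)
qed

lemma subm_sum:
 assumes "lmod M" "subm N M" "subm W M"
 defines "T == {n \<oplus>\<^sub>M w |n w. n:N & w:W}"
 shows "subm T M" "N <= T" "W <= T"
proof -
 interpret M: left_module \<Lambda> M by fact
 have P: "lmod (direct_prod M M)" by (rule lmod_prod[OF assms(1,1)])
 have h: "(%x. fst x \<oplus>\<^sub>M snd x):mhom (direct_prod M M) M"
  by (rule hom_add[OF P assms(1) hom_fst hom_snd])
 have "subm (N \<times> W) (direct_prod M M)"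
  using iffD1[OF M.subm_iff assms(2)] iffD1[OF M.subm_iff assms(3)]
  by (auto simp: left_module.subm_iff[OF P])
 moreover have "T = (%x. fst x \<oplus>\<^sub>M snd x) ` (N \<times> W)" by (force simp: T_def)
 ultimately show "subm T M" using subm_image[OF P assms(1) h] by simp
 have "\<zero>\<^sub>M:N" "\<zero>\<^sub>M:W" "N <= car M" "W <= car M"
  using iffD1[OF M.subm_iff assms(2)] iffD1[OF M.subm_iff assms(3)] by auto
 then show "N <= T" "W <= T"
  unfolding T_def by (blast intro: M.M.r_zero[symmetric], blast intro: M.M.l_zero[symmetric])
qed

text \<open>Take \<open>N\<close> of greatest dimension over the radical with trivial intersection
  with \<open>W\<close>. If \<open>u\<close>, fixed by some \<open>e i\<close>, lay outside
  \<open>N + W\<close>, then adjoining \<open>u\<close> would keep the intersection trivial: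
  \<open>J\<close> moves \<open>u\<close> into the radical and hence into \<open>N\<close>, so only
  scalar multiples of \<open>u\<close> are new.\<close>

lemma complement_over_rad:
 assumes "fdm M" "subm W M" "W <= L M" "W \<inter> rad M = {\<zero>\<^sub>M}"
 obtains N where "subm N M" "rad M <= N" "N \<inter> W = {\<zero>\<^sub>M}"
  "!!x. x:car M ==> EX n:N. EX w:W. x = n \<oplus>\<^sub>M w"
proof -
 note lm = fdmD(1)[OF assms(1)]
 interpret M: left_module \<Lambda> M by (rule lm)
 define P where "P N \<longleftrightarrow> subm N M & rad M <= N & N \<inter> W = {\<zero>\<^sub>M}" for N
 have "EX x. P x & (ALL y. P y --> kdim M y <= kdim M x)"
 proof (rule ex_has_greatest_nat[of P "rad M" "kdim M" "Suc (kdim M (car M))"])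
  show "P (rad M)" using rad_subm[OF lm] assms(4) by (auto simp: P_def)
  show "ALL y. P y --> kdim M y < Suc (kdim M (car M))"
   using kdim_mono[OF assms(1) subm_KV[OF lm] subm_KV[OF lm M.carrier_subm]]
    iffD1[OF M.subm_iff] by (auto simp: P_def less_Suc_eq_le)
 qed
 then obtain N where N: "P N" and max: "!!B. P B ==> kdim M B <= kdim M N" by blast
 have Ns: "subm N M" "rad M <= N" "N \<inter> W = {\<zero>\<^sub>M}" using N by (auto simp: P_def)
 note ND = iffD1[OF M.subm_iff Ns(1)] and WD = iffD1[OF M.subm_iff assms(2)]
 define T where "T = {n \<oplus>\<^sub>M w |n w. n:N & w:W}"
 note T = subm_sum[OF lm Ns(1) assms(2), folded T_def]
 note TD = iffD1[OF M.subm_iff T(1)]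
 have "x:T" if x: "x:car M" for x
 proof (rule ccontr)
  assume "x ~: T"
  then obtain i y where i: "i < r" "y:car \<Lambda>" "e i \<odot>\<^sub>M (y \<odot>\<^sub>M x) ~: T"
   using subm_detect[OF lm T(1) x] by blast
  define u where "u = e i \<odot>\<^sub>M (y \<odot>\<^sub>M x)"
  have u: "u:car M" "u ~: T" using i x by (auto simp: u_def)
  have eu: "e i \<odot>\<^sub>M u = u"
   using i x e_idem[OF i(1)] M.smult_assoc1[of "e i" "e i" "y \<odot>\<^sub>M x"] by (simp add: u_def)
  define B where "B = {n \<oplus>\<^sub>M w |n w. n:N & w:cyc M u}"
  note B = subm_sum[OF lm Ns(1) cyc_subm[OF lm u(1)], folded B_def]
  note BD = iffD1[OF M.subm_iff B(1)]
  have "b = \<zero>\<^sub>M" if b: "b:B" "b:W" for b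
  proof (rule ccontr)
   assume "b ~= \<zero>\<^sub>M"
   moreover have bc: "b:car M" using b WD by auto
   ultimately obtain l v where v: "l < r" "v:car \<Lambda>" "e l \<odot>\<^sub>M (v \<odot>\<^sub>M b) ~= \<zero>\<^sub>M"
    using detect[OF lm] by blast
   obtain n a where n: "n:N" "a:car \<Lambda>" "b = n \<oplus>\<^sub>M a \<odot>\<^sub>M u"
    using b(1) by (auto simp: B_def cyc_def)
   define n' where "n' = e l \<odot>\<^sub>M (v \<odot>\<^sub>M n)"
   define b' where "b' = e l \<odot>\<^sub>M (v \<odot>\<^sub>M b)"
   have n': "n':N" "n':car M" using ND n v by (auto simp: n'_def)
   have b': "b':W" "b':car M" "b' ~= \<zero>\<^sub>M" using WD b v by (auto simp: b'_def)
   obtain c j where cj: "c:car K" "j:J"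
    "e l \<odot>\<^sub>M ((v \<otimes> a) \<odot>\<^sub>M u) = emb c \<odot>\<^sub>M u \<oplus>\<^sub>M j \<odot>\<^sub>M u" "l ~= i ==> c = \<zero>\<^sub>K"
    using e_smult[OF lm i(1) v(1) _ u(1) eu, of "v \<otimes> a"] v n by auto
   have nc: "n:car M" using ND n by auto
   have ju: "j \<odot>\<^sub>M u:N" "j \<odot>\<^sub>M u:car M" using radI[OF lm cj(2) u(1)] Ns(2) ND by auto
   have cu: "emb c \<odot>\<^sub>M u:car M" using cj u by simp
   have "b' = n' \<oplus>\<^sub>M e l \<odot>\<^sub>M ((v \<otimes> a) \<odot>\<^sub>M u)"
    using n v nc u by (simp add: b'_def n'_def M.smult_r_distr M.smult_assoc1)
   then have b'e: "b' = (n' \<oplus>\<^sub>M j \<odot>\<^sub>M u) \<oplus>\<^sub>M emb c \<odot>\<^sub>M u"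
    using cj(3) n' ju cu by (simp add: M.M.a_ac)
   define n2 where "n2 = n' \<oplus>\<^sub>M j \<odot>\<^sub>M u"
   have n2: "n2:N" "n2:car M" using ND n' ju by (auto simp: n2_def)
   \<comment> \<open>\<open>b'\<close> is \<open>n2\<close> plus a scalar multiple of
     \<open>u\<close>. With scalar zero it lies in \<open>N\<close> and in \<open>W\<close>;
     otherwise the scalar can be inverted and \<open>u\<close> lies in \<open>N + W\<close>.\<close>
   show False
   proof (cases "c = \<zero>\<^sub>K")
    case True
    then have "b' = n2" using b'e u n2 by (simp add: n2_def emb_zero)
    then show False using n2 b' Ns(3) by blast
   next
    case False
    note ci = emb_inv[OF cj(1) False]
    have "emb c \<odot>\<^sub>M u = \<ominus>\<^sub>M n2 \<oplus>\<^sub>M b'"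
     using b'e n2 cu unfolding n2_def[symmetric] by (simp add: M.M.r_neg1)
    moreover have "\<ominus>\<^sub>M n2:N" by (rule M.subm_neg[OF Ns(1) n2(1)])
    ultimately have "emb c \<odot>\<^sub>M u:T" using b' unfolding T_def by blast
    then have "emb (inv\<^bsub>K\<^esub> c) \<odot>\<^sub>M (emb c \<odot>\<^sub>M u):T" using TD ci by blast
    moreover have "emb (inv\<^bsub>K\<^esub> c) \<odot>\<^sub>M (emb c \<odot>\<^sub>M u) = u"
     using ci cj u M.smult_assoc1[of "emb (inv\<^bsub>K\<^esub> c)" "emb c" u] by simp
    ultimately show False using u by simp
   qed
  qed
  then have PB: "P B" using B Ns BD WD by (auto simp: P_def)
  have "N = B"
   using kdim_eq[OF assms(1) subm_KV[OF lm Ns(1)] subm_KV[OF lm B(1)] B(2)]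
    kdim_mono[OF assms(1) subm_KV[OF lm Ns(1)] subm_KV[OF lm B(1)] B(2)] max[OF PB] by simp
  then have "u:N" using B(3) cyc_self[OF lm u(1)] by auto
  then show False using T(2) u by auto
 qed
 then show thesis
  using that[OF Ns] unfolding T_def by blast
qed

end

section \<open>Projective and injective modules\<close>

text \<open>Modulo a complement of the line through \<open>v\<close>, the space is that line and so
  a copy of the field; the functional is the quotient map read through this identification.\<close>

lemma (in vspace) functional_exists:
 assumes "vectorspace.fin_dim K V" "v:car V" "v ~= \<zero>\<^sub>V"
 obtains \<theta> where "\<theta>:module_hom K V (regular_module K)" "\<theta> v ~= \<zero>"
proof -
 let ?R = "regular_module K"
 have lR: "left_module K ?R" by (rule lmod_regular[OF lmod_ring[OF left_module_axioms]])
 let ?U = "(%c. c \<odot>\<^sub>V v) ` car ?R"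
 have U: "Module.submodule ?U K V"
  by (rule subm_image[OF lR left_module_axioms hom_smult[OF assms(2)] left_module.carrier_subm[OF lR]])
 show thesis
 proof (rule complement[OF assms(1) U])
 fix A assume A: "Module.submodule A K V" "A \<inter> ?U = {\<zero>\<^sub>V}"
  "!!x. x:car V ==> EX a:A. EX u:?U. x = a \<oplus>\<^sub>V u"
 note q = quot_module[OF left_module_axioms A(1)]
 note p = homD[OF q(2)]
 let ?p = "cmap V A"
 interpret Q: left_module K "quot_module V A" by (rule q(1))
 define f where "f c = c \<odot>\<^sub>(quot_module V A) ?p v" for c
 have pv: "?p v:car (quot_module V A)" using p(1) assms(2) .
 have f: "f:module_hom K ?R (quot_module V A)" unfolding f_def by (rule Q.hom_smult[OF pv])
 have fker: "c = \<zero>" if c: "c:car K" "f c = \<zero>\<^sub>(quot_module V A)" for c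
 proof (rule ccontr)
  assume "c ~= \<zero>"
  have "c \<odot>\<^sub>V v:A" using q(4)[of "c \<odot>\<^sub>V v"] p(3) c assms(2) by (simp add: f_def)
  then have "c \<odot>\<^sub>V v = \<zero>\<^sub>V" using A(2) c by auto
  then have "(inv c \<otimes> c) \<odot>\<^sub>V v = \<zero>\<^sub>V"
   using c(1) \<open>c ~= \<zero>\<close> field_Units assms(2) smult_assoc1[of "inv c" c v] by simp
  then show False using c \<open>c ~= \<zero>\<close> field_Units assms(2,3) by simp
 qed
 have fs: "f ` car ?R = car (quot_module V A)"
 proof -
  have "?p x:f ` car ?R" if x: "x:car V" for x
  proof -
   obtain a c where ac: "a:A" "c:car K" "x = a \<oplus>\<^sub>V c \<odot>\<^sub>V v" using A(3)[OF x] by auto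
   have "a:car V" using ac iffD1[OF subm_iff A(1)] by auto
   then have "?p x = f c" using ac p assms(2) q(4)[of a] pv by (simp add: f_def)
   then show ?thesis using ac by simp
  qed
  then have "?p ` car V <= f ` car ?R" by auto
  then show ?thesis using q(3) homD(1)[OF f] by auto
 qed
 have fb: "bij_betw f (car ?R) (car (quot_module V A))"
  using hom_inj_iff[OF lR q(1) f] fker fs by (simp add: bij_betw_def)
 define \<theta> where "\<theta> x = inv_into (car ?R) f (?p x)" for x
 have "\<theta>:module_hom K V ?R"
  unfolding \<theta>_def by (rule hom_comp[OF q(2) inv_hom[OF lR f fb]])
 moreover have "\<theta> v = \<one>"
 proof -
  have "f \<one> = ?p v" using pv by (simp add: f_def)
  then show ?thesis using bij_betw_inv_into_left[OF fb, of \<one>] by (simp add: \<theta>_def)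
 qed
 ultimately show thesis using that by simp
 qed
qed

lemma in_listset: "xs:listset As \<longleftrightarrow> list_all2 (:) xs As"
 by (induction As arbitrary: xs) (auto simp: set_Cons_def list_all2_Cons2)

lemma listset_subm:
 assumes "left_module R M" "!!i. i:set is ==> Module.submodule (X i) R M"
 shows "Module.submodule (listset (map X is)) R (list_module M (length is))"
proof -
 interpret M: left_module R M by fact
 interpret P: left_module R "list_module M (length is)" by (rule lmod_list[OF assms(1)])
 have X: "X (is ! l) <= car M & \<zero>\<^sub>M:X (is ! l) &
   (ALL x:X (is ! l). ALL y:X (is ! l). x \<oplus>\<^sub>M y:X (is ! l)) &
   (ALL a:car R. ALL x:X (is ! l). a \<odot>\<^sub>M x:X (is ! l))" if "l < length is" for l
  using iffD1[OF M.subm_iff assms(2)[OF nth_mem[OF that]]] .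
 show ?thesis
  unfolding P.subm_iff in_listset Ball_def subset_iff
  using X by (auto simp: list_all2_conv_all_nth in_set_conv_nth subset_iff)
qed

context fd_algebra
begin

lemma KV_list: "KV (list_module M n) = list_module (KV M) n"
 by (simp add: KV_def list_module_def)

lemma kdim_listset:
 assumes "fdm M" "!!i. i:set is ==> ksub M (X i)"
 shows "kdim (list_module M (length is)) (listset (map X is)) = (\<Sum>i\<leftarrow>is. kdim M (X i))"
 using assms(2)
proof (induction "is")
 case Nil
 have "kdim (list_module M 0) {\<zero>\<^sub>(list_module M 0)} = 0"
  by (rule kdim_zero[OF lmod_list[OF fdmD(1)[OF assms(1)]]])
 then show ?case by simp
next
 case (Cons i "is")
 note lm = fdmD(1)[OF assms(1)]
 let ?n = "length is"
 let ?U = "listset (map X (i # is))"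
 have X: "ksub M (X i)" using Cons by simp
 interpret V: left_module K "KV M" by (rule lmod_KV[OF lm])
 note Xi = iffD1[OF V.subm_iff X]
 have U: "ksub (list_module M (Suc ?n)) ?U"
  using listset_subm[OF V.left_module_axioms, of "i # is" X] Cons.prems by (simp add: KV_list del: listset.simps list.map)
 have U': "ksub (list_module M ?n) (listset (map X is))"
  using listset_subm[OF V.left_module_axioms, of "is" X] Cons.prems by (simp add: KV_list)
 have 1: "kdim (list_module M (Suc ?n)) ?U = kdim (list_module M ?n) (tl ` ?U) +
   kdim (list_module M (Suc ?n)) {u:?U. tl u = \<zero>\<^sub>(list_module M ?n)}"
  by (rule kdim_hom[OF fdm_list[OF assms(1)] lmod_list[OF lm] hom_KV[OF hom_tl] U])
 have z: "\<zero>\<^sub>(list_module M ?n):listset (map X is)"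
  using iffD1[OF left_module.subm_iff[OF lmod_KV[OF lmod_list[OF lm]]] U'] by simp
 have 2: "tl ` ?U = listset (map X is)"
 proof
  show "listset (map X is) <= tl ` ?U"
  proof
   fix xs assume "xs:listset (map X is)"
   then have "\<zero>\<^sub>M # xs:?U" using Xi by (auto simp: set_Cons_def)
   then show "xs:tl ` ?U" by (metis imageI list.sel(3))
  qed
 qed (auto simp: set_Cons_def)
 have 3: "{u:?U. tl u = \<zero>\<^sub>(list_module M ?n)} = (%x. x # replicate ?n \<zero>\<^sub>M) ` X i"
  using z by (auto simp: set_Cons_def)
 have "kdim (list_module M (Suc ?n)) ((%x. x # replicate ?n \<zero>\<^sub>M) ` X i) = kdim M (X i)"
  by (rule kdim_inj[OF assms(1) lmod_list[OF lm] hom_KV[OF hom_Cons_zero[OF lm]] X]) simp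
 then show ?case using 1 2 3 Cons.IH Cons.prems by simp
qed

lemma edim_listset:
 assumes "fdm M" "!!i. i:set is ==> subm (X i) M" "u:car \<Lambda>"
 shows "edim (list_module M (length is)) u (listset (map X is)) = (\<Sum>i\<leftarrow>is. edim M u (X i))"
proof -
 have "{xs:listset (map X is). map (smult M u) xs = xs} = listset (map (%i. {x:X i. u \<odot>\<^sub>M x = x}) is)"
  by (auto simp: in_listset list_all2_conv_all_nth list_eq_iff_nth_eq)
 then show ?thesis
  unfolding edim_def using kdim_listset[OF assms(1), of "is" "%i. {x:X i. u \<odot>\<^sub>M x = x}"]
   ksub_idem[OF fdmD(1)[OF assms(1)] assms(2,3)] by simp
qed

lemma kdim_le_functionals:
 assumes "fdm M" "ksub M U" "!!\<theta>. \<theta>:set ts ==> \<theta>:module_hom K ((KV M)(|carrier := U|)) (regular_module K)"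
  "!!x. x:U ==> (!!\<theta>. \<theta>:set ts ==> \<theta> x = \<zero>\<^sub>K) ==> x = \<zero>\<^sub>M"
 shows "kdim M U <= length ts"
proof -
 interpret V: vspace K "KV M" by (rule vspace_KV[OF fdmD(1)[OF assms(1)]])
 interpret U: vspace K "(KV M)(|carrier := U|)" by (rule V.vspace_sub[OF assms(2)])
 have "EX A. finite A & card A <= length ts & A <= car ((KV M)(|carrier := U|)) &
  (ALL T. Module.submodule T K ((KV M)(|carrier := U|)) & {\<zero>\<^sub>M} <= T & A <= T --> T = car ((KV M)(|carrier := U|)))"
  by (rule generators_of_functionals[OF field_K U.left_module_axioms])
   (use U.zero_subm assms(3,4) in auto)
 then obtain A where A: "finite A" "card A <= length ts" "A <= car ((KV M)(|carrier := U|))"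
  "ALL T. Module.submodule T K ((KV M)(|carrier := U|)) & {\<zero>\<^sub>M} <= T & A <= T --> T = car ((KV M)(|carrier := U|))"
  by (elim exE conjE)
 have "kdim M U <= card A"
  unfolding kdim_def
 proof (rule U.dim_le(1)[OF A(1,3)])
  fix T assume T: "Module.submodule T K ((KV M)(|carrier := U|))" "A <= T"
  have "\<zero>\<^sub>M:T" using iffD1[OF U.subm_iff T(1)] by simp
  then show "T = car ((KV M)(|carrier := U|))" using A(4) T by simp
 qed
 then show ?thesis using A(2) by simp
qed

text \<open>Injectivity tested on finite-dimensional modules of the universe suffices for all
 finite-dimensional test modules, whatever their type.\<close>

definition inj_mod :: "('a, 'm) module => bool" where
 "inj_mod I \<longleftrightarrow> lmod I & (\<forall>(A :: ('a, 'a list) module) (B :: ('a, 'a list) module) i f.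
   fdm A & fdm B & i:mhom A B & inj_on i (car A) & f:mhom A I -->
   (EX g:mhom B I. ALL x:car A. g (i x) = f x))"

lemma inj_mod_test:
 fixes A :: "('a, 'a list) module" and B :: "('a, 'a list) module"
 assumes "inj_mod I" "fdm A" "fdm B" "i:mhom A B" "inj_on i (car A)" "f:mhom A I"
 shows "EX g:mhom B I. ALL x:car A. g (i x) = f x"
 using assms(1)[unfolded inj_mod_def, THEN conjunct2, rule_format, of A B i f] assms(2-) by simp

lemma inj_modD:
 fixes A :: "('a, 'm) module" and B :: "('a, 'n) module"
 assumes "inj_mod I" "fdm A" "fdm B" "i:mhom A B"
  "!!x. x:car A ==> i x = \<zero>\<^sub>B ==> x = \<zero>\<^sub>A" "f:mhom A I"
 obtains g where "g:mhom B I" "!!x. x:car A ==> g (i x) = f x"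
proof -
 obtain A' :: "('a, 'a list) module" where A': "A':fg_modules \<Lambda>" "module_iso \<Lambda> A A'"
  using fdm_representable[OF assms(2)] .
 obtain B' :: "('a, 'a list) module" where B': "B':fg_modules \<Lambda>" "module_iso \<Lambda> B B'"
  using fdm_representable[OF assms(3)] .
 obtain a a' where a: "a:mhom A A'" "a':mhom A' A"
  "!!x. x:car A ==> a' (a x) = x" "!!y. y:car A' ==> a (a' y) = y"
  using module_isoE[OF A'(2) fdmD(1)[OF assms(2)]] by metis
 obtain b b' where b: "b:mhom B B'" "b':mhom B' B"
  "!!x. x:car B ==> b' (b x) = x"
  using module_isoE[OF B'(2) fdmD(1)[OF assms(3)]] by metis
 have fd: "fdm A'" "fdm B'" using A' B' fg_modules_iff by auto
 define i' where "i' y = b (i (a' y))" for y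
 have i': "i':mhom A' B'" unfolding i'_def by (intro hom_comp[OF hom_comp[OF a(2) assms(4)] b(1)])
 have "inj_on i (car A)"
  using hom_inj_iff[OF fdmD(1)[OF assms(2)] fdmD(1)[OF assms(3)] assms(4)] assms(5) by simp
 then have inj: "x = y" if "x:car A" "y:car A" "i x = i y" for x y
  using that by (auto dest: inj_onD)
 have inj': "inj_on i' (car A')"
 proof (rule inj_onI)
  fix x y assume xy: "x:car A'" "y:car A'" "i' x = i' y"
  have c: "a' x:car A" "a' y:car A" using homD(1)[OF a(2)] xy by auto
  then have "i (a' x) = i (a' y)"
   using xy(3) b(3)[OF homD(1)[OF assms(4)]] unfolding i'_def by metis
  then have "a' x = a' y" by (rule inj[OF c])
  then have "a (a' x) = a (a' y)" by (rule arg_cong)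
  then show "x = y" using a(4)[OF xy(1)] a(4)[OF xy(2)] by (metis)
 qed
 obtain g where g: "g:mhom B' I" "!!x. x:car A' ==> g (i' x) = f (a' x)"
  using inj_mod_test[OF assms(1) fd i' inj' hom_comp[OF a(2) assms(6)]] by auto
 have "g (b (i x)) = f x" if "x:car A" for x
  using g(2)[OF homD(1)[OF a(1) that]] a(3)[OF that] by (simp add: i'_def)
 then show thesis using that[OF hom_comp[OF b(1) g(1)]] by blast
qed

lemma inj_mod_retract:
 assumes "inj_mod I" "lmod P" "\<sigma>:mhom P I" "\<rho>:mhom I P"
  "!!x. x:car P ==> \<rho> (\<sigma> x) = x"
 shows "inj_mod P"
 unfolding inj_mod_def
proof (intro conjI allI impI assms(2))
 fix A B :: "('a, 'a list) module" and i f
 assume h: "fdm A & fdm B & i:mhom A B & inj_on i (car A) & f:mhom A P"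
 then have "(%x. \<sigma> (f x)):mhom A I" using hom_comp assms(3) by blast
 then obtain g where g: "g:mhom B I" "!!x. x:car A ==> g (i x) = \<sigma> (f x)"
  using inj_mod_test[OF assms(1), of A B i "%x. \<sigma> (f x)"] h by auto
 have "\<rho> (g (i x)) = f x" if "x:car A" for x
 proof -
  have "f:mhom A P" using h by simp
  then show ?thesis using g(2)[OF that] assms(5) homD(1) that by metis
 qed
 then show "EX g:mhom B P. ALL x:car A. g (i x) = f x"
  by (intro bexI[OF _ hom_comp[OF g(1) assms(4)]]) simp
qed

lemma hom_Cons:
 assumes "f:module_hom R A M" "g:module_hom R A (list_module M n)"
 shows "(%x. f x # g x):module_hom R A (list_module M (Suc n))"
 using assms by (auto simp: module_hom_def Pi_iff)

lemma hom_hd: "hd:module_hom R (list_module M (Suc n)) M"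
proof (rule module_homI)
 fix x y assume "x:car (list_module M (Suc n))" "y:car (list_module M (Suc n))"
 then show "hd (x \<oplus>\<^sub>(list_module M (Suc n)) y) = hd x \<oplus>\<^sub>M hd y" by (cases x; cases y) auto
next
 fix x assume "x:car (list_module M (Suc n))"
 then show "hd x:car M" by (cases x) auto
next
 fix a x assume "x:car (list_module M (Suc n))"
 then show "hd (a \<odot>\<^sub>(list_module M (Suc n)) x) = a \<odot>\<^sub>M hd x" by (cases x) auto
qed

lemma inj_mod_list:
 assumes "inj_mod I"
 shows "inj_mod (list_module I n)"
proof (induction n)
 have lm: "lmod I" using assms by (simp add: inj_mod_def)
 case 0
 have h: "(%x. []):mhom B (list_module I 0)" for B :: "('a, 'a list) module"
  by (auto intro!: module_homI)
 show ?case
  unfolding inj_mod_def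
 proof (intro conjI allI impI lmod_list[OF lm])
  fix A B :: "('a, 'a list) module" and i f
  assume "fdm A & fdm B & i:mhom A B & inj_on i (car A) & f:mhom A (list_module I 0)"
  then have f: "f:mhom A (list_module I 0)" by simp
  show "EX g:mhom B (list_module I 0). ALL x:car A. g (i x) = f x"
   using homD(1)[OF f] by (intro bexI[OF _ h]) auto
 qed
next
 have lm: "lmod I" using assms by (simp add: inj_mod_def)
 case (Suc n)
 show ?case
  unfolding inj_mod_def
 proof (intro conjI allI impI lmod_list[OF lm])
  fix A B :: "('a, 'a list) module" and i f
  assume h: "fdm A & fdm B & i:mhom A B & inj_on i (car A) & f:mhom A (list_module I (Suc n))"
  then have f: "f:mhom A (list_module I (Suc n))" by simp
  obtain g where g: "g:mhom B I" "!!x. x:car A ==> g (i x) = hd (f x)"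
   using inj_mod_test[OF assms _ _ _ _ hom_comp[OF f hom_hd], of B i] h by auto
  obtain k where k: "k:mhom B (list_module I n)" "!!x. x:car A ==> k (i x) = tl (f x)"
   using inj_mod_test[OF Suc _ _ _ _ hom_comp[OF f hom_tl], of B i] h by auto
  have "g (i x) # k (i x) = f x" if "x:car A" for x
   using g(2)[OF that] k(2)[OF that] homD(1)[OF f that] by (cases "f x") auto
  then show "EX g:mhom B (list_module I (Suc n)). ALL x:car A. g (i x) = f x"
   by (intro bexI[OF _ hom_Cons[OF g(1) k(1)]]) simp
 qed
qed

lemma inj_mod_regular:
 assumes "weakly_symmetric \<Lambda>"
 shows "inj_mod reg"
 unfolding inj_mod_def
proof (intro conjI allI impI lmod_reg)
 fix A B :: "('a, 'a list) module" and i f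
 assume "fdm A & fdm B & i:mhom A B & inj_on i (car A) & f:mhom A reg"
 then show "EX g:mhom B reg. ALL x:car A. g (i x) = f x"
  using assms[unfolded weakly_symmetric_def injective_module_def, THEN conjunct1, THEN conjunct2, rule_format, of A B i f]
   fdmD(1) by auto
qed

end

section \<open>Indecomposable projectives over a weakly symmetric algebra\<close>

locale ws_algebra = split_rad3_algebra + assumes ws: "weakly_symmetric \<Lambda>"
begin

definition Pc :: "nat => 'b set" where
 "Pc i = {x:car \<Lambda>. x \<otimes> e i = x}"

text \<open>The indecomposable projective with top \<open>S i\<close>. It stays a left ideal, so its
  elements can be multiplied in the algebra.\<close>

definition Pm :: "nat => ('b, 'b) module" where
 "Pm i = reg(|carrier := Pc i|)"

lemma Pm_simps [simp]:
 "car (Pm i) = Pc i" "\<zero>\<^sub>(Pm i) = \<zero>" "add (Pm i) = add \<Lambda>" "smult (Pm i) = monoid.mult \<Lambda>"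
 by (simp_all add: Pm_def)

lemma Pc_lideal: "i < r ==> lideal (Pc i)"
 unfolding lideal_iff Pc_def by (auto simp: Alg.l_distr Alg.m_assoc)

lemma e_Pc: "i < r ==> e i:Pc i"
 by (simp add: Pc_def e_idem)

lemma Pc_closed: "x:Pc i ==> x:car \<Lambda>"
 by (simp add: Pc_def)

lemma Pc_e: "x:Pc i ==> x \<otimes> e i = x"
 by (simp add: Pc_def)

lemma fdm_Pm: "i < r ==> fdm (Pm i)"
 unfolding Pm_def by (rule fdm_sub[OF fdm_regular Pc_lideal])

lemma lmod_Pm: "i < r ==> lmod (Pm i)"
 using fdm_Pm fdmD by blast

lemma Pm_subm: "i < r ==> subm N (Pm i) \<longleftrightarrow> lideal N & N <= Pc i"
 unfolding Pm_def by (rule subm_sub_iff[OF lmod_reg Pc_lideal])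

lemma Pm_hom:
 assumes "lmod M" "u:car M" "i < r"
 shows "(%x. x \<odot>\<^sub>M u):mhom (Pm i) M"
 unfolding Pm_def using cyc_hom[OF assms(1,2)] by (rule hom_sub_domain) (auto simp: Pc_def)

lemma Pm_hom_image:
 assumes "lmod M" "u:car M" "i < r" "e i \<odot>\<^sub>M u = u"
 shows "(%x. x \<odot>\<^sub>M u) ` Pc i = cyc M u"
proof -
 interpret M: left_module \<Lambda> M by fact
 have "x \<odot>\<^sub>M u:(%x. x \<odot>\<^sub>M u) ` Pc i" if x: "x:car \<Lambda>" for x
 proof (rule image_eqI)
  show "x \<odot>\<^sub>M u = (x \<otimes> e i) \<odot>\<^sub>M u" using x assms by (simp add: M.smult_assoc1)
  show "x \<otimes> e i:Pc i" using x assms e_idem by (simp add: Pc_def Alg.m_assoc)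
 qed
 then show ?thesis using Pc_closed by (auto simp: cyc_def)
qed

definition Je :: "nat => 'b set" where "Je i = Pc i \<inter> J"

lemma Je_lideal: "i < r ==> lideal (Je i)"
 unfolding Je_def by (rule left_module.subm_Int[OF lmod_reg Pc_lideal J_lideal])

lemma Je_subm: "i < r ==> subm (Je i) (Pm i)"
 using Pm_subm Je_lideal by (auto simp: Je_def)

lemma e_notin_J: "i < r ==> e i ~: J"
 using e_nonzero simple_kill[OF S_simple] by blast

text \<open>An element of \<open>N\<close> outside \<open>J\<close> can be multiplied into
  \<open>c e i + j\<close> with \<open>c\<close> a nonzero scalar and \<open>j\<close> in
  \<open>J\<close>. Then \<open>N\<close> and the radical together are everything, and Nakayama
  applies.\<close>

lemma proper_subm_Pm:
 assumes "i < r" "subm N (Pm i)" "N ~= Pc i"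
 shows "N <= Je i"
proof (rule ccontr)
 assume "~ N <= Je i"
 have N: "lideal N" "N <= Pc i" using assms Pm_subm by auto
 then obtain x where x: "x:N" "x ~: J" using \<open>~ N <= Je i\<close> by (auto simp: Je_def)
 note ND = iffD1[OF lideal_iff N(1)]
 have xc: "x:car \<Lambda>" "x:Pc i" using x ND N by auto
 obtain l y where l: "l < r" "y:car \<Lambda>" "e l \<otimes> (y \<otimes> x) ~: J"
  using subm_detect[OF lmod_reg J_lideal _ x(2)] xc by auto
 have eq: "e l \<otimes> (y \<otimes> x) = e l \<otimes> (y \<otimes> x) \<otimes> e i"
  using l xc Pc_e[OF xc(2)] assms(1) by (simp add: Alg.m_assoc)
 \<comment> \<open>The detected element is also fixed by right multiplication with
   \<open>e i\<close>; for \<open>l\<close> different from \<open>i\<close> it would lie in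
   \<open>J\<close>.\<close>
 have "l = i" using l e_orth[OF l(1) assms(1), of "y \<otimes> x"] eq xc by auto
 define c where "c = \<kappa> i (y \<otimes> x)"
 define j where "j = e i \<otimes> (y \<otimes> x) \<ominus> emb c \<otimes> e i"
 have cj: "c:car K" "j:J" "j:car \<Lambda>"
  using \<kappa>[OF assms(1), of "y \<otimes> x"] l xc eq \<open>l = i\<close> J_sub by (auto simp: c_def j_def)
 have dec: "e i \<otimes> (y \<otimes> x) = j \<oplus> emb c \<otimes> e i"
  using cj l xc assms(1) by (simp add: j_def add_minus_cancel_\<Lambda>)
 have c0: "c ~= \<zero>\<^sub>K"
  using dec l(3) \<open>l = i\<close> cj assms(1) by (auto simp: emb_zero)
 note ci = emb_inv[OF cj(1) c0]
 have "N = car (Pm i)"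
 proof (rule nakayama[OF lmod_Pm[OF assms(1)] assms(2)])
  fix p assume p: "p:car (Pm i)"
  then have pc: "p:car \<Lambda>" "p \<otimes> e i = p" by (auto simp: Pc_def)
  define a where "a = p \<otimes> emb (inv\<^bsub>K\<^esub> c)"
  have a: "a:car \<Lambda>" using pc ci by (simp add: a_def)
  have ap: "a \<otimes> (emb c \<otimes> e i) = p"
   using pc ci cj assms(1) Alg.m_assoc[of "emb (inv\<^bsub>K\<^esub> c)" "emb c" "e i"] by (simp add: a_def Alg.m_assoc)
  have jP: "j = j \<otimes> e i"
  proof -
   have "(e i \<otimes> (y \<otimes> x)) \<otimes> e i = e i \<otimes> (y \<otimes> x)" using eq \<open>l = i\<close> by simp
   moreover have "(emb c \<otimes> e i) \<otimes> e i = emb c \<otimes> e i" using cj assms(1) e_idem by (simp add: Alg.m_assoc)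
   ultimately show ?thesis
    using l xc cj assms(1) by (simp add: j_def a_minus_def Alg.l_distr Alg.l_minus)
  qed
  have "a \<otimes> (e i \<otimes> (y \<otimes> x)) = p \<oplus> a \<otimes> j"
   unfolding dec using a cj assms(1) ap pc by (simp add: Alg.r_distr a_ac_\<Lambda>)
  then have "p = a \<otimes> (e i \<otimes> (y \<otimes> x)) \<oplus> \<ominus> (a \<otimes> j)"
   using minus_add_cancel_\<Lambda>[of p "a \<otimes> j"] a cj pc by (simp add: a_minus_def)
  moreover have "a \<otimes> (e i \<otimes> (y \<otimes> x)):N" using ND x a l xc assms(1) by auto
  moreover have "\<ominus> (a \<otimes> j):rad (Pm i)"
  proof -
   have "j:Pc i" using jP cj by (simp add: Pc_def)
   have "(\<ominus> a \<otimes> j) \<odot>\<^sub>(Pm i) e i:rad (Pm i)"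
    using radI[OF lmod_Pm[OF assms(1)], of "\<ominus> a \<otimes> j" "e i"] J_left[OF _ cj(2), of "\<ominus> a"] a e_Pc[OF assms(1)] by simp
   then show ?thesis using a cj jP assms(1) by (simp add: Alg.m_assoc Alg.l_minus)
  qed
  ultimately show "EX n:N. EX k:rad (Pm i). p = n \<oplus>\<^sub>(Pm i) k" by auto
 qed
 then show False using assms(3) by simp
qed

text \<open>The kernel of the map to the atom misses \<open>e i\<close> and is therefore proper. In
  this way the top of \<open>Pm i\<close> is seen to be \<open>S i\<close>.\<close>

lemma Pm_annihilator:
 assumes "i < r" "lmod M" "atom M i s" "x:Pc i"
 shows "x \<odot>\<^sub>M s = \<zero>\<^sub>M \<longleftrightarrow> x:Je i"
proof
 interpret M: left_module \<Lambda> M by fact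
 note s = atomD[OF assms(3)]
 { assume "x:Je i" then show "x \<odot>\<^sub>M s = \<zero>\<^sub>M" using s(1) by (auto simp: Je_def L_def) }
 have "subm {x:car (Pm i). x \<odot>\<^sub>M s = \<zero>\<^sub>M} (Pm i)"
  by (rule subm_kernel[OF lmod_Pm[OF assms(1)] assms(2) Pm_hom[OF assms(2) s(2) assms(1)]])
 moreover have "e i ~: {x:car (Pm i). x \<odot>\<^sub>M s = \<zero>\<^sub>M}" using s by simp
 ultimately have "{x:car (Pm i). x \<odot>\<^sub>M s = \<zero>\<^sub>M} <= Je i"
  using proper_subm_Pm[OF assms(1)] e_Pc[OF assms(1)] by blast
 then show "x \<odot>\<^sub>M s = \<zero>\<^sub>M ==> x:Je i" using assms(4) by auto
qed

lemma S_cyc: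
 assumes "i < r" "atom (S i) i s"
 shows "cyc (S i) s = car (S i)"
 using simple_cyc[OF S_simple[OF assms(1)]] atomD[OF assms(2)] by simp

lemma dv_Pc:
 assumes "i < r" "j < r"
 shows "dv reg j (Pc i) = (if i = j then 1 else 0) + dv reg j (Je i)"
proof -
 obtain s where s: "atom (S i) i s" using S_atom[OF assms(1)] by blast
 note lS = simpleD(1)[OF S_simple[OF assms(1)]]
 have "dv (Pm i) j (Pc i) = dv (S i) j ((%x. x \<odot>\<^sub>(S i) s) ` Pc i) +
   dv (Pm i) j {x:Pc i. x \<odot>\<^sub>(S i) s = \<zero>\<^sub>(S i)}"
  using left_module.carrier_subm[OF lmod_Pm[OF assms(1)]]
  by (intro dv_hom[OF fdm_Pm[OF assms(1)] lS Pm_hom[OF lS atomD(2)[OF s] assms(1)] _ assms(2)]) simp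
 moreover have "{x:Pc i. x \<odot>\<^sub>(S i) s = \<zero>\<^sub>(S i)} = Je i"
  using Pm_annihilator[OF assms(1) lS s] by (auto simp: Je_def)
 moreover have "(%x. x \<odot>\<^sub>(S i) s) ` Pc i = cyc (S i) s"
  by (rule Pm_hom_image[OF lS atomD(2)[OF s] assms(1) atomD(3)[OF s]])
 ultimately show ?thesis
  using dv_cyc_atom[OF lS s assms] by (auto simp: Pm_def)
qed

lemma Pm_lift:
 assumes "i < r" "lmod A" "lmod B" "p:mhom A B" "p ` car A = car B"
  "f:mhom (Pm i) B"
 shows "EX g:mhom (Pm i) A. ALL x:car (Pm i). p (g x) = f x"
proof -
 interpret A: left_module \<Lambda> A by fact
 have "f (e i):car B" using homD(1)[OF assms(6)] e_Pc[OF assms(1)] by simp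
 then obtain a where a: "a:car A" "p a = f (e i)" using assms(5) by (metis imageE)
 have "p (x \<odot>\<^sub>A a) = f x" if "x:Pc i" for x
  using homD(3)[OF assms(4), of x a] homD(3)[OF assms(6), of x "e i"] a that e_Pc[OF assms(1)]
   Pc_e[OF that] Pc_closed[OF that] by simp
 then show ?thesis using Pm_hom[OF assms(2) a(1) assms(1)] by (intro bexI) auto
qed

lemma socle_eq_L:
 assumes "lmod M"
 shows "socle \<Lambda> M = L M"
proof
 interpret M: left_module \<Lambda> M by fact
 let ?A = "\<Union> {N. subm N M & simple_module \<Lambda> (M(|carrier := N|))}"
 have Ac: "?A <= car M" using M.subm_iff by auto
 show "socle \<Lambda> M <= L M"
  unfolding socle_def
 proof (rule submodule_generated_least[OF L_subm[OF assms]])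
  show "?A <= L M"
  proof
   fix x assume "x:?A"
   then obtain N where N: "subm N M" "simple_module \<Lambda> (M(|carrier := N|))" "x:N" by auto
   then show "x:L M"
    using simple_kill[OF N(2)] Ac by (auto simp: L_def)
  qed
 qed
 show "L M <= socle \<Lambda> M"
 proof (rule subsetI, rule ccontr)
  fix x assume x: "x:L M" "x ~: socle \<Lambda> M"
  note soc = M.submodule_generated[OF Ac, folded socle_def]
  obtain l y where l: "l < r" "y:car \<Lambda>" "e l \<odot>\<^sub>M (y \<odot>\<^sub>M x) ~: socle \<Lambda> M"
   using subm_detect[OF assms soc(1) L_closed[OF x(1)] x(2)] .
  note Ls = iffD1[OF M.subm_iff L_subm[OF assms]]
  let ?z = "e l \<odot>\<^sub>M (y \<odot>\<^sub>M x)"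
  have "?z ~= \<zero>\<^sub>M" using l(3) iffD1[OF M.subm_iff soc(1)] by auto
  then have z: "atom M l ?z"
   using l x(1) Ls L_closed[OF x(1)] e_idem[OF l(1)] M.smult_assoc1[of "e l" "e l" "y \<odot>\<^sub>M x"]
   by (simp add: atom_def)
  have "cyc M ?z <= ?A"
   using atom_iso(2)[OF assms z l(1)] cyc_subm[OF assms atomD(2)[OF z]] by auto
  then show False using l(3) soc(2) cyc_self[OF assms atomD(2)[OF z]] by blast
 qed
qed

text \<open>Weak symmetry speaks about indecomposable projectives of the universe, so
  \<open>Pm i\<close> is replaced by a copy \<open>P\<close>. Since \<open>Je i\<close> contains
  every proper submodule, \<open>P\<close> is indecomposable, its radical is the image of
  \<open>Je i\<close> and its top is \<open>S i\<close>; hence its socle is \<open>S i\<close> too,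
  and an atom is carried back to \<open>Pm i\<close>.\<close>

lemma L_Pm:
 assumes i: "i < r"
 obtains t where "atom (Pm i) i t" "L (Pm i) = cyc (Pm i) t"
proof -
 note lP = lmod_Pm[OF i]
 obtain P :: "('b, 'b list) module" where P: "P:fg_modules \<Lambda>" "module_iso \<Lambda> (Pm i) P"
  using fdm_representable[OF fdm_Pm[OF i]] .
 have fP: "fdm P" "lmod P" using P fg_modules_iff fdmD by auto
 interpret P: left_module \<Lambda> P by (rule fP)
 obtain f g where fg: "f:mhom (Pm i) P" "g:mhom P (Pm i)"
  "!!x. x:car (Pm i) ==> g (f x) = x" "!!y. y:car P ==> f (g y) = y"
  using module_isoE[OF P(2) lP] by metis
 have gc: "g y:Pc i" if "y:car P" for y using homD(1)[OF fg(2) that] by simp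
 have fc: "f x:car P" if "x:Pc i" for x using homD(1)[OF fg(1)] that by simp
 have fz: "f \<zero> = \<zero>\<^sub>P" using hom_zero[OF lP fP(2) fg(1)] by simp
 have gz: "g \<zero>\<^sub>P = \<zero>" using hom_zero[OF fP(2) lP fg(2)] by simp
 have proj: "projective_module \<Lambda> P"
  unfolding projective_module_def
 proof (intro conjI allI impI fP(2))
  fix A B :: "('b, 'b list) module" and p h
  assume a: "lmod A & lmod B & p:mhom A B & p ` car A = car B & h:mhom P B"
  then obtain k where k: "k:mhom (Pm i) A" "!!x. x:car (Pm i) ==> p (k x) = h (f x)"
   using Pm_lift[OF i, of A B p "%x. h (f x)"] hom_comp[OF fg(1), of h B] by auto
  have "p (k (g x)) = h x" if "x:car P" for x using k(2)[of "g x"] gc[OF that] fg(4)[OF that] by simp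
  then show "EX k:mhom P A. ALL x:car P. p (k x) = h x"
   by (intro bexI[OF _ hom_comp[OF fg(2) k(1)]]) auto
 qed
 have ind: "indecomposable_module \<Lambda> P"
  unfolding indecomposable_module_def
 proof (intro conjI allI impI fP(2))
  show "~ zero_module P"
  proof
   assume "zero_module P"
   then have "f (e i) = \<zero>\<^sub>P" using fc[OF e_Pc[OF i]] by (simp add: zero_module_def)
   then have "e i = \<zero>" using fg(3)[of "e i"] e_Pc[OF i] gz by simp
   then show False using e_notin_J[OF i] J_zero by simp
  qed
  fix A B :: "('b, 'b list) module"
  assume a: "lmod A & lmod B & module_iso \<Lambda> P (direct_prod A B)"
  interpret A: left_module \<Lambda> A using a by simp
  interpret B: left_module \<Lambda> B using a by simp
  have lAB: "lmod (direct_prod A B)"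
   by (rule lmod_prod[OF A.left_module_axioms B.left_module_axioms])
  have "module_iso \<Lambda> (Pm i) (direct_prod A B)" using a module_iso_trans[OF P(2)] by blast
  then obtain h k where hk: "h:mhom (Pm i) (direct_prod A B)" "k:mhom (direct_prod A B) (Pm i)"
   "!!x. x:car (Pm i) ==> k (h x) = x" "!!y. y:car (direct_prod A B) ==> h (k y) = y"
   using module_isoE[OF _ lP] by metis
  have hA: "(%x. fst (h x)):mhom (Pm i) A" by (rule hom_comp[OF hk(1) hom_fst])
  have hB: "(%x. snd (h x)):mhom (Pm i) B" by (rule hom_comp[OF hk(1) hom_snd])
  let ?NA = "{x:car (Pm i). fst (h x) = \<zero>\<^sub>A}" and ?NB = "{x:car (Pm i). snd (h x) = \<zero>\<^sub>B}"
  have NA: "subm ?NA (Pm i)" by (rule subm_kernel[OF lP A.left_module_axioms hA])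
  have NB: "subm ?NB (Pm i)" by (rule subm_kernel[OF lP B.left_module_axioms hB])
  have kc: "k y:Pc i" if "y:car (direct_prod A B)" for y using homD(1)[OF hk(2) that] by simp
  \<comment> \<open>If both kernels were proper they would lie in \<open>Je i\<close>, but
    \<open>e i\<close> is the sum of an element of each, coming from its two components.\<close>
  consider "?NA = Pc i" | "?NB = Pc i" | "?NA <= Je i" "?NB <= Je i"
   using proper_subm_Pm[OF i NA] proper_subm_Pm[OF i NB] by blast
  then show "zero_module A \<or> zero_module B"
  proof cases
   case 1
   have "y = \<zero>\<^sub>A" if y: "y:car A" for y
   proof -
    have yz: "(y, \<zero>\<^sub>B):car (direct_prod A B)" using y by simp
    then have "k (y, \<zero>\<^sub>B):?NA" using kc 1 by blast
    then show ?thesis using hk(4)[OF yz] by simp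
   qed
   then show ?thesis by (auto simp: zero_module_def)
  next
   case 2
   have "y = \<zero>\<^sub>B" if y: "y:car B" for y
   proof -
    have yz: "(\<zero>\<^sub>A, y):car (direct_prod A B)" using y by simp
    then have "k (\<zero>\<^sub>A, y):?NB" using kc 2 by blast
    then show ?thesis using hk(4)[OF yz] by simp
   qed
   then show ?thesis by (auto simp: zero_module_def)
  next
   case 3
   obtain y z where yz: "h (e i) = (y, z)" by (cases "h (e i)")
   then have c: "y:car A" "z:car B" using homD(1)[OF hk(1), of "e i"] e_Pc[OF i] by auto
   have "h (k (\<zero>\<^sub>A, z)) = (\<zero>\<^sub>A, z)" "h (k (y, \<zero>\<^sub>B)) = (y, \<zero>\<^sub>B)" using hk(4) c by simp_all
   then have "k (\<zero>\<^sub>A, z):?NA" "k (y, \<zero>\<^sub>B):?NB" using kc c by simp_all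
   then have "k (\<zero>\<^sub>A, z):J" "k (y, \<zero>\<^sub>B):J" using 3 by (auto simp: Je_def)
   then have "k (y, \<zero>\<^sub>B) \<oplus> k (\<zero>\<^sub>A, z):J" by (simp add: J_add)
   moreover have "k (y, \<zero>\<^sub>B) \<oplus> k (\<zero>\<^sub>A, z) = k (h (e i))"
    using homD(2)[OF hk(2), of "(y, \<zero>\<^sub>B)" "(\<zero>\<^sub>A, z)"] c yz by simp
   ultimately show ?thesis using hk(3)[of "e i"] e_Pc[OF i] e_notin_J[OF i] by simp
  qed
 qed
 have soc: "module_iso \<Lambda> (P(|carrier := L P|)) (quot_module P (radical \<Lambda> P))"
  using ws P(1) proj ind socle_eq_L[OF fP(2)]
  by (auto simp: weakly_symmetric_def fg_projectives_def)
 define R where "R = f ` Je i"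
 have R: "subm R P" unfolding R_def by (rule subm_image[OF lP fP(2) fg(1) Je_subm[OF i]])
 have Rn: "f (e i) ~: R"
 proof
  assume "f (e i):R"
  then obtain x where x: "x:Je i" "f (e i) = f x" by (auto simp: R_def)
  have "g (f (e i)) = e i" using fg(3)[of "e i"] e_Pc[OF i] by simp
  moreover have "g (f x) = x" using fg(3)[of x] x(1) by (simp add: Je_def)
  ultimately have "e i = x" unfolding x(2) by (rule trans[OF sym])
  then show False using \<open>x:Je i\<close> e_notin_J[OF i] by (simp add: Je_def)
 qed
 have proper: "N <= R" if N: "subm N P" "N ~= car P" for N
 proof -
  have Nc: "N <= car P" using iffD1[OF P.subm_iff N(1)] by simp
  have "g ` N ~= Pc i"
  proof
   assume "g ` N = Pc i"
   have "y:N" if y: "y:car P" for y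
   proof -
    have "g y:g ` N" using gc[OF y] \<open>g ` N = Pc i\<close> by simp
    then obtain n where "n:N" "g y = g n" by auto
    then show ?thesis using fg(4)[OF y] fg(4)[of n] Nc by auto
   qed
   then show False using N Nc by blast
  qed
  then have "g ` N <= Je i" using proper_subm_Pm[OF i subm_image[OF fP(2) lP fg(2) N(1)]] by simp
  have "x:f ` Je i" if "x:N" for x
  proof (rule image_eqI)
   show "x = f (g x)" using fg(4) Nc that by auto
   show "g x:Je i" using \<open>g ` N <= Je i\<close> that by auto
  qed
  then show ?thesis by (auto simp: R_def)
 qed
 \<comment> \<open>There is just one maximal submodule, so the intersection that defines the radical
   is that submodule.\<close>
 have "maximal_submodule \<Lambda> P N \<longleftrightarrow> N = R" for N
 proof
  assume "maximal_submodule \<Lambda> P N"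
  then show "N = R"
   using proper[of N] R Rn fc[OF e_Pc[OF i]] unfolding maximal_submodule_def by blast
 next
  assume "N = R"
  then show "maximal_submodule \<Lambda> P N"
   using R Rn fc[OF e_Pc[OF i]] proper unfolding maximal_submodule_def by blast
 qed
 then have rad: "radical \<Lambda> P = R"
  using iffD1[OF P.subm_iff R] by (auto simp: radical_def)
 obtain s where s: "atom (S i) i s" using S_atom[OF i] by blast
 note lS = simpleD(1)[OF S_simple[OF i]] and sD = atomD[OF s]
 note q = quot_module[OF fP(2) R]
 define h where "h y = g y \<odot>\<^sub>(S i) s" for y
 have h: "h:mhom P (S i)"
  unfolding h_def by (rule hom_comp[OF fg(2) Pm_hom[OF lS sD(2) i]])
 have hR: "h y = \<zero>\<^sub>(S i) \<longleftrightarrow> y:R" if y: "y:car P" for y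
 proof -
  have "h y = \<zero>\<^sub>(S i) \<longleftrightarrow> g y:Je i" unfolding h_def by (rule Pm_annihilator[OF i lS s gc[OF y]])
  also have "\<dots> \<longleftrightarrow> y:R"
  proof
   assume "g y:Je i"
   then have "f (g y):R" unfolding R_def by (rule imageI)
   then show "y:R" using fg(4)[OF y] by simp
  next
   assume "y:R"
   then obtain x where x: "x:Je i" "y = f x" by (auto simp: R_def)
   have "g (f x) = x" using fg(3)[of x] x(1) by (simp add: Je_def)
   then show "g y:Je i" using x by simp
  qed
  finally show ?thesis .
 qed
 have hs: "h ` car P = car (S i)"
 proof -
  have "x \<odot>\<^sub>(S i) s:h ` car P" if "x:Pc i" for x
   using fg(3)[of x] fc[OF that] that unfolding h_def by (intro image_eqI[of _ _ "f x"]) auto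
  then have "(%x. x \<odot>\<^sub>(S i) s) ` Pc i <= h ` car P" by auto
  then have "cyc (S i) s <= h ` car P"
   unfolding Pm_hom_image[OF lS sD(2) i sD(3)] .
  then show ?thesis using S_cyc[OF i s] homD(1)[OF h] by auto
 qed
 obtain k where k: "k:mhom (quot_module P R) (S i)" "!!x. x:car P ==> k (cmap P R x) = h x"
  using hom_factor[OF fP(2) q(1) lS q(2,3) h] hR q(4) by auto
 have "module_iso \<Lambda> (quot_module P R) (S i)"
 proof (rule module_isoI[OF q(1) lS k(1)])
  fix x assume "x:car (quot_module P R)" "k x = \<zero>\<^sub>(S i)"
  moreover then obtain y where "y:car P" "x = cmap P R y" using q(3) by auto
  ultimately show "x = \<zero>\<^sub>(quot_module P R)" using k(2) hR q(4) by auto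
 next
  show "k ` car (quot_module P R) = car (S i)"
   unfolding q(3)[symmetric] using k(2) hs by (simp add: image_image)
 qed
 then have iso: "module_iso \<Lambda> (P(|carrier := L P|)) (S i)" using soc rad module_iso_trans by metis
 note lL = lmod_sub[OF fP(2) L_subm[OF fP(2)]]
 obtain a b where ab: "b:mhom (S i) (P(|carrier := L P|))"
  "!!y. y:car (P(|carrier := L P|)) ==> b (a y) = y" "a:mhom (P(|carrier := L P|)) (S i)"
  "!!x. x:car (S i) ==> a (b x) = x"
  using module_isoE[OF iso lL] by metis
 \<comment> \<open>The generator of the simple socle is the atom of \<open>S i\<close>, carried
   through socle of \<open>P\<close> and then into \<open>Pm i\<close>.\<close>
 define t where "t = g (b s)"
 have bs: "b s:L P" using homD(1)[OF ab(1) sD(2)] by simp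
 then have bsc: "b s:car P" by (simp add: L_def)
 have tc: "t:Pc i" using gc[OF bsc] by (simp add: t_def)
 have gL: "g ` L P = L (Pm i)"
 proof (intro equalityI subsetI)
  fix x assume "x:g ` L P"
  then obtain y where y: "y:L P" "x = g y" by auto
  then have yc: "y:car P" using y(1) by (simp add: L_def)
  have "j \<otimes> g y = \<zero>" if "j:J" for j
   using homD(3)[OF fg(2), of j y] yc y that J_sub[OF that] gz by (simp add: L_def)
  then show "x:L (Pm i)" using y gc[OF yc] by (simp add: L_def)
 next
  fix x assume x: "x:L (Pm i)"
  then have xc: "x:Pc i" by (simp add: L_def)
  have "j \<odot>\<^sub>P f x = \<zero>\<^sub>P" if "j:J" for j
   using homD(3)[OF fg(1), of j x] xc x that J_sub[OF that] fz by (simp add: L_def)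
  then have "f x:L P" using fc[OF xc] by (simp add: L_def)
  then show "x:g ` L P" using fg(3)[of x] xc by (metis imageI Pm_simps(1))
 qed
 have tn: "t ~= \<zero>"
 proof
  assume "t = \<zero>"
  then have "b s = \<zero>\<^sub>P" using fg(4)[OF bsc] fz by (simp add: t_def)
  then have "s = \<zero>\<^sub>(S i)" using ab(4)[OF sD(2)] hom_zero[OF lL lS ab(3)] by simp
  then show False using sD(4) by simp
 qed
 have "e i \<otimes> t = t"
  using homD(3)[OF fg(2), of "e i" "b s"] homD(3)[OF ab(1), of "e i" s] bs bsc i sD by (simp add: t_def)
 then have "atom (Pm i) i t"
  using gL bs tn by (auto simp: atom_def t_def)
 moreover have "L (Pm i) = cyc (Pm i) t"
 proof
  show "cyc (Pm i) t <= L (Pm i)"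
   using cyc_least[OF lP L_subm[OF lP]] gL bs by (auto simp: t_def)
  show "L (Pm i) <= cyc (Pm i) t"
  proof
   fix x assume "x:L (Pm i)"
   then obtain y where y: "y:L P" "x = g y" using gL by auto
   have "a y:car (S i)" using homD(1)[OF ab(3)] y by simp
   then obtain w where w: "w:car \<Lambda>" "a y = w \<odot>\<^sub>(S i) s" using S_cyc[OF i s] by (auto simp: cyc_def)
   have "y = b (a y)" using ab(2) y by simp
   also have "\<dots> = w \<odot>\<^sub>P b s" using homD(3)[OF ab(1) w(1) sD(2)] w by simp
   finally have "x = w \<otimes> t" using homD(3)[OF fg(2) w(1) bsc] y by (simp add: t_def)
   then show "x:cyc (Pm i) t" using w by (simp add: cyc_def)
  qed
 qed
 ultimately show thesis using that by blast
qed

end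

section \<open>The quiver\<close>

lemma (in vspace) dim_generators:
 assumes "vectorspace.fin_dim K V"
 obtains vs where "length vs = vectorspace.dim K V" "set vs <= car V"
  "!!U. Module.submodule U K V ==> set vs <= U ==> U = car V"
proof -
 interpret v: vectorspace K V by (rule vectorspace)
 have "EX n A. finite A & card A = n & A <= car V & v.gen_set A"
  using assms unfolding v.fin_dim_def by blast
 from LeastI_ex[OF this] have "EX A. finite A & card A = v.dim & A <= car V & v.gen_set A"
  unfolding v.dim_def .
 then obtain A where A: "finite A" "card A = v.dim" "A <= car V" "v.gen_set A"
  by (elim exE conjE)
 obtain vs where vs: "set vs = A" "distinct vs" using finite_distinct_list[OF A(1)] by blast
 show thesis
 proof (rule that)
  show "length vs = v.dim" using vs A distinct_card[OF vs(2)] by simp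
  show "set vs <= car V" using vs A by simp
  show "U = car V" if "Module.submodule U K V" "set vs <= U" for U
   using span_eqD[OF A(4,3) that(1)] that(2) vs by simp
 qed
qed

context ws_algebra
begin

text \<open>Every nonzero submodule contains an atom, and the submodule generated by it is a nonzero
  part of a simple socle.\<close>

lemma L_Pm_le:
 assumes i: "i < r" and N: "subm N (Pm i)" "N ~= {\<zero>}"
 shows "L (Pm i) <= N"
proof -
 note lP = lmod_Pm[OF i]
 obtain t where t: "atom (Pm i) i t" "L (Pm i) = cyc (Pm i) t" using L_Pm[OF i] .
 obtain l z where z: "l < r" "z:N" "atom (Pm i) l z" using atom_exists[OF lP N(1)] N(2) by auto
 note zD = atomD[OF z(3)]
 have sub: "cyc (Pm i) z <= L (Pm i)" using cyc_least[OF lP L_subm[OF lP] zD(1)] .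
 then have "subm (cyc (Pm i) z) ((Pm i)(|carrier := L (Pm i)|))"
  using subm_sub_iff[OF lP L_subm[OF lP]] cyc_subm[OF lP zD(2)] by simp
 then have "cyc (Pm i) z = {\<zero>} \<or> cyc (Pm i) z = L (Pm i)"
  using simpleD(3)[OF atom_iso(2)[OF lP t(1) i], folded t(2)] by simp
 then have "cyc (Pm i) z = L (Pm i)" using cyc_self[OF lP zD(2)] zD(4) by auto
 then show ?thesis using cyc_least[OF lP N(1) z(2)] by simp
qed

lemma dv_L_Pm:
 assumes "i < r" "j < r"
 shows "dv reg j (L (Pm i)) = (if j = i then 1 else 0)"
proof -
 obtain t where t: "atom (Pm i) i t" "L (Pm i) = cyc (Pm i) t" using L_Pm[OF assms(1)] .
 have "dv (Pm i) j (L (Pm i)) = (if j = i then 1 else 0)"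
  unfolding t(2) by (rule dv_cyc_atom[OF lmod_Pm[OF assms(1)] t(1) assms])
 then show ?thesis by (simp add: Pm_def)
qed

abbreviation Jm :: "nat => ('b, 'b) module" where
 "Jm i == reg(|carrier := Je i|)"

text \<open>The second radical layer, J J e i. It is killed by \<open>J\<close> and sits in a simple
  socle, so it is zero or all of the socle; the first case is excluded later by the spectral
  radius.\<close>

definition Rj :: "nat => 'b set" where "Rj i = rad (Jm i)"

lemma lmod_Jm: "i < r ==> lmod (Jm i)"
 by (rule lmod_sub[OF lmod_reg Je_lideal])

lemma Rj_lideal: "i < r ==> lideal (Rj i)" "i < r ==> Rj i <= Je i"
 using rad_subm[OF lmod_Jm] subm_sub_iff[OF lmod_reg Je_lideal]
 by (auto simp: Rj_def)

lemma Rj_subset_L: "i < r ==> Rj i <= L (Pm i)"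
proof -
 assume i: "i < r"
 have LJ: "subm (L (Pm i) \<inter> Je i) (Jm i)"
  using subm_sub_iff[OF lmod_reg Je_lideal[OF i]] L_subm[OF lmod_Pm[OF i]]
   Pm_subm[OF i] left_module.subm_Int[OF lmod_reg _ Je_lideal[OF i]] by auto
 have "rad (Jm i) <= L (Pm i) \<inter> Je i"
 proof (rule rad_least[OF LJ])
  fix j x assume j: "j:J" and "x:car (Jm i)"
  then have x: "x:Pc i" "x:J" "x:car \<Lambda>" by (auto simp: Je_def J_sub)
  have "j' \<otimes> (j \<otimes> x) = \<zero>" if "j':J" for j'
   using J_cube[OF that j x(2)] J_sub[OF that] J_sub[OF j] x by (simp add: Alg.m_assoc)
  moreover have "j \<otimes> x:Je i"
   using iffD1[OF lideal_iff Je_lideal[OF i]] J_sub[OF j] x by (auto simp: Je_def)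
  ultimately show "j \<odot>\<^sub>(Jm i) x:L (Pm i) \<inter> Je i" by (auto simp: L_def Je_def)
 qed
 then show ?thesis by (simp add: Rj_def)
qed

lemma Rj_cases: "i < r ==> Rj i = {\<zero>} \<or> Rj i = L (Pm i)"
 using L_Pm_le[of i "Rj i"] Rj_subset_L Rj_lideal Pm_subm[of i "Rj i"] by (auto simp: Je_def)

text \<open>The multiplicity of \<open>S j\<close> in the middle layer of \<open>Pm i\<close>. The
  subtraction is never truncated, by \<open>dv_Rj_le\<close>.\<close>

definition E :: "nat => nat => nat" where
 "E i j = dv reg j (Je i) - dv reg j (Rj i)"

lemma dv_Rj_le: "i < r ==> j < r ==> dv reg j (Rj i) <= dv reg j (Je i)"
 by (intro dv_mono[OF fdm_regular Rj_lideal(1) Je_lideal Rj_lideal(2)])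

lemma dv_Je: "i < r ==> j < r ==> dv reg j (Je i) = E i j + dv reg j (Rj i)"
 using dv_Rj_le by (simp add: E_def)

text \<open>Every nonzero \<open>u \<in> e j \<Lambda> e i\<close> can be multiplied into the socle of \<open>\<Lambda> e i\<close>, so multiplication
 followed by a functional not vanishing on the socle pairs \<open>e i \<Lambda> e j\<close> with \<open>e j \<Lambda> e i\<close>.\<close>

lemma cartan_le:
 assumes i: "i < r" and j: "j < r"
 shows "dv reg j (Pc i) <= dv reg i (Pc j)"
proof -
 let ?R = "reg"
 let ?U = "{x:Pc i. e j \<otimes> x = x}" and ?V = "{x:Pc j. e i \<otimes> x = x}" and ?W = "{x:Pc i. e i \<otimes> x = x}"
 have kU: "ksub ?R ?U" using ksub_idem[OF lmod_reg Pc_lideal[OF i] e_closed[OF j]] by simp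
 have kV: "ksub ?R ?V" using ksub_idem[OF lmod_reg Pc_lideal[OF j] e_closed[OF i]] by simp
 have kW: "ksub ?R ?W" using ksub_idem[OF lmod_reg Pc_lideal[OF i] e_closed[OF i]] by simp
 interpret R: vspace K "KV ?R" by (rule vspace_KV[OF lmod_reg])
 interpret V: vspace K "(KV ?R)(|carrier := ?V|)" by (rule R.vspace_sub[OF kV])
 interpret W: vspace K "(KV ?R)(|carrier := ?W|)" by (rule R.vspace_sub[OF kW])
 interpret F: field K by (rule field_K)
 obtain t where t: "atom (Pm i) i t" "L (Pm i) = cyc (Pm i) t" using L_Pm[OF i] .
 note tD = atomD[OF t(1)]
 have tW: "t:car ((KV ?R)(|carrier := ?W|))" "t ~= \<zero>\<^sub>((KV ?R)(|carrier := ?W|))"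
  using tD(2-4) by simp_all
 \<comment> \<open>The functional lives on the corner \<open>e i \<Lambda> e i\<close> and is
   required only not to vanish on the socle generator.\<close>
 obtain \<theta> where th: "\<theta>:module_hom K ((KV ?R)(|carrier := ?W|)) (regular_module K)" "\<theta> t ~= \<zero>\<^sub>K"
  by (rule W.functional_exists[OF R.fin_dim_sub[OF fdmD(2)[OF fdm_regular] kW] tW])
 obtain vs where vs: "length vs = vectorspace.dim K ((KV ?R)(|carrier := ?V|))"
  "set vs <= car ((KV ?R)(|carrier := ?V|))"
  "!!T. Module.submodule T K ((KV ?R)(|carrier := ?V|)) ==> set vs <= T ==> T = car ((KV ?R)(|carrier := ?V|))"
  by (rule V.dim_generators[OF R.fin_dim_sub[OF fdmD(2)[OF fdm_regular] kV]]) (rule that, assumption, assumption, blast)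
 have prod: "v \<otimes> u:?W" if "v:?V" "u:?U" for u v
 proof -
  have c: "v:car \<Lambda>" "u:car \<Lambda>" "u \<otimes> e i = u" "e i \<otimes> v = v" using that by (auto simp: Pc_def)
  then have "v \<otimes> u \<otimes> e i = v \<otimes> u" "e i \<otimes> (v \<otimes> u) = v \<otimes> u"
   using i Alg.m_assoc[of v u "e i"] Alg.m_assoc[of "e i" v u] by simp_all
  then show ?thesis using c by (simp add: Pc_def)
 qed
 have lin1: "\<theta> (v \<otimes> (u \<oplus> u')) = \<theta> (v \<otimes> u) \<oplus>\<^sub>K \<theta> (v \<otimes> u')" if "v:?V" "u:?U" "u':?U" for u u' v
  using homD(2)[OF th(1), of "v \<otimes> u" "v \<otimes> u'"] prod that by (simp add: Pc_def Alg.r_distr)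
 have lin2: "\<theta> (v \<otimes> (emb c \<otimes> u)) = c \<otimes>\<^sub>K \<theta> (v \<otimes> u)" if "v:?V" "u:?U" "c:car K" for u c v
 proof -
  have cl: "v:car \<Lambda>" "u:car \<Lambda>" using that by (auto simp: Pc_def)
  have "v \<otimes> (emb c \<otimes> u) = emb c \<otimes> (v \<otimes> u)"
   using cl that(3) by (metis Alg.m_assoc emb_closed emb_commute)
  then show ?thesis using homD(3)[OF th(1) that(3), of "v \<otimes> u"] prod[OF that(1,2)] by simp
 qed
 have lin3: "\<theta> ((v \<oplus> v') \<otimes> u) = \<theta> (v \<otimes> u) \<oplus>\<^sub>K \<theta> (v' \<otimes> u)" if "v:?V" "v':?V" "u:?U" for u v v'
  using homD(2)[OF th(1), of "v \<otimes> u" "v' \<otimes> u"] prod that by (simp add: Pc_def Alg.l_distr)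
 have lin4: "\<theta> ((emb c \<otimes> v) \<otimes> u) = c \<otimes>\<^sub>K \<theta> (v \<otimes> u)" if "v:?V" "u:?U" "c:car K" for u c v
  using homD(3)[OF th(1) that(3), of "v \<otimes> u"] prod[OF that(1,2)] that by (simp add: Pc_def Alg.m_assoc)
 have thc: "\<theta> (v \<otimes> u):car K" if "v:?V" "u:?U" for u v
  using homD(1)[OF th(1), of "v \<otimes> u"] prod[OF that] by simp
 have "kdim ?R ?U <= length (map (%v u. \<theta> (v \<otimes> u)) vs)"
 proof (rule kdim_le_functionals[OF fdm_regular kU])
  fix \<phi> assume "\<phi>:set (map (%v u. \<theta> (v \<otimes> u)) vs)"
  then obtain v where v: "v:?V" "\<phi> = (%u. \<theta> (v \<otimes> u))" using vs(2) by auto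
  show "\<phi>:module_hom K ((KV ?R)(|carrier := ?U|)) (regular_module K)"
   unfolding v(2) using v(1) lin1 lin2 thc by (intro module_homI) simp_all
 next
  fix u assume u: "u:?U" and ker: "!!\<phi>. \<phi>:set (map (%v u. \<theta> (v \<otimes> u)) vs) ==> \<phi> u = \<zero>\<^sub>K"
  have uc: "u:car \<Lambda>" "u:Pc i" "e j \<otimes> u = u" using u by (auto simp: Pc_def)
  \<comment> \<open>Vanishing of the finitely many functionals attached to the spanning list passes
    to all \<open>v\<close>, because the annihilating \<open>v\<close> form a subspace.\<close>
  define T where "T = {v:?V. \<theta> (v \<otimes> u) = \<zero>\<^sub>K}"
  have "Module.submodule T K ((KV ?R)(|carrier := ?V|))"
  proof (rule V.left_submoduleI)
   have "\<theta> ((emb \<zero>\<^sub>K \<otimes> \<zero>) \<otimes> u) = \<zero>\<^sub>K"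
    using lin4[of \<zero> u "\<zero>\<^sub>K"] thc[of \<zero> u] V.M.zero_closed u by simp
   then show "\<zero>\<^sub>((KV ?R)(|carrier := ?V|)):T" using V.M.zero_closed by (simp add: T_def)
   show "a \<oplus>\<^sub>((KV ?R)(|carrier := ?V|)) b:T" if "a:T" "b:T" for a b
    using that V.M.a_closed[of a b] lin3 u by (simp add: T_def)
   show "a \<odot>\<^sub>((KV ?R)(|carrier := ?V|)) b:T" if "a:car K" "b:T" for a b
    using that V.smult_closed[of a b] lin4 u by (simp add: T_def)
  qed (auto simp: T_def)
  moreover have "set vs <= T" using vs(2) ker by (auto simp: T_def)
  ultimately have all: "\<theta> (v \<otimes> u) = \<zero>\<^sub>K" if "v:?V" for v
   using vs(3)[of T] that by (auto simp: T_def)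
  have "u = \<zero>"
  proof (rule ccontr)
   assume "u ~= \<zero>"
   have cu: "u:cyc (Pm i) u" using cyc_self[OF lmod_Pm[OF i], of u] uc by simp
   \<comment> \<open>Some multiple of \<open>u\<close> is the socle generator \<open>t\<close>;
     cutting the multiplier down with \<open>e i\<close> and \<open>e j\<close> gives an admissible
     \<open>v\<close>.\<close>
   have "L (Pm i) <= cyc (Pm i) u"
    using cyc_subm[OF lmod_Pm[OF i], of u] uc cu \<open>u ~= \<zero>\<close> by (intro L_Pm_le[OF i]) auto
   then obtain y where y: "y:car \<Lambda>" "t = y \<otimes> u" using tD(1) by (auto simp: cyc_def)
   define v where "v = e i \<otimes> y \<otimes> e j"
   have "v:?V" using y i j e_idem[OF i] e_idem[OF j] Alg.m_assoc[of "e i" "e i" "y \<otimes> e j"]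
    by (simp add: v_def Pc_def Alg.m_assoc)
   moreover have "v \<otimes> u = t"
   proof -
    have "v \<otimes> u = e i \<otimes> (y \<otimes> (e j \<otimes> u))" using y uc i j by (simp add: v_def Alg.m_assoc)
    then show ?thesis using uc y tD by simp
   qed
   ultimately show False using all th(2) by auto
  qed
  then show "u = \<zero>\<^sub>?R" by simp
 qed
 then show ?thesis using vs(1) by (simp add: edim_def kdim_def)
qed

lemma cartan_sym: "i < r ==> j < r ==> dv reg j (Pc i) = dv reg i (Pc j)"
 using cartan_le[of i j] cartan_le[of j i] by simp

text \<open>Off the diagonal neither the top nor the socle of \<open>Pm i\<close> contributes to the
  multiplicity of \<open>S j\<close>, so \<open>E\<close> coincides with the Cartan matrix and
  inherits its symmetry.\<close>

lemma E_cartan: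
 assumes "i < r" "j < r" "i ~= j"
 shows "E i j = dv reg j (Pc i)"
proof -
 have "dv reg j (Rj i) <= dv reg j (L (Pm i))"
  using L_subm[OF lmod_Pm[OF assms(1)]] Pm_subm[OF assms(1)] assms
  by (intro dv_mono[OF fdm_regular Rj_lideal(1) _ Rj_subset_L]) auto
 then show ?thesis using dv_L_Pm[OF assms(1,2)] dv_Pc[OF assms(1,2)] dv_Je[OF assms(1,2)] assms(3) by simp
qed

lemma E_sym: "i < r ==> j < r ==> E i j = E j i"
 using E_cartan[of i j] E_cartan[of j i] cartan_sym[of i j] by (cases "i = j") auto

lemma E_zero:
 assumes "i < r" "j < r" "i ~= j" "E i j = 0" "x:car \<Lambda>"
 shows "e j \<otimes> x \<otimes> e i = \<zero>"
proof -
 let ?U = "{x:Pc i. e j \<otimes> x = x}"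
 have "ksub reg ?U"
  using ksub_idem[OF lmod_reg Pc_lideal[OF assms(1)] e_closed[OF assms(2)]] by simp
 moreover have "kdim reg ?U = 0" using E_cartan[OF assms(1-3)] assms(4) by (simp add: edim_def)
 ultimately have "?U = {\<zero>}" using kdim_pos[OF fdm_regular, of ?U] by simp
 moreover have "e j \<otimes> x \<otimes> e i:?U"
  using assms e_idem[OF assms(1)] e_idem[OF assms(2)] Alg.m_assoc[of "e j" "e j" "x \<otimes> e i"]
  by (simp add: Pc_def Alg.m_assoc)
 ultimately show ?thesis by auto
qed

end

section \<open>Connectedness of the quiver\<close>

locale connected_algebra = ws_algebra + assumes indec: "indecomposable_algebra K \<Lambda>"
begin

definition factor :: "'b set => 'b => ('a, 'b) module" where
 "factor A f = (|carrier = A, monoid.mult = monoid.mult \<Lambda>, one = f, zero = \<zero>, add = add \<Lambda>, smult = smult \<Lambda>|)"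

lemma factor_simps [simp]:
 "car (factor A f) = A" "monoid.mult (factor A f) = monoid.mult \<Lambda>" "\<one>\<^sub>(factor A f) = f"
 "\<zero>\<^sub>(factor A f) = \<zero>" "add (factor A f) = add \<Lambda>" "smult (factor A f) = smult \<Lambda>"
 by (simp_all add: factor_def)

lemma factor_algebra:
 assumes A: "lideal A" and f: "f:A" "!!x. x:A ==> x \<otimes> f = x" "!!x. x:A ==> f \<otimes> x = x"
 shows "k_algebra K (factor A f)"
proof -
 note AD = iffD1[OF lideal_iff A]
 have AK: "Module.submodule A K \<Lambda>"
  using AD unfolding left_module.subm_iff[OF lmod_K] by (auto simp: emb_mult_left[symmetric])
 have lA: "left_module K (factor A f)"
  by (rule lmod_image(1)[OF lmod_sub[OF lmod_K AK], where p = "%x. x"]) auto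
 interpret lA: left_module K "factor A f" by (rule lA)
 have sub: "x:car \<Lambda>" if "x:A" for x using AD that by auto
 have "ring (factor A f)"
 proof (intro ringI lA.M.abelian_group_axioms monoidI)
 qed (use AD f sub in \<open>auto simp: Alg.m_assoc Alg.l_distr Alg.r_distr\<close>)
 moreover have "vectorspace K (factor A f)" using lA vectorspace_iff_left_module[OF field_K] by blast
 ultimately show ?thesis
  unfolding k_algebra_def k_algebra_axioms_def using sub smult_mult_left smult_mult_right by auto
qed

text \<open>A proper nonempty closed set of vertices and its complement have no arrows between them,
  so by symmetry and \<open>E_zero\<close> the corners between them vanish. The two ideals of
  elements that involve only one side then split the algebra.\<close>

lemma E_connected:
 assumes T: "T <= {..<r}" "T ~= {}" "!!i j. i:T ==> j < r ==> E i j ~= 0 ==> j:T"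
 shows "T = {..<r}"
proof (rule ccontr)
 assume "T ~= {..<r}"
 define T' where "T' = {..<r} - T"
 have T': "T' <= {..<r}" "T' ~= {}" using \<open>T ~= {..<r}\<close> T by (auto simp: T'_def)
 \<comment> \<open>The elements \<open>x\<close> for which the module generated by \<open>x\<close>
   has no composition factor of a type in \<open>X\<close>; the factor belonging to \<open>T\<close>
   is therefore \<open>A T'\<close>.\<close>
 define A where "A X = {x:car \<Lambda>. ALL j:X. ALL y:car \<Lambda>. e j \<otimes> (y \<otimes> x) = \<zero>}" for X
 have E0: "E i j = 0" "E j i = 0" "i < r" "j < r" "i ~= j" if "i:T" "j:T'" for i j
  using T(1) T(3)[of i j] E_sym[of j i] that by (auto simp: T'_def subset_iff)
 have z1: "e j \<otimes> x \<otimes> e i = \<zero>" if "i:T" "j:T'" "x:car \<Lambda>" for i j x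
  by (rule E_zero[OF E0(3-5,1)[OF that(1,2)] that(3)])
 have z2: "e i \<otimes> x \<otimes> e j = \<zero>" if "i:T" "j:T'" "x:car \<Lambda>" for i j x
  by (rule E_zero[OF E0(4,3)[OF that(1,2)] E0(5)[OF that(1,2), symmetric] E0(2)[OF that(1,2)] that(3)])
 have lid: "lideal (A X)" if "X <= {..<r}" for X
  using that unfolding lideal_iff A_def
  by (auto simp: Alg.r_distr subset_iff) (simp add: Alg.m_assoc[symmetric], metis Alg.m_assoc Alg.m_closed e_closed)
 have right: "x \<otimes> a:A X" if "X <= {..<r}" "x:A X" "a:car \<Lambda>" for X x a
 proof -
  have x: "x:car \<Lambda>" using that by (simp add: A_def)
  have "e j \<otimes> (y \<otimes> (x \<otimes> a)) = \<zero>" if "j:X" "y:car \<Lambda>" for j y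
  proof -
   have "e j:car \<Lambda>" using \<open>X <= {..<r}\<close> that by auto
   then have "e j \<otimes> (y \<otimes> (x \<otimes> a)) = (e j \<otimes> (y \<otimes> x)) \<otimes> a"
    using that x \<open>a:car \<Lambda>\<close> by (simp add: Alg.m_assoc)
   then show ?thesis using that \<open>x:A X\<close> \<open>a:car \<Lambda>\<close> by (simp add: A_def)
  qed
  then show ?thesis using x that by (simp add: A_def)
 qed
 have int: "x = \<zero>" if x: "x:A T" "x:A T'" for x
 proof (rule ccontr)
  assume "x ~= \<zero>"
  then obtain i y where "i < r" "y:car \<Lambda>" "e i \<otimes> (y \<otimes> x) ~= \<zero>"
   using detect[OF lmod_reg, of x] x by (auto simp: A_def)
  then show False using x by (auto simp: A_def T'_def)
 qed
 let ?B = "A T" and ?A = "A T'"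
 define N where "N = {n \<oplus>\<^sub>reg w |n w. n:?A & w:?B}"
 note N = subm_sum[OF lmod_reg lid[OF T'(1)] lid[OF T(1)], folded N_def]
 \<comment> \<open>Otherwise an element \<open>e l \<otimes> y\<close> would lie outside
   \<open>N\<close>. But it belongs to one of the two ideals, according to the side of
   \<open>l\<close>, since all corners to the other side vanish.\<close>
 have "\<one>:N"
 proof (rule ccontr)
  assume "\<one> ~: N"
  then obtain l y where l: "l < r" "y:car \<Lambda>" "e l \<otimes> y ~: N"
   using subm_detect[OF lmod_reg N(1), of \<one>] by auto
  have "e l \<otimes> y:?A \<or> e l \<otimes> y:?B"
  proof (cases "l:T")
   case True
   have "e j \<otimes> (z \<otimes> (e l \<otimes> y)) = \<zero>" if "j:T'" "z:car \<Lambda>" for j z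
   proof -
    have "e j:car \<Lambda>" using that T' by auto
    then have "e j \<otimes> (z \<otimes> (e l \<otimes> y)) = (e j \<otimes> z \<otimes> e l) \<otimes> y" using l that by (simp add: Alg.m_assoc)
    then show ?thesis using z1[OF True that] l by simp
   qed
   then show ?thesis using l by (simp add: A_def)
  next
   case False
   then have lT: "l:T'" using l by (simp add: T'_def)
   have "e j \<otimes> (z \<otimes> (e l \<otimes> y)) = \<zero>" if "j:T" "z:car \<Lambda>" for j z
   proof -
    have "e j:car \<Lambda>" using that T by auto
    then have "e j \<otimes> (z \<otimes> (e l \<otimes> y)) = (e j \<otimes> z \<otimes> e l) \<otimes> y" using l that by (simp add: Alg.m_assoc)
    then show ?thesis using z2[OF that(1) lT that(2)] l by simp
   qed
   then show ?thesis using l by (simp add: A_def)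
  qed
  then show False using N(2,3) l(3) by auto
 qed
 then obtain f g where fg: "f:?A" "g:?B" "\<one> = f \<oplus> g" by (auto simp: N_def)
 have c: "f:car \<Lambda>" "g:car \<Lambda>" using fg by (auto simp: A_def)
 note AD = iffD1[OF lideal_iff lid[OF T'(1)]] and BD = iffD1[OF lideal_iff lid[OF T(1)]]
 have dl: "x \<otimes> f \<oplus> x \<otimes> g = x" if "x:car \<Lambda>" for x
  using Alg.r_distr[of f g x] c that fg(3)[symmetric] by simp
 have dr: "f \<otimes> x \<oplus> g \<otimes> x = x" if "x:car \<Lambda>" for x
  using Alg.l_distr[of f g x] c that fg(3)[symmetric] by simp
 \<comment> \<open>Both ideals are two-sided, so the products lie in their intersection.\<close>
 have AB: "x \<otimes> y = \<zero>" "y \<otimes> x = \<zero>" if "x:?A" "y:?B" for x y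
 proof -
  have "x:car \<Lambda>" "y:car \<Lambda>" using that by (auto simp: A_def)
  then show "x \<otimes> y = \<zero>" "y \<otimes> x = \<zero>"
   using int right[OF T(1)] right[OF T'(1)] AD BD that by auto
 qed
 have Af: "x \<otimes> f = x" "f \<otimes> x = x" "x \<otimes> g = \<zero>" if "x:?A" for x
 proof -
  have x: "x:car \<Lambda>" using that by (simp add: A_def)
  then show "x \<otimes> f = x" "f \<otimes> x = x" "x \<otimes> g = \<zero>" using dl[OF x] dr[OF x] AB[OF that fg(2)] c by auto
 qed
 have Bg: "y \<otimes> g = y" "g \<otimes> y = y" "y \<otimes> f = \<zero>" if "y:?B" for y
 proof -
  have y: "y:car \<Lambda>" using that by (simp add: A_def)
  then show "y \<otimes> g = y" "g \<otimes> y = y" "y \<otimes> f = \<zero>" using dl[OF y] dr[OF y] AB[OF fg(1) that] c by auto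
 qed
 have nz: "~ zero_module (factor ?A f)" "~ zero_module (factor ?B g)"
 proof -
  obtain i where i: "i:T" using T by auto
  then have ir: "i < r" using T(1) by auto
  have "e j \<otimes> (y \<otimes> e i) = \<zero>" if "j:T'" "y:car \<Lambda>" for j y
   using z1[OF i that] Alg.m_assoc[of "e j" y "e i"] ir T'(1) that by auto
  then have "e i:?A" using ir by (simp add: A_def)
  moreover have "e i ~= \<zero>" using e_notin_J[OF ir] J_zero by auto
  ultimately show "~ zero_module (factor ?A f)" by (auto simp: zero_module_def)
  obtain j where j: "j:T'" using T' by auto
  then have jr: "j < r" using T'(1) by auto
  have "e i \<otimes> (y \<otimes> e j) = \<zero>" if "i:T" "y:car \<Lambda>" for i y
   using z2[OF that(1) j that(2)] Alg.m_assoc[of "e i" y "e j"] jr T(1) that by auto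
  then have "e j:?B" using jr by (simp add: A_def)
  moreover have "e j ~= \<zero>" using e_notin_J[OF jr] J_zero by auto
  ultimately show "~ zero_module (factor ?B g)" by (auto simp: zero_module_def)
 qed
 let ?h = "%x. (x \<otimes> f, x \<otimes> g)"
 let ?D = "direct_prod (factor ?A f) (factor ?B g)"
 have cA: "x \<otimes> f:?A" "x \<otimes> g:?B" if "x:car \<Lambda>" for x using AD BD fg that by auto
 have mult: "x \<otimes> y \<otimes> f = (x \<otimes> f) \<otimes> (y \<otimes> f)" "x \<otimes> y \<otimes> g = (x \<otimes> g) \<otimes> (y \<otimes> g)"
  if "x:car \<Lambda>" "y:car \<Lambda>" for x y
  using that c Af(2)[OF cA(1)[OF that(2)]] Bg(2)[OF cA(2)[OF that(2)]] by (simp_all add: Alg.m_assoc)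
 have dpm: "(a, b) \<otimes>\<^sub>?D (a', b') = (a \<otimes> a', b \<otimes> b')" "\<one>\<^sub>?D = (f, g)" for a b a' b'
  by (simp_all add: direct_prod_def)
 have "?h:ring_iso \<Lambda> ?D"
  unfolding ring_iso_def
 proof (intro CollectI conjI)
  show "?h:Ring.ring_hom \<Lambda> ?D"
   by (rule ring_hom_memI) (use c cA mult in \<open>auto simp: dpm Alg.l_distr\<close>)
  show "bij_betw ?h (car \<Lambda>) (car ?D)"
  proof (rule bij_betw_byWitness[where f' = "%(a, b). a \<oplus> b"])
   show "ALL a:car \<Lambda>. (case ?h a of (a, b) => a \<oplus> b) = a" using dl by simp
   show "ALL a':car ?D. ?h (case a' of (a, b) => a \<oplus> b) = a'"
   proof
    fix p assume "p:car ?D"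
    then obtain a b where p: "p = (a, b)" "a:?A" "b:?B" by auto
    then have cc: "a:car \<Lambda>" "b:car \<Lambda>" by (auto simp: A_def)
    then show "?h (case p of (a, b) => a \<oplus> b) = p"
     using p c Af Bg by (simp add: Alg.l_distr)
   qed
   show "?h ` car \<Lambda> <= car ?D" using cA by auto
   show "(%(a, b). a \<oplus> b) ` car ?D <= car \<Lambda>" by (auto simp: A_def)
  qed
 qed
 moreover have "?h (d \<odot> x) = d \<odot>\<^sub>?D ?h x" if "d:car K" "x:car \<Lambda>" for d x
  using that c by (simp add: smult_mult_left)
 ultimately have "algebra_iso K \<Lambda> ?D" unfolding algebra_iso_def by (intro bexI[of _ ?h]) auto
 moreover have "k_algebra K (factor ?A f)" using Af by (intro factor_algebra lid[OF T'(1)] fg) auto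
 moreover have "k_algebra K (factor ?B g)" using Bg by (intro factor_algebra lid[OF T(1)] fg) auto
 ultimately show False using indec nz unfolding indecomposable_algebra_def by blast
qed

end

section \<open>Thick subcategories\<close>

lemma projective_lift:
 fixes A B :: "('a, 'a list) module"
 assumes "projective_module R P" "left_module R A" "left_module R B" "p:module_hom R A B"
  "p ` car A = car B" "f:module_hom R P B"
 obtains g where "g:module_hom R P A" "!!x. x:car P ==> p (g x) = f x"
 using assms unfolding projective_module_def by blast

lemma projective_retract:
 assumes Q: "projective_module R Q" and P: "left_module R P"
  and st: "\<sigma>:module_hom R P Q" "\<rho>:module_hom R Q P" "!!x. x:car P ==> \<rho> (\<sigma> x) = x"
 shows "projective_module R P"
 unfolding projective_module_def
proof (intro conjI allI impI P)
 fix A B :: "('a, 'a list) module" and p f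
 assume a: "left_module R A & left_module R B & p:module_hom R A B & p ` car A = car B & f:module_hom R P B"
 then obtain g where g: "g:module_hom R Q A" "!!x. x:car Q ==> p (g x) = f (\<rho> x)"
  using projective_lift[OF Q _ _ _ _ hom_comp[OF st(2)], of A B p f] by auto
 show "EX g:module_hom R P A. ALL x:car P. p (g x) = f x"
  using hom_comp[OF st(1) g(1)] g(2) st(3) homD(1)[OF st(1)] by (intro bexI[of _ "%x. g (\<sigma> x)"]) auto
qed

lemma projective_iso:
 assumes "projective_module R Q" "left_module R P" "module_iso R P Q"
 shows "projective_module R P"
proof -
 obtain f g where "f:module_hom R P Q" "g:module_hom R Q P" "!!x. x:car P ==> g (f x) = x"
  using module_isoE[OF assms(3,2)] by metis
 then show ?thesis by (rule projective_retract[OF assms(1,2)])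
qed

lemma projective_regular:
 assumes "ring R"
 shows "projective_module R (regular_module R)"
 unfolding projective_module_def
proof (intro conjI allI impI lmod_regular[OF assms])
 interpret R: ring R by fact
 fix A B :: "('a, 'a list) module" and p f
 assume a: "left_module R A & left_module R B & p:module_hom R A B & p ` car A = car B
  & f:module_hom R (regular_module R) B"
 then have f: "f:module_hom R (regular_module R) B" and p: "p:module_hom R A B" "p ` car A = car B"
  and lA: "left_module R A" by auto
 have "f \<one>\<^sub>R:p ` car A" using homD(1)[OF f] p(2) by simp
 then obtain m where m: "m:car A" "f \<one>\<^sub>R = p m" by (rule imageE)
 have "p (x \<odot>\<^sub>A m) = f x" if "x:car R" for x
  using homD(3)[OF p(1) that m(1)] homD(3)[OF f that, of "\<one>\<^sub>R"] m that by simp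
 then show "EX g:module_hom R (regular_module R) A. ALL x:car (regular_module R). p (g x) = f x"
  using left_module.hom_smult[OF lA m(1)] by (intro bexI[of _ "%x. x \<odot>\<^sub>A m"]) auto
qed

lemma hom_in1: "left_module R B ==> (%x. (x, \<zero>\<^sub>B)):module_hom R A (direct_prod A B)"
 by (rule hom_pair[OF hom_id hom_zero_map])

lemma hom_in2: "left_module R A ==> (%x. (\<zero>\<^sub>A, x)):module_hom R B (direct_prod A B)"
 by (rule hom_pair[OF hom_zero_map hom_id])

lemma hom_copair:
 assumes "left_module R A" "left_module R B" "left_module R C" "f:module_hom R A C" "g:module_hom R B C"
 shows "(%p. f (fst p) \<oplus>\<^sub>C g (snd p)):module_hom R (direct_prod A B) C"
 by (rule hom_add[OF lmod_prod[OF assms(1,2)] assms(3) hom_comp[OF hom_fst assms(4)] hom_comp[OF hom_snd assms(5)]])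

lemma projective_direct_prod:
 assumes "projective_module R P" "projective_module R Q"
 shows "projective_module R (direct_prod P Q)"
 unfolding projective_module_def
proof (intro conjI allI impI)
 have l: "left_module R P" "left_module R Q" using assms by (auto simp: projective_module_def)
 then show lD: "left_module R (direct_prod P Q)" by (rule lmod_prod)
 interpret P: left_module R P by (rule l)
 interpret Q: left_module R Q by (rule l)
 fix A B :: "('a, 'a list) module" and p f
 assume a: "left_module R A & left_module R B & p:module_hom R A B & p ` car A = car B
  & f:module_hom R (direct_prod P Q) B"
 then have f: "f:module_hom R (direct_prod P Q) B" and p: "p:module_hom R A B" "p ` car A = car B"
  and lA: "left_module R A" and lB: "left_module R B" by auto
 obtain g where g: "g:module_hom R P A" "!!x. x:car P ==> p (g x) = f (x, \<zero>\<^sub>Q)"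
  using projective_lift[OF assms(1) lA lB p hom_comp[OF hom_in1[OF l(2)] f]] by metis
 obtain h where h: "h:module_hom R Q A" "!!x. x:car Q ==> p (h x) = f (\<zero>\<^sub>P, x)"
  using projective_lift[OF assms(2) lA lB p hom_comp[OF hom_in2[OF l(1)] f]] by metis
 have "p (g (fst z) \<oplus>\<^sub>A h (snd z)) = f z" if zc: "z:car (direct_prod P Q)" for z
 proof -
  obtain x y where z: "z = (x, y)" "x:car P" "y:car Q" using zc by auto
  have "f z = f (x, \<zero>\<^sub>Q) \<oplus>\<^sub>B f (\<zero>\<^sub>P, y)"
   using homD(2)[OF f, of "(x, \<zero>\<^sub>Q)" "(\<zero>\<^sub>P, y)"] z by simp
  then show ?thesis
   using homD(2)[OF p(1), of "g x" "h y"] homD(1)[OF g(1)] homD(1)[OF h(1)] g(2) h(2) z by simp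
 qed
 then show "EX g:module_hom R (direct_prod P Q) A. ALL x:car (direct_prod P Q). p (g x) = f x"
  using hom_copair[OF l lA g(1) h(1)] by (intro bexI) auto
qed

lemma list_module_0: "left_module R M ==> car (list_module M 0) = {\<zero>\<^sub>(list_module M 0)}"
 by auto

lemma projective_zero:
 assumes "left_module R P" "car P = {\<zero>\<^sub>P}"
 shows "projective_module R P"
 unfolding projective_module_def
proof (intro conjI allI impI assms(1))
 fix A B :: "('a, 'a list) module" and p f
 assume a: "left_module R A & left_module R B & p:module_hom R A B & p ` car A = car B & f:module_hom R P B"
 then have "p \<zero>\<^sub>A = \<zero>\<^sub>B" "f \<zero>\<^sub>P = \<zero>\<^sub>B" using hom_zero assms(1) by blast+
 then show "EX g:module_hom R P A. ALL x:car P. p (g x) = f x"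
  using hom_zero_map[of R A P] a assms(2) by (intro bexI) auto
qed

context fd_algebra
begin

lemma list_module_Suc_iso:
 assumes "left_module R M"
 shows "module_iso R (list_module M (Suc n)) (direct_prod M (list_module M n))"
proof (rule module_isoI'[OF hom_pair[OF hom_hd hom_tl] hom_Cons[OF hom_fst hom_snd]], goal_cases)
 case (1 x)
 then show ?case by (cases x) auto
qed auto

lemma projective_list:
 assumes "ring R"
 shows "projective_module R (list_module (regular_module R) n)"
proof (induction n)
 case 0
 show ?case by (rule projective_zero[OF lmod_list[OF lmod_regular[OF assms]] list_module_0[OF lmod_regular[OF assms]]])
next
 case (Suc n)
 show ?case
  by (rule projective_iso[OF projective_direct_prod[OF projective_regular[OF assms] Suc]
     lmod_list[OF lmod_regular[OF assms]] list_module_Suc_iso[OF lmod_regular[OF assms]]])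
qed

lemma fg_projectives_iff: "P:fg_projectives \<Lambda> \<longleftrightarrow> fdm P & projective_module \<Lambda> P"
 by (simp add: fg_projectives_def fg_modules_iff)

lemma free_in_fg_projectives: "list_module reg n:fg_projectives \<Lambda>"
 using fg_projectives_iff fdm_list[OF fdm_regular] projective_list[OF ring_\<Lambda>] by blast

lemma free_cover:
 assumes "fdm M"
 obtains n p where "p:mhom (list_module reg n) M"
  "p ` car (list_module reg n) = car M"
proof -
 interpret M: left_module \<Lambda> M by (rule fdmD(1)[OF assms])
 have "finitely_generated \<Lambda> M" using fdm_iff_fg[OF M.left_module_axioms] assms by simp
 then obtain xs where xs: "set xs <= car M"
  "ALL x:car M. EX rs. length rs = length xs & set rs <= car \<Lambda> & list_comb M xs rs = x"
  using M.list_comb_surj by blast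
 have h: "list_comb M xs:mhom (list_module reg (length xs)) M"
  using M.hom_list_comb[OF xs(1)] by simp
 have "list_comb M xs ` car (list_module reg (length xs)) = car M"
 proof
  show "list_comb M xs ` car (list_module reg (length xs)) <= car M"
   using homD(1)[OF h] by blast
  show "car M <= list_comb M xs ` car (list_module reg (length xs))"
  proof
   fix x assume "x:car M"
   then obtain rs where "length rs = length xs" "set rs <= car \<Lambda>" "list_comb M xs rs = x" using xs(2) by blast
   then show "x:list_comb M xs ` car (list_module reg (length xs))"
    by (intro image_eqI[of _ _ rs]) auto
  qed
 qed
 then show thesis using that h by blast
qed

lemma projective_split:
 assumes "P:fg_projectives \<Lambda>" "M:fg_modules \<Lambda>" "g:mhom M P" "g ` car M = car P"
 obtains s where "s:mhom P M" "!!x. x:car P ==> g (s x) = x"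
proof -
 have f: "fdm P" "fdm M" "projective_module \<Lambda> P" using assms fg_projectives_iff fg_modules_iff by auto
 show thesis
  by (rule projective_lift[OF f(3) fdmD(1)[OF f(2)] fdmD(1)[OF f(1)] assms(3,4) hom_id]) (rule that)
qed

lemma free_retract:
 assumes "P:fg_projectives \<Lambda>"
 obtains n \<sigma> \<rho> where "\<sigma>:mhom P (list_module reg n)"
  "\<rho>:mhom (list_module reg n) P" "!!x. x:car P ==> \<rho> (\<sigma> x) = x"
proof -
 have P: "fdm P" using assms fg_projectives_iff by blast
 obtain n p where p: "p:mhom (list_module reg n) P"
  "p ` car (list_module reg n) = car P" using free_cover[OF P] .
 have "list_module reg n:fg_modules \<Lambda>" using fg_modules_iff fdm_list[OF fdm_regular] by blast
 then show thesis by (rule projective_split[OF assms _ p]) (rule that[OF _ p(1)], assumption, blast)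
qed

lemma fg_projective_inj:
 assumes "weakly_symmetric \<Lambda>" "P:fg_projectives \<Lambda>"
 shows "inj_mod P"
proof -
 obtain n \<sigma> \<rho> where st: "\<sigma>:mhom P (list_module reg n)"
  "\<rho>:mhom (list_module reg n) P" "!!x. x:car P ==> \<rho> (\<sigma> x) = x"
  using free_retract[OF assms(2)] by metis
 have "fdm P" using assms fg_projectives_iff by blast
 then show ?thesis
  using inj_mod_retract[OF inj_mod_list[OF inj_mod_regular[OF assms(1)]] _ st] fdmD(1) by blast
qed

lemma short_exactD:
 assumes "short_exact \<Lambda> L f M g N" "lmod L" "lmod M" "lmod N"
 shows "f:mhom L M" "g:mhom M N" "g ` car M = car N"
  "!!x. x:car L ==> f x = \<zero>\<^sub>M ==> x = \<zero>\<^sub>L" "!!x. x:car L ==> g (f x) = \<zero>\<^sub>N"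
  "!!y. y:car M ==> g y = \<zero>\<^sub>N ==> EX x:car L. y = f x"
proof -
 note s = assms(1)[unfolded short_exact_def a_kernel_eq]
 show "f:mhom L M" "g:mhom M N" "g ` car M = car N" using s by auto
 then show "!!x. x:car L ==> f x = \<zero>\<^sub>M ==> x = \<zero>\<^sub>L"
  using s hom_inj_iff[OF assms(2,3)] by blast
 show "!!x. x:car L ==> g (f x) = \<zero>\<^sub>N" "!!y. y:car M ==> g y = \<zero>\<^sub>N ==> EX x:car L. y = f x"
  using s by blast+
qed

lemma short_exactI:
 assumes "lmod L" "lmod M" "lmod N" "f:mhom L M" "g:mhom M N"
  "!!x. x:car L ==> f x = \<zero>\<^sub>M ==> x = \<zero>\<^sub>L"
  "!!x. x:car L ==> g (f x) = \<zero>\<^sub>N" "!!y. y:car M ==> g y = \<zero>\<^sub>N ==> EX x:car L. y = f x"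
  "g ` car M = car N"
 shows "short_exact \<Lambda> L f M g N"
 unfolding short_exact_def a_kernel_eq
proof (intro conjI assms(4,5,9))
 show "inj_on f (car L)" using hom_inj_iff[OF assms(1,2,4)] assms(6) by blast
 show "f ` car L = {x:car M. g x = \<zero>\<^sub>N}"
  using assms(7,8) homD(1)[OF assms(4)] by blast
qed

text \<open>The map taking \<open>x\<close> to \<open>x\<close> minus the image of its retraction
  kills the kernel of \<open>g\<close>, and so it descends to a section of \<open>g\<close>.\<close>

lemma split_section:
 assumes "lmod L" "lmod M" "lmod N" "f:mhom L M" "g:mhom M N"
  "g ` car M = car N" "!!x. x:car L ==> g (f x) = \<zero>\<^sub>N"
  "!!y. y:car M ==> g y = \<zero>\<^sub>N ==> EX x:car L. y = f x"
  and \<rho>: "\<rho>:mhom M L" "!!x. x:car L ==> \<rho> (f x) = x"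
 obtains s where "s:mhom N M" "!!x. x:car M ==> s (g x) = x \<ominus>\<^sub>M f (\<rho> x)"
  "!!y. y:car N ==> g (s y) = y"
proof -
 interpret M: left_module \<Lambda> M by fact
 interpret N: left_module \<Lambda> N by fact
 have h: "(%x. x \<ominus>\<^sub>M f (\<rho> x)):mhom M M"
  by (rule hom_diff[OF assms(2,2) hom_id hom_comp[OF \<rho>(1) assms(4)]])
 have ker: "x \<ominus>\<^sub>M f (\<rho> x) = \<zero>\<^sub>M" if x: "x:car M" "g x = \<zero>\<^sub>N" for x
 proof -
  obtain l where l: "l:car L" "x = f l" using assms(8)[OF x] by (elim bexE)
  then show ?thesis using \<rho>(2)[OF l(1)] x(1) M.M.minus_eq_zero_iff by simp
 qed
 obtain s where s: "s:mhom N M" "ALL x:car M. s (g x) = x \<ominus>\<^sub>M f (\<rho> x)"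
  using hom_factor[OF assms(2,3,2) assms(5,6) h ker] by blast
 have "g (s y) = y" if y: "y:car N" for y
 proof -
  obtain x where x: "x:car M" "y = g x" using y assms(6) by (metis imageE)
  have r: "\<rho> x:car L" "f (\<rho> x):car M" using homD(1)[OF \<rho>(1) x(1)] homD(1)[OF assms(4)] by auto
  have "g (s y) = g x \<ominus>\<^sub>N g (f (\<rho> x))" using s(2) x hom_minus[OF assms(2,3,5) x(1) r(2)] by simp
  then show ?thesis using assms(7)[OF r(1)] x y N.M.minus_eq by simp
 qed
 then show thesis using that[OF s(1)] s(2) by blast
qed

lemma thick_fg_modules: "thick_subcategory \<Lambda> (fg_modules \<Lambda>)"
 unfolding thick_subcategory_def by blast

text \<open>The algebra is injective over itself, so finitely generated projectives are injective
  and a sequence that starts with one splits. A sequence that ends with one splits by projectivity.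
  In every case the third term is a retract of a projective.\<close>

lemma thick_fg_projectives:
 assumes ws: "weakly_symmetric \<Lambda>"
 shows "thick_subcategory \<Lambda> (fg_projectives \<Lambda>)"
 unfolding thick_subcategory_def
proof (intro conjI ballI allI impI)
 show "fg_projectives \<Lambda> <= fg_modules \<Lambda>" by (simp add: fg_projectives_def)
 show "N:fg_projectives \<Lambda>" if "M:fg_projectives \<Lambda>" "N:fg_modules \<Lambda>" "module_iso \<Lambda> M N" for M N
  using that projective_iso[of \<Lambda> M N] module_iso_sym[of \<Lambda> M N] fdmD(1)[of N] fdmD(1)[of M]
  unfolding fg_projectives_iff fg_modules_iff by blast
 show "A:fg_projectives \<Lambda>" if M: "M:fg_projectives \<Lambda>" and A: "A:fg_modules \<Lambda>" and B: "B:fg_modules \<Lambda>"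
  and iso: "module_iso \<Lambda> M (direct_prod A B)" for M A B
 proof -
  have l: "lmod A" "lmod B" "lmod M" "projective_module \<Lambda> M" "fdm A"
   using M A B fdmD(1) unfolding fg_projectives_iff fg_modules_iff by auto
  have pD: "projective_module \<Lambda> (direct_prod A B)"
   by (rule projective_iso[OF l(4) lmod_prod[OF l(1,2)] module_iso_sym[OF l(3) iso]])
  have "projective_module \<Lambda> A"
   by (rule projective_retract[OF pD l(1) hom_in1[OF l(2)] hom_fst]) simp
  then show ?thesis using l(5) fg_projectives_iff by blast
 qed
next
 fix L M N f g
 assume fg: "L:fg_modules \<Lambda>" "M:fg_modules \<Lambda>" "N:fg_modules \<Lambda>" and se: "short_exact \<Lambda> L f M g N"
 have fd: "fdm L" "fdm M" "fdm N" using fg fg_modules_iff by auto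
 note l = fd[THEN fdmD(1)]
 note s = short_exactD[OF se l]
 have sec: "EX \<rho> s. \<rho>:mhom M L & s:mhom N M & (ALL x:car M. s (g x) = x \<ominus>\<^sub>M f (\<rho> x))
  & (ALL y:car N. g (s y) = y)" if LP: "L:fg_projectives \<Lambda>"
 proof -
  obtain \<rho> where \<rho>: "\<rho>:mhom M L" "!!x. x:car L ==> \<rho> (f x) = x"
   using inj_modD[OF fg_projective_inj[OF ws LP] fd(1,2) s(1) s(4) hom_id] by metis
  obtain t where "t:mhom N M" "!!x. x:car M ==> t (g x) = x \<ominus>\<^sub>M f (\<rho> x)"
   "!!y. y:car N ==> g (t y) = y"
   using split_section[OF l s(1-3,5,6) \<rho>] by metis
  then show ?thesis using \<rho>(1) by blast
 qed
 interpret M: left_module \<Lambda> M by (rule l)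
 {
  assume a: "L:fg_projectives \<Lambda> & M:fg_projectives \<Lambda>"
  then obtain t where t: "t:mhom N M" "ALL y:car N. g (t y) = y" using sec by blast
  have "projective_module \<Lambda> M" using a fg_projectives_iff by blast
  then have "projective_module \<Lambda> N" by (rule projective_retract[OF _ l(3) t(1) s(2)]) (use t in blast)
  then show "N:fg_projectives \<Lambda>" using fd fg_projectives_iff by blast
 next
  assume a: "L:fg_projectives \<Lambda> & N:fg_projectives \<Lambda>"
  then obtain \<rho> t where t: "\<rho>:mhom M L" "t:mhom N M" "ALL x:car M. t (g x) = x \<ominus>\<^sub>M f (\<rho> x)"
   using sec by blast
  have "projective_module \<Lambda> (direct_prod L N)" using a projective_direct_prod fg_projectives_iff by blast
  then have "projective_module \<Lambda> M"
  proof (rule projective_retract[OF _ l(2) hom_pair[OF t(1) s(2)] hom_copair[OF l(1,3,2) s(1) t(2)]])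
   fix x assume x: "x:car M"
   then have "f (\<rho> x):car M" using homD(1)[OF t(1)] homD(1)[OF s(1)] by blast
   then show "f (fst (\<rho> x, g x)) \<oplus>\<^sub>M t (snd (\<rho> x, g x)) = x"
    using x t(3) M.M.add_minus_cancel[of x "f (\<rho> x)"] by (simp add: M.M.a_comm)
  qed
  then show "M:fg_projectives \<Lambda>" using fd fg_projectives_iff by blast
 next
  assume a: "M:fg_projectives \<Lambda> & N:fg_projectives \<Lambda>"
  obtain t where t: "t:mhom N M" "!!y. y:car N ==> g (t y) = y"
   by (rule projective_split[OF conjunct2[OF a] fg(2) s(2,3)]) (rule that, assumption, blast)
  interpret N: left_module \<Lambda> N by (rule l)
  let ?k = "inv_into (car L) f"
  let ?d = "%x. x \<ominus>\<^sub>M t (g x)"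
  have fk: "f ` car L <= car M" "inj_on f (car L)" using homD(1)[OF s(1)] se[unfolded short_exact_def] by blast+
  have k: "?k:mhom (M(|carrier := f ` car L|)) L"
   by (rule inv_hom[OF l(1) hom_sub_codomain[OF s(1)]]) (use fk in \<open>auto simp: bij_betw_def\<close>)
  have d: "?d:mhom M (M(|carrier := f ` car L|))"
  proof (rule hom_sub_codomain[OF hom_diff[OF l(2,2) hom_id hom_comp[OF s(2) t(1)]]])
   fix x assume x: "x:car M"
   have gx: "g x:car N" "t (g x):car M" using x homD(1)[OF s(2)] homD(1)[OF t(1)] by auto
   have "g (?d x) = \<zero>\<^sub>N" using hom_minus[OF l(2,3) s(2) x gx(2)] t(2)[OF gx(1)] gx N.M.minus_eq_zero_iff by simp
   then show "?d x:f ` car L" using s(6)[of "?d x"] x gx by auto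
  qed
  have "projective_module \<Lambda> M" using a fg_projectives_iff by blast
  then have "projective_module \<Lambda> L"
  proof (rule projective_retract[OF _ l(1) s(1) hom_comp[OF d k]])
   fix x assume x: "x:car L"
   then have fx: "f x:car M" using fk by blast
   have "?d (f x) = f x" using s(5)[OF x] hom_zero[OF l(3,2) t(1)] fx by (simp add: M.M.minus_eq)
   then show "?k (?d (f x)) = x" using inv_into_f_f[OF fk(2) x] by simp
  qed
  then show "L:fg_projectives \<Lambda>" using fd fg_projectives_iff by blast
 }
qed

lemma contains_regularI:
 assumes "!!M. M:fg_projectives \<Lambda> ==> M:C"
 shows "contains_regular \<Lambda> C"
proof -
 obtain N :: "('a, 'a list) module" where N: "N:fg_modules \<Lambda>" "module_iso \<Lambda> reg N"
  using fdm_representable[OF fdm_regular] .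
 then have f: "fdm N" using fg_modules_iff by blast
 have "projective_module \<Lambda> N"
  by (rule projective_iso[OF projective_regular[OF ring_\<Lambda>] fdmD(1)[OF f] module_iso_sym[OF lmod_reg N(2)]])
 then show ?thesis using assms N f fg_projectives_iff unfolding contains_regular_def by blast
qed

end

section \<open>Membership in a thick subcategory for modules of any type\<close>

locale thick = fd_algebra +
 fixes C :: "('b, 'b list) module set"
 assumes C: "thick_subcategory \<Lambda> C" and C_reg: "contains_regular \<Lambda> C"
begin

text \<open>Having a copy in \<open>C\<close>. Quotients, direct products and left ideals have
  elements of other types than lists over the algebra, and this lets them be treated as
  members.\<close>

definition inC :: "('b, 'm) module => bool" where
 "inC M \<longleftrightarrow> fdm M & (EX N:C. module_iso \<Lambda> M N)"

lemma C_fdm: "M:C ==> fdm M"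
 using C fg_modules_iff unfolding thick_subcategory_def by blast

lemma inC_fdm: "inC M ==> fdm M"
 by (simp add: inC_def)

lemma inC_C: "M:C ==> inC M"
 using C_fdm module_iso_refl unfolding inC_def by blast

lemma inC_iso: 
 assumes "inC M" "lmod N" "module_iso \<Lambda> M N"
 shows "inC N"
 using assms module_iso_trans[OF module_iso_sym[OF _ assms(3)]] fdm_iso[OF _ assms(2,3)] fdmD(1)
 unfolding inC_def by metis

lemma inC_iff:
 fixes M :: "('b, 'b list) module"
 assumes "fdm M" shows "inC M \<longleftrightarrow> M:C"
proof
 assume "inC M"
 then obtain N where N: "N:C" "module_iso \<Lambda> M N" by (auto simp: inC_def)
 moreover have "module_iso \<Lambda> N M" by (rule module_iso_sym[OF fdmD(1)[OF assms] N(2)])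
 ultimately show "M:C"
  using C assms fg_modules_iff unfolding thick_subcategory_def by blast
qed (rule inC_C)

text \<open>The exact sequence is conjugated by isomorphisms into the universe, where closure of
  \<open>C\<close> applies.\<close>

lemma inC_ses:
 assumes fd: "fdm L" "fdm M" "fdm N" and se: "short_exact \<Lambda> L f M g N"
 shows "(inC L & inC M --> inC N) & (inC L & inC N --> inC M) & (inC M & inC N --> inC L)"
proof -
 note l = fd[THEN fdmD(1)]
 note s = short_exactD[OF se l]
 obtain L' M' N' :: "('b, 'b list) module" where fg': "L':fg_modules \<Lambda>" "M':fg_modules \<Lambda>" "N':fg_modules \<Lambda>"
  and iso: "module_iso \<Lambda> L L'" "module_iso \<Lambda> M M'" "module_iso \<Lambda> N N'"
  using fdm_representable fd by metis
 have fd': "fdm L'" "fdm M'" "fdm N'" using fg' fg_modules_iff by auto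
 note l' = fd'[THEN fdmD(1)]
 obtain a a' where a: "a:mhom L L'" "a':mhom L' L" "!!x. x:car L ==> a' (a x) = x"
  "!!x. x:car L' ==> a (a' x) = x" using module_isoE[OF iso(1) l(1)] by metis
 obtain b b' where b: "b:mhom M M'" "b':mhom M' M" "!!x. x:car M ==> b' (b x) = x"
  "!!x. x:car M' ==> b (b' x) = x" using module_isoE[OF iso(2) l(2)] by metis
 obtain c c' where c: "c:mhom N N'" "c':mhom N' N" "!!x. x:car N ==> c' (c x) = x"
  "!!x. x:car N' ==> c (c' x) = x" using module_isoE[OF iso(3) l(3)] by metis
 note cl = a(1,2)[THEN homD(1)] b(1,2)[THEN homD(1)] c(1,2)[THEN homD(1)] s(1,2)[THEN homD(1)]
 have z: "a \<zero>\<^sub>L = \<zero>\<^sub>L'" "b' \<zero>\<^sub>M' = \<zero>\<^sub>M" "c \<zero>\<^sub>N = \<zero>\<^sub>N'" "c' \<zero>\<^sub>N' = \<zero>\<^sub>N"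
  using hom_zero[OF l(1) l'(1) a(1)] hom_zero[OF l'(2) l(2) b(2)] hom_zero[OF l(3) l'(3) c(1)] hom_zero[OF l'(3) l(3) c(2)] by auto
 have "short_exact \<Lambda> L' (%x. b (f (a' x))) M' (%y. c (g (b' y))) N'"
 proof (rule short_exactI[OF l' hom_comp[OF hom_comp[OF a(2) s(1)] b(1)] hom_comp[OF hom_comp[OF b(2) s(2)] c(1)]])
  fix x assume x: "x:car L'"
  { assume "b (f (a' x)) = \<zero>\<^sub>M'"
   then have "f (a' x) = \<zero>\<^sub>M" using b(3)[of "f (a' x)"] cl x z by metis
   then have "a' x = \<zero>\<^sub>L" using s(4) cl(2)[OF x] by blast
   then show "x = \<zero>\<^sub>L'" using a(4)[OF x] z by metis }
  show "c (g (b' (b (f (a' x))))) = \<zero>\<^sub>N'" using b(3)[of "f (a' x)"] cl(7)[OF cl(2)[OF x]] s(5)[OF cl(2)[OF x]] z by simp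
 next
  fix y assume y: "y:car M'" "c (g (b' y)) = \<zero>\<^sub>N'"
  then have "g (b' y) = \<zero>\<^sub>N" using c(3)[of "g (b' y)"] cl z by metis
  then obtain x where x: "x:car L" "b' y = f x" using s(6) cl(4)[OF y(1)] by blast
  then have "y = b (f (a' (a x)))" using b(4)[OF y(1)] a(3)[OF x(1)] by simp
  then show "EX x:car L'. y = b (f (a' x))" using cl(1)[OF x(1)] by blast
 next
  show "(%y. c (g (b' y))) ` car M' = car N'"
  proof (intro equalityI subsetI)
   fix y assume "y:(%y. c (g (b' y))) ` car M'" then show "y:car N'" using cl by blast
  next
   fix n assume n: "n:car N'"
   then obtain m where m: "m:car M" "c' n = g m" using s(3) cl(6) by (metis imageE)
   then have "n = c (g (b' (b m)))" using b(3)[OF m(1)] c(4)[OF n] by simp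
   then show "n:(%y. c (g (b' y))) ` car M'" using cl(3)[OF m(1)] by blast
  qed
 qed
 then have t: "(L':C & M':C --> N':C) & (L':C & N':C --> M':C) & (M':C & N':C --> L':C)"
  using C fg' unfolding thick_subcategory_def by blast
 have i: "inC L \<longleftrightarrow> L':C" "inC M \<longleftrightarrow> M':C" "inC N \<longleftrightarrow> N':C"
  using inC_iff[OF fd'(1)] inC_iff[OF fd'(2)] inC_iff[OF fd'(3)]
   inC_iso[OF _ l'(1) iso(1)] inC_iso[OF _ l(1) module_iso_sym[OF l(1) iso(1)]]
   inC_iso[OF _ l'(2) iso(2)] inC_iso[OF _ l(2) module_iso_sym[OF l(2) iso(2)]]
   inC_iso[OF _ l'(3) iso(3)] inC_iso[OF _ l(3) module_iso_sym[OF l(3) iso(3)]] by blast+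
 show ?thesis unfolding i by (rule t)
qed

lemma
 assumes M: "fdm M" and U: "subm U M"
 shows inC_quot: "inC (M(|carrier := U|)) ==> inC M ==> inC (quot_module M U)"
  and inC_sub: "inC M ==> inC (quot_module M U) ==> inC (M(|carrier := U|))"
proof -
 note q = quot_module[OF fdmD(1)[OF M] U]
 have Uc: "U <= car M" using iffD1[OF left_module.subm_iff[OF fdmD(1)[OF M]] U] by blast
 have "short_exact \<Lambda> (M(|carrier := U|)) (%x. x) M (cmap M U) (quot_module M U)"
  by (rule short_exactI[OF lmod_sub[OF fdmD(1)[OF M] U] fdmD(1)[OF M] q(1) hom_incl[OF Uc] q(2) _ _ _ q(3)])
   (use q(4) Uc in auto)
 note inC_ses[OF fdm_sub[OF M U] M fdm_quot[OF M U] this]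
 then show "inC (M(|carrier := U|)) ==> inC M ==> inC (quot_module M U)"
  "inC M ==> inC (quot_module M U) ==> inC (M(|carrier := U|))" by blast+
qed

lemma inC_hom:
 assumes M: "fdm M" and N: "lmod N" and f: "f:mhom M N" "f ` car M = car N"
 defines "U == {x:car M. f x = \<zero>\<^sub>N}"
 shows "inC (M(|carrier := U|)) ==> inC M ==> inC N"
  and "inC M ==> inC N ==> inC (M(|carrier := U|))"
  and "inC (M(|carrier := U|)) ==> inC N ==> inC M"
proof -
 have U: "subm U M" unfolding U_def by (rule subm_kernel[OF fdmD(1)[OF M] N f(1)])
 have Uc: "U <= car M" by (auto simp: U_def)
 have "short_exact \<Lambda> (M(|carrier := U|)) (%x. x) M f N"
  by (rule short_exactI[OF lmod_sub[OF fdmD(1)[OF M] U] fdmD(1)[OF M] N hom_incl[OF Uc] f(1) _ _ _ f(2)])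
   (auto simp: U_def)
 note inC_ses[OF fdm_sub[OF M U] M fdm_image[OF M N f] this]
 then show "inC (M(|carrier := U|)) ==> inC M ==> inC N"
  "inC M ==> inC N ==> inC (M(|carrier := U|))" "inC (M(|carrier := U|)) ==> inC N ==> inC M" by blast+
qed

lemma inC_retract:
 fixes Q :: "('b, 'q) module"
 assumes Z: "inC Z" and Q: "lmod Q" and st: "\<sigma>:mhom Q Z" "\<rho>:mhom Z Q"
  "!!x. x:car Q ==> \<rho> (\<sigma> x) = x"
 shows "inC Q"
proof -
 have fZ: "fdm Z" by (rule inC_fdm[OF Z])
 note lZ = fdmD(1)[OF fZ]
 have "\<rho> ` car Z = car Q" using homD(1)[OF st(2)] homD(1)[OF st(1)] st(3) by (metis (no_types) equalityI image_eqI image_subsetI subsetI)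
 then have fQ: "fdm Q" by (rule fdm_image[OF fZ Q st(2)])
 let ?B = "Z(|carrier := {z:car Z. \<rho> z = \<zero>\<^sub>Q}|)"
 have fB: "fdm ?B" by (rule fdm_sub[OF fZ subm_kernel[OF lZ Q st(2)]])
 obtain Q' :: "('b, 'b list) module" where Q': "Q':fg_modules \<Lambda>" "module_iso \<Lambda> Q Q'"
  using fdm_representable[OF fQ] .
 obtain B' :: "('b, 'b list) module" where B': "B':fg_modules \<Lambda>" "module_iso \<Lambda> ?B B'"
  using fdm_representable[OF fB] .
 obtain Z' where Z': "Z':C" "module_iso \<Lambda> Z Z'" using Z by (auto simp: inC_def)
 have "module_iso \<Lambda> Z' (direct_prod Q' B')"
  using module_iso_trans[OF module_iso_trans[OF module_iso_sym[OF lZ Z'(2)] retract_iso[OF lZ Q st]]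
    direct_prod_iso_cong[OF Q'(2) B'(2) Q fdmD(1)[OF fB]]] .
 then have "Q':C" using C Z'(1) Q'(1) B'(1) unfolding thick_subcategory_def by blast
 then show ?thesis using Q'(2) fQ by (auto simp: inC_def)
qed

lemma inC_regular: "inC reg"
 using C_reg fdm_regular by (auto simp: inC_def contains_regular_def)

lemma inC_direct_prod:
 assumes "inC A" "inC B"
 shows "inC (direct_prod A B)"
proof -
 have fd: "fdm A" "fdm B" using assms inC_fdm by auto
 note l = fd[THEN fdmD(1)]
 interpret A: left_module \<Lambda> A by (rule l)
 interpret B: left_module \<Lambda> B by (rule l)
 have "short_exact \<Lambda> A (%x. (x, \<zero>\<^sub>B)) (direct_prod A B) snd B"
 proof (rule short_exactI[OF l(1) lmod_prod[OF l] l(2) hom_in1[OF l(2)] hom_snd])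
  show "snd ` car (direct_prod A B) = car B" using A.M.zero_closed by force
 qed auto
 then show ?thesis using inC_ses[OF fd(1) fdm_direct_prod[OF fd] fd(2)] assms by blast
qed

lemma inC_zero:
 assumes "lmod M" "car M = {\<zero>\<^sub>M}"
 shows "inC M"
 by (rule inC_retract[OF inC_regular assms(1) hom_zero_map[OF lmod_reg] hom_zero_map[OF assms(1)]])
  (use assms(2) in auto)

lemma inC_free: "inC (list_module reg n)"
proof (induction n)
 case 0
 show ?case by (rule inC_zero[OF lmod_list[OF lmod_reg] list_module_0[OF lmod_reg]])
next
 case (Suc n)
 show ?case
  by (rule inC_iso[OF inC_direct_prod[OF inC_regular Suc] lmod_list[OF lmod_reg]
    module_iso_sym[OF lmod_list[OF lmod_reg] list_module_Suc_iso[OF lmod_reg]]])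
qed

lemma fg_projectives_subset: "fg_projectives \<Lambda> <= C"
proof
 fix P assume P: "P:fg_projectives \<Lambda>"
 obtain n \<sigma> \<rho> where st: "\<sigma>:mhom P (list_module reg n)"
  "\<rho>:mhom (list_module reg n) P" "!!x. x:car P ==> \<rho> (\<sigma> x) = x"
  using free_retract[OF P] by metis
 have fP: "fdm P" using P fg_projectives_iff by blast
 have "inC P" by (rule inC_retract[OF inC_free fdmD(1)[OF fP] st])
 then show "P:C" using inC_iff[OF fP] by blast
qed

end

section \<open>Bounding the extension groups by the quiver\<close>

lemma hom_restrict:
 assumes "left_module R M" "f:module_hom R M N"
 shows "restrict f (car M):module_hom R M N"
proof -
 interpret M: left_module R M by fact
 show ?thesis by (rule module_homI) (use homD[OF assms(2)] M.smult_closed in auto)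
qed

context fd_algebra
begin

lemma Hom_space_simps:
 "car (Hom_space \<Lambda> M N) = mhom M N \<inter> extensional (car M)"
 "\<zero>\<^sub>(Hom_space \<Lambda> M N) = (\<lambda>x\<in>car M. \<zero>\<^sub>N)"
 "f \<oplus>\<^sub>(Hom_space \<Lambda> M N) g = (\<lambda>x\<in>car M. f x \<oplus>\<^sub>N g x)"
 "c \<odot>\<^sub>(Hom_space \<Lambda> M N) f = (\<lambda>x\<in>car M. emb c \<odot>\<^sub>N f x)"
 by (simp_all add: Hom_space_def emb_def)

lemma hom_emb:
 assumes "lmod N" "f:mhom M N" "c:car K"
 shows "(%x. emb c \<odot>\<^sub>N f x):mhom M N"
proof -
 interpret N: left_module \<Lambda> N by fact
 show ?thesis
 proof (rule module_homI)
  fix a x assume "a:car \<Lambda>" "x:car M"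
  then show "emb c \<odot>\<^sub>N f (a \<odot>\<^sub>M x) = a \<odot>\<^sub>N (emb c \<odot>\<^sub>N f x)"
   using homD(1,3)[OF assms(2)] assms(3) N.smult_assoc1[of "emb c" a "f x"] N.smult_assoc1[of a "emb c" "f x"]
    emb_commute[of c a] by simp
 qed (use homD(1,2)[OF assms(2)] assms(3) in \<open>auto simp: N.smult_r_distr N.smult_closed\<close>)
qed

lemma lmod_Hom_space:
 assumes lM: "lmod M" and lN: "lmod N"
 shows "left_module K (Hom_space \<Lambda> M N)"
proof -
 interpret N: left_module \<Lambda> N by fact
 let ?H = "Hom_space \<Lambda> M N"
 have mem: "restrict h (car M):car ?H" if "h:mhom M N" for h
  using hom_restrict[OF lM that] by (simp add: Hom_space_simps)
 have ext: "f = g" if "f:car ?H" "g:car ?H" "!!x. x:car M ==> f x = g x" for f g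
  using that by (intro extensionalityI[of f "car M" g]) (auto simp: Hom_space_simps)
 have v: "f:mhom M N" if "f:car ?H" for f using that by (simp add: Hom_space_simps)
 note vc = homD(1)[OF v]
 have ac: "f \<oplus>\<^sub>?H g:car ?H" if "f:car ?H" "g:car ?H" for f g
  unfolding Hom_space_simps(3) by (rule mem[OF hom_add[OF lM lN v[OF that(1)] v[OF that(2)]]])
 have zc: "\<zero>\<^sub>?H:car ?H"
  unfolding Hom_space_simps(2) by (rule mem[OF hom_zero_map[OF lN]])
 have sc: "c \<odot>\<^sub>?H f:car ?H" if "c:car K" "f:car ?H" for c f
  unfolding Hom_space_simps(4) by (rule mem[OF hom_emb[OF lN v[OF that(2)] that(1)]])
 have ap: "(f \<oplus>\<^sub>?H g) x = f x \<oplus>\<^sub>N g x" "\<zero>\<^sub>?H x = \<zero>\<^sub>N" "(c \<odot>\<^sub>?H f) x = emb c \<odot>\<^sub>N f x"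
  if "x:car M" for f g c x using that by (simp_all add: Hom_space_simps)
 have "abelian_group ?H"
 proof (rule abelian_groupI)
  fix f g h assume f: "f:car ?H" and g: "g:car ?H" and h: "h:car ?H"
  show "f \<oplus>\<^sub>?H g \<oplus>\<^sub>?H h = f \<oplus>\<^sub>?H (g \<oplus>\<^sub>?H h)"
   by (rule ext) (use f g h ac ap vc in \<open>simp_all add: N.M.a_assoc\<close>)
 next
  fix f g assume f: "f:car ?H" and g: "g:car ?H"
  show "f \<oplus>\<^sub>?H g = g \<oplus>\<^sub>?H f"
   by (rule ext) (use f g ac ap vc in \<open>simp_all add: N.M.a_comm\<close>)
 next
  fix f assume f: "f:car ?H"
  show "\<zero>\<^sub>?H \<oplus>\<^sub>?H f = f"
   by (rule ext) (use f ac zc ap vc in simp_all)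
  let ?g = "restrict (%x. \<zero>\<^sub>N \<ominus>\<^sub>N f x) (car M)"
  have g: "?g:car ?H" by (rule mem[OF hom_diff[OF lM lN hom_zero_map[OF lN] v[OF f]]])
  have "?g \<oplus>\<^sub>?H f = \<zero>\<^sub>?H"
   by (rule ext) (use f g ac zc ap vc N.M.add_minus_cancel in simp_all)
  then show "EX y:car ?H. y \<oplus>\<^sub>?H f = \<zero>\<^sub>?H" using g by blast
 qed (use ac zc in auto)
 then show ?thesis
 proof (intro left_module.intro left_module_axioms.intro)
  show "ring K" using field_K by (simp add: field_def domain_def cring_def)
  show "(a \<oplus>\<^sub>K b) \<odot>\<^sub>?H f = a \<odot>\<^sub>?H f \<oplus>\<^sub>?H b \<odot>\<^sub>?H f"
   if "a:car K" "b:car K" "f:car ?H" for a b f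
   by (rule ext) (use that lmod_ring[OF lmod_K] ac sc ap vc in \<open>simp_all add: emb_add N.smult_l_distr ring.ring_simprules(1)\<close>)
  show "a \<odot>\<^sub>?H (f \<oplus>\<^sub>?H g) = a \<odot>\<^sub>?H f \<oplus>\<^sub>?H a \<odot>\<^sub>?H g"
   if "a:car K" "f:car ?H" "g:car ?H" for a f g
   by (rule ext) (use that ac sc ap vc in \<open>simp_all add: N.smult_r_distr\<close>)
  show "a \<otimes>\<^sub>K b \<odot>\<^sub>?H f = a \<odot>\<^sub>?H (b \<odot>\<^sub>?H f)"
   if "a:car K" "b:car K" "f:car ?H" for a b f
   by (rule ext) (use that lmod_ring[OF lmod_K] ac sc ap vc in \<open>simp_all add: emb_mult N.smult_assoc1 ring.ring_simprules(5)\<close>)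
  show "\<one>\<^sub>K \<odot>\<^sub>?H f = f" if "f:car ?H" for f
   by (rule ext) (use that lmod_ring[OF lmod_K] ac sc ap vc in \<open>simp_all add: emb_one N.smult_one ring.ring_simprules(6)\<close>)
 qed (use sc in auto)
qed

lemma resolution_exists:
 fixes M :: "('a, 'a list) module"
 assumes "fdm M"
 shows "EX P d. projective_resolution \<Lambda> M P d"
proof -
 have "EX q. fdm N --> fst q:fg_projectives \<Lambda> & snd q:mhom (fst q) N & snd q ` car (fst q) = car N"
  for N :: "('a, 'a list) module"
 proof (cases "fdm N")
  case True
  show ?thesis
   by (rule free_cover[OF True]) (use free_in_fg_projectives in \<open>metis fst_conv snd_conv\<close>)
 qed simp
 then obtain q where q: "!!N :: ('a, 'a list) module. fdm N --> fst (q N):fg_projectives \<Lambda>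
  & snd (q N):mhom (fst (q N)) N & snd (q N) ` car (fst (q N)) = car N"
  by metis
 define F where "F N = fst (q N)" for N
 define p where "p N = snd (q N)" for N
 have Fp: "F N:fg_projectives \<Lambda>" "p N:mhom (F N) N" "p N ` car (F N) = car N"
  if "fdm N" for N using q that by (auto simp: F_def p_def)
 \<comment> \<open>The successive syzygies. They stay in the universe because the free covers are
   modules of lists.\<close>
 define N where "N = rec_nat M (%_ N. (F N)(|carrier := a_kernel (F N) N (p N)|))"
 have NS: "N (Suc n) = (F (N n))(|carrier := a_kernel (F (N n)) (N n) (p (N n))|)" for n by (simp add: N_def)
 have N0: "N 0 = M" by (simp add: N_def)
 have fF: "fdm (F N)" if "fdm N" for N using Fp(1)[OF that] fg_projectives_iff by blast
 have fN: "fdm (N n)" for n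
 proof (induction n)
  case 0
  then show ?case using assms N0 by simp
 next
  case (Suc n)
  then show ?case
   unfolding NS a_kernel_eq by (intro fdm_sub fF subm_kernel[OF fdmD(1)[OF fF] fdmD(1) Fp(2)])
 qed
 have "projective_resolution \<Lambda> M (%n. F (N n)) (%n. p (N n))"
  unfolding projective_resolution_def
 proof (intro conjI allI)
  show "p (N (Suc n)):mhom (F (N (Suc n))) (F (N n))" for n
  proof -
   have c: "car (N (Suc n)) <= car (F (N n))" "add (N (Suc n)) = add (F (N n))"
    "smult (N (Suc n)) = smult (F (N n))" by (auto simp: NS a_kernel_eq)
   show ?thesis
    by (rule module_homI) (use homD[OF Fp(2)[OF fN[of "Suc n"]]] c in auto)
  qed
  show "p (N (Suc (Suc n))) ` car (F (N (Suc (Suc n)))) = a_kernel (F (N (Suc n))) (F (N n)) (p (N (Suc n)))" for n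
   using Fp(3)[OF fN[of "Suc (Suc n)"]] NS[of "Suc n"] NS[of n] by (simp add: a_kernel_eq)
  show "p (N (Suc 0)) ` car (F (N (Suc 0))) = a_kernel (F (N 0)) M (p (N 0))"
   using Fp(3)[OF fN[of "Suc 0"]] NS[of 0] N0 by simp
 qed (use Fp[OF fN] N0 in \<open>simp_all add: Fp[OF assms]\<close>)
 then show ?thesis by blast
qed

end

context ws_algebra
begin

text \<open>A spanning list of a complement of \<open>e i U\<close> in \<open>e i M\<close>, with as
  many members as its dimension; together with \<open>U\<close> it captures everything fixed by
  \<open>e i\<close>.\<close>

lemma isotypic_generators:
 assumes M: "fdm M" and U: "subm U M" and i: "i < r"
 obtains us where "length us = dv M i (car M) - dv M i U" "!!u. u:set us ==> u:car M & e i \<odot>\<^sub>M u = u"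
  "!!T u. subm T M ==> U <= T ==> set us <= T ==> u:car M ==> e i \<odot>\<^sub>M u = u ==> u:T"
proof -
 note lM = fdmD(1)[OF M]
 interpret M: left_module \<Lambda> M by (rule lM)
 let ?U = "{x:U. e i \<odot>\<^sub>M x = x}" and ?V = "{x:car M. e i \<odot>\<^sub>M x = x}"
 have kU: "ksub M ?U" by (rule ksub_idem[OF lM U e_closed[OF i]])
 have kV: "ksub M ?V" by (rule ksub_idem[OF lM M.carrier_subm e_closed[OF i]])
 have sub: "?U <= ?V" using iffD1[OF M.subm_iff U] by blast
 interpret R: vspace K "KV M" by (rule vspace_KV[OF lM])
 show thesis
 proof (rule kdim_complement[OF M kU kV sub])
  fix A assume A: "ksub M A" "A <= ?V" "A \<inter> ?U = {\<zero>\<^sub>M}"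
   "!!v. v:?V ==> EX a:A. EX u:?U. v = a \<oplus>\<^sub>M u" "kdim M ?V = kdim M A + kdim M ?U"
  interpret A: vspace K "(KV M)(|carrier := A|)" by (rule R.vspace_sub[OF A(1)])
  show thesis
  proof (rule A.dim_generators[OF R.fin_dim_sub[OF fdmD(2)[OF M] A(1)]])
   fix us assume us: "length us = vectorspace.dim K ((KV M)(|carrier := A|))"
    "set us <= car ((KV M)(|carrier := A|))"
    "!!T. Module.submodule T K ((KV M)(|carrier := A|)) ==> set us <= T ==> T = car ((KV M)(|carrier := A|))"
   show thesis
   proof (rule that[of us])
    show "length us = dv M i (car M) - dv M i U" using us(1) A(5) by (simp add: edim_def kdim_def)
    show "u:car M & e i \<odot>\<^sub>M u = u" if "u:set us" for u using that us(2) A(2) by auto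
    fix T u assume T: "subm T M" "U <= T" "set us <= T" and u: "u:car M" "e i \<odot>\<^sub>M u = u"
    have "Module.submodule (T \<inter> A) K ((KV M)(|carrier := A|))"
     using subm_sub_iff[OF R.left_module_axioms A(1)] R.subm_Int[OF subm_KV[OF lM T(1)] A(1)] by simp
    then have TA: "T \<inter> A = A" using us(3)[of "T \<inter> A"] us(2) T(3) by simp
    obtain a v where av: "a:A" "v:?U" "u = a \<oplus>\<^sub>M v" using A(4)[of u] u by auto
    then have "a:T" "v:T" using TA T(2) by auto
    then show "u:T" using av(3) iffD1[OF M.subm_iff T(1)] by blast
   qed
  qed
 qed
qed

text \<open>The arrows from \<open>i\<close> to \<open>j\<close>, as elements of the radical of
  \<open>Pm i\<close> that span the part fixed by \<open>e j\<close> modulo the second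
  layer.\<close>

lemma arrows:
 assumes i: "i < r" and j: "j < r"
 obtains us where "length us = E i j" "!!u. u:set us ==> u:Je i & e j \<otimes> u = u"
  "!!T u. lideal T ==> Rj i <= T ==> set us <= T ==> u:Je i ==> e j \<otimes> u = u ==> u:T"
proof -
 have R: "subm (Rj i) (Jm i)" unfolding Rj_def by (rule rad_subm[OF lmod_Jm[OF i]])
 show thesis
 proof (rule isotypic_generators[OF fdm_sub[OF fdm_regular Je_lideal[OF i]] R j])
  fix us assume us: "length us = dv (Jm i) j (car (Jm i)) - dv (Jm i) j (Rj i)"
   "!!u. u:set us ==> u:car (Jm i) & e j \<odot>\<^sub>(Jm i) u = u"
   "!!T u. subm T (Jm i) ==> Rj i <= T ==> set us <= T ==> u:car (Jm i) ==> e j \<odot>\<^sub>(Jm i) u = u ==> u:T"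
  show thesis
  proof (rule that[of us])
   show "length us = E i j" by (simp add: us(1) E_def)
   show mem: "u:Je i & e j \<otimes> u = u" if "u:set us" for u using us(2)[OF that] by simp
   fix T u assume T: "lideal T" "Rj i <= T" "set us <= T" and u: "u:Je i" "e j \<otimes> u = u"
   have "subm (T \<inter> Je i) (Jm i)"
    using subm_sub_iff[OF lmod_reg Je_lideal[OF i]] left_module.subm_Int[OF lmod_reg T(1) Je_lideal[OF i]] by simp
   then show "u:T" using us(3)[of "T \<inter> Je i" u] T(2,3) mem Rj_lideal(2)[OF i] u by auto
  qed
 qed
qed

lemma fdm_S: "i < r ==> fdm (S i)"
proof -
 assume i: "i < r"
 note lS = simpleD(1)[OF S_simple[OF i]]
 obtain s where s: "atom (S i) i s" using S_atom[OF i] by blast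
 show "fdm (S i)"
  by (rule fdm_image[OF fdm_regular lS cyc_hom[OF lS atomD(2)[OF s]]])
   (use S_cyc[OF i s] in \<open>simp add: cyc_def\<close>)
qed

text \<open>The resolution is a chosen one and need not be minimal, so it is compared with the
  projective cover through a lift \<open>h\<close> from \<open>Pm i\<close> to \<open>P 0\<close>.
  The map \<open>h\<close> carries \<open>Je i\<close> into the image of the first differential. A
  cocycle is tested at preimages of the arrows; if these \<open>E i j\<close> values vanish it
  vanishes on all preimages of \<open>Je i\<close>, and then it extends over \<open>P 0\<close>,
  that is, it is a coboundary.\<close>

lemma ext_le:
 assumes i: "i < r" and j: "j < r"
 shows "vectorspace.dim K (Ext \<Lambda> 1 (S i) (S j)) <= E i j"
proof -
 define Pd where "Pd = (SOME (P, d). projective_resolution \<Lambda> (S i) P d)"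
 obtain P d where Pd: "Pd = (P, d)" by (cases Pd)
 have "EX Pd. case Pd of (P, d) => projective_resolution \<Lambda> (S i) P d"
  using resolution_exists[OF fdm_S[OF i]] by auto
 from someI_ex[OF this] have "projective_resolution \<Lambda> (S i) P d" using Pd by (simp add: Pd_def)
 note res = this[unfolded projective_resolution_def a_kernel_eq]
 have fP: "fdm (P n)" for n using conjunct1[OF res, THEN spec, of n] by (simp only: fg_projectives_iff)
 note lP = fdmD(1)[OF fP]
 have d0: "d 0:mhom (P 0) (S i)" "d 0 ` car (P 0) = car (S i)"
  and d1: "d (Suc 0):mhom (P (Suc 0)) (P 0)" "d (Suc 0) ` car (P (Suc 0)) = {x:car (P 0). d 0 x = \<zero>\<^sub>(S i)}"
  and d2: "d (Suc (Suc 0)):mhom (P (Suc (Suc 0))) (P (Suc 0))"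
   "d (Suc (Suc 0)) ` car (P (Suc (Suc 0))) = {x:car (P (Suc 0)). d (Suc 0) x = \<zero>\<^sub>(P 0)}"
  using res by blast+
 note lSi = simpleD(1)[OF S_simple[OF i]] and lSj = simpleD(1)[OF S_simple[OF j]]
 interpret P0: left_module \<Lambda> "P 0" by (rule lP)
 interpret P1: left_module \<Lambda> "P (Suc 0)" by (rule lP)
 interpret Si: left_module \<Lambda> "S i" by (rule lSi)
 interpret Sj: left_module \<Lambda> "S j" by (rule lSj)
 obtain s where s: "atom (S i) i s" using S_atom[OF i] by blast
 obtain t where t: "atom (S j) j t" using S_atom[OF j] by blast
 obtain h where h: "h:mhom (Pm i) (P 0)" "!!x. x:Pc i ==> d 0 (h x) = x \<odot>\<^sub>(S i) s"
  using Pm_lift[OF i lP lSi d0 Pm_hom[OF lSi atomD(2)[OF s] i]] by auto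
 note hD = homD[OF h(1), simplified]
 have h0: "h \<zero> = \<zero>\<^sub>(P 0)" using hom_zero[OF lmod_Pm[OF i] lP h(1)] by simp
 have JeP: "x:Pc i" "x:car \<Lambda>" if "x:Je i" for x using that Pc_closed by (auto simp: Je_def)
 have lift: "EX y:car (P (Suc 0)). d (Suc 0) y = h x" if "x:Je i" for x
 proof -
  have "d 0 (h x) = \<zero>\<^sub>(S i)" using h(2)[OF JeP(1)[OF that]] Pm_annihilator[OF i lSi s JeP(1)[OF that]] that by simp
  then have "h x:d (Suc 0) ` car (P (Suc 0))" using d1(2) hD(1)[OF JeP(1)[OF that]] by blast
  then show ?thesis by (metis imageE)
 qed
 note d1D = homD[OF d1(1)]
 have d11: "d (Suc 0) \<zero>\<^sub>(P (Suc 0)) = \<zero>\<^sub>(P 0)" by (rule hom_zero[OF lP lP d1(1)])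
 obtain us where us: "length us = E i j" "!!u. u:set us ==> u:Je i & e j \<otimes> u = u"
  "!!T u. lideal T ==> Rj i <= T ==> set us <= T ==> u:Je i ==> e j \<otimes> u = u ==> u:T"
  by (rule arrows[OF i j]) (rule that, assumption, blast, blast)
 \<comment> \<open>The preimages are normalised by \<open>e j\<close>, so a cocycle takes them into
   the line of \<open>S j\<close> fixed by \<open>e j\<close>, where the single functional
   \<open>\<theta>\<close> decides vanishing.\<close>
 have "EX y. y:car (P (Suc 0)) & d (Suc 0) y = h u & e j \<odot>\<^sub>(P (Suc 0)) y = y" if "u:set us" for u
 proof -
  obtain y where y: "y:car (P (Suc 0))" "d (Suc 0) y = h u" using lift us(2) \<open>u:set us\<close> by blast
  have "d (Suc 0) (e j \<odot>\<^sub>(P (Suc 0)) y) = h u"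
   using d1D(3)[OF e_closed[OF j] y(1)] y(2) hD(3)[of "e j" u] us(2)[OF that] JeP(1) j by simp
  moreover have "e j \<odot>\<^sub>(P (Suc 0)) (e j \<odot>\<^sub>(P (Suc 0)) y) = e j \<odot>\<^sub>(P (Suc 0)) y"
   using P1.smult_assoc1[of "e j" "e j" y] e_idem[OF j] j y by simp
  ultimately show ?thesis
   using P1.smult_closed[OF e_closed[OF j] y(1)] by (intro exI[of _ "e j \<odot>\<^sub>(P (Suc 0)) y"] conjI)
 qed
 then obtain Y where Y: "!!u. u:set us ==> Y u:car (P (Suc 0)) & d (Suc 0) (Y u) = h u & e j \<odot>\<^sub>(P (Suc 0)) Y u = Y u"
  by metis
 interpret Vj: vspace K "KV (S j)" by (rule vspace_KV[OF lSj])
 have tk: "t:car (KV (S j))" "t ~= \<zero>\<^sub>(KV (S j))" using atomD[OF t] by auto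
 obtain \<theta> where th: "\<theta>:module_hom K (KV (S j)) (regular_module K)" "\<theta> t ~= \<zero>\<^sub>K"
  by (rule Vj.functional_exists[OF fdmD(2)[OF fdm_S[OF j]] tk])
 note thD = homD[OF th(1), simplified]
 let ?H = "Hom_space \<Lambda> (P (Suc 0)) (S j)" and ?G = "Hom_space \<Lambda> (P 0) (S j)"
 define Z where "Z = Ext_cocycles \<Lambda> P d (Suc 0) (S j)"
 define B where "B = Ext_coboundaries \<Lambda> P d (Suc 0) (S j)"
 note lH = lmod_Hom_space[OF lP lSj]
 interpret H: left_module K ?H by (rule lH)
 have Zmem: "f:Z \<longleftrightarrow> f:car ?H & (ALL x:car (P (Suc (Suc 0))). f (d (Suc (Suc 0)) x) = \<zero>\<^sub>(S j))" for f
  by (simp add: Z_def Ext_cocycles_def)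
 have d2c: "d (Suc (Suc 0)) x:car (P (Suc 0))" if "x:car (P (Suc (Suc 0)))" for x
  by (rule homD(1)[OF d2(1) that])
 have subZ: "Module.submodule Z K ?H"
 proof (rule H.left_submoduleI)
  show "Z <= car ?H" using Zmem by blast
  show "\<zero>\<^sub>?H:Z" using Zmem H.M.zero_closed d2c by (simp add: Hom_space_simps(2))
  show "a \<oplus>\<^sub>?H b:Z" if "a:Z" "b:Z" for a b
   using that H.M.a_closed[of a b] d2c unfolding Zmem by (simp add: Hom_space_simps(3))
  show "a \<odot>\<^sub>?H b:Z" if "a:car K" "b:Z" for a b
   using that H.smult_closed[of a b] d2c Sj.smult_zero[of "emb a"] unfolding Zmem by (simp add: Hom_space_simps(4))
 qed
 define \<Phi> where "\<Phi> g = (\<lambda>x\<in>car (P (Suc 0)). g (d (Suc 0) x))" for g :: "'b list => 'b list"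
 have B: "B = \<Phi> ` car ?G" by (simp add: B_def Ext_coboundaries_def \<Phi>_def[abs_def])
 have \<Phi>c: "\<Phi> g:car ?H" if "g:mhom (P 0) (S j)" for g
  using hom_restrict[OF lP hom_comp[OF d1(1) that]] by (simp add: \<Phi>_def Hom_space_simps(1))
 have \<Phi>: "\<Phi>:module_hom K ?G ?H"
 proof (rule module_homI)
  show "\<Phi> g:car ?H" if "g:car ?G" for g using \<Phi>c that by (simp add: Hom_space_simps(1))
  show "\<Phi> (f \<oplus>\<^sub>?G g) = \<Phi> f \<oplus>\<^sub>?H \<Phi> g" for f g
   unfolding \<Phi>_def Hom_space_simps(3) by (rule restrict_ext) (use d1D(1) in simp)
  show "\<Phi> (c \<odot>\<^sub>?G g) = c \<odot>\<^sub>?H \<Phi> g" for c g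
   unfolding \<Phi>_def Hom_space_simps(4) by (rule restrict_ext) (use d1D(1) in simp)
 qed
 have d12: "d (Suc 0) (d (Suc (Suc 0)) x) = \<zero>\<^sub>(P 0)" if "x:car (P (Suc (Suc 0)))" for x
  using d2(2) that by blast
 have BZ: "B <= Z"
 proof
  fix f assume "f:B"
  then obtain g where g: "g:car ?G" "f = \<Phi> g" unfolding B by blast
  then have gh: "g:mhom (P 0) (S j)" by (simp add: Hom_space_simps(1))
  have "f (d (Suc (Suc 0)) x) = \<zero>\<^sub>(S j)" if "x:car (P (Suc (Suc 0)))" for x
   using g(2) d2c[OF that] d12[OF that] hom_zero[OF lP lSj gh] by (simp add: \<Phi>_def)
  then show "f:Z" using \<Phi>c[OF gh] g(2) Zmem by simp
 qed
 have subB: "Module.submodule B K (?H(|carrier := Z|))"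
  using subm_sub_iff[OF lH subZ] BZ
   subm_image[OF lmod_Hom_space[OF lP lSj] lH \<Phi> left_module.carrier_subm[OF lmod_Hom_space[OF lP lSj]]]
  unfolding B by blast
 have "vectorspace.dim K (quot_module (?H(|carrier := Z|)) B) <= length (map (%u f. \<theta> (f (Y u))) us)"
 proof (rule dim_quot_le_functionals[OF field_K lmod_sub[OF lH subZ] subB])
  fix \<phi> assume "\<phi>:set (map (%u f. \<theta> (f (Y u))) us)"
  then obtain u where u: "u:set us" "\<phi> = (%f. \<theta> (f (Y u)))" by auto
  have fc: "f (Y u):car (S j)" if "f:Z" for f
   using that Y[OF u(1)] homD(1)[of f \<Lambda> "P (Suc 0)" "S j"] by (simp add: Zmem Hom_space_simps(1))
  show "\<phi>:module_hom K (?H(|carrier := Z|)) (regular_module K)"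
   unfolding u(2) by (rule module_homI) (use Y[OF u(1)] fc thD in \<open>simp_all add: Hom_space_simps(3,4)\<close>)
 next
  fix f assume fZ0: "f:car (?H(|carrier := Z|))"
   and ker: "!!\<phi>. \<phi>:set (map (%u f. \<theta> (f (Y u))) us) ==> \<phi> f = \<zero>\<^sub>K"
  have fZ: "f:Z" using fZ0 by simp
  have f: "f:mhom (P (Suc 0)) (S j)" "f:extensional (car (P (Suc 0)))"
   using fZ by (simp_all add: Zmem Hom_space_simps(1))
  note fD = homD[OF f(1)]
  have f00: "f \<zero>\<^sub>(P (Suc 0)) = \<zero>\<^sub>(S j)" by (rule hom_zero[OF lP lSj f(1)])
  have f0: "f y = \<zero>\<^sub>(S j)" if "y:car (P (Suc 0))" "d (Suc 0) y = \<zero>\<^sub>(P 0)" for y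
  proof -
   have "y:d (Suc (Suc 0)) ` car (P (Suc (Suc 0)))" using d2(2) that by blast
   then show ?thesis using fZ Zmem by blast
  qed
  \<comment> \<open>A cocycle kills the kernel of the first differential by exactness, so its value
    depends only on the image in \<open>P 0\<close>.\<close>
  have fdet: "f y = f y'" if y: "y:car (P (Suc 0))" "y':car (P (Suc 0))" "d (Suc 0) y = d (Suc 0) y'" for y y'
  proof -
   have "d (Suc 0) (y \<ominus>\<^sub>(P (Suc 0)) y') = \<zero>\<^sub>(P 0)"
    using hom_minus[OF lP lP d1(1) y(1,2)] P0.M.minus_eq_zero_iff[OF d1D(1)[OF y(1)] d1D(1)[OF y(2)]] y(3) by simp
   then have "f (y \<ominus>\<^sub>(P (Suc 0)) y') = \<zero>\<^sub>(S j)" using f0 y by simp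
   then show ?thesis
    using hom_minus[OF lP lSj f(1) y(1,2)] Sj.M.minus_eq_zero_iff[OF fD(1)[OF y(1)] fD(1)[OF y(2)]] by simp
  qed
  have fY: "f (Y u) = \<zero>\<^sub>(S j)" if u: "u:set us" for u
  proof -
   note Yu = Y[OF u]
   have fc: "f (Y u):car (S j)" using Yu fD(1) by blast
   then obtain x where x: "x:car \<Lambda>" "f (Y u) = x \<odot>\<^sub>(S j) t" using S_cyc[OF j t] by (auto simp: cyc_def)
   have "f (Y u) = e j \<odot>\<^sub>(S j) (x \<odot>\<^sub>(S j) t)" using fD(3)[OF e_closed[OF j], of "Y u"] Yu x(2) by simp
   then have fe: "f (Y u) = emb (\<kappa> j x) \<odot>\<^sub>(S j) t"
    using e_corner_atom[OF lSj j x(1) atomD(1,3)[OF t]] by simp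
   have kc: "\<kappa> j x:car K" by (rule \<kappa>(1)[OF j x(1)])
   have "\<theta> (f (Y u)) = \<zero>\<^sub>K" using ker u by auto
   then have "\<kappa> j x \<otimes>\<^sub>K \<theta> t = \<zero>\<^sub>K" using thD(3)[OF kc atomD(2)[OF t]] fe by simp
   then have "\<kappa> j x = \<zero>\<^sub>K"
    using th(2) thD(1)[OF atomD(2)[OF t]] kc domain.integral[OF field.axioms(1)[OF field_K]] by blast
   then show ?thesis using fe emb_zero Sj.zero_smult[OF atomD(2)[OF t]] by simp
  qed
  \<comment> \<open>The elements of \<open>Je i\<close> with a preimage killed by \<open>f\<close>.
    They form a left ideal that contains the second layer, because \<open>J\<close> acts as zero on
    \<open>S j\<close>, and that contains the arrows by assumption.\<close>
  define T where "T = {u:Je i. EX y:car (P (Suc 0)). d (Suc 0) y = h u & f y = \<zero>\<^sub>(S j)}"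
  have Tin: "v:T" if "d (Suc 0) y = h v" "f y = \<zero>\<^sub>(S j)" "v:Je i" "y:car (P (Suc 0))" for v y
   using that unfolding T_def by (intro CollectI conjI bexI[of _ y])
  note JD = iffD1[OF lideal_iff Je_lideal[OF i]]
  have lT: "lideal T"
   unfolding lideal_iff
  proof (intro conjI ballI)
   show "T <= car \<Lambda>" using JeP by (auto simp: T_def)
   show "\<zero>:T" using JD d11 h0 f00 P1.M.zero_closed by (intro Tin[of "\<zero>\<^sub>(P (Suc 0))"]) auto
   fix u assume u: "u:T"
   then obtain y where y: "y:car (P (Suc 0))" "d (Suc 0) y = h u" "f y = \<zero>\<^sub>(S j)" "u:Je i" by (auto simp: T_def)
   { fix v assume v: "v:T"
    then obtain z where z: "z:car (P (Suc 0))" "d (Suc 0) z = h v" "f z = \<zero>\<^sub>(S j)" "v:Je i" by (auto simp: T_def)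
    have "d (Suc 0) (y \<oplus>\<^sub>(P (Suc 0)) z) = h (u \<oplus> v)" using d1D(2)[OF y(1) z(1)] hD(2)[OF JeP(1)[OF y(4)] JeP(1)[OF z(4)]] y z by simp
    moreover have "f (y \<oplus>\<^sub>(P (Suc 0)) z) = \<zero>\<^sub>(S j)" using fD(2)[OF y(1) z(1)] y z by simp
    ultimately show "u \<oplus> v:T" by (rule Tin) (use y(1,4) z(1,4) JD P1.M.a_closed in auto) }
   fix a assume a: "a:car \<Lambda>"
   have "d (Suc 0) (a \<odot>\<^sub>(P (Suc 0)) y) = h (a \<otimes> u)" using d1D(3)[OF a y(1)] hD(3)[OF a JeP(1)[OF y(4)]] y by simp
   moreover have "f (a \<odot>\<^sub>(P (Suc 0)) y) = \<zero>\<^sub>(S j)" using fD(3)[OF a y(1)] y Sj.smult_zero[OF a] by simp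
   ultimately show "a \<otimes> u:T" by (rule Tin) (use a y(1,4) JD P1.smult_closed in auto)
  qed
  have "Rj i <= T"
   unfolding Rj_def
  proof (rule rad_least)
   show "subm T (Jm i)"
    using subm_sub_iff[OF lmod_reg Je_lideal[OF i]] lT by (auto simp: T_def)
   fix a x assume a: "a:J" and x: "x:car (Jm i)"
   then have xJ: "x:Je i" by simp
   obtain y where y: "y:car (P (Suc 0))" "d (Suc 0) y = h x" using lift[OF xJ] by blast
   have "d (Suc 0) (a \<odot>\<^sub>(P (Suc 0)) y) = h (a \<otimes> x)" using d1D(3)[OF J_sub[OF a] y(1)] hD(3)[OF J_sub[OF a] JeP(1)[OF xJ]] y by simp
   moreover have "f (a \<odot>\<^sub>(P (Suc 0)) y) = \<zero>\<^sub>(S j)"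
    using fD(3)[OF J_sub[OF a] y(1)] simple_kill[OF S_simple[OF j] fD(1)[OF y(1)] a] by simp
   ultimately have "a \<otimes> x:T" by (rule Tin) (use J_sub[OF a] y(1) JD xJ P1.smult_closed in auto)
   then show "a \<odot>\<^sub>(Jm i) x:T" by simp
  qed
  moreover have "set us <= T" using us(2) Y fY by (intro subsetI Tin[of "Y _"]) auto
  ultimately have eT: "u:T" if "u:Je i" "e j \<otimes> u = u" for u using us(3)[OF lT] that by blast
  \<comment> \<open>A nonzero value would survive some multiplication followed by
    \<open>e j\<close>, since the other idempotents kill \<open>S j\<close>; the same multiple of
    \<open>x\<close> lies in \<open>T\<close>.\<close>
  have fJ: "f y = \<zero>\<^sub>(S j)" if x: "x:Je i" and y: "y:car (P (Suc 0))" "d (Suc 0) y = h x" for x y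
  proof (rule ccontr)
   assume ne: "f y ~= \<zero>\<^sub>(S j)"
   obtain l a where la: "l < r" "a:car \<Lambda>" "e l \<odot>\<^sub>(S j) (a \<odot>\<^sub>(S j) f y) ~= \<zero>\<^sub>(S j)"
    using detect[OF lSj fD(1)[OF y(1)] ne] .
   have "l = j" using e_kill_S[OF la(1) j] la fD(1)[OF y(1)] Sj.smult_closed by blast
   let ?u = "e j \<otimes> (a \<otimes> x)"
   have "a \<otimes> x:Je i" using JD la x by blast
   then have uJ: "?u:Je i" using JD j by auto
   have "e j \<otimes> ?u = ?u" using e_idem[OF j] j la JeP(2)[OF x] by (simp add: Alg.m_assoc[symmetric])
   then obtain y' where y': "y':car (P (Suc 0))" "d (Suc 0) y' = h ?u" "f y' = \<zero>\<^sub>(S j)"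
    using eT[OF uJ] by (auto simp: T_def)
   let ?z = "e j \<odot>\<^sub>(P (Suc 0)) (a \<odot>\<^sub>(P (Suc 0)) y)"
   have ay: "a \<odot>\<^sub>(P (Suc 0)) y:car (P (Suc 0))" using la y P1.smult_closed by blast
   have "d (Suc 0) ?z = e j \<odot>\<^sub>(P 0) (a \<odot>\<^sub>(P 0) h x)"
    using d1D(3)[OF e_closed[OF j] ay] d1D(3)[OF la(2) y(1)] y by simp
   also have "\<dots> = h ?u"
    using hD(3)[OF e_closed[OF j] JeP(1)[OF \<open>a \<otimes> x:Je i\<close>]] hD(3)[OF la(2) JeP(1)[OF x]] by simp
   finally have "f ?z = \<zero>\<^sub>(S j)" using fdet[of ?z y'] y' ay P1.smult_closed[OF e_closed[OF j] ay] by simp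
   then show False using la(3) \<open>l = j\<close> fD(3)[OF e_closed[OF j] ay] fD(3)[OF la(2) y(1)] by simp
  qed
  \<comment> \<open>\<open>P 0\<close> is the sum of the image of \<open>h\<close> and the image of
    the differential. Taking zero on the first and \<open>f\<close> on the second is consistent,
    because the overlap comes from \<open>Je i\<close>.\<close>
  let ?D = "direct_prod (Pm i) (P (Suc 0))"
  let ?p = "%z. h (fst z) \<oplus>\<^sub>(P 0) d (Suc 0) (snd z)"
  note lD = lmod_prod[OF lmod_Pm[OF i] lP[of "Suc 0"]]
  have p: "?p:mhom ?D (P 0)" by (rule hom_copair[OF lmod_Pm[OF i] lP lP h(1) d1(1)])
  have surj: "?p ` car ?D = car (P 0)"
  proof (intro equalityI subsetI)
   fix w assume "w:?p ` car ?D" then show "w:car (P 0)" using homD(1)[OF p] by blast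
  next
   fix w assume w: "w:car (P 0)"
   have "d 0 w:(%x. x \<odot>\<^sub>(S i) s) ` Pc i"
    using Pm_hom_image[OF lSi atomD(2)[OF s] i atomD(3)[OF s]] S_cyc[OF i s] homD(1)[OF d0(1) w] by simp
   then obtain x where x: "x:Pc i" "d 0 w = x \<odot>\<^sub>(S i) s" by blast
   have hx: "h x:car (P 0)" by (rule hD(1)[OF x(1)])
   have "d 0 (w \<ominus>\<^sub>(P 0) h x) = \<zero>\<^sub>(S i)"
    using hom_minus[OF lP lSi d0(1) w hx] x(2) h(2)[OF x(1)] homD(1)[OF d0(1) w] Si.M.minus_eq_zero_iff by simp
   then have "w \<ominus>\<^sub>(P 0) h x:d (Suc 0) ` car (P (Suc 0))" using d1(2) w hx by auto
   then obtain y where y: "y:car (P (Suc 0))" "w \<ominus>\<^sub>(P 0) h x = d (Suc 0) y" by blast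
   then have "w = ?p (x, y)" using P0.M.add_minus_cancel[OF w hx] d1D(1)[OF y(1)] hx by (simp add: P0.M.a_comm)
   then show "w:?p ` car ?D" using x y by (intro image_eqI[of _ _ "(x, y)"]) auto
  qed
  have kerp: "f (snd z) = \<zero>\<^sub>(S j)" if z: "z:car ?D" "?p z = \<zero>\<^sub>(P 0)" for z
  proof -
   obtain x y where xy: "z = (x, y)" "x:Pc i" "y:car (P (Suc 0))" using z(1) by auto
   have hx: "h x:car (P 0)" and dy: "d (Suc 0) y:car (P 0)" using hD(1) d1D(1) xy by auto
   have dd: "d 0 (d (Suc 0) y) = \<zero>\<^sub>(S i)" using d1(2) xy(3) by blast
   have eq: "h x \<oplus>\<^sub>(P 0) d (Suc 0) y = \<zero>\<^sub>(P 0)" using z(2) xy by simp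
   have "\<zero>\<^sub>(S i) = d 0 (h x) \<oplus>\<^sub>(S i) \<zero>\<^sub>(S i)"
    using homD(2)[OF d0(1) hx dy] eq dd hom_zero[OF lP lSi d0(1)] by simp
   then have "d 0 (h x) = \<zero>\<^sub>(S i)" using homD(1)[OF d0(1) hx] by simp
   then have xJ: "x:Je i" using h(2)[OF xy(2)] Pm_annihilator[OF i lSi s xy(2)] by simp
   have "h x = \<ominus>\<^sub>(P 0) d (Suc 0) y" using P0.M.minus_equality[OF eq dy hx] by simp
   then have "d (Suc 0) (\<ominus>\<^sub>(P (Suc 0)) y) = h x" using hom_neg[OF lP lP d1(1) xy(3)] by simp
   then have "f (\<ominus>\<^sub>(P (Suc 0)) y) = \<zero>\<^sub>(S j)" using fJ[OF xJ] xy(3) by simp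
   then have "\<ominus>\<^sub>(S j) f y = \<zero>\<^sub>(S j)" using hom_neg[OF lP lSj f(1) xy(3)] by simp
   then have "f y = \<ominus>\<^sub>(S j) \<zero>\<^sub>(S j)" using Sj.M.minus_minus[OF fD(1)[OF xy(3)]] by simp
   then show ?thesis using xy by simp
  qed
  have "EX g:mhom (P 0) (S j). ALL z:car ?D. g (?p z) = f (snd z)"
   by (rule hom_factor[OF lD lP lSj p surj hom_comp[OF hom_snd f(1)]]) (rule kerp)
  then obtain g where g: "g:mhom (P 0) (S j)" "ALL z:car ?D. g (?p z) = f (snd z)" by (elim bexE)
  have "f = \<Phi> (restrict g (car (P 0)))"
  proof (rule extensionalityI[OF f(2)])
   show "\<Phi> (restrict g (car (P 0))):extensional (car (P (Suc 0)))" by (simp add: \<Phi>_def)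
   fix y assume y: "y:car (P (Suc 0))"
   have "(\<zero>, y):car ?D" using y iffD1[OF lideal_iff Pc_lideal[OF i]] by simp
   then have "g (h \<zero> \<oplus>\<^sub>(P 0) d (Suc 0) y) = f y" using g(2) by fastforce
   then show "f y = \<Phi> (restrict g (car (P 0))) y" using h0 d1D(1)[OF y] y by (simp add: \<Phi>_def)
  qed
  moreover have "restrict g (car (P 0)):car ?G"
   using hom_restrict[OF lP g(1)] by (simp add: Hom_space_simps(1))
  ultimately show "f:B" unfolding B by (rule image_eqI)
 qed
 moreover have "Ext \<Lambda> 1 (S i) (S j) = quot_module (?H(|carrier := Z|)) B"
  unfolding Ext_def Pd_def[symmetric] Pd by (simp add: Z_def B_def)
 ultimately show ?thesis using us(1) by simp
qed

end

section \<open>Projective covers and injective hulls\<close>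

lemma count_list_replicate: "count_list (replicate n i) j = (if i = j then n else 0)"
 by (induction n) auto

lemma count_list_blocks: "j < r ==> count_list (concat (map (%i. replicate (n i) i) [0..<r])) j = n j"
proof -
 have "count_list (concat (map (%i. replicate (n i) i) [0..<r])) j = (if j < r then n j else 0)"
  by (induction r) (auto simp: count_list_replicate)
 then show "j < r ==> ?thesis" by simp
qed

lemma (in left_module) list_comb_in_subm:
 assumes "Module.submodule T R M" "list_all2 (%m x. x \<odot>\<^sub>M m:T) ms xs"
 shows "list_comb M ms xs:T"
 using assms(2) iffD1[OF subm_iff assms(1)] by (induction rule: list_all2_induct) auto

context ws_algebra
begin

lemma J_cube_smult:
 assumes "lmod M" "a:J" "b:J" "c:J" "x:car M"
 shows "a \<odot>\<^sub>M (b \<odot>\<^sub>M (c \<odot>\<^sub>M x)) = \<zero>\<^sub>M"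
proof -
 interpret M: left_module \<Lambda> M by fact
 note s = J_sub[OF assms(2)] J_sub[OF assms(3)] J_sub[OF assms(4)]
 have "a \<odot>\<^sub>M (b \<odot>\<^sub>M (c \<odot>\<^sub>M x)) = (a \<otimes> b \<otimes> c) \<odot>\<^sub>M x"
  using s assms(5) by (simp add: M.smult_assoc1 M.smult_closed)
 then show ?thesis using J_cube[OF assms(2-4)] M.zero_smult[OF assms(5)] by simp
qed

lemma hom_L:
 assumes "lmod M" "lmod N" "f:mhom M N" "x:L M"
 shows "f x:L N"
proof -
 have x: "x:car M" "!!j. j:J ==> j \<odot>\<^sub>M x = \<zero>\<^sub>M" using assms(4) by (auto simp: L_def)
 have "j \<odot>\<^sub>N f x = \<zero>\<^sub>N" if "j:J" for j
  using homD(3)[OF assms(3) J_sub[OF that] x(1)] x(2)[OF that] hom_zero[OF assms(1-3)] by simp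
 then show ?thesis using homD(1)[OF assms(3) x(1)] by (simp add: L_def)
qed

lemma L_sub: "U <= car M ==> L (M(|carrier := U|)) = U \<inter> L M"
 by (auto simp: L_def)

lemma L_inj:
 assumes "lmod M" "lmod N" "f:mhom M N"
  "!!x. x:L M ==> f x = \<zero>\<^sub>N ==> x = \<zero>\<^sub>M" "x:car M" "f x = \<zero>\<^sub>N"
 shows "x = \<zero>\<^sub>M"
proof (rule ccontr)
 assume "x ~= \<zero>\<^sub>M"
 then obtain y where y: "y:car \<Lambda>" "y \<odot>\<^sub>M x:L M" "y \<odot>\<^sub>M x ~= \<zero>\<^sub>M"
  using L_nonzero[OF assms(1,5)] by blast
 have "f (y \<odot>\<^sub>M x) = \<zero>\<^sub>N"
  using homD(3)[OF assms(3) y(1) assms(5)] assms(6) left_module.smult_zero[OF assms(2) y(1)] by simp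
 then show False using assms(4)[OF y(2)] y(3) by blast
qed

text \<open>The isotypic lists for all types are concatenated, with each generator recorded beside
  its type. A submodule that contains all of them misses nothing, by
  \<open>subm_detect\<close>.\<close>

lemma generating_list:
 assumes M: "fdm M" and U: "subm U M"
 obtains ks ms where "list_all2 (%i m. i < r & m:car M & e i \<odot>\<^sub>M m = m) ks ms"
  "!!j. j < r ==> count_list ks j = dv M j (car M) - dv M j U"
  "!!T. subm T M ==> U <= T ==> set ms <= T ==> T = car M"
proof -
 note lM = fdmD(1)[OF M]
 interpret M: left_module \<Lambda> M by (rule lM)
 define good where "good i us \<longleftrightarrow> length us = dv M i (car M) - dv M i U & (ALL u:set us. u:car M & e i \<odot>\<^sub>M u = u)
  & (ALL T u. subm T M --> U <= T --> set us <= T --> u:car M --> e i \<odot>\<^sub>M u = u --> u:T)" for i us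
 have "EX us. good i us" if "i < r" for i
 proof (rule isotypic_generators[OF M U that], goal_cases)
  case (1 us)
  then show ?case unfolding good_def by (intro exI[of _ us]) blast
 qed
 then obtain B where B: "!!i. i < r ==> good i (B i)" by metis
 define ps where "ps = concat (map (%i. map (Pair i) (B i)) [0..<r])"
 have ps: "i < r & m:set (B i)" if "(i, m):set ps" for i m using that by (auto simp: ps_def)
 have pm: "i < r & m:car M & e i \<odot>\<^sub>M m = m" if "(i, m):set ps" for i m
  using B[of i] ps[OF that] unfolding good_def by blast
 have fst: "map fst ps = concat (map (%i. replicate (length (B i)) i) [0..<r])"
  by (simp add: ps_def map_concat comp_def map_replicate_const)
 show thesis
 proof (rule that[of "map fst ps" "map snd ps"])
  show "list_all2 (%i m. i < r & m:car M & e i \<odot>\<^sub>M m = m) (map fst ps) (map snd ps)"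
   by (simp add: list.rel_map list_all2_same) (metis pm prod.collapse)
  show "count_list (map fst ps) j = dv M j (car M) - dv M j U" if "j < r" for j
   unfolding fst using count_list_blocks[OF that, of "%i. length (B i)"] B[OF that] by (simp add: good_def)
  fix T assume T: "subm T M" "U <= T" "set (map snd ps) <= T"
  have BT: "set (B i) <= T" if "i < r" for i
  proof
   fix m assume "m:set (B i)"
   then have "(i, m):set ps" using \<open>i < r\<close> by (auto simp: ps_def)
   then show "m:T" using T(3) by force
  qed
  show "T = car M"
  proof (rule ccontr)
   assume "T ~= car M"
   then obtain x where x: "x:car M" "x ~: T" using iffD1[OF M.subm_iff T(1)] by blast
   obtain i y where iy: "i < r" "y:car \<Lambda>" "e i \<odot>\<^sub>M (y \<odot>\<^sub>M x) ~: T" using subm_detect[OF lM T(1) x] .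
   have c: "y \<odot>\<^sub>M x:car M" using iy x M.smult_closed by blast
   have "e i \<odot>\<^sub>M (e i \<odot>\<^sub>M (y \<odot>\<^sub>M x)) = e i \<odot>\<^sub>M (y \<odot>\<^sub>M x)"
    using M.smult_assoc1[of "e i" "e i" "y \<odot>\<^sub>M x"] e_idem[OF iy(1)] iy(1) c by simp
   then show False
    using B[OF iy(1)] T(1,2) BT[OF iy(1)] M.smult_closed[OF e_closed[OF iy(1)] c] iy(3) unfolding good_def by blast
  qed
 qed
qed

text \<open>The direct sum of the \<open>Pm k\<close> for \<open>k\<close> in the list
  \<open>ks\<close>. Its elements are lists, so it belongs to the universe, and multiplicities
  become \<open>count_list\<close>.\<close>

definition Pl :: "nat list => ('b, 'b list) module" where
 "Pl ks = (list_module reg (length ks))(|carrier := listset (map Pc ks)|)"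

lemma Pl_simps [simp]:
 "car (Pl ks) = listset (map Pc ks)" "\<zero>\<^sub>(Pl ks) = replicate (length ks) \<zero>"
 "add (Pl ks) = map2 (add \<Lambda>)" "smult (Pl ks) = (%c. map (monoid.mult \<Lambda> c))"
 by (simp_all add: Pl_def)

lemma in_listset_map: "xs:listset (map X ks) \<longleftrightarrow> length xs = length ks & (ALL l < length ks. xs ! l:X (ks ! l))"
 by (auto simp: in_listset list_all2_conv_all_nth)

lemma ks_nth: "set ks <= {..<r} ==> l < length ks ==> ks ! l < r"
 using nth_mem by fastforce

lemma Pl_listset_subm:
 assumes "set ks <= {..<r}" "!!i. i < r ==> lideal (X i)" "!!i. i < r ==> X i <= Pc i"
 shows "subm (listset (map X ks)) (Pl ks)"
proof -
 have "subm (listset (map Y ks)) (list_module reg (length ks))"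
  if "!!i. i < r ==> lideal (Y i)" for Y
  by (rule listset_subm[OF lmod_reg]) (use assms(1) that in auto)
 moreover have "listset (map X ks) <= listset (map Pc ks)"
  using assms(3)[OF ks_nth[OF assms(1)]] unfolding in_listset_map by (intro subsetI) (simp add: in_listset_map subset_iff)
 ultimately show ?thesis
  unfolding Pl_def using subm_sub_iff[OF lmod_list[OF lmod_reg]] assms(2) Pc_lideal by blast
qed

lemma fdm_Pl: "set ks <= {..<r} ==> fdm (Pl ks)"
 unfolding Pl_def
 by (rule fdm_sub[OF fdm_list[OF fdm_regular] listset_subm[OF lmod_reg]]) (use Pc_lideal in auto)

lemma dv_Pl:
 assumes "set ks <= {..<r}" "!!i. i < r ==> lideal (X i)" "j < r"
 shows "dv (Pl ks) j (listset (map X ks)) = (\<Sum>i<r. count_list ks i * dv reg j (X i))"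
proof -
 have "dv (Pl ks) j (listset (map X ks)) = (\<Sum>i\<leftarrow>ks. dv reg j (X i))"
  unfolding Pl_def edim_sub by (rule edim_listset[OF fdm_regular]) (use assms in auto)
 then show ?thesis using sum_list_map_eq_sum_count2[OF assms(1)] by simp
qed

lemma projective_Pm: "i < r ==> projective_module \<Lambda> (Pm i)"
 unfolding projective_module_def using lmod_Pm Pm_lift by blast

lemma Pl_Cons_iso:
 "module_iso \<Lambda> (Pl (i # ks)) (direct_prod (Pm i) (Pl ks))"
proof (rule module_isoI'[of "%xs. (hd xs, tl xs)" _ _ _ "%p. fst p # snd p"])
 show "(%xs. (hd xs, tl xs)):mhom (Pl (i # ks)) (direct_prod (Pm i) (Pl ks))"
  by (rule module_homI) (auto simp: set_Cons_def)
 show "(%p. fst p # snd p):mhom (direct_prod (Pm i) (Pl ks)) (Pl (i # ks))"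
  by (rule module_homI) (auto simp: set_Cons_def)
qed (auto simp: set_Cons_def)

lemma Pl_projective: "set ks <= {..<r} ==> Pl ks:fg_projectives \<Lambda>"
proof (induction ks)
 case Nil
 have "projective_module \<Lambda> (Pl [])" using fdm_Pl[of "[]"] by (intro projective_zero fdmD(1)) auto
 then show ?case using fg_projectives_iff fdm_Pl by simp
next
 case (Cons i ks)
 then have "i < r" "projective_module \<Lambda> (Pl ks)" using fg_projectives_iff by auto
 then have "projective_module \<Lambda> (direct_prod (Pm i) (Pl ks))" by (intro projective_direct_prod projective_Pm)
 then have "projective_module \<Lambda> (Pl (i # ks))"
  by (rule projective_iso[OF _ fdmD(1)[OF fdm_Pl[OF Cons.prems]] Pl_Cons_iso])
 then show ?case using fg_projectives_iff fdm_Pl[OF Cons.prems] by simp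
qed

lemma inj_mod_Pl: "set ks <= {..<r} ==> inj_mod (Pl ks)"
 using fg_projective_inj[OF ws Pl_projective] .

lemma L_Pl: "set ks <= {..<r} ==> L (Pl ks) = listset (map (%i. L (Pm i)) ks)"
 by (auto simp: L_def in_listset_map list_eq_iff_nth_eq)

lemma L_Pm_lideal: "i < r ==> lideal (L (Pm i))" "i < r ==> L (Pm i) <= Pc i"
 using Pm_subm[of i "L (Pm i)"] L_subm[OF lmod_Pm] by blast+

lemma dv_L_Pl:
 assumes "set ks <= {..<r}" "j < r"
 shows "dv (Pl ks) j (L (Pl ks)) = count_list ks j"
proof -
 have "dv (Pl ks) j (L (Pl ks)) = (\<Sum>i<r. count_list ks i * dv reg j (L (Pm i)))"
  unfolding L_Pl[OF assms(1)] by (rule dv_Pl[OF assms(1) L_Pm_lideal(1) assms(2)])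
 also have "\<dots> = (\<Sum>i<r. if i = j then count_list ks j else 0)"
  by (rule sum.cong) (use dv_L_Pm assms(2) in auto)
 finally show ?thesis using assms(2) by simp
qed

lemma Rj_kill:
 assumes "lmod M" "lev2 M" "m:car M" "i < r" "x:Rj i"
 shows "x \<odot>\<^sub>M m = \<zero>\<^sub>M"
proof -
 interpret M: left_module \<Lambda> M by fact
 note h = hom_sub_domain[OF cyc_hom[OF assms(1,3)], of "Je i"]
 have Jc: "Je i <= car \<Lambda>" by (auto simp: Je_def J_sub)
 have "rad (Jm i) <= {x:car (Jm i). x \<odot>\<^sub>M m = \<zero>\<^sub>M}"
 proof (rule rad_least[OF subm_kernel[OF lmod_Jm[OF assms(4)] assms(1) h]])
  show "Je i <= car reg" using Jc by simp
  fix j x assume j: "j:J" and "x:car (Jm i)"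
  then have x: "x:Je i" "x:car \<Lambda>" "x:J" using Jc by (auto simp: Je_def)
  have "(j \<otimes> x) \<odot>\<^sub>M m = j \<odot>\<^sub>M (x \<odot>\<^sub>M m)" using M.smult_assoc1[OF J_sub[OF j] x(2) assms(3)] .
  moreover have "j \<odot>\<^sub>M (x \<odot>\<^sub>M m) = \<zero>\<^sub>M" using assms(2,3) j x(3) unfolding lev2_def by blast
  moreover have "j \<otimes> x:Je i" using iffD1[OF lideal_iff Je_lideal[OF assms(4)]] J_sub[OF j] x by blast
  ultimately show "j \<odot>\<^sub>(Jm i) x:{x:car (Jm i). x \<odot>\<^sub>M m = \<zero>\<^sub>M}" by simp
 qed
 then show ?thesis using assms(5) by (auto simp: Rj_def)
qed

lemma list_comb_unit:
 assumes "lmod M" "list_all2 (%i m. i < r & m:car M & e i \<odot>\<^sub>M m = m) ks ms" "m:set ms"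
 shows "EX xs:listset (map Pc ks). list_comb M ms xs = m"
 using assms(2,3)
proof (induction rule: list_all2_induct)
 case (Cons i ks n ms)
 interpret M: left_module \<Lambda> M by fact
 have ms: "set ms <= car M" "length ks = length ms" "set ks <= {..<r}"
  using Cons(2) by (auto simp: list_all2_conv_all_nth in_set_conv_nth)
 have zl: "replicate (length ks) \<zero>:listset (map Pc ks)"
  using iffD1[OF lideal_iff Pc_lideal] ks_nth[OF ms(3)] by (simp add: in_listset_map)
 show ?case
 proof (cases "m = n")
  case True
  then show ?thesis
   using Cons(1) zl M.list_comb_zero[OF ms(1)] ms e_Pc[of i]
   by (intro bexI[of _ "e i # replicate (length ks) \<zero>"]) (auto simp: set_Cons_def)
 next
  case False
  then obtain xs where "xs:listset (map Pc ks)" "list_comb M ms xs = m" using Cons by auto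
  then show ?thesis
   using Cons(1) iffD1[OF lideal_iff Pc_lideal[of i]] M.list_comb_closed[OF ms(1), of xs] Cons.prems ms False
   by (intro bexI[of _ "\<zero> # xs"]) (auto simp: set_Cons_def M.zero_smult)
 qed
qed simp

text \<open>Generators modulo the radical define the map, and Nakayama makes it surjective. The last
  clause holds because products of two elements of \<open>J\<close> act as zero in Loewy length
  two.\<close>

lemma projective_cover:
 assumes M: "fdm M"
 obtains ks p where "set ks <= {..<r}" "!!j. j < r ==> count_list ks j = dv M j (car M) - dv M j (rad M)"
  "p:mhom (Pl ks) M" "p ` car (Pl ks) = car M"
  "{xs:car (Pl ks). p xs:rad M} = listset (map Je ks)"
  "!!xs. lev2 M ==> xs:listset (map Rj ks) ==> p xs = \<zero>\<^sub>M"
proof -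
 note lM = fdmD(1)[OF M]
 interpret M: left_module \<Lambda> M by (rule lM)
 note radM = rad_subm[OF lM]
 show thesis
 proof (rule generating_list[OF M radM])
  fix ks ms assume km: "list_all2 (%i m. i < r & m:car M & e i \<odot>\<^sub>M m = m) ks ms"
   and cnt: "!!j. j < r ==> count_list ks j = dv M j (car M) - dv M j (rad M)"
   and gen: "!!T. subm T M ==> rad M <= T ==> set ms <= T ==> T = car M"
  have len: "length ks = length ms" using km list_all2_lengthD by blast
  have kn: "ks ! l < r" "ms ! l:car M" if "l < length ks" for l
   using km that by (auto simp: list_all2_conv_all_nth)
  have ks: "set ks <= {..<r}" and ms: "set ms <= car M"
   using kn len by (auto simp: in_set_conv_nth)
  let ?p = "list_comb M ms"
  note lP = fdmD(1)[OF fdm_Pl[OF ks]]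
  have PlR: "listset (map Pc ks) <= car (list_module reg (length ks))"
  proof
   fix xs assume xs: "xs:listset (map Pc ks)"
   have "xs ! l:car \<Lambda>" if "l < length ks" for l using xs that Pc_closed unfolding in_listset_map by blast
   then show "xs:car (list_module reg (length ks))"
    using xs by (auto simp: in_listset_map in_set_conv_nth)
  qed
  have p: "?p:mhom (Pl ks) M"
   unfolding Pl_def by (rule hom_sub_domain[OF M.hom_list_comb[OF ms len[symmetric]] PlR])
  have im: "subm (?p ` car (Pl ks)) M"
   by (rule subm_image[OF lP lM p left_module.carrier_subm[OF lP]])
  note T = subm_sum[OF lM im radM]
  have "set ms <= ?p ` car (Pl ks)" using list_comb_unit[OF lM km] by fastforce
  then have sumT: "{n \<oplus>\<^sub>M w |n w. n:?p ` car (Pl ks) & w:rad M} = car M"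
   by (intro gen T(1) T(3) order_trans[OF _ T(2)])
  have surj: "?p ` car (Pl ks) = car M"
  proof (rule nakayama[OF lM im])
   fix x assume "x:car M"
   then show "EX n:?p ` car (Pl ks). EX k:rad M. x = n \<oplus>\<^sub>M k" unfolding sumT[symmetric] by blast
  qed
  let ?B = "{xs:car (Pl ks). ?p xs:rad M}"
  have B: "subm ?B (Pl ks)" by (rule subm_vimage[OF lP lM p radM])
  have A: "subm (listset (map Je ks)) (Pl ks)"
   by (rule Pl_listset_subm[OF ks Je_lideal]) (auto simp: Je_def)
  have AB: "listset (map Je ks) <= ?B"
  proof
   fix xs assume xs: "xs:listset (map Je ks)"
   then have xl: "length xs = length ks" "!!l. l < length ks ==> xs ! l:Je (ks ! l)" by (auto simp: in_listset_map)
   have "?p xs:rad M"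
    by (rule M.list_comb_in_subm[OF radM])
     (use xl len kn radI[OF lM] in \<open>auto simp: list_all2_conv_all_nth Je_def\<close>)
   then show "xs:?B" using xl by (auto simp: in_listset_map Je_def)
  qed
  have "listset (map Je ks) = ?B"
  \<comment> \<open>One inclusion is clear; both sides have the same multiplicities, since each has
    \<open>count_list ks j\<close> fewer factors of type \<open>j\<close> than the whole of
    \<open>Pl ks\<close>.\<close>
  proof (rule dv_eq[OF fdm_Pl[OF ks] A B AB])
   fix j assume j: "j < r"
   have pB: "?p ` ?B = rad M"
   proof (intro equalityI subsetI)
    fix y assume "y:rad M"
    moreover then have "y:?p ` car (Pl ks)" using surj iffD1[OF M.subm_iff radM] by blast
    ultimately show "y:?p ` ?B" by blast
   qed blast
   have kerB: "{x:?B. ?p x = \<zero>\<^sub>M} = {x:car (Pl ks). ?p x = \<zero>\<^sub>M}"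
    using iffD1[OF M.subm_iff radM] by auto
   have 1: "dv (Pl ks) j ?B = dv M j (rad M) + dv (Pl ks) j {x:car (Pl ks). ?p x = \<zero>\<^sub>M}"
    using dv_hom[OF fdm_Pl[OF ks] lM p B j] unfolding pB kerB .
   have 2: "dv (Pl ks) j (car (Pl ks)) = dv M j (car M) + dv (Pl ks) j {x:car (Pl ks). ?p x = \<zero>\<^sub>M}"
    using dv_hom[OF fdm_Pl[OF ks] lM p left_module.carrier_subm[OF lP] j] unfolding surj .
   have 3: "dv M j (rad M) <= dv M j (car M)"
    using iffD1[OF M.subm_iff radM] by (intro dv_mono[OF M radM M.carrier_subm _ j]) blast
   have "dv (Pl ks) j (car (Pl ks)) = (\<Sum>i<r. count_list ks i * dv reg j (Pc i))"
    using dv_Pl[OF ks Pc_lideal j] by simp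
   also have "\<dots> = (\<Sum>i<r. (if i = j then count_list ks j else 0) + count_list ks i * dv reg j (Je i))"
    by (rule sum.cong) (use dv_Pc j in \<open>auto simp: algebra_simps\<close>)
   also have "\<dots> = count_list ks j + dv (Pl ks) j (listset (map Je ks))"
    using dv_Pl[OF ks Je_lideal j] j by (simp add: sum.distrib)
   finally show "dv (Pl ks) j (listset (map Je ks)) = dv (Pl ks) j ?B" using 1 2 3 cnt[OF j] by simp
  qed
  moreover have "?p xs = \<zero>\<^sub>M" if lv: "lev2 M" and xs: "xs:listset (map Rj ks)" for xs
  proof -
   have "?p xs:{\<zero>\<^sub>M}"
    by (rule M.list_comb_in_subm[OF M.zero_subm])
     (use xs len Rj_kill[OF lM lv kn(2,1)] in \<open>auto simp: list_all2_conv_all_nth in_listset_map\<close>)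
   then show ?thesis by simp
  qed
  ultimately show thesis using that[OF ks cnt p surj] by simp
 qed
qed

text \<open>The socle is semisimple, so the kernel of its projective cover is the radical of
  \<open>Pl ks\<close>. Sending each summand to its own socle is an endomorphism of
  \<open>Pl ks\<close> with the same kernel, which identifies the socle of \<open>M\<close> with
  that of \<open>Pl ks\<close>. Injectivity of \<open>Pl ks\<close> extends the embedding to
  \<open>M\<close>, and it stays injective because the socle meets every nonzero submodule.\<close>

lemma injective_hull:
 assumes M: "fdm M"
 obtains ks \<theta> where "set ks <= {..<r}" "!!j. j < r ==> count_list ks j = dv M j (L M)"
  "\<theta>:mhom M (Pl ks)" "!!x. x:car M ==> \<theta> x = \<zero>\<^sub>(Pl ks) ==> x = \<zero>\<^sub>M" "\<theta> ` L M = L (Pl ks)"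
proof -
 note lM = fdmD(1)[OF M]
 interpret M: left_module \<Lambda> M by (rule lM)
 let ?N = "M(|carrier := L M|)"
 have N: "fdm ?N" by (rule fdm_sub[OF M L_subm[OF lM]])
 note lN = fdmD(1)[OF N]
 interpret N: left_module \<Lambda> ?N by (rule lN)
 have Lc: "L M <= car M" by (auto simp: L_def)
 have "rad ?N <= {\<zero>\<^sub>?N}" by (rule rad_least[OF N.zero_subm]) (auto simp: L_def)
 then have rad0: "rad ?N = {\<zero>\<^sub>M}" using iffD1[OF N.subm_iff rad_subm[OF lN]] by auto
 show thesis
 proof (rule projective_cover[OF N])
  fix ks p assume ks: "set ks <= {..<r}" and cnt: "!!j. j < r ==> count_list ks j = dv ?N j (car ?N) - dv ?N j (rad ?N)"
   and p: "p:mhom (Pl ks) ?N" "p ` car (Pl ks) = car ?N"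
   and kp: "{xs:car (Pl ks). p xs:rad ?N} = listset (map Je ks)"
  note lP = fdmD(1)[OF fdm_Pl[OF ks]]
  have cnt': "count_list ks j = dv M j (L M)" if "j < r" for j
   using cnt[OF that] dv_zero[OF M that] by (simp add: rad0)
  have "EX t. i < r --> atom (Pm i) i t" for i using L_Pm[of i] by metis
  then obtain t where t: "!!i. i < r ==> atom (Pm i) i (t i)" by metis
  have tc: "t i:Pc i" "t i:car \<Lambda>" if "i < r" for i using atomD(2)[OF t[OF that]] Pc_closed by auto
  \<comment> \<open>Right multiplication by the socle generator of the summand; weak symmetry places
    this generator in \<open>Pm i\<close> with the same type \<open>i\<close>.\<close>
  let ?\<psi> = "%xs. map2 (%x i. x \<otimes> t i) xs ks"
  have \<psi>: "?\<psi>:mhom (Pl ks) (Pl ks)"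
  proof (rule module_homI)
   fix xs assume xs: "xs:car (Pl ks)"
   then have xl: "length xs = length ks" "!!l. l < length ks ==> xs ! l:Pc (ks ! l)" by (auto simp: in_listset_map)
   note c = Pc_closed[OF xl(2)]
   show "?\<psi> xs:car (Pl ks)"
    using xl c iffD1[OF lideal_iff Pc_lideal[OF ks_nth[OF ks]]] tc[OF ks_nth[OF ks]] by (simp add: in_listset_map)
   { fix ys assume ys: "ys:car (Pl ks)"
    then have yl: "length ys = length ks" "!!l. l < length ks ==> ys ! l:Pc (ks ! l)" by (auto simp: in_listset_map)
    show "?\<psi> (xs \<oplus>\<^sub>(Pl ks) ys) = ?\<psi> xs \<oplus>\<^sub>(Pl ks) ?\<psi> ys"
     using xl yl c Pc_closed[OF yl(2)] tc[OF ks_nth[OF ks]] by (simp add: list_eq_iff_nth_eq Alg.l_distr) }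
   show "?\<psi> (a \<odot>\<^sub>(Pl ks) xs) = a \<odot>\<^sub>(Pl ks) ?\<psi> xs" if "a:car \<Lambda>" for a
    using xl c tc[OF ks_nth[OF ks]] that by (simp add: list_eq_iff_nth_eq Alg.m_assoc)
  qed
  have k\<psi>: "?\<psi> xs = \<zero>\<^sub>(Pl ks) \<longleftrightarrow> xs:listset (map Je ks)" if "xs:car (Pl ks)" for xs
   using that Pm_annihilator[OF ks_nth[OF ks] lmod_Pm[OF ks_nth[OF ks]] t[OF ks_nth[OF ks]]]
   by (auto simp: in_listset_map list_eq_iff_nth_eq)
  have kp': "p xs = \<zero>\<^sub>M \<longleftrightarrow> xs:listset (map Je ks)" if "xs:car (Pl ks)" for xs
   using kp that by (auto simp: rad0)
  have "EX f:mhom ?N (Pl ks). ALL xs:car (Pl ks). f (p xs) = ?\<psi> xs"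
   by (rule hom_factor[OF lP lN lP p \<psi>]) (use kp' k\<psi> in simp)
  then obtain f where f: "f:mhom ?N (Pl ks)" "!!xs. xs:car (Pl ks) ==> f (p xs) = ?\<psi> xs" by blast
  have f0: "x = \<zero>\<^sub>M" if x: "x:L M" "f x = \<zero>\<^sub>(Pl ks)" for x
  proof -
   have "x:p ` car (Pl ks)" using p(2) x(1) by simp
   then obtain xs where xs: "xs:car (Pl ks)" "x = p xs" by blast
   then show ?thesis using f(2)[OF xs(1)] k\<psi>[OF xs(1)] kp'[OF xs(1)] x(2) by simp
  qed
  have fi: "x = \<zero>\<^sub>?N" if "x:car ?N" "f x = \<zero>\<^sub>(Pl ks)" for x using f0 that by simp
  \<comment> \<open>Inclusion is automatic and the multiplicities agree, so no preimages have to be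
    constructed.\<close>
  have imf: "f ` L M = L (Pl ks)"
  proof (rule dv_eq[OF fdm_Pl[OF ks]])
   show "subm (f ` L M) (Pl ks)" using subm_image[OF lN lP f(1) N.carrier_subm] by simp
   show "f ` L M <= L (Pl ks)" using hom_L[OF lN lP f(1)] by (auto simp: L_def)
   show "dv (Pl ks) j (f ` L M) = dv (Pl ks) j (L (Pl ks))" if "j < r" for j
    using dv_inj[OF N lP f(1) N.carrier_subm that fi] cnt'[OF that] dv_L_Pl[OF ks that] by simp
  qed (rule L_subm[OF lP])
  show thesis
  proof (rule inj_modD[OF inj_mod_Pl[OF ks] N M hom_incl[OF Lc] _ f(1)])
   fix \<theta> assume \<theta>: "\<theta>:mhom M (Pl ks)" "!!x. x:car ?N ==> \<theta> x = f x"
   have "\<theta> ` L M = L (Pl ks)" using imf \<theta>(2) by simp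
   moreover have "x = \<zero>\<^sub>M" if "x:car M" "\<theta> x = \<zero>\<^sub>(Pl ks)" for x
    by (rule L_inj[OF lM lP \<theta>(1) _ that]) (use f0 \<theta>(2) in simp)
   ultimately show thesis using that[OF ks cnt' \<theta>(1)] by blast
  qed simp
 qed
qed

end

section \<open>Strict homomorphisms between modules of Loewy length two\<close>

lemma (in left_module) list_comb_add_left:
 assumes "set ms <= car M" "set ns <= car M" "set xs <= car R" "length ns = length ms" "length xs = length ms"
 shows "list_comb M (map2 (add M) ms ns) xs = list_comb M ms xs \<oplus>\<^sub>M list_comb M ns xs"
 using assms
proof (induction ms arbitrary: ns xs)
 case (Cons m ms)
 then obtain n ns' x xs' where eq: "ns = n # ns'" "xs = x # xs'" by (metis length_Suc_conv)
 with Cons show ?case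
  using list_comb_closed[of ms xs'] list_comb_closed[of ns' xs']
  by (simp add: smult_r_distr smult_closed M.a_ac)
qed simp

context fd_algebra
begin

lemma list_comb_emb:
 assumes "lmod M" "set ms <= car M" "set xs <= car \<Lambda>" "length xs = length ms" "c:car K"
 shows "list_comb M (map (%m. emb c \<odot>\<^sub>M m) ms) xs = emb c \<odot>\<^sub>M list_comb M ms xs"
 using assms(2-4)
proof (induction ms arbitrary: xs)
 case Nil
 then show ?case using left_module.smult_zero[OF assms(1)] assms(5) by simp
next
 case (Cons m ms)
 interpret M: left_module \<Lambda> M by fact
 obtain x xs' where eq: "xs = x # xs'" using Cons by (metis length_Suc_conv)
 have x: "x:car \<Lambda>" "m:car M" using Cons eq by auto
 have "x \<odot>\<^sub>M (emb c \<odot>\<^sub>M m) = emb c \<odot>\<^sub>M (x \<odot>\<^sub>M m)"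
  using M.smult_assoc1[of x "emb c" m] M.smult_assoc1[of "emb c" x m] emb_commute[OF assms(5) x(1)] x assms(5) by simp
 then show ?case
  using Cons eq x M.list_comb_closed[of ms xs'] assms(5) by (simp add: M.smult_r_distr M.smult_closed)
qed

end

context ws_algebra
begin

text \<open>In Loewy length two the quotient by the socle is semisimple; a complement of the image
  of \<open>U\<close> is found there and pulled back.\<close>

lemma complement_mod_L:
 assumes Y: "fdm Y" and lev: "lev2 Y" and U: "subm U Y"
 obtains N where "subm N Y" "L Y <= N" "N \<inter> U <= L Y"
  "!!y. y:car Y ==> EX n:N. EX u:U. y = n \<oplus>\<^sub>Y u"
proof -
 note lY = fdmD(1)[OF Y]
 interpret Y: left_module \<Lambda> Y by (rule lY)
 note LY = L_subm[OF lY]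
 note q = quot_module[OF lY LY]
 let ?Q = "quot_module Y (L Y)" and ?\<pi> = "cmap Y (L Y)"
 interpret Q: left_module \<Lambda> ?Q by (rule q)
 have JQ: "j \<odot>\<^sub>?Q x = \<zero>\<^sub>?Q" if "j:J" "x:car ?Q" for j x
 proof -
  have "x:?\<pi> ` car Y" using that q(3) by simp
  then obtain y where y: "y:car Y" "x = ?\<pi> y" by blast
  have "j \<odot>\<^sub>Y y:L Y" using lev2_rad[OF lY] lev radI[OF lY that(1) y(1)] by blast
  then show ?thesis
   using homD(3)[OF q(2) J_sub[OF that(1)] y(1)] q(4)[of "j \<odot>\<^sub>Y y"] y(2) Y.smult_closed[OF J_sub[OF that(1)] y(1)] by simp
 qed
 then have LQ: "L ?Q = car ?Q" by (auto simp: L_def)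
 have "rad ?Q <= {\<zero>\<^sub>?Q}" by (rule rad_least[OF Q.zero_subm]) (use JQ in simp)
 then have rQ: "rad ?Q = {\<zero>\<^sub>?Q}" using iffD1[OF Q.subm_iff rad_subm[OF q(1)]] by auto
 have W: "subm (?\<pi> ` U) ?Q" by (rule subm_image[OF lY q(1,2) U])
 have W': "?\<pi> ` U <= L ?Q" "?\<pi> ` U \<inter> rad ?Q = {\<zero>\<^sub>?Q}" using iffD1[OF Q.subm_iff W] LQ rQ by auto
 have Uc: "U <= car Y" using iffD1[OF Y.subm_iff U] by blast
 show thesis
 proof (rule complement_over_rad[OF fdm_quot[OF Y LY] W W'])
  fix N0 assume N0: "subm N0 ?Q" "rad ?Q <= N0" "N0 \<inter> ?\<pi> ` U = {\<zero>\<^sub>?Q}"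
   "!!x. x:car ?Q ==> EX n:N0. EX w:?\<pi> ` U. x = n \<oplus>\<^sub>?Q w"
  let ?N = "{y:car Y. ?\<pi> y:N0}"
  show thesis
  proof (rule that[of ?N])
   show "subm ?N Y" by (rule subm_vimage[OF lY q(1,2) N0(1)])
   show "L Y <= ?N"
   proof
    fix x assume x: "x:L Y"
    then have "x:car Y" "?\<pi> x = \<zero>\<^sub>?Q" using q(4)[OF L_closed[OF x]] L_closed[OF x] by simp_all
    then show "x:?N" using iffD1[OF Q.subm_iff N0(1)] by simp
   qed
   show "?N \<inter> U <= L Y"
   proof
    fix x assume x: "x:?N \<inter> U"
    then have "?\<pi> x:N0 \<inter> ?\<pi> ` U" by blast
    then show "x:L Y" using N0(3) q(4)[of x] x by simp
   qed
   fix y assume y: "y:car Y"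
   obtain n w where nw: "n:N0" "w:?\<pi> ` U" "?\<pi> y = n \<oplus>\<^sub>?Q w" using N0(4)[OF homD(1)[OF q(2) y]] by blast
   obtain u where u: "u:U" "w = ?\<pi> u" using nw(2) by blast
   have uc: "u:car Y" "n:car ?Q" "w:car ?Q"
    using u Uc nw(1) iffD1[OF Q.subm_iff N0(1)] homD(1)[OF q(2), of u] by auto
   have "?\<pi> (y \<ominus>\<^sub>Y u) = n"
    using hom_minus[OF lY q(1,2) y uc(1)] nw(3) u(2)[symmetric] Q.M.minus_add_cancel[OF uc(2,3)] by simp
   then have "y \<ominus>\<^sub>Y u:?N" using nw(1) y uc(1) by simp
   then show "EX n:?N. EX u:U. y = n \<oplus>\<^sub>Y u" using u(1) Y.M.add_minus_cancel[OF y uc(1)] by metis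
  qed
 qed
qed

lemma Je_listset_closed: "n:listset (map Je ks) ==> length n = length ks & set n <= car \<Lambda>"
 by (auto simp: in_listset_map in_set_conv_nth Je_def J_sub)

text \<open>A coefficient at a type other than \<open>i\<close> that is fixed by \<open>e i\<close>
  lies in \<open>J\<close>; at type \<open>i\<close> it is a scalar plus an element of
  \<open>J\<close>. The scalar parts add up to an element of \<open>A\<close>, and the rest is a
  combination with radical coefficients.\<close>

lemma comb_split:
 assumes Y: "lmod Y" and i: "i < r" and A: "ksub Y A"
  and ky: "list_all2 (%k m. k < r & m:car Y & e k \<odot>\<^sub>Y m = m & (k = i --> m:A)) ks y"
  and "list_all2 (%k n. n:Pc k & e i \<otimes> n = n) ks ns"
 shows "EX a:A. EX ns':listset (map Je ks). list_comb Y y ns = a \<oplus>\<^sub>Y list_comb Y y ns'"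
 using ky assms(5)
proof (induction arbitrary: ns rule: list_all2_induct)
 case Nil
 interpret Y: left_module \<Lambda> Y by fact
 interpret V: vspace K "KV Y" by (rule vspace_KV[OF Y])
 show ?case using Nil iffD1[OF V.subm_iff A] by (intro bexI[of _ "\<zero>\<^sub>Y"] bexI[of _ "[]"]) auto
next
 case (Cons k ks m y)
 interpret Y: left_module \<Lambda> Y by fact
 interpret V: vspace K "KV Y" by (rule vspace_KV[OF Y])
 note AD = iffD1[OF V.subm_iff A, simplified]
 obtain n nt where ns: "ns = n # nt" "n:Pc k" "e i \<otimes> n = n" "list_all2 (%k n. n:Pc k & e i \<otimes> n = n) ks nt"
  using Cons.prems by (auto simp: list_all2_Cons1)
 obtain a ns' where IH: "a:A" "ns':listset (map Je ks)" "list_comb Y y nt = a \<oplus>\<^sub>Y list_comb Y y ns'"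
  using Cons.IH[OF ns(4)] by blast
 have k: "k < r" "m:car Y" "e k \<odot>\<^sub>Y m = m" using Cons(1) by auto
 have nc: "n:car \<Lambda>" "n \<otimes> e k = n" using ns(2) by (auto simp: Pc_def)
 have yc: "set y <= car Y" "length ks = length y"
  using Cons(2) by (auto simp: list_all2_conv_all_nth in_set_conv_nth)
 have nl: "length ns' = length y" "set ns' <= car \<Lambda>"
  using Je_listset_closed[OF IH(2)] yc(2) by auto
 let ?C = "list_comb Y y ns'"
 have C: "?C:car Y" by (rule Y.list_comb_closed[OF yc(1) nl])
 have ac: "a:car Y" using AD IH(1) by blast
 show ?case
 proof (cases "k = i")
  case True
  define c where "c = \<kappa> i n"
  define j where "j = n \<ominus> emb c \<otimes> e i"
  have c: "c:car K" using \<kappa>(1)[OF i nc(1)] by (simp add: c_def)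
  have "e i \<otimes> n \<otimes> e i = n" using ns(3) nc(2) True by simp
  then have jJ: "j:J" using \<kappa>(2)[OF i nc(1)] by (simp add: j_def c_def)
  note PD = iffD1[OF lideal_iff Pc_lideal[OF i]]
  have ce: "emb c \<otimes> e i:Pc i" using PD e_Pc[OF i] c by auto
  have "j:Pc i"
   using left_module.subm_minus[OF lmod_reg Pc_lideal[OF i], of n "emb c \<otimes> e i"] ns(2) True ce by (simp add: j_def)
  then have jJe: "j:Je k" using jJ True by (simp add: Je_def)
  have cec: "emb c \<otimes> e i:car \<Lambda>" using c i by simp
  have "n = j \<oplus> emb c \<otimes> e i" unfolding j_def using add_minus_cancel_\<Lambda>[OF nc(1) cec] by simp
  then have "n \<odot>\<^sub>Y m = (j \<oplus> emb c \<otimes> e i) \<odot>\<^sub>Y m" by simp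
  also have "\<dots> = j \<odot>\<^sub>Y m \<oplus>\<^sub>Y emb c \<odot>\<^sub>Y m"
   using Y.smult_l_distr[OF J_sub[OF jJ] cec k(2)] Y.smult_assoc1[of "emb c" "e i" m] c i k True by simp
  finally have nm: "n \<odot>\<^sub>Y m = j \<odot>\<^sub>Y m \<oplus>\<^sub>Y emb c \<odot>\<^sub>Y m" .
  have mA: "m:A" using Cons(1) True by simp
  have cl: "emb c \<odot>\<^sub>Y m:car Y" "j \<odot>\<^sub>Y m:car Y" using c k J_sub[OF jJ] Y.smult_closed by auto
  have "emb c \<odot>\<^sub>Y m \<oplus>\<^sub>Y a:A" using AD mA IH(1) c by blast
  moreover have "j # ns':listset (map Je (k # ks))" using jJe IH(2) by (auto simp: set_Cons_def)
  moreover have "list_comb Y (m # y) ns = (emb c \<odot>\<^sub>Y m \<oplus>\<^sub>Y a) \<oplus>\<^sub>Y list_comb Y (m # y) (j # ns')"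
   using ns(1) IH(3) nm cl C ac by (simp add: Y.M.a_ac)
  ultimately show ?thesis by blast
 next
  case False
  have "e i \<otimes> n \<otimes> e k = n" using ns(3) nc(2) by simp
  then have "n:J" using e_orth[OF i k(1) _ nc(1)] False by simp
  then have "n # ns':listset (map Je (k # ks))" using ns(2) IH(2) by (auto simp: set_Cons_def Je_def)
  moreover have "list_comb Y (m # y) ns = a \<oplus>\<^sub>Y list_comb Y (m # y) (n # ns')"
   using ns(1) IH(3) Y.smult_closed[OF nc(1) k(2)] C ac by (simp add: Y.M.a_ac)
  ultimately show ?thesis using IH(1) by blast
 qed
qed

text \<open>The dimension vector of the quotient by the socle. This is the top once socle and
  radical agree; the subtraction is justified by \<open>dv_split\<close>.\<close>

definition ca :: "('b, 'm) module => nat => nat" where "ca M j = dv M j (car M) - dv M j (L M)"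
definition cb :: "('b, 'm) module => nat => nat" where "cb M j = dv M j (L M)"

lemma dv_split:
 assumes "fdm M" "j < r"
 shows "dv M j (car M) = ca M j + cb M j"
proof -
 note l = fdmD(1)[OF assms(1)]
 have "L M <= car M" by (auto simp: L_def)
 then show ?thesis
  using dv_mono[OF assms(1) L_subm[OF l] left_module.carrier_subm[OF l] _ assms(2)] by (simp add: ca_def cb_def)
qed

end

text \<open>Every \<open>Pm i\<close> has Loewy length exactly three. The spectral radius guarantees
  this, see \<open>Rj_eq_L\<close>.\<close>

locale loewy_algebra = connected_algebra +
 assumes Rj: "i < r ==> Rj i = L (Pm i)"

sublocale loewy_algebra \<subseteq> adjacency_form r E
 by unfold_locales (use E_sym E_connected in blast)+

context loewy_algebra
begin

lemma Eop_cong: "(!!j. j < r ==> x j = y j) ==> Eop x i = Eop y i"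
 by (simp add: Eop_def)

lemma dv_Pl_Je:
 assumes "set ks <= {..<r}" "j < r"
 shows "dv (Pl ks) j (listset (map Je ks)) = count_list ks j + Eop (count_list ks) j"
proof -
 have "dv (Pl ks) j (listset (map Je ks)) = (\<Sum>i<r. count_list ks i * dv reg j (Je i))"
  by (rule dv_Pl[OF assms(1) Je_lideal assms(2)])
 also have "\<dots> = (\<Sum>i<r. (if i = j then count_list ks j else 0) + E j i * count_list ks i)"
  by (rule sum.cong) (use dv_Je dv_L_Pm Rj E_sym assms(2) in \<open>auto simp: algebra_simps\<close>)
 finally show ?thesis using assms(2) by (simp add: sum.distrib Eop_def)
qed

lemma dv_Pl_carrier:
 assumes "set ks <= {..<r}" "j < r"
 shows "dv (Pl ks) j (car (Pl ks)) = 2 * count_list ks j + Eop (count_list ks) j"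
proof -
 have "dv (Pl ks) j (car (Pl ks)) = (\<Sum>i<r. count_list ks i * dv reg j (Pc i))"
  using dv_Pl[OF assms(1) Pc_lideal assms(2)] by simp
 also have "\<dots> = (\<Sum>i<r. (if i = j then count_list ks j else 0) + count_list ks i * dv reg j (Je i))"
  by (rule sum.cong) (use dv_Pc assms(2) in \<open>auto simp: algebra_simps\<close>)
 also have "\<dots> = count_list ks j + dv (Pl ks) j (listset (map Je ks))"
  using dv_Pl[OF assms(1) Je_lideal assms(2)] assms(2) by (simp add: sum.distrib)
 finally show ?thesis using dv_Pl_Je[OF assms] by simp
qed

text \<open>The kernel of the projective cover lies between the socle of \<open>Pl ks\<close> and
  its radical. The count is stated additively, so that its nonnegativity is part of the
  conclusion.\<close>

lemma syzygy:
 assumes M: "fdm M" "lev2 M" "L M = rad M"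
 obtains ks p where "set ks <= {..<r}" "!!j. j < r ==> count_list ks j = ca M j"
  "p:mhom (Pl ks) M" "p ` car (Pl ks) = car M"
  "{xs:car (Pl ks). p xs:L M} = listset (map Je ks)"
  "{xs:car (Pl ks). p xs = \<zero>\<^sub>M} <= listset (map Je ks)"
  "L (Pl ks) <= {xs:car (Pl ks). p xs = \<zero>\<^sub>M}"
  "!!j. j < r ==> dv (Pl ks) j {xs:car (Pl ks). p xs = \<zero>\<^sub>M} + cb M j = Eop (ca M) j + ca M j"
proof -
 note lM = fdmD(1)[OF M(1)]
 interpret M: left_module \<Lambda> M by (rule lM)
 show thesis
 proof (rule projective_cover[OF M(1)])
  fix ks p assume ks: "set ks <= {..<r}" and cnt: "!!j. j < r ==> count_list ks j = dv M j (car M) - dv M j (rad M)"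
   and p: "p:mhom (Pl ks) M" "p ` car (Pl ks) = car M"
   and kp: "{xs:car (Pl ks). p xs:rad M} = listset (map Je ks)"
   and kill: "!!xs. lev2 M ==> xs:listset (map Rj ks) ==> p xs = \<zero>\<^sub>M"
  note lP = fdmD(1)[OF fdm_Pl[OF ks]]
  have cnt': "count_list ks j = ca M j" if "j < r" for j using cnt[OF that] M(3) by (simp add: ca_def)
  show thesis
  proof (rule that[OF ks cnt' p kp[folded M(3)]])
   show "{xs:car (Pl ks). p xs = \<zero>\<^sub>M} <= listset (map Je ks)"
    unfolding kp[symmetric] using iffD1[OF M.subm_iff rad_subm[OF lM]] by auto
   show "L (Pl ks) <= {xs:car (Pl ks). p xs = \<zero>\<^sub>M}"
   proof
    fix xs assume xs: "xs:L (Pl ks)"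
    then have "xs:listset (map Rj ks)" using L_Pl[OF ks] Rj ks_nth[OF ks] by (simp add: in_listset_map)
    then show "xs:{xs:car (Pl ks). p xs = \<zero>\<^sub>M}" using kill[OF M(2)] L_closed[OF xs] by blast
   qed
   fix j assume j: "j < r"
   have "dv (Pl ks) j (car (Pl ks)) = dv M j (car M) + dv (Pl ks) j {xs:car (Pl ks). p xs = \<zero>\<^sub>M}"
    using dv_hom[OF fdm_Pl[OF ks] lM p(1) left_module.carrier_subm[OF lP] j] unfolding p(2) .
   moreover have "Eop (count_list ks) j = Eop (ca M) j" by (rule Eop_cong) (rule cnt')
   ultimately show "dv (Pl ks) j {xs:car (Pl ks). p xs = \<zero>\<^sub>M} + cb M j = Eop (ca M) j + ca M j"
    using dv_Pl_carrier[OF ks j] cnt'[OF j] dv_split[OF M(1) j] by simp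
  qed
 qed
qed

text \<open>The images of the generators of \<open>M\<close> are searched in complements of \<open>L Y\<close>. The relations of \<open>M\<close>
 impose linear conditions with values in \<open>L Y\<close>, fewer than there are unknowns; the complements make
 the resulting map strict.\<close>

lemma strict_map:
 assumes M: "fdm M" "lev2 M" "L M = rad M" and Y: "fdm Y" "lev2 Y"
  and less: "(\<Sum>j<r. (Eop (ca M) j - cb M j) * cb Y j) < (\<Sum>j<r. ca M j * ca Y j)"
 obtains f x0 where "f:mhom M Y" "x0:car M" "f x0 ~= \<zero>\<^sub>Y"
  "!!x. x:car M ==> f x:L Y ==> EX l:L M. f x = f l"
proof -
 note lM = fdmD(1)[OF M(1)] and lY = fdmD(1)[OF Y(1)]
 interpret M: left_module \<Lambda> M by (rule lM)
 interpret Y: left_module \<Lambda> Y by (rule lY)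
 note LY = L_subm[OF lY]
 have LYs: "a \<odot>\<^sub>Y z:L Y" if "a:car \<Lambda>" "z:L Y" for a z
  using iffD1[OF Y.subm_iff LY] that by blast
 show thesis
 proof (rule syzygy[OF M])
  fix ks p assume ks: "set ks <= {..<r}" and cnt: "!!j. j < r ==> count_list ks j = ca M j"
   and p: "p:mhom (Pl ks) M" "p ` car (Pl ks) = car M"
   and kp: "{xs:car (Pl ks). p xs:L M} = listset (map Je ks)"
   and N1: "{xs:car (Pl ks). p xs = \<zero>\<^sub>M} <= listset (map Je ks)"
   and N2: "L (Pl ks) <= {xs:car (Pl ks). p xs = \<zero>\<^sub>M}"
   and N3: "!!j. j < r ==> dv (Pl ks) j {xs:car (Pl ks). p xs = \<zero>\<^sub>M} + cb M j = Eop (ca M) j + ca M j"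
  note fP = fdm_Pl[OF ks] and lP = fdmD(1)[OF fdm_Pl[OF ks]]
  define N where "N = {xs:car (Pl ks). p xs = \<zero>\<^sub>M}"
  note N1 = N1[folded N_def] and N2 = N2[folded N_def] and N3 = N3[folded N_def]
  have N: "subm N (Pl ks)" unfolding N_def by (rule subm_kernel[OF lP lM p(1)])
  let ?N = "(Pl ks)(|carrier := N|)"
  have fN: "fdm ?N" by (rule fdm_sub[OF fP N])
  note lN = fdmD(1)[OF fN]
  have LN: "subm (L (Pl ks)) ?N" using subm_sub_iff[OF lP N] L_subm[OF lP] N2 by blast
  show thesis
  proof (rule generating_list[OF fN LN])
   fix js ns assume jn: "list_all2 (%j n. j < r & n:car ?N & e j \<odot>\<^sub>?N n = n) js ns"
    and cj: "!!j. j < r ==> count_list js j = dv ?N j (car ?N) - dv ?N j (L (Pl ks))"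
    and gen: "!!T. subm T ?N ==> L (Pl ks) <= T ==> set ns <= T ==> T = car ?N"
   have jlen: "length js = length ns" using jn list_all2_lengthD by blast
   have jl: "js ! l < r" "ns ! l:N" "map ((\<otimes>) (e (js ! l))) (ns ! l) = ns ! l" if "l < length js" for l
    using jn that by (auto simp: list_all2_conv_all_nth)
   have js: "set js <= {..<r}" using jl by (auto simp: in_set_conv_nth)
   have nsN: "n:listset (map Je ks)" "n:N" if "n:set ns" for n
    using jl(2) N1 that jlen by (auto simp: in_set_conv_nth)
   have Jec: "length n = length ks" "set n <= car \<Lambda>" if "n:listset (map Je ks)" for n
    using Je_listset_closed[OF that] by auto
   have Pcc: "length n = length ks" "set n <= car \<Lambda>" if "n:listset (map Pc ks)" for n
   proof -
    have nl: "length n = length ks" "!!l. l < length ks ==> n ! l:Pc (ks ! l)" using that by (auto simp: in_listset_map)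
    then show "length n = length ks" "set n <= car \<Lambda>" using Pc_closed[OF nl(2)] by (auto simp: in_set_conv_nth)
   qed
   \<comment> \<open>The relations of \<open>M\<close> of type \<open>j\<close>, counted modulo the
     socle of \<open>Pl ks\<close>.\<close>
   have cj': "count_list js j = Eop (ca M) j - cb M j" if "j < r" for j
    using cj[OF that] dv_L_Pl[OF ks that] cnt[OF that] N3[OF that] by simp
   define B where "B i = {x:L Y. e i \<odot>\<^sub>Y x = x}" for i
   have kB: "ksub Y (B i)" if "i < r" for i unfolding B_def by (rule ksub_idem[OF lY LY e_closed[OF that]])
   \<comment> \<open>The unknowns of type \<open>i\<close> range over a complement, within
     \<open>e i Y\<close>, of its socle part.\<close>
   define good where "good i A \<longleftrightarrow> ksub Y A & A <= {x:car Y. e i \<odot>\<^sub>Y x = x} & A \<inter> B i = {\<zero>\<^sub>Y} & kdim Y A = ca Y i" for i A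
   have "EX A. i < r --> good i A" for i
   proof (cases "i < r")
    case True
    have sub: "B i <= {x:car Y. e i \<odot>\<^sub>Y x = x}" by (auto simp: B_def L_def)
    show ?thesis
    proof (rule kdim_complement[OF Y(1) kB[OF True] ksub_idem[OF lY Y.carrier_subm e_closed[OF True]] sub], goal_cases)
     case (1 A)
     then have "kdim Y A = ca Y i" by (simp add: ca_def edim_def B_def)
     then show ?case unfolding good_def using 1(1-3) by blast
    qed
   qed simp
   then obtain A where "!!i. i < r ==> good i (A i)" by metis
   then have A: "!!i. i < r ==> ksub Y (A i) & A i <= {x:car Y. e i \<odot>\<^sub>Y x = x} & A i \<inter> B i = {\<zero>\<^sub>Y} & kdim Y (A i) = ca Y i"
    by (simp only: good_def)
   let ?S = "list_module Y (length ks)" and ?T = "list_module Y (length js)"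
   let ?W = "listset (map A ks)" and ?V = "listset (map B js)"
   have kW: "ksub ?S ?W" unfolding KV_list by (rule listset_subm[OF lmod_KV[OF lY]]) (use A ks in auto)
   have kV: "ksub ?T ?V" unfolding KV_list by (rule listset_subm[OF lmod_KV[OF lY]]) (use kB js in auto)
   have "kdim ?S ?W = (\<Sum>i\<leftarrow>ks. kdim Y (A i))" by (rule kdim_listset[OF Y(1)]) (use A ks in auto)
   also have "\<dots> = (\<Sum>i<r. count_list ks i * kdim Y (A i))" using sum_list_map_eq_sum_count2[OF ks] by simp
   also have "\<dots> = (\<Sum>i<r. ca M i * ca Y i)" by (rule sum.cong) (use cnt A in auto)
   finally have dW: "kdim ?S ?W = (\<Sum>i<r. ca M i * ca Y i)" .
   have "kdim ?T ?V = (\<Sum>i\<leftarrow>js. kdim Y (B i))" by (rule kdim_listset[OF Y(1)]) (use kB js in auto)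
   also have "\<dots> = (\<Sum>i<r. count_list js i * kdim Y (B i))" using sum_list_map_eq_sum_count2[OF js] by simp
   also have "\<dots> = (\<Sum>i<r. (Eop (ca M) i - cb M i) * cb Y i)"
    by (rule sum.cong) (use cj' in \<open>auto simp: cb_def edim_def B_def\<close>)
   finally have dV: "kdim ?T ?V = (\<Sum>i<r. (Eop (ca M) i - cb M i) * cb Y i)" .
   \<comment> \<open>A tuple of proposed images of the generators is sent to the values of the
     relations. These lie in the socle of \<open>Y\<close>, since relations have coefficients in
     \<open>J\<close>.\<close>
   let ?\<Phi> = "%y. map (list_comb Y y) ns"
   have \<Phi>: "?\<Phi>:module_hom K (KV ?S) (KV ?T)"
   proof (rule module_homI)
    fix y assume "y:car (KV ?S)"
    then have y: "length y = length ks" "set y <= car Y" by auto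
    have cl: "list_comb Y y n:car Y" if "n:set ns" for n
     using Y.list_comb_closed[OF y(2)] Jec[OF nsN(1)[OF that]] y(1) by simp
    then show "?\<Phi> y:car (KV ?T)" using jlen by auto
    { fix z assume "z:car (KV ?S)"
     then have z: "length z = length ks" "set z <= car Y" by auto
     have "list_comb Y (map2 (add Y) y z) n = list_comb Y y n \<oplus>\<^sub>Y list_comb Y z n" if "n:set ns" for n
      using Y.list_comb_add_left[OF y(2) z(2)] Jec[OF nsN(1)[OF that]] y(1) z(1) by simp
     then show "?\<Phi> (y \<oplus>\<^sub>(KV ?S) z) = ?\<Phi> y \<oplus>\<^sub>(KV ?T) ?\<Phi> z" by (simp add: list_eq_iff_nth_eq) }
    fix c assume c: "c:car K"
    have "list_comb Y (map (%m. emb c \<odot>\<^sub>Y m) y) n = emb c \<odot>\<^sub>Y list_comb Y y n" if "n:set ns" for n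
     using list_comb_emb[OF lY y(2) _ _ c] Jec[OF nsN(1)[OF that]] y(1) by simp
    then show "?\<Phi> (c \<odot>\<^sub>(KV ?S) y) = c \<odot>\<^sub>(KV ?T) ?\<Phi> y" by (simp add: list_eq_iff_nth_eq)
   qed
   have Wy: "length y = length ks" "!!l. l < length ks ==> y ! l:A (ks ! l)" "set y <= car Y"
    "!!l. l < length ks ==> y ! l:car Y & e (ks ! l) \<odot>\<^sub>Y (y ! l) = y ! l" if y: "y:?W" for y
   proof -
    show 1: "length y = length ks" "!!l. l < length ks ==> y ! l:A (ks ! l)" using y by (auto simp: in_listset_map)
    show 2: "!!l. l < length ks ==> y ! l:car Y & e (ks ! l) \<odot>\<^sub>Y (y ! l) = y ! l"
     using 1(2) A[OF ks_nth[OF ks]] by blast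
    show "set y <= car Y" using 1(1) 2 by (auto simp: in_set_conv_nth)
   qed
   have Fhom: "list_comb Y y:mhom (Pl ks) Y" if y: "y:?W" for y
    unfolding Pl_def by (rule hom_sub_domain[OF Y.hom_list_comb[OF Wy(3,1)[OF y]]]) (use Pcc in auto)
   have FL: "list_comb Y y n:L Y" if y: "y:?W" and n: "n:listset (map Je ks)" for y n
   proof (rule Y.list_comb_in_subm[OF LY])
    have "x \<odot>\<^sub>Y m:L Y" if "x:Je i" "m:car Y" for x m i
     using lev2_rad[OF lY] Y(2) radI[OF lY, of x m] that by (auto simp: Je_def)
    then show "list_all2 (%m x. x \<odot>\<^sub>Y m:L Y) y n"
     using Wy(1,4)[OF y] n by (auto simp: list_all2_conv_all_nth in_listset_map)
   qed
   have im: "?\<Phi> ` ?W <= ?V"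
   proof
    fix z assume "z:?\<Phi> ` ?W"
    then obtain y where y: "y:?W" "z = ?\<Phi> y" by blast
    have "list_comb Y y (ns ! l):B (js ! l)" if l: "l < length js" for l
    proof -
     have n: "ns ! l:set ns" using l jlen by simp
     have "ns ! l:car (Pl ks)" using nsN(2)[OF n] by (simp add: N_def)
     then have "list_comb Y y (e (js ! l) \<odot>\<^sub>(Pl ks) (ns ! l)) = e (js ! l) \<odot>\<^sub>Y list_comb Y y (ns ! l)"
      using homD(3)[OF Fhom[OF y(1)] e_closed[OF jl(1)[OF l]]] by blast
     then show ?thesis using FL[OF y(1) nsN(1)[OF n]] jl(3)[OF l] by (simp add: B_def)
    qed
    then show "z:?V" using y(2) jlen by (simp add: in_listset_map)
   qed
   note lS = fdmD(1)[OF fdm_list[OF Y(1), of "length ks"]] and lT = fdmD(1)[OF fdm_list[OF Y(1), of "length js"]]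
   \<comment> \<open>The conditions take values in a space of smaller dimension than that of the
     unknowns, so some nonzero tuple satisfies all of them.\<close>
   have "kdim ?T (?\<Phi> ` ?W) <= kdim ?T ?V"
    by (rule kdim_mono[OF fdm_list[OF Y(1)] subm_image[OF lmod_KV[OF lS] lmod_KV[OF lT] \<Phi> kW] kV im])
   then have "kdim ?S {y:?W. ?\<Phi> y = \<zero>\<^sub>?T} ~= 0"
    using kdim_hom[OF fdm_list[OF Y(1)] lT \<Phi> kW] dW dV less by simp
   then have "{y:?W. ?\<Phi> y = \<zero>\<^sub>?T} ~= {\<zero>\<^sub>?S}" using kdim_zero[OF lS] by metis
   moreover have "\<zero>\<^sub>?S:{y:?W. ?\<Phi> y = \<zero>\<^sub>?T}"
    using hom_zero[OF lmod_KV[OF lS] lmod_KV[OF lT] \<Phi>]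
     iffD1[OF left_module.subm_iff[OF lmod_KV[OF lS]] kW] by simp
   ultimately obtain y where y: "y:?W" "?\<Phi> y = \<zero>\<^sub>?T" "y ~= \<zero>\<^sub>?S" by blast
   let ?F = "list_comb Y y"
   note F = Fhom[OF y(1)]
   note FD = homD[OF F]
   have Fns: "?F n = \<zero>\<^sub>Y" if "n:set ns" for n
   proof -
    have "?F n:set (?\<Phi> y)" using that by simp
    then have "?F n:set (replicate (length js) \<zero>\<^sub>Y)" unfolding y(2) list_module_simps(2) .
    then show ?thesis by simp
   qed
   \<comment> \<open>Relations in the socle of \<open>Pl ks\<close> come from the second radical
     layer and hold in any module of Loewy length two; this is why generators of the kernel modulo
     that socle suffice.\<close>
   have FLP: "?F n = \<zero>\<^sub>Y" if n: "n:L (Pl ks)" for n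
   proof -
    have "n:listset (map Rj ks)" using n L_Pl[OF ks] Rj ks_nth[OF ks] by (simp add: in_listset_map)
    then have "?F n:{\<zero>\<^sub>Y}"
     using Wy(1,4)[OF y(1)] Rj_kill[OF lY Y(2) _ ks_nth[OF ks]]
     by (intro Y.list_comb_in_subm[OF Y.zero_subm]) (auto simp: list_all2_conv_all_nth in_listset_map)
    then show ?thesis by simp
   qed
   let ?K = "{n:car ?N. ?F n = \<zero>\<^sub>Y}"
   have Nc: "N <= car (Pl ks)" by (auto simp: N_def)
   have "?K = car ?N"
    by (rule gen[OF subm_kernel[OF lN lY hom_sub_domain[OF F Nc]]]) (use FLP Fns N2 nsN(2) in auto)
   then have FN: "?F n = \<zero>\<^sub>Y" if "n:car (Pl ks)" "p n = \<zero>\<^sub>M" for n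
    using that by (auto simp: N_def)
   have "EX f:mhom M Y. ALL n:car (Pl ks). f (p n) = ?F n"
    by (rule hom_factor[OF lP lM lY p F]) (rule FN)
   then obtain f where f: "f:mhom M Y" "!!n. n:car (Pl ks) ==> f (p n) = ?F n" by blast
   have ky: "list_all2 (%k m. k < r & m:car Y & e k \<odot>\<^sub>Y m = m) ks y"
    using Wy(1,4)[OF y(1)] ks_nth[OF ks] by (auto simp: list_all2_conv_all_nth)
   obtain m where m: "m:set y" "m ~= \<zero>\<^sub>Y"
    using y(3) replicate_eqI[OF Wy(1)[OF y(1)], of "\<zero>\<^sub>Y"] by auto
   obtain n0 where n0: "n0:car (Pl ks)" "?F n0 = m" using list_comb_unit[OF lY ky m(1)] by auto
   show thesis
   proof (rule that[OF f(1), of "p n0"])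
    show "p n0:car M" by (rule homD(1)[OF p(1) n0(1)])
    show "f (p n0) ~= \<zero>\<^sub>Y" using f(2)[OF n0(1)] n0(2) m(2) by simp
    fix x assume x: "x:car M" "f x:L Y"
    have "x:p ` car (Pl ks)" using x(1) p(2) by simp
    then obtain n where n: "n:car (Pl ks)" "x = p n" by blast
    have FnL: "?F n:L Y" using f(2)[OF n(1)] n(2) x(2) by simp
    have sJ: "subm (listset (map Je ks)) (Pl ks)"
     by (rule Pl_listset_subm[OF ks Je_lideal]) (auto simp: Je_def)
    have B0: "subm (?F ` listset (map Je ks)) Y" by (rule subm_image[OF lP lY F sJ])
    have "?F n:?F ` listset (map Je ks)"
    proof (rule ccontr)
     assume no: "?F n ~: ?F ` listset (map Je ks)"
     obtain i a where ia: "i < r" "a:car \<Lambda>" "e i \<odot>\<^sub>Y (a \<odot>\<^sub>Y ?F n) ~: ?F ` listset (map Je ks)"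
      using subm_detect[OF lY B0 FD(1)[OF n(1)] no] .
     let ?n = "e i \<odot>\<^sub>(Pl ks) (a \<odot>\<^sub>(Pl ks) n)"
     interpret P: left_module \<Lambda> "Pl ks" by (rule lP)
     have c: "a \<odot>\<^sub>(Pl ks) n:car (Pl ks)" by (rule P.smult_closed[OF ia(2) n(1)])
     have n': "?n:car (Pl ks)" by (rule P.smult_closed[OF e_closed[OF ia(1)] c])
     have en: "e i \<odot>\<^sub>(Pl ks) ?n = ?n" using P.smult_assoc1[OF e_closed[OF ia(1)] e_closed[OF ia(1)] c] e_idem[OF ia(1)] by simp
     have F': "?F ?n = e i \<odot>\<^sub>Y (a \<odot>\<^sub>Y ?F n)" using FD(3)[OF e_closed[OF ia(1)] c] FD(3)[OF ia(2) n(1)] by simp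
     have FL': "?F ?n:L Y" unfolding F' by (rule LYs[OF e_closed[OF ia(1)] LYs[OF ia(2) FnL]])
     define n' where "n' = ?n"
     have nl: "list_all2 (%k n. n:Pc k & e i \<otimes> n = n) ks n'"
      using n' en unfolding n'_def[symmetric] by (auto simp: in_listset_map list_all2_conv_all_nth list_eq_iff_nth_eq)
     have ky': "list_all2 (%k m. k < r & m:car Y & e k \<odot>\<^sub>Y m = m & (k = i --> m:A i)) ks y"
      using Wy(1,2,4)[OF y(1)] ks_nth[OF ks] by (auto simp: list_all2_conv_all_nth)
     note Ai = A[OF ia(1)]
     \<comment> \<open>The scalar part \<open>b\<close> of the value lies in the chosen complement,
       and also in the socle because the other terms do. Hence it is zero, and the value comes from
       radical coefficients, whose image in \<open>M\<close> is in the socle.\<close>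
     obtain b n'' where b: "b:A i" "n'':listset (map Je ks)" "?F n' = b \<oplus>\<^sub>Y ?F n''"
      using comb_split[OF lY ia(1) conjunct1[OF Ai] ky' nl] by blast
     have bc: "b:car Y" "e i \<odot>\<^sub>Y b = b" using b(1) Ai by auto
     note FL'' = FL[OF y(1) b(2)]
     have "b = ?F n' \<ominus>\<^sub>Y ?F n''" unfolding b(3) using Y.M.minus_add_cancel[OF bc(1) L_closed[OF FL'']] by simp
     then have "b:L Y" using Y.subm_minus[OF LY FL' FL''] by (simp add: n'_def)
     then have "b:A i \<inter> B i" using b(1) bc(2) by (simp add: B_def)
     then have "?F n' = ?F n''" using Ai b(3) L_closed[OF FL''] by simp
     then show False using ia(3) F' b(2) by (metis imageI n'_def)
    qed
    then obtain n'' where n'': "n'':listset (map Je ks)" "?F n = ?F n''" by blast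
    then have "n'':car (Pl ks)" "p n'':L M" using kp by auto
    then show "EX l:L M. f x = f l" using f(2) n n''(2) by metis
   qed
  qed
 qed
qed

end

section \<open>Thick subcategories over an algebra of Loewy length three\<close>

text \<open>Consecutive members of the sequence are the related pairs. The inequalities in
  \<open>F\<close> and \<open>G\<close> ensure that subtraction of natural numbers is genuine, so
  both iterations satisfy the same recursion.\<close>

lemma (in adjacency_form) two_sided_sequence:
 assumes R0: "R a0 b0"
  and F: "!!a b. R a b ==> (ALL i<r. b i <= Eop a i) & R (%i. Eop a i - b i) a"
  and G: "!!a b. R a b ==> (ALL i<r. a i <= Eop b i) & R b (%i. Eop b i - a i)"
 obtains a :: "int => nat => nat" where "a 0 = a0" "a (-1) = b0" "!!n. R (a n) (a (n - 1))"
  "!!n i. i < r ==> a (n + 1) i + a (n - 1) i = Eop (a n) i"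
proof -
 define u where "u n = ((%(a, b). (%i. Eop a i - b i, a)) ^^ n) (a0, b0)" for n
 define v where "v n = ((%(a, b). (b, %i. Eop b i - a i)) ^^ n) (a0, b0)" for n
 have u0: "u 0 = (a0, b0)" "v 0 = (a0, b0)" by (simp_all add: u_def v_def)
 have uS: "fst (u (Suc n)) = (%i. Eop (fst (u n)) i - snd (u n) i)" "snd (u (Suc n)) = fst (u n)" for n
  by (simp_all add: u_def case_prod_beta)
 have vS: "fst (v (Suc n)) = snd (v n)" "snd (v (Suc n)) = (%i. Eop (snd (v n)) i - fst (v n) i)" for n
  by (simp_all add: v_def case_prod_beta)
 have uR: "R (fst (u n)) (snd (u n))" for n
  by (induction n) (use R0 F in \<open>auto simp: u0 uS\<close>)
 have vR: "R (fst (v n)) (snd (v n))" for n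
  by (induction n) (use R0 G in \<open>auto simp: u0 vS\<close>)
 \<comment> \<open>\<open>u n\<close> is the pair at position \<open>n\<close> and
   \<open>v n\<close> the pair at position \<open>- n\<close>, each paired with the entry one place
   to its left; the two orbits share the pair at 0.\<close>
 define a where "a n = (if 0 <= n then fst (u (nat n)) else fst (v (nat (- n))))" for n :: int
 have ap: "a (int n) = fst (u n)" for n by (simp add: a_def)
 have an: "a (- int n) = fst (v n)" for n by (cases n) (simp_all add: a_def u0 nat_add_distrib)
 have an1: "a (- int n - 1) = snd (v n)" for n
 proof -
  have "- int n - 1 = - int (Suc n)" by simp
  then show ?thesis by (simp only: an vS)
 qed
 have ap1: "a (int n - 1) = snd (u n)" for n
 proof (cases n)
  case 0
  then show ?thesis using an1[of 0] by (simp add: u0)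
 next
  case (Suc m)
  then show ?thesis using ap[of m] by (simp add: uS)
 qed
 show thesis
 proof (rule that[of a])
  show "a 0 = a0" "a (- 1) = b0" using ap[of 0] ap1[of 0] by (simp_all add: u0)
  show "R (a n) (a (n - 1))" for n
   by (cases n rule: int_cases2) (use uR vR in \<open>simp_all add: ap ap1 an an1\<close>)
  fix n :: int and i assume i: "i < r"
  have pos: "a (int k + 1) i + a (int k - 1) i = Eop (a (int k)) i" for k
   using ap[of "Suc k"] F[OF uR[of k]] i by (simp add: ap ap1 uS add.commute)
  show "a (n + 1) i + a (n - 1) i = Eop (a n) i"
  proof (rule int_cases2[of n])
   fix k assume n: "n = - int k"
   show ?thesis
   proof (cases k)
    case 0
    then show ?thesis using pos[of 0] n by simp
   next
    case (Suc m)
    have n1: "a (n + 1) = fst (v m)" using n Suc an[of m] by simp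
    show ?thesis unfolding n1 unfolding n an an1 Suc vS using G[OF vR[of m]] i by simp
   qed
  qed (use pos in simp)
 qed
qed

section \<open>Simple modules and syzygies inside a thick subcategory\<close>

locale core = loewy_algebra +
 fixes C :: "('b, 'b list) module set"
 assumes C': "thick_subcategory \<Lambda> C" and C_reg': "contains_regular \<Lambda> C"

sublocale core \<subseteq> thick K \<Lambda> C
 by unfold_locales (use C' C_reg' in auto)

context core
begin

text \<open>The simple submodule generated by such an atom meets the radical trivially; it has a
  complement by \<open>complement_over_rad\<close>, and so it is a summand of
  \<open>X\<close>.\<close>

lemma atom_splits:
 assumes X: "inC X" and z: "atom X i z" "i < r" "z ~: rad X"
 shows "inC (S i)"
proof -
 have fX: "fdm X" by (rule inC_fdm[OF X])
 note lX = fdmD(1)[OF fX] and zD = atomD[OF z(1)]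
 interpret X: left_module \<Lambda> X by (rule lX)
 let ?W = "cyc X z"
 note W = cyc_subm[OF lX zD(2)] and zW = cyc_self[OF lX zD(2)]
 have WL: "?W <= L X" by (rule cyc_least[OF lX L_subm[OF lX] zD(1)])
 have "subm (?W \<inter> rad X) (X(|carrier := ?W|))"
  using subm_sub_iff[OF lX W] X.subm_Int[OF W rad_subm[OF lX]] by simp
 then have "?W \<inter> rad X = {\<zero>\<^sub>X} \<or> ?W \<inter> rad X = ?W"
  using simpleD(3)[OF atom_iso(2)[OF lX z(1,2)]] by simp
 then have Wr: "?W \<inter> rad X = {\<zero>\<^sub>X}" using z(3) zW by blast
 note lW = lmod_sub[OF lX W]
 have Wc: "?W <= car X" using iffD1[OF X.subm_iff W] by blast
 show ?thesis
 proof (rule complement_over_rad[OF fX W WL Wr])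
  fix N assume N: "subm N X" "rad X <= N" "N \<inter> ?W = {\<zero>\<^sub>X}"
   "!!x. x:car X ==> EX n:N. EX w:?W. x = n \<oplus>\<^sub>X w"
  have Nc: "N <= car X" using iffD1[OF X.subm_iff N(1)] by blast
  note lN = lmod_sub[OF lX N(1)]
  let ?D = "direct_prod (X(|carrier := N|)) (X(|carrier := ?W|))"
  have p: "(%z. fst z \<oplus>\<^sub>X snd z):mhom ?D X"
   by (rule hom_copair[OF lN lW lX hom_incl[OF Nc] hom_incl[OF Wc]])
  have "EX g:mhom X (X(|carrier := ?W|)). ALL z:car ?D. g (fst z \<oplus>\<^sub>X snd z) = snd z"
  proof (rule hom_factor[OF lmod_prod[OF lN lW] lX lW p _ hom_snd])
   show "(%z. fst z \<oplus>\<^sub>X snd z) ` car ?D = car X"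
   proof (intro equalityI subsetI)
    fix x assume "x:(%z. fst z \<oplus>\<^sub>X snd z) ` car ?D"
    then show "x:car X" using homD(1)[OF p] by blast
   next
    fix x assume "x:car X"
    then obtain n w where "n:N" "w:?W" "x = n \<oplus>\<^sub>X w" using N(4) by blast
    then show "x:(%z. fst z \<oplus>\<^sub>X snd z) ` car ?D" by (intro image_eqI[of _ _ "(n, w)"]) auto
   qed
   fix y assume y: "y:car ?D" "fst y \<oplus>\<^sub>X snd y = \<zero>\<^sub>X"
   then have c: "fst y:N" "snd y:?W" "fst y:car X" "snd y:car X" using Nc Wc by auto
   have "\<ominus>\<^sub>X snd y = fst y" by (rule X.M.minus_equality[OF y(2) c(4,3)])
   then have "snd y = \<ominus>\<^sub>X fst y" using X.M.minus_minus[OF c(4)] by simp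
   then have "snd y:N" using X.subm_neg[OF N(1) c(1)] by simp
   then show "snd y = \<zero>\<^sub>(X(|carrier := ?W|))" using N(3) c(2) by auto
  qed
  then obtain g where g: "g:mhom X (X(|carrier := ?W|))"
   "!!z. z:car ?D ==> g (fst z \<oplus>\<^sub>X snd z) = snd z" by blast
  have gw: "g w = w" if "w:?W" for w
  proof -
   have "(\<zero>\<^sub>X, w):car ?D" using that iffD1[OF X.subm_iff N(1)] by simp
   then have "g (\<zero>\<^sub>X \<oplus>\<^sub>X w) = w" using g(2) by fastforce
   then show ?thesis using that Wc X.M.l_zero by (metis subsetD)
  qed
  have "inC (X(|carrier := ?W|))" by (rule inC_retract[OF X lW hom_incl[OF Wc] g(1)]) (use gw in simp)
  then show ?thesis using inC_iso[OF _ simpleD(1)[OF S_simple[OF z(2)]] atom_iso(1)[OF lX z(1,2)]] by blast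
 qed
qed

lemma inC_Pm: "i < r ==> inC (Pm i)"
 and inj_mod_Pm: "i < r ==> inj_mod (Pm i)"
proof -
 assume i: "i < r"
 note lP = lmod_Pm[OF i]
 have Pi: "Pc i <= car reg" using Pc_closed by auto
 have e: "e i:car (Pm i)" using e_Pc[OF i] by simp
 have id: "x \<odot>\<^sub>(Pm i) e i = x" if "x:car (Pm i)" for x using that Pc_e by simp
 note incl = hom_incl[OF Pi, folded Pm_def]
 show "inC (Pm i)" by (rule inC_retract[OF inC_regular lP incl cyc_hom[OF lP e] id])
 show "inj_mod (Pm i)" by (rule inj_mod_retract[OF inj_mod_regular[OF ws] lP incl cyc_hom[OF lP e] id])
qed

lemma inC_Pl: "set ks <= {..<r} ==> inC (Pl ks)"
 using Pl_projective fg_projectives_subset inC_C by blast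

text \<open>The radical of \<open>Pm i\<close> is the kernel of the map onto \<open>S i\<close>, and
  its quotient by the socle, again a copy of \<open>S i\<close>, is the semisimple middle layer.
  Both are in \<open>C\<close>, and \<open>S j\<close> is a summand of that layer when there is an
  arrow.\<close>

lemma simple_step:
 assumes i: "i < r" and j: "j < r" and E: "E i j ~= 0" and S: "inC (S i)"
 shows "inC (S j)"
proof -
 note lP = lmod_Pm[OF i] and lS = simpleD(1)[OF S_simple[OF i]]
 obtain s where s: "atom (S i) i s" using S_atom[OF i] by blast
 obtain t where t: "atom (Pm i) i t" "L (Pm i) = cyc (Pm i) t" using L_Pm[OF i] .
 note h = Pm_hom[OF lS atomD(2)[OF s] i]
 have surj: "(%x. x \<odot>\<^sub>(S i) s) ` car (Pm i) = car (S i)"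
  using Pm_hom_image[OF lS atomD(2)[OF s] i atomD(3)[OF s]] S_cyc[OF i s] by simp
 have ker: "{x:car (Pm i). x \<odot>\<^sub>(S i) s = \<zero>\<^sub>(S i)} = Je i"
  using Pm_annihilator[OF i lS s] by (auto simp: Je_def)
 have JP: "(Pm i)(|carrier := Je i|) = Jm i" by (simp add: Pm_def)
 have J: "inC (Jm i)"
  using inC_hom(2)[OF fdm_Pm[OF i] lS h surj inC_Pm[OF i] S] unfolding ker JP .
 note fJ = inC_fdm[OF J] and lJ = fdmD(1)[OF inC_fdm[OF J]]
 have LJ: "subm (Rj i) (Jm i)" unfolding Rj_def by (rule rad_subm[OF lJ])
 have "inC ((Pm i)(|carrier := cyc (Pm i) t|))"
  by (rule inC_iso[OF S lmod_sub[OF lP cyc_subm[OF lP atomD(2)[OF t(1)]]]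
    module_iso_sym[OF lmod_sub[OF lP cyc_subm[OF lP atomD(2)[OF t(1)]]] atom_iso(1)[OF lP t(1) i]]])
 then have "inC ((Jm i)(|carrier := Rj i|))" unfolding Rj[OF i] t(2) by (simp add: Pm_def)
 then have X: "inC (quot_module (Jm i) (Rj i))" by (rule inC_quot[OF fJ LJ _ J])
 let ?X = "quot_module (Jm i) (Rj i)"
 note q = quot_module[OF lJ LJ]
 interpret X: left_module \<Lambda> ?X by (rule q)
 have JX: "a \<odot>\<^sub>?X x = \<zero>\<^sub>?X" if ax: "a:J" "x:car ?X" for a x
 proof -
  have "x:cmap (Jm i) (Rj i) ` car (Jm i)" using ax q(3) by simp
  then obtain y where y: "y:car (Jm i)" "x = cmap (Jm i) (Rj i) y" by blast
  have ay: "a \<odot>\<^sub>(Jm i) y:Rj i" unfolding Rj_def by (rule radI[OF lJ ax(1) y(1)])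
  have "a \<odot>\<^sub>(Jm i) y:car (Jm i)" using ay Rj_lideal(2)[OF i] by auto
  then show ?thesis
   using homD(3)[OF q(2) J_sub[OF ax(1)] y(1)] q(4)[of "a \<odot>\<^sub>(Jm i) y"] ay y(2) by simp
 qed
 have "rad ?X <= {\<zero>\<^sub>?X}" by (rule rad_least[OF X.zero_subm]) (use JX in simp)
 have kerq: "{x:car (Jm i). cmap (Jm i) (Rj i) x = \<zero>\<^sub>?X} = Rj i"
  using q(4) Rj_lideal(2)[OF i] by auto
 have "dv (Jm i) j (car (Jm i)) = dv ?X j (car ?X) + dv (Jm i) j (Rj i)"
  using dv_hom[OF fJ q(1,2) left_module.carrier_subm[OF lJ] j] unfolding q(3) kerq .
 then have "dv ?X j (car ?X) = E i j" by (simp add: E_def)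
 then have "kdim ?X {x:car ?X. e j \<odot>\<^sub>?X x = x} ~= 0" using E by (simp add: edim_def)
 then have "{x:car ?X. e j \<odot>\<^sub>?X x = x} ~= {\<zero>\<^sub>?X}" using kdim_zero[OF q(1)] by metis
 moreover have "\<zero>\<^sub>?X:{x:car ?X. e j \<odot>\<^sub>?X x = x}" using X.smult_zero[OF e_closed[OF j]] by simp
 ultimately obtain z where z: "z:car ?X" "e j \<odot>\<^sub>?X z = z" "z ~= \<zero>\<^sub>?X" by blast
 have "atom ?X j z" using z JX by (simp add: atom_def L_def)
 then show ?thesis by (rule atom_splits[OF X _ j]) (use \<open>rad ?X <= {\<zero>\<^sub>?X}\<close> z(3) in blast)
qed

text \<open>Simple modules spread along arrows to all vertices. A submodule in \<open>C\<close> of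
  greatest dimension is then everything, since an atom of the quotient would give an extension of it
  in \<open>C\<close>.\<close>

lemma all_modules:
 assumes i: "i < r" "inC (S i)" and M: "fdm M"
 shows "inC M"
proof -
 have "{i. i < r & inC (S i)} = {..<r}"
  by (rule E_connected) (use i simple_step in auto)
 then have S: "inC (S j)" if "j < r" for j using that by auto
 note lM = fdmD(1)[OF M]
 interpret M: left_module \<Lambda> M by (rule lM)
 let ?P = "%U. subm U M & inC (M(|carrier := U|))"
 have P0: "?P {\<zero>\<^sub>M}"
  using M.zero_subm inC_zero[OF lmod_sub[OF lM M.zero_subm]] by simp
 have bound: "ALL U. ?P U --> kdim M U < Suc (kdim M (car M))"
  using kdim_mono[OF M subm_KV[OF lM] subm_KV[OF lM M.carrier_subm]] M.subm_iff
  by (simp add: less_Suc_eq_le)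
 obtain U where U: "?P U" "!!V. ?P V ==> kdim M V <= kdim M U"
  using ex_has_greatest_nat[of ?P, OF P0 bound] by blast
 have Us: "subm U M" using U(1) by blast
 let ?Q = "quot_module M U" and ?\<pi> = "cmap M U"
 note q = quot_module[OF lM Us]
 interpret Q: left_module \<Lambda> ?Q by (rule q)
 have "car ?Q = {\<zero>\<^sub>?Q}"
 proof (rule ccontr)
  assume "car ?Q ~= {\<zero>\<^sub>?Q}"
  then obtain l z where z: "l < r" "atom ?Q l z" using atom_exists[OF q(1) Q.carrier_subm] by blast
  note zD = atomD[OF z(2)]
  note W = cyc_subm[OF q(1) zD(2)]
  let ?V = "{x:car M. ?\<pi> x:cyc ?Q z}"
  have V: "subm ?V M" by (rule subm_vimage[OF lM q(1,2) W])
  have UV: "U <= ?V"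
  proof
   fix x assume x: "x:U"
   then have "x:car M" using iffD1[OF M.subm_iff Us] by blast
   then show "x:?V" using q(4)[of x] x iffD1[OF Q.subm_iff W] by simp
  qed
  let ?MV = "M(|carrier := ?V|)" and ?QW = "?Q(|carrier := cyc ?Q z|)"
  have h: "?\<pi>:mhom ?MV ?QW"
   by (rule hom_sub_codomain[OF hom_sub_domain[OF q(2)]]) auto
  have hs: "?\<pi> ` car ?MV = car ?QW"
  proof (intro equalityI subsetI)
   fix y assume "y:car ?QW"
   then have y: "y:cyc ?Q z" "y:?\<pi> ` car M" using q(3) iffD1[OF Q.subm_iff W] by auto
   then show "y:?\<pi> ` car ?MV" by auto
  qed auto
  have ker: "{x:car ?MV. ?\<pi> x = \<zero>\<^sub>?QW} = U" using q(4) UV by auto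
  have "inC ?QW"
   by (rule inC_iso[OF S[OF z(1)] lmod_sub[OF q(1) W]
     module_iso_sym[OF lmod_sub[OF q(1) W] atom_iso(1)[OF q(1) z(2,1)]]])
  then have "inC ?MV"
   using inC_hom(3)[OF fdm_sub[OF M V] lmod_sub[OF q(1) W] h hs] U(1) unfolding ker by simp
  then have "kdim M ?V <= kdim M U" using U(2) V by blast
  then have "U = ?V"
   using kdim_eq[OF M subm_KV[OF lM Us] subm_KV[OF lM V] UV] kdim_mono[OF M subm_KV[OF lM Us] subm_KV[OF lM V] UV] by simp
  moreover have "z:?\<pi> ` car M" using zD(2) q(3) by simp
  then obtain x where x: "x:car M" "z = ?\<pi> x" by blast
  then have "x:?V" using cyc_self[OF q(1) zD(2)] by simp
  ultimately have "x:U" by simp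
  then show False using q(4)[OF x(1)] x(2) zD(4) by simp
 qed
 then have Q0: "y = \<zero>\<^sub>?Q" if "y:car ?Q" for y using that by simp
 have "U = car M"
 proof (intro equalityI subsetI)
  show "x:U" if x: "x:car M" for x using q(4)[OF x] Q0[OF homD(1)[OF q(2) x]] by simp
 qed (use iffD1[OF M.subm_iff Us] in blast)
 then show ?thesis using U(1) by simp
qed

text \<open>If two radical factors act nontrivially on \<open>X\<close>, they do so on some
  \<open>u\<close> fixed by \<open>e l\<close>. The map from \<open>Pm l\<close> to \<open>u\<close>
  does not kill the simple socle, so it is injective and splits. The other summand is smaller and
  still in \<open>C\<close>, hence projective by minimality, and then so is
  \<open>X\<close>.\<close>

lemma lev2_exists:
 assumes "M:C" "M ~: fg_projectives \<Lambda>"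
 obtains X :: "('b, 'b list) module" where "inC X" "lev2 X" "car X ~= {\<zero>\<^sub>X}"
proof -
 let ?P = "%X. X:C & X ~: fg_projectives \<Lambda>"
 obtain X where X: "?P X" "!!Y. ?P Y ==> kdim X (car X) <= kdim Y (car Y)"
  using ex_has_least_nat[of ?P M "%X. kdim X (car X)"] assms by blast
 have fX: "fdm X" and iX: "inC X" using X(1) C_fdm inC_C by auto
 note lX = fdmD(1)[OF fX]
 interpret X: left_module \<Lambda> X by (rule lX)
 have np: "~ projective_module \<Lambda> X" using X(1) fX fg_projectives_iff by blast
 have "lev2 X"
 proof (rule ccontr)
  assume "~ lev2 X"
  then obtain a b x where abx: "a:J" "b:J" "x:car X" "a \<odot>\<^sub>X (b \<odot>\<^sub>X x) ~= \<zero>\<^sub>X"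
   unfolding lev2_def by blast
  \<comment> \<open>\<open>?N1\<close> is the socle, and \<open>?N2\<close> consists of the elements
    killed by all products of two elements of \<open>J\<close>; membership outside a submodule is
    what \<open>subm_detect\<close> can normalise.\<close>
  let ?N1 = "{x:car X. ALL j:J. j \<odot>\<^sub>X x:{\<zero>\<^sub>X}}"
  let ?N2 = "{x:car X. ALL j:J. j \<odot>\<^sub>X x:?N1}"
  have N2: "subm ?N2 X"
   by (rule J_vimage_subm[OF lX J_vimage_subm[OF lX X.zero_subm]])
  have "x ~: ?N2" using abx by blast
  then obtain l y where l: "l < r" "y:car \<Lambda>" "e l \<odot>\<^sub>X (y \<odot>\<^sub>X x) ~: ?N2"
   using subm_detect[OF lX N2 abx(3)] by blast
  define u where "u = e l \<odot>\<^sub>X (y \<odot>\<^sub>X x)"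
  have yx: "y \<odot>\<^sub>X x:car X" by (rule X.smult_closed[OF l(2) abx(3)])
  have u: "u:car X" "e l \<odot>\<^sub>X u = u" "u ~: ?N2"
   using X.smult_closed[OF e_closed[OF l(1)] yx] X.smult_assoc1[OF e_closed[OF l(1)] e_closed[OF l(1)] yx] e_idem[OF l(1)] l(3)
   by (simp_all add: u_def)
  note h = Pm_hom[OF lX u(1) l(1)] and lP = lmod_Pm[OF l(1)]
  let ?K = "{x:car (Pm l). x \<odot>\<^sub>X u = \<zero>\<^sub>X}"
  have K: "subm ?K (Pm l)" by (rule subm_kernel[OF lP lX h])
  have "?K = {\<zero>}"
  proof (rule ccontr)
   assume "?K ~= {\<zero>}"
   then have LK: "L (Pm l) <= ?K" by (rule L_Pm_le[OF l(1) K])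
   have "j' \<odot>\<^sub>X (j \<odot>\<^sub>X u) = \<zero>\<^sub>X" if jj: "j:J" "j':J" for j j'
   proof -
    note c = J_sub[OF jj(1)] J_sub[OF jj(2)] e_closed[OF l(1)]
    have "a \<otimes> (j' \<otimes> j \<otimes> e l) = \<zero>" if "a:J" for a
     using J_cube[OF that jj(2,1)] J_sub[OF that] c by (simp add: Alg.m_assoc[symmetric])
    moreover have "j' \<otimes> j \<otimes> e l:Pc l" using c e_idem[OF l(1)] by (simp add: Pc_def Alg.m_assoc)
    ultimately have "j' \<otimes> j \<otimes> e l:L (Pm l)" by (simp add: L_def)
    then have "(j' \<otimes> j \<otimes> e l) \<odot>\<^sub>X u = \<zero>\<^sub>X" using LK by blast
    then show ?thesis using c u X.smult_assoc1 X.smult_closed by simp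
   qed
   then have "u:?N2" using u(1) X.smult_closed J_sub by simp
   then show False using u(3) by blast
  qed
  then have inj: "x = \<zero>\<^sub>(Pm l)" if "x:car (Pm l)" "x \<odot>\<^sub>X u = \<zero>\<^sub>X" for x using that by auto
  obtain g where g: "g:mhom X (Pm l)" "!!x. x:car (Pm l) ==> g (x \<odot>\<^sub>X u) = x"
   by (rule inj_modD[OF inj_mod_Pm[OF l(1)] fdm_Pm[OF l(1)] fX h inj hom_id]) (assumption, assumption, rule that)
  let ?B = "{z:car X. g z = \<zero>\<^sub>(Pm l)}"
  let ?X' = "X(|carrier := ?B|)"
  have gs: "g ` car X = car (Pm l)"
  proof (intro equalityI subsetI)
   fix y assume "y:car (Pm l)"
   then have "y = g (y \<odot>\<^sub>X u)" "y \<odot>\<^sub>X u:car X" using g(2) homD(1)[OF h] by auto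
   then show "y:g ` car X" by blast
  qed (use homD(1)[OF g(1)] in blast)
  have X': "inC ?X'" by (rule inC_hom(2)[OF fX lP g(1) gs iX inC_Pm[OF l(1)]])
  have "kdim X (car X) = kdim (Pm l) (car (Pm l)) + kdim X ?B"
   using kdim_hom[OF fX lP hom_KV[OF g(1)] subm_KV[OF lX X.carrier_subm]] unfolding gs .
  moreover have "kdim (Pm l) (car (Pm l)) ~= 0"
  proof
   assume "kdim (Pm l) (car (Pm l)) = 0"
   then have "car (Pm l) = {\<zero>\<^sub>(Pm l)}"
    by (rule kdim_pos[OF fdm_Pm[OF l(1)] subm_KV[OF lP left_module.carrier_subm[OF lP]]])
   then show False using e_Pc[OF l(1)] e_notin_J[OF l(1)] J_zero by auto
  qed
  ultimately have "~ kdim X (car X) <= kdim ?X' (car ?X')" by simp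
  then have "?X':fg_projectives \<Lambda>" using X(2)[of ?X'] X' inC_iff[OF inC_fdm[OF X']] by blast
  then have "projective_module \<Lambda> (direct_prod (Pm l) ?X')"
   using fg_projectives_iff by (intro projective_direct_prod projective_Pm[OF l(1)]) blast
  then have "projective_module \<Lambda> X"
   by (rule projective_iso[OF _ lX retract_iso[OF lX lP h g]])
  then show False using np by blast
 qed
 moreover have "car X ~= {\<zero>\<^sub>X}" using projective_zero[OF lX] np by blast
 ultimately show thesis using that iX by blast
qed

text \<open>An element of the socle outside the radical would produce an atom outside it, and a
  simple summand in \<open>C\<close>.\<close>

lemma pure:
 assumes no: "!!i. i < r ==> ~ inC (S i)" and X: "inC X" "lev2 X"
 shows "L X = rad X"
proof (rule ccontr)
 assume ne: "L X ~= rad X"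
 note lX = fdmD(1)[OF inC_fdm[OF X(1)]]
 interpret X: left_module \<Lambda> X by (rule lX)
 note R = rad_subm[OF lX] and LX = L_subm[OF lX]
 obtain x where x: "x:L X" "x ~: rad X" using ne lev2_rad[OF lX] X(2) by blast
 obtain l y where l: "l < r" "y:car \<Lambda>" "e l \<odot>\<^sub>X (y \<odot>\<^sub>X x) ~: rad X"
  using subm_detect[OF lX R L_closed[OF x(1)] x(2)] .
 have yx: "y \<odot>\<^sub>X x:L X" using iffD1[OF X.subm_iff LX] l(2) x(1) by blast
 then have "e l \<odot>\<^sub>X (y \<odot>\<^sub>X x):L X" using iffD1[OF X.subm_iff LX] e_closed[OF l(1)] by blast
 moreover have "e l \<odot>\<^sub>X (y \<odot>\<^sub>X x) ~= \<zero>\<^sub>X" using l(3) iffD1[OF X.subm_iff R] by metis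
 moreover have "e l \<odot>\<^sub>X (e l \<odot>\<^sub>X (y \<odot>\<^sub>X x)) = e l \<odot>\<^sub>X (y \<odot>\<^sub>X x)"
  using X.smult_assoc1[OF e_closed[OF l(1)] e_closed[OF l(1)] L_closed[OF yx]] e_idem[OF l(1)] by simp
 ultimately have "atom X l (e l \<odot>\<^sub>X (y \<odot>\<^sub>X x))" by (simp add: atom_def)
 then show False using atom_splits[OF X(1) _ l(1) l(3)] no[OF l(1)] by blast
qed

text \<open>The syzygies are followed through pairs of vectors alone, so no sequence of modules has
  to be chosen. The vectors matter only below \<open>r\<close>.\<close>

definition realized :: "(nat => nat) => (nat => nat) => bool" where
 "realized a b \<longleftrightarrow> (EX X :: ('b, 'b list) module. inC X & lev2 X & (ALL j<r. ca X j = a j & cb X j = b j))"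

lemma realized_cong:
 "realized a b ==> (!!i. i < r ==> a i = a' i) ==> (!!i. i < r ==> b i = b' i) ==> realized a' b'"
 unfolding realized_def by metis

lemma realizedI:
 assumes X: "inC X" "lev2 X" and "!!j. j < r ==> ca X j = a j" "!!j. j < r ==> cb X j = b j"
 shows "realized a b"
proof -
 have fX: "fdm X" by (rule inC_fdm[OF X(1)])
 note lX = fdmD(1)[OF fX]
 interpret X: left_module \<Lambda> X by (rule lX)
 obtain N :: "('b, 'b list) module" where N: "N:fg_modules \<Lambda>" "module_iso \<Lambda> X N"
  using fdm_representable[OF fX] .
 have lN: "lmod N" using N fg_modules_iff fdmD(1) by blast
 interpret N: left_module \<Lambda> N by (rule lN)
 obtain f g where fg: "f:mhom X N" "g:mhom N X" "!!x. x:car X ==> g (f x) = x"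
  "!!y. y:car N ==> f (g y) = y" by (rule module_isoE[OF N(2) lX]) (rule that, assumption, assumption, blast, blast)
 note gc = homD(1)[OF fg(2)] and fc = homD(1)[OF fg(1)]
 have im: "f ` car X = car N"
 proof (intro equalityI subsetI)
  fix y assume "y:car N"
  then show "y:f ` car X" using fg(4)[of y] gc[of y] by (metis image_eqI)
 qed (use fc in blast)
 have imL: "f ` L X = L N"
 proof (intro equalityI subsetI)
  fix y assume "y:L N"
  then show "y:f ` L X" using hom_L[OF lN lX fg(2)] fg(4)[OF L_closed] by (metis image_eqI)
 qed (use hom_L[OF lX lN fg(1)] in blast)
 have inj: "x = \<zero>\<^sub>X" if "x:car X" "f x = \<zero>\<^sub>N" for x
  using fg(3)[OF that(1)] that(2) hom_zero[OF lN lX fg(2)] by simp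
 have d1: "dv N j (car N) = dv X j (car X)" if "j < r" for j
  by (rule dv_inj[OF fX lN fg(1) X.carrier_subm that, unfolded im]) (rule inj)
 have d2: "dv N j (L N) = dv X j (L X)" if "j < r" for j
  by (rule dv_inj[OF fX lN fg(1) L_subm[OF lX] that, unfolded imL]) (rule inj[OF L_closed])
 have "ALL j<r. ca N j = a j & cb N j = b j" using assms(3,4) d1 d2 by (simp add: ca_def cb_def)
 moreover have "inC N" by (rule inC_iso[OF X(1) lN N(2)])
 moreover have "lev2 N"
  unfolding lev2_def
 proof (intro ballI)
  fix j j' y assume j: "j:J" "j':J" and y: "y:car N"
  have "j \<odot>\<^sub>X (j' \<odot>\<^sub>X g y) = \<zero>\<^sub>X" using X(2) j gc[OF y] unfolding lev2_def by blast
  moreover have "f (j \<odot>\<^sub>X (j' \<odot>\<^sub>X g y)) = j \<odot>\<^sub>N (j' \<odot>\<^sub>N y)"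
   using homD(3)[OF fg(1) J_sub[OF j(1)] X.smult_closed[OF J_sub[OF j(2)] gc[OF y]]]
    homD(3)[OF fg(1) J_sub[OF j(2)] gc[OF y]] fg(4)[OF y] by simp
  ultimately show "j \<odot>\<^sub>N (j' \<odot>\<^sub>N y) = \<zero>\<^sub>N" using hom_zero[OF lX lN fg(1)] by simp
 qed
 ultimately show ?thesis unfolding realized_def by blast
qed

text \<open>The kernel of the projective cover consists of radical elements, hence has Loewy length
  two, and it contains the whole socle of the cover; so its socle has the dimension vector of the
  top of the given module.\<close>

lemma realized_syzygy:
 assumes no: "!!i. i < r ==> ~ inC (S i)" and ab: "realized a b"
 shows "(ALL i<r. b i <= Eop a i) & realized (%i. Eop a i - b i) a"
proof -
 obtain X :: "('b, 'b list) module" where X: "inC X" "lev2 X" "!!j. j < r ==> ca X j = a j" "!!j. j < r ==> cb X j = b j"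
  using ab unfolding realized_def by blast
 note fX = inC_fdm[OF X(1)]
 note lX = fdmD(1)[OF fX]
 show ?thesis
 proof (rule syzygy[OF fX X(2) pure[OF no X(1,2)]])
  fix ks p assume ks: "set ks <= {..<r}" and cnt: "!!j. j < r ==> count_list ks j = ca X j"
   and p: "p:mhom (Pl ks) X" "p ` car (Pl ks) = car X"
   and N1: "{xs:car (Pl ks). p xs = \<zero>\<^sub>X} <= listset (map Je ks)"
   and N2: "L (Pl ks) <= {xs:car (Pl ks). p xs = \<zero>\<^sub>X}"
   and N3: "!!j. j < r ==> dv (Pl ks) j {xs:car (Pl ks). p xs = \<zero>\<^sub>X} + cb X j = Eop (ca X) j + ca X j"
  let ?N = "(Pl ks)(|carrier := {xs:car (Pl ks). p xs = \<zero>\<^sub>X}|)"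
  have iN: "inC ?N" by (rule inC_hom(2)[OF fdm_Pl[OF ks] lX p inC_Pl[OF ks] X(1)])
  have lev: "lev2 ?N"
   unfolding lev2_def
  proof (intro ballI)
   fix j j' xs assume j: "j:J" "j':J" and "xs:car ?N"
   then have "xs:listset (map Je ks)" using N1 by auto
   then show "j \<odot>\<^sub>?N (j' \<odot>\<^sub>?N xs) = \<zero>\<^sub>?N"
    using J_cube[OF j] J_sub[OF j(1)] J_sub[OF j(2)] by (auto simp: in_listset_map list_eq_iff_nth_eq Je_def J_sub Alg.m_assoc)
  qed
  have "{xs:car (Pl ks). p xs = \<zero>\<^sub>X} <= car (Pl ks)" by blast
  then have LN: "L ?N = L (Pl ks)" using L_sub N2 by blast
  have cbN: "cb ?N j = a j" if "j < r" for j
   unfolding cb_def LN using dv_L_Pl[OF ks that] cnt[OF that] X(3)[OF that] by simp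
  have sum: "ca ?N j + b j = Eop a j" if j: "j < r" for j
  proof -
   have "dv ?N j (car ?N) = ca ?N j + cb ?N j" by (rule dv_split[OF inC_fdm[OF iN] j])
   moreover have "Eop (ca X) j = Eop a j" by (rule Eop_cong) (rule X(3))
   ultimately show ?thesis using N3[OF j] cbN[OF j] X(3,4)[OF j] by simp
  qed
  have caN: "ca ?N j = Eop a j - b j" "b j <= Eop a j" if "j < r" for j using sum[OF that] by linarith+
  have "realized (%i. Eop a i - b i) a" by (rule realizedI[OF iN lev caN(1) cbN])
  moreover have "ALL i<r. b i <= Eop a i" using caN(2) by blast
  ultimately show ?thesis by blast
 qed
qed

text \<open>Dual to \<open>realized_syzygy\<close>, with the hull in place of the cover. Only the
  socle of the cokernel needs care: it contains the image of the radical of \<open>Pl ks\<close>,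
  and equality depends on there being no simple module in \<open>C\<close>.\<close>

lemma realized_cosyzygy:
 assumes no: "!!i. i < r ==> ~ inC (S i)" and ab: "realized a b"
 shows "(ALL i<r. a i <= Eop b i) & realized b (%i. Eop b i - a i)"
proof -
 obtain X :: "('b, 'b list) module" where X: "inC X" "lev2 X" "!!j. j < r ==> ca X j = a j" "!!j. j < r ==> cb X j = b j"
  using ab unfolding realized_def by blast
 note fX = inC_fdm[OF X(1)]
 note lX = fdmD(1)[OF fX]
 interpret X: left_module \<Lambda> X by (rule lX)
 show ?thesis
 proof (rule injective_hull[OF fX])
  fix ks \<theta> assume ks: "set ks <= {..<r}" and cnt: "!!j. j < r ==> count_list ks j = dv X j (L X)"
   and \<theta>: "\<theta>:mhom X (Pl ks)" "!!x. x:car X ==> \<theta> x = \<zero>\<^sub>(Pl ks) ==> x = \<zero>\<^sub>X" "\<theta> ` L X = L (Pl ks)"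
  note fP = fdm_Pl[OF ks] and lP = fdmD(1)[OF fdm_Pl[OF ks]]
  interpret P: left_module \<Lambda> "Pl ks" by (rule lP)
  let ?U = "\<theta> ` car X"
  have U: "subm ?U (Pl ks)" by (rule subm_image[OF lX lP \<theta>(1) X.carrier_subm])
  have Uc: "?U <= car (Pl ks)" using homD(1)[OF \<theta>(1)] by blast
  have LU: "L (Pl ks) <= ?U" unfolding \<theta>(3)[symmetric] by (rule image_mono) (auto simp: L_def)
  have "module_iso \<Lambda> X ((Pl ks)(|carrier := ?U|))"
   by (rule module_isoI[OF lX lmod_sub[OF lP U] hom_sub_codomain[OF \<theta>(1)]]) (use \<theta>(2) in auto)
  then have "inC ((Pl ks)(|carrier := ?U|))" by (rule inC_iso[OF X(1) lmod_sub[OF lP U]])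
  then have iN: "inC (quot_module (Pl ks) ?U)" by (rule inC_quot[OF fP U _ inC_Pl[OF ks]])
  let ?N = "quot_module (Pl ks) ?U" and ?\<pi> = "cmap (Pl ks) ?U"
  note q = quot_module[OF lP U]
  interpret N: left_module \<Lambda> ?N by (rule q)
  have piL: "?\<pi> x = \<zero>\<^sub>?N" if "x:L (Pl ks)" for x using q(4)[OF L_closed[OF that]] LU that by blast
  have Nim: "EX x:car (Pl ks). y = ?\<pi> x" if "y:car ?N" for y using that q(3) by (metis imageE)
  have pis: "a \<odot>\<^sub>?N ?\<pi> x = ?\<pi> (a \<odot>\<^sub>(Pl ks) x)" if "a:car \<Lambda>" "x:car (Pl ks)" for a x
   using homD(3)[OF q(2) that] by simp
  have lev: "lev2 ?N"
   unfolding lev2_def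
  proof (intro ballI)
   fix j j' y assume j: "j:J" "j':J" and "y:car ?N"
   then obtain x where x: "x:car (Pl ks)" "y = ?\<pi> x" using Nim by blast
   have c: "j' \<odot>\<^sub>(Pl ks) x:car (Pl ks)" "j \<odot>\<^sub>(Pl ks) (j' \<odot>\<^sub>(Pl ks) x):car (Pl ks)"
    using P.smult_closed J_sub j x(1) by blast+
   have "j \<odot>\<^sub>(Pl ks) (j' \<odot>\<^sub>(Pl ks) x):L (Pl ks)"
    using c(2) J_cube_smult[OF lP _ j x(1)] unfolding L_def by blast
   then show "j \<odot>\<^sub>?N (j' \<odot>\<^sub>?N y) = \<zero>\<^sub>?N"
    using piL pis[OF J_sub[OF j(2)] x(1)] pis[OF J_sub[OF j(1)] c(1)] x(2) by simp
  qed
  let ?Je = "listset (map Je ks)"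
  have sJ: "subm ?Je (Pl ks)" by (rule Pl_listset_subm[OF ks Je_lideal]) (auto simp: Je_def)
  have Jc: "?Je <= car (Pl ks)" using iffD1[OF P.subm_iff sJ] by blast
  have JL: "j \<odot>\<^sub>(Pl ks) x:L (Pl ks)" if j: "j:J" and x: "x:?Je" for j x
  proof -
   have c: "j \<odot>\<^sub>(Pl ks) x:car (Pl ks)" using P.smult_closed[OF J_sub[OF j]] Jc x by blast
   have "j' \<odot>\<^sub>(Pl ks) (j \<odot>\<^sub>(Pl ks) x) = \<zero>\<^sub>(Pl ks)" if j': "j':J" for j'
    using J_cube[OF j' j] J_sub[OF j] J_sub[OF j'] x by (auto simp: in_listset_map list_eq_iff_nth_eq Je_def J_sub Alg.m_assoc)
   then show ?thesis using c unfolding L_def by blast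
  qed
  have JJ: "j \<odot>\<^sub>(Pl ks) x:?Je" if j: "j:J" and x: "x:car (Pl ks)" for j x
   using x iffD1[OF lideal_iff Pc_lideal[OF ks_nth[OF ks]]] J_right[OF j Pc_closed] J_sub[OF j]
   by (auto simp: in_listset_map Je_def)
  have "?\<pi> ` ?Je <= L ?N"
  proof
   fix y assume "y:?\<pi> ` ?Je"
   then obtain x where x: "x:?Je" "y = ?\<pi> x" by blast
   have xc: "x:car (Pl ks)" using x(1) Jc by blast
   have "j \<odot>\<^sub>?N y = \<zero>\<^sub>?N" if "j:J" for j using piL[OF JL[OF that x(1)]] pis[OF J_sub[OF that] xc] x(2) by simp
   then show "y:L ?N" using homD(1)[OF q(2) xc] x(2) by (simp add: L_def)
  qed
  moreover have "rad ?N <= ?\<pi> ` ?Je"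
  proof (rule rad_least[OF subm_image[OF lP q(1,2) sJ]])
   fix j y assume j: "j:J" and "y:car ?N"
   then obtain x where x: "x:car (Pl ks)" "y = ?\<pi> x" using Nim by blast
   then show "j \<odot>\<^sub>?N y:?\<pi> ` ?Je" using pis[OF J_sub[OF j] x(1)] JJ[OF j x(1)] by blast
  qed
  ultimately have LN: "L ?N = ?\<pi> ` ?Je" using pure[OF no iN lev] by blast
  have UJ: "?U <= ?Je"
  proof
   fix y assume "y:?U"
   then obtain x where x: "x:car X" "y = \<theta> x" by blast
   have yc: "y:listset (map Pc ks)" using homD(1)[OF \<theta>(1) x(1)] x(2) by simp
   have kill: "j \<odot>\<^sub>(Pl ks) (j' \<odot>\<^sub>(Pl ks) y) = \<zero>\<^sub>(Pl ks)" if j: "j:J" "j':J" for j j'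
   proof -
    have "\<theta> (j \<odot>\<^sub>X (j' \<odot>\<^sub>X x)) = j \<odot>\<^sub>(Pl ks) (j' \<odot>\<^sub>(Pl ks) y)"
     using homD(3)[OF \<theta>(1) J_sub[OF j(1)] X.smult_closed[OF J_sub[OF j(2)] x(1)]] homD(3)[OF \<theta>(1) J_sub[OF j(2)] x(1)] x(2) by simp
    moreover have "j \<odot>\<^sub>X (j' \<odot>\<^sub>X x) = \<zero>\<^sub>X" using X(2) j x(1) unfolding lev2_def by blast
    ultimately show ?thesis using hom_zero[OF lX lP \<theta>(1)] by simp
   qed
   \<comment> \<open>A component outside \<open>Je\<close> generates its whole projective, yet
     products of two radical elements kill it. The second layer of that projective would be zero,
     although it is the nonzero socle.\<close>
   have "y ! l:Je (ks ! l)" if l: "l < length ks" for l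
   proof (rule ccontr)
    assume no: "y ! l ~: Je (ks ! l)"
    let ?k = "ks ! l" and ?y = "y ! l"
    have k: "?k < r" by (rule ks_nth[OF ks l])
    have yP: "?y:Pc ?k" "?y:car \<Lambda>" "length y = length ks" using yc l Pc_closed unfolding in_listset_map by blast+
    have kl: "j \<otimes> (j' \<otimes> ?y) = \<zero>" if "j:J" "j':J" for j j'
    proof -
     have "(j \<odot>\<^sub>(Pl ks) (j' \<odot>\<^sub>(Pl ks) y)) ! l = \<zero>" unfolding kill[OF that] using l by simp
     then show ?thesis using l yP(3) by simp
    qed
    note lk = lmod_Pm[OF k]
    have yk: "?y:car (Pm ?k)" using yP by simp
    have "cyc (Pm ?k) ?y = Pc ?k"
     using proper_subm_Pm[OF k cyc_subm[OF lk yk]] cyc_self[OF lk yk] no by blast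
    then obtain z where z: "z:car \<Lambda>" "e ?k = z \<otimes> ?y" using e_Pc[OF k] by (auto simp: cyc_def)
    have "rad (Jm ?k) <= {\<zero>}"
    proof (rule rad_least)
     show "subm {\<zero>} (Jm ?k)" using left_module.zero_subm[OF lmod_Jm[OF k]] by simp
     fix j x assume j: "j:J" and "x:car (Jm ?k)"
     then have x: "x:J" "x \<otimes> e ?k = x" "x:car \<Lambda>" by (auto simp: Je_def Pc_def)
     have "j \<otimes> x = j \<otimes> ((x \<otimes> z) \<otimes> ?y)" using x z yP J_sub[OF j] Alg.m_assoc[of x z ?y] by simp
     then show "j \<odot>\<^sub>(Jm ?k) x:{\<zero>}" using kl[OF j J_right[OF x(1) z(1)]] by simp
    qed
    then have "L (Pm ?k) <= {\<zero>}" using Rj[OF k] by (simp add: Rj_def)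
    moreover obtain t where "atom (Pm ?k) ?k t" "L (Pm ?k) = cyc (Pm ?k) t" using L_Pm[OF k] .
    ultimately show False using atomD(1,4) by fastforce
   qed
   then show "y:?Je" using yc by (simp add: in_listset_map)
  qed
  have ker: "{x:?Je. ?\<pi> x = \<zero>\<^sub>?N} = ?U" "{x:car (Pl ks). ?\<pi> x = \<zero>\<^sub>?N} = ?U"
   using q(4) UJ Uc Jc by blast+
  have main: "cb ?N j + a j = Eop b j & ca ?N j = b j" if j: "j < r" for j
  proof -
   have 1: "dv (Pl ks) j ?Je = cb ?N j + dv (Pl ks) j ?U"
    using dv_hom[OF fP q(1,2) sJ j] unfolding ker cb_def LN .
   have 2: "dv (Pl ks) j (car (Pl ks)) = dv ?N j (car ?N) + dv (Pl ks) j ?U"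
    using dv_hom[OF fP q(1,2) P.carrier_subm j] unfolding ker q(3) .
   have 3: "dv (Pl ks) j ?U = a j + b j"
    using dv_inj[OF fX lP \<theta>(1) X.carrier_subm j \<theta>(2)] dv_split[OF fX j] X(3,4)[OF j] by simp
   have 4: "count_list ks i = b i" if "i < r" for i using cnt[OF that] X(4)[OF that] by (simp add: cb_def)
   have "Eop (count_list ks) j = Eop b j" by (rule Eop_cong) (rule 4)
   then show ?thesis
    using 1 2 3 4[OF j] dv_Pl_Je[OF ks j] dv_Pl_carrier[OF ks j] dv_split[OF inC_fdm[OF iN] j] by simp
  qed
  have cN: "ca ?N j = b j" "cb ?N j = Eop b j - a j" "a j <= Eop b j" if "j < r" for j using main[OF that] by linarith+
  have "realized b (%i. Eop b i - a i)" by (rule realizedI[OF iN lev cN(1,2)])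
  moreover have "ALL i<r. a i <= Eop b i" using cN(3) by blast
  ultimately show ?thesis by blast
 qed
qed

end

section \<open>Cokernels of strict maps and the exponential growth\<close>

context core
begin

text \<open>The cone of a strict map \<open>f\<close> has the cokernel of \<open>f\<close> as a direct summand: embed \<open>M\<close> into
 \<open>Y \<oplus> H\<close>, where \<open>H\<close> is the injective hull of the kernel of \<open>f\<close>.\<close>

lemma strict_coker:
 assumes M: "inC M" and Y: "inC Y" "lev2 Y" and f: "f:mhom M Y"
  and strict: "!!x. x:car M ==> f x:L Y ==> EX l:L M. f x = f l"
 shows "inC (quot_module Y (f ` car M))"
proof -
 have fM: "fdm M" and fY: "fdm Y" using M Y inC_fdm by auto
 note lM = fdmD(1)[OF fM] and lY = fdmD(1)[OF fY]
 interpret M: left_module \<Lambda> M by (rule lM)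
 interpret Y: left_module \<Lambda> Y by (rule lY)
 let ?K = "{x:car M. f x = \<zero>\<^sub>Y}"
 let ?MK = "M(|carrier := ?K|)"
 have Kc: "?K <= car M" by blast
 have fK: "fdm ?MK" by (rule fdm_sub[OF fM subm_kernel[OF lM lY f]])
 show ?thesis
 proof (rule injective_hull[OF fK])
  fix ks \<theta>\<^sub>0 assume ks: "set ks <= {..<r}" and \<theta>\<^sub>0: "\<theta>\<^sub>0:mhom ?MK (Pl ks)"
   "!!x. x:car ?MK ==> \<theta>\<^sub>0 x = \<zero>\<^sub>(Pl ks) ==> x = \<zero>\<^sub>?MK" "\<theta>\<^sub>0 ` L ?MK = L (Pl ks)"
  note lP = fdmD(1)[OF fdm_Pl[OF ks]]
  interpret P: left_module \<Lambda> "Pl ks" by (rule lP)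
  have "EX \<theta>:mhom M (Pl ks). ALL x:car ?MK. \<theta> x = \<theta>\<^sub>0 x"
  proof (rule inj_modD[OF inj_mod_Pl[OF ks] fK fM hom_incl[OF Kc] _ \<theta>\<^sub>0(1)], goal_cases)
   case (2 g)
   then show ?case by (intro bexI[of _ g] ballI)
  qed simp
  then obtain \<theta> where \<theta>: "\<theta>:mhom M (Pl ks)" "!!x. x:car ?MK ==> \<theta> x = \<theta>\<^sub>0 x" by blast
  \<comment> \<open>On the kernel of \<open>f\<close> the second component is injective, so
    \<open>M\<close> embeds into the product; the quotient \<open>?Z\<close> is the cone.\<close>
  let ?D = "direct_prod Y (Pl ks)" and ?\<phi> = "%x. (f x, \<theta> x)"
  have iD: "inC ?D" by (rule inC_direct_prod[OF Y(1) inC_Pl[OF ks]])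
  note fD = inC_fdm[OF iD] and lD = fdmD(1)[OF inC_fdm[OF iD]]
  have \<phi>: "?\<phi>:mhom M ?D" by (rule hom_pair[OF f \<theta>(1)])
  let ?U = "?\<phi> ` car M"
  have U: "subm ?U ?D" by (rule subm_image[OF lM lD \<phi> M.carrier_subm])
  have "module_iso \<Lambda> M (?D(|carrier := ?U|))"
  proof (rule module_isoI[OF lM lmod_sub[OF lD U] hom_sub_codomain[OF \<phi>]])
   fix x assume x: "x:car M" "?\<phi> x = \<zero>\<^sub>(?D(|carrier := ?U|))"
   then have xK: "x:car ?MK" "\<theta> x = \<zero>\<^sub>(Pl ks)" by auto
   then show "x = \<zero>\<^sub>M" using \<theta>\<^sub>0(2)[OF xK(1)] \<theta>(2)[OF xK(1)] by simp
  qed auto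
  then have "inC (?D(|carrier := ?U|))" by (rule inC_iso[OF M lmod_sub[OF lD U]])
  then have iZ: "inC (quot_module ?D ?U)" by (rule inC_quot[OF fD U _ iD])
  let ?Z = "quot_module ?D ?U"
  define q where "q = cmap ?D ?U"
  note q = quot_module[OF lD U, folded q_def]
  note lZ = q(1)
  interpret Z: left_module \<Lambda> ?Z by (rule lZ)
  have q\<phi>: "q (f x, \<theta> x) = \<zero>\<^sub>?Z" if "x:car M" for x
  proof -
   have "(f x, \<theta> x):car ?D" "(f x, \<theta> x):?U" using homD(1)[OF \<phi> that] that by auto
   then show ?thesis using q(4) by blast
  qed
  note fc = homD(1)[OF f] and \<theta>c = homD(1)[OF \<theta>(1)]
  \<comment> \<open>Up to sign \<open>\<tau>\<close> is \<open>f\<close> followed by the map from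
    \<open>Y\<close> to the cone. It measures the failure of that map to descend to the
    cokernel.\<close>
  define \<tau> where "\<tau> x = q (\<zero>\<^sub>Y, \<theta> x)" for x
  have \<tau>: "\<tau>:mhom M ?Z"
   unfolding \<tau>_def[abs_def] by (rule hom_comp[OF hom_comp[OF \<theta>(1) hom_in2[OF lY]] q(2)])
  have \<tau>K: "\<tau> k = \<zero>\<^sub>?Z" if "k:?K" for k
  proof -
   have "q (f k, \<theta> k) = \<zero>\<^sub>?Z" by (rule q\<phi>) (use that in blast)
   moreover have "f k = \<zero>\<^sub>Y" using that by blast
   ultimately show ?thesis by (simp add: \<tau>_def)
  qed
  have \<tau>L: "\<tau> x = \<zero>\<^sub>?Z" if x: "x:car M" "f x:L Y" for x
  proof -
   obtain l where l: "l:L M" "f x = f l" using strict[OF x] by blast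
   have lc: "l:car M" by (rule L_closed[OF l(1)])
   have "f (x \<ominus>\<^sub>M l) = \<zero>\<^sub>Y"
    using hom_minus[OF lM lY f x(1) lc] Y.M.minus_eq_zero_iff[OF fc[OF x(1)] fc[OF lc]] l(2) by simp
   then have d: "\<tau> (x \<ominus>\<^sub>M l) = \<zero>\<^sub>?Z" using \<tau>K x(1) lc by simp
   \<comment> \<open>\<open>\<theta>\<close> carries the socle of \<open>M\<close> into the socle of
     the hull, which is the image of the socle of the kernel of \<open>f\<close>. So
     \<open>l\<close> may be replaced by an element on which \<open>\<tau>\<close> vanishes.\<close>
   have "\<theta> l:\<theta>\<^sub>0 ` L ?MK" unfolding \<theta>\<^sub>0(3) by (rule hom_L[OF lM lP \<theta>(1) l(1)])
   then obtain k where k: "k:L ?MK" "\<theta> l = \<theta>\<^sub>0 k" by blast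
   have kK: "k:car ?MK" by (rule L_closed[OF k(1)])
   have "\<tau> l = \<tau> k" using k(2) \<theta>(2)[OF kK] by (simp add: \<tau>_def)
   then have l0: "\<tau> l = \<zero>\<^sub>?Z" using \<tau>K kK by simp
   have "\<tau> ((x \<ominus>\<^sub>M l) \<oplus>\<^sub>M l) = \<zero>\<^sub>?Z" using homD(2)[OF \<tau>, of "x \<ominus>\<^sub>M l" l] x(1) lc d l0 by simp
   then show ?thesis using M.M.add_minus_cancel[OF x(1) lc] by simp
  qed
  let ?fM = "f ` car M"
  have sf: "subm ?fM Y" by (rule subm_image[OF lM lY f M.carrier_subm])
  note p = quot_module[OF lY sf]
  let ?Q = "quot_module Y ?fM" and ?\<pi> = "cmap Y ?fM"
  interpret Q: left_module \<Lambda> ?Q by (rule p)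
  show ?thesis
  proof (rule complement_mod_L[OF fY Y(2) sf])
   fix N assume N: "subm N Y" "L Y <= N" "N \<inter> ?fM <= L Y"
    "!!y. y:car Y ==> EX n:N. EX u:?fM. y = n \<oplus>\<^sub>Y u"
   have Nc: "N <= car Y" using iffD1[OF Y.subm_iff N(1)] by blast
   note lN = lmod_sub[OF lY N(1)]
   let ?E = "direct_prod (Y(|carrier := N|)) M"
   have s: "(%z. fst z \<oplus>\<^sub>Y f (snd z)):mhom ?E Y"
    by (rule hom_copair[OF lN lM lY hom_incl[OF Nc] f])
   have dec: "EX n:N. EX m:car M. y = n \<oplus>\<^sub>Y f m" if "y:car Y" for y using N(4)[OF that] by blast
   \<comment> \<open>\<open>t\<close> is zero on \<open>N\<close> and agrees with
     \<open>\<tau>\<close> on the image of \<open>f\<close>. This is consistent, as \<open>N\<close>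
     meets that image only in the socle of \<open>Y\<close>, where \<open>\<tau>L\<close>
     applies.\<close>
   have "EX t:mhom Y ?Z. ALL z:car ?E. t (fst z \<oplus>\<^sub>Y f (snd z)) = \<tau> (snd z)"
   proof (rule hom_factor[OF lmod_prod[OF lN lM] lY lZ s _ hom_comp[OF hom_snd \<tau>]])
    show "(%z. fst z \<oplus>\<^sub>Y f (snd z)) ` car ?E = car Y"
    proof (intro equalityI subsetI)
     fix y assume "y:car Y"
     then obtain n m where "n:N" "m:car M" "y = n \<oplus>\<^sub>Y f m" using dec by blast
     then show "y:(%z. fst z \<oplus>\<^sub>Y f (snd z)) ` car ?E" by (intro image_eqI[of _ _ "(n, m)"]) auto
    qed (use homD(1)[OF s] in blast)
    fix z assume z: "z:car ?E" "fst z \<oplus>\<^sub>Y f (snd z) = \<zero>\<^sub>Y"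
    then have c: "fst z:N" "fst z:car Y" "snd z:car M" "f (snd z):car Y" using Nc fc by auto
    have "\<ominus>\<^sub>Y f (snd z) = fst z" by (rule Y.M.minus_equality[OF z(2) c(4,2)])
    then have "f (snd z) = \<ominus>\<^sub>Y fst z" using Y.M.minus_minus[OF c(4)] by simp
    then have "f (snd z):N" using Y.subm_neg[OF N(1) c(1)] by simp
    then show "\<tau> (snd z) = \<zero>\<^sub>?Z" using \<tau>L[OF c(3)] N(3) c(3) by blast
   qed
   then obtain t where t: "t:mhom Y ?Z" "!!z. z:car ?E ==> t (fst z \<oplus>\<^sub>Y f (snd z)) = \<tau> (snd z)" by blast
   have tn: "t (n \<oplus>\<^sub>Y f m) = \<tau> m" if "n:N" "m:car M" for n m using t(2)[of "(n, m)"] that by simp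
   have tf: "t (f m) = \<tau> m" if "m:car M" for m
    using tn[of "\<zero>\<^sub>Y" m] that iffD1[OF Y.subm_iff N(1)] fc[OF that] by simp
   have "EX \<rho>:mhom ?Z ?Q. ALL z:car ?D. \<rho> (q z) = ?\<pi> (fst z)"
   proof (rule hom_factor[OF lD lZ p(1) q(2,3) hom_comp[OF hom_fst p(2)]])
    fix z assume z: "z:car ?D" "q z = \<zero>\<^sub>?Z"
    then have "z:?U" using q(4) by blast
    then obtain x where "x:car M" "fst z = f x" by auto
    then show "?\<pi> (fst z) = \<zero>\<^sub>?Q" using p(4)[of "f x"] fc by simp
   qed
   then obtain \<rho> where \<rho>: "\<rho>:mhom ?Z ?Q" "!!z. z:car ?D ==> \<rho> (q z) = ?\<pi> (fst z)" by blast
   have \<rho>t: "\<rho> (t y) = \<zero>\<^sub>?Q" if y: "y:car Y" for y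
   proof -
    obtain n m where nm: "n:N" "m:car M" "y = n \<oplus>\<^sub>Y f m" using dec[OF y] by blast
    then have "\<rho> (t y) = ?\<pi> \<zero>\<^sub>Y" using tn[OF nm(1,2)] \<rho>(2)[of "(\<zero>\<^sub>Y, \<theta> m)"] \<theta>c[OF nm(2)] by (simp add: \<tau>_def)
    then show ?thesis using hom_zero[OF lY p(1,2)] by simp
   qed
   have g: "(%y. q (y, \<zero>\<^sub>(Pl ks)) \<oplus>\<^sub>?Z t y):mhom Y ?Z"
    by (rule hom_add[OF lY lZ hom_comp[OF hom_in1[OF lP] q(2)] t(1)])
   \<comment> \<open>Adding \<open>t\<close> corrects the map from \<open>Y\<close> to the cone: on
     \<open>f m\<close> the two terms add up to the class of \<open>(f m, \<theta> m)\<close>, which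
     is zero. The correction is invisible to \<open>\<rho>\<close>, so \<open>\<sigma>\<close> is a
     section of it.\<close>
   have "EX \<sigma>:mhom ?Q ?Z. ALL y:car Y. \<sigma> (?\<pi> y) = q (y, \<zero>\<^sub>(Pl ks)) \<oplus>\<^sub>?Z t y"
   proof (rule hom_factor[OF lY p(1) lZ p(2,3) g])
    fix y assume y: "y:car Y" "?\<pi> y = \<zero>\<^sub>?Q"
    then obtain m where m: "m:car M" "y = f m" using p(4)[OF y(1)] by blast
    have "q (f m, \<zero>\<^sub>(Pl ks)) \<oplus>\<^sub>?Z q (\<zero>\<^sub>Y, \<theta> m) = q (f m, \<theta> m)"
     using homD(2)[OF q(2), of "(f m, \<zero>\<^sub>(Pl ks))" "(\<zero>\<^sub>Y, \<theta> m)"] fc[OF m(1)] \<theta>c[OF m(1)]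
      P.M.zero_closed P.M.l_zero[OF \<theta>c[OF m(1)]] Y.M.r_zero[OF fc[OF m(1)]] by (simp del: Pl_simps)
    then show "q (y, \<zero>\<^sub>(Pl ks)) \<oplus>\<^sub>?Z t y = \<zero>\<^sub>?Z" using q\<phi>[OF m(1)] tf[OF m(1)] m(2) by (simp add: \<tau>_def)
   qed
   then obtain \<sigma> where \<sigma>: "\<sigma>:mhom ?Q ?Z"
    "!!y. y:car Y ==> \<sigma> (?\<pi> y) = q (y, \<zero>\<^sub>(Pl ks)) \<oplus>\<^sub>?Z t y" by blast
   show ?thesis
   proof (rule inC_retract[OF iZ p(1) \<sigma>(1) \<rho>(1)])
    fix x assume "x:car ?Q"
    then have "x:?\<pi> ` car Y" using p(3) by simp
    then obtain y where y: "y:car Y" "x = ?\<pi> y" by blast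
    have yD: "(y, \<zero>\<^sub>(Pl ks)):car ?D" using y(1) P.M.zero_closed by (simp del: Pl_simps)
    have "\<rho> (\<sigma> x) = ?\<pi> y \<oplus>\<^sub>?Q \<zero>\<^sub>?Q"
     using \<sigma>(2)[OF y(1)] y(2) homD(2)[OF \<rho>(1) homD(1)[OF q(2) yD] homD(1)[OF t(1) y(1)]]
      \<rho>(2)[OF yD] \<rho>t[OF y(1)] by simp
    then show "\<rho> (\<sigma> x) = x" using y(2) homD(1)[OF p(2) y(1)] by simp
   qed
  qed
 qed
qed

text \<open>A nonzero module has a nonzero socle. If the top vanishes, then socle and hence radical
  are everything by \<open>pure\<close>, and Nakayama gives zero.\<close>

lemma
 assumes no: "!!i. i < r ==> ~ inC (S i)" and X: "inC X" "lev2 X"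
 shows ca_zero: "(EX i<r. ca X i ~= 0) \<longleftrightarrow> car X ~= {\<zero>\<^sub>X}"
  and cb_zero: "(EX i<r. cb X i ~= 0) \<longleftrightarrow> car X ~= {\<zero>\<^sub>X}"
proof -
 have fX: "fdm X" by (rule inC_fdm[OF X(1)])
 note lX = fdmD(1)[OF fX]
 interpret X: left_module \<Lambda> X by (rule lX)
 note LX = L_subm[OF lX]
 have Lc: "L X <= car X" by (auto simp: L_def)
 have 1: "ca X i = 0 & cb X i = 0" if "car X = {\<zero>\<^sub>X}" "i < r" for i
  using dv_split[OF fX that(2)] dv_zero[OF fX that(2)] that(1) by simp
 have 2: "car X = {\<zero>\<^sub>X}" if "ALL i<r. cb X i = 0"
 proof (rule ccontr)
  assume "car X ~= {\<zero>\<^sub>X}"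
  then obtain x where x: "x:car X" "x ~= \<zero>\<^sub>X" using X.M.zero_closed by blast
  obtain y where "y \<odot>\<^sub>X x:L X" "y \<odot>\<^sub>X x ~= \<zero>\<^sub>X" using L_nonzero[OF lX x] by blast
  moreover have "L X = {\<zero>\<^sub>X}" by (rule dv_eq_0[OF fX LX]) (use that in \<open>simp add: cb_def\<close>)
  ultimately show False by blast
 qed
 have 3: "car X = {\<zero>\<^sub>X}" if z: "ALL i<r. ca X i = 0"
 proof -
  have "L X = car X"
   by (rule dv_eq[OF fX LX X.carrier_subm Lc]) (use dv_split[OF fX] z in \<open>simp add: cb_def\<close>)
  then have R: "rad X = car X" using pure[OF no X] by simp
  have "{\<zero>\<^sub>X} = car X"
  proof (rule nakayama[OF lX X.zero_subm])
   fix x assume "x:car X"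
   then show "EX n:{\<zero>\<^sub>X}. EX k:rad X. x = n \<oplus>\<^sub>X k" unfolding R by (intro bexI[of _ "\<zero>\<^sub>X"] bexI[of _ x]) auto
  qed
  then show ?thesis by simp
 qed
 show "(EX i<r. ca X i ~= 0) \<longleftrightarrow> car X ~= {\<zero>\<^sub>X}" using 1 3 by metis
 show "(EX i<r. cb X i ~= 0) \<longleftrightarrow> car X ~= {\<zero>\<^sub>X}" using 1 2 by metis
qed

lemma realized_zero:
 assumes no: "!!i. i < r ==> ~ inC (S i)" and "realized a b"
 shows "(EX i<r. a i ~= 0) \<longleftrightarrow> (EX i<r. b i ~= 0)"
proof -
 obtain X :: "('b, 'b list) module" where X: "inC X" "lev2 X" "ALL j<r. ca X j = a j & cb X j = b j"
  using assms(2) unfolding realized_def by blast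
 have e: "(EX i<r. a i ~= 0) \<longleftrightarrow> (EX i<r. ca X i ~= 0)" "(EX i<r. b i ~= 0) \<longleftrightarrow> (EX i<r. cb X i ~= 0)" using X(3) by metis+
 show ?thesis by (simp only: e ca_zero[OF no X(1,2)] cb_zero[OF no X(1,2)])
qed

lemma simple_in_C:
 assumes M: "M:C" "M ~: fg_projectives \<Lambda>" and w: "!!i. i < r ==> w i > 0"
  "!!i. i < r ==> \<rho> * w i <= (\<Sum>j<r. real (E i j) * w j)" and \<rho>: "\<rho> > 2"
 shows "EX i<r. inC (S i)"
proof (rule ccontr)
 assume "~ (EX i<r. inC (S i))"
 then have no: "!!i. i < r ==> ~ inC (S i)" by blast
 \<comment> \<open>Minimality is now taken among nonzero modules of Loewy length at most two in
   \<open>C\<close>, so that the image of a map can be a competitor.\<close>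
 let ?P = "%X :: ('b, 'b list) module. inC X & lev2 X & car X ~= {\<zero>\<^sub>X}"
 obtain X1 where "?P X1" by (rule lev2_exists[OF M]) blast
 then obtain X where X0: "?P X" "!!Y. ?P Y ==> kdim X (car X) <= kdim Y (car Y)"
  using ex_has_least_nat[of ?P X1 "%X. kdim X (car X)"] by blast
 then have X: "inC X" "lev2 X" "car X ~= {\<zero>\<^sub>X}" by auto
 have fX: "fdm X" by (rule inC_fdm[OF X(1)])
 note lX = fdmD(1)[OF fX]
 interpret X: left_module \<Lambda> X by (rule lX)
 have R0: "realized (ca X) (cb X)" unfolding realized_def using X by blast
 obtain a :: "int => nat => nat" where a: "a 0 = ca X" "a (-1) = cb X" "!!n. realized (a n) (a (n - 1))"
  "!!n i. i < r ==> a (n + 1) i + a (n - 1) i = Eop (a n) i"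
  by (rule two_sided_sequence[of realized, OF R0 realized_syzygy[OF no] realized_cosyzygy[OF no]])
   (assumption, assumption, assumption, assumption, rule that, assumption, assumption, blast, blast)
 have nz: "EX i<r. a n i ~= 0" for n
 proof (rule int_induct[of _ 0])
  show "EX i<r. a 0 i ~= 0" unfolding a(1) using ca_zero[OF no X(1,2)] X(3) by blast
  show "EX i<r. a (n + 1) i ~= 0" if "EX i<r. a n i ~= 0" for n
   using realized_zero[OF no a(3)[of "n + 1"]] that by simp
  show "EX i<r. a (n - 1) i ~= 0" if "EX i<r. a n i ~= 0" for n
   using realized_zero[OF no a(3)[of n]] that by simp
 qed
 interpret W: wave_sequence r E w \<rho> a
  by unfold_locales (use w \<rho> a(4) nz in auto)
 obtain m where m: "m >= 1" "dot (a 1) (a (m - 1)) < dot (a 0) (a m)" using W.pairing_positive by blast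
 obtain Y :: "('b, 'b list) module" where Y: "inC Y" "lev2 Y" "!!j. j < r ==> ca Y j = a m j" "!!j. j < r ==> cb Y j = a (m - 1) j"
  using a(3)[of m] unfolding realized_def by blast
 have fY: "fdm Y" by (rule inC_fdm[OF Y(1)])
 note lY = fdmD(1)[OF fY]
 interpret Y: left_module \<Lambda> Y by (rule lY)
 \<comment> \<open>The relations of \<open>X\<close> are counted by the top of its first syzygy, so
   the numbers compared by the strict map are exactly the two pairings.\<close>
 have E1: "Eop (ca X) j - cb X j = a 1 j" if "j < r" for j
  using a(4)[OF that, of 0] by (simp add: a(1)[symmetric] a(2)[symmetric])
 have "(\<Sum>j<r. (Eop (ca X) j - cb X j) * cb Y j) = dot (a 1) (a (m - 1))"
  unfolding dot_def by (rule sum.cong) (use E1 Y(4) in auto)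
 moreover have "(\<Sum>j<r. ca X j * ca Y j) = dot (a 0) (a m)"
  unfolding dot_def by (rule sum.cong) (use Y(3) a(1) in auto)
 ultimately have less: "(\<Sum>j<r. (Eop (ca X) j - cb X j) * cb Y j) < (\<Sum>j<r. ca X j * ca Y j)" using m(2) by simp
 show False
 proof (rule strict_map[OF fX X(2) pure[OF no X(1,2)] fY Y(2) less])
  fix f x0 assume f: "f:mhom X Y" and x0: "x0:car X" "f x0 ~= \<zero>\<^sub>Y"
   and strict: "!!x. x:car X ==> f x:L Y ==> EX l:L X. f x = f l"
  have iQ: "inC (quot_module Y (f ` car X))" by (rule strict_coker[OF X(1) Y(1,2) f strict])
  let ?U = "f ` car X"
  let ?Q = "quot_module Y ?U" and ?\<pi> = "cmap Y ?U"
  have U: "subm ?U Y" by (rule subm_image[OF lX lY f X.carrier_subm])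
  note Uc = iffD1[OF Y.subm_iff U]
  note q = quot_module[OF lY U]
  interpret Q: left_module \<Lambda> ?Q by (rule q)
  \<comment> \<open>The image is the kernel of the map from \<open>Y\<close> to a cokernel in
    \<open>C\<close>. It is a nonzero competitor of \<open>X\<close>, so it cannot be smaller and
    \<open>f\<close> has no kernel.\<close>
  have "inC (Y(|carrier := ?U|))" by (rule inC_sub[OF fY U Y(1) iQ])
  moreover have "lev2 (Y(|carrier := ?U|))" using Y(2) Uc unfolding lev2_def by auto
  moreover have "f x0:?U" using x0(1) by blast
  ultimately have "kdim X (car X) <= kdim Y ?U" using X0(2)[of "Y(|carrier := ?U|)"] x0(2) by auto
  then have "kdim X {x:car X. f x = \<zero>\<^sub>Y} = 0"
   using kdim_hom[OF fX lY hom_KV[OF f] subm_KV[OF lX X.carrier_subm]] by simp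
  then have ker: "{x:car X. f x = \<zero>\<^sub>Y} = {\<zero>\<^sub>X}"
   by (rule kdim_pos[OF fX subm_KV[OF lX subm_kernel[OF lX lY f]]])
  have inj: "x = \<zero>\<^sub>X" if "x:car X" "f x = \<zero>\<^sub>Y" for x using ker that by blast
  have pis: "b \<odot>\<^sub>?Q ?\<pi> x = ?\<pi> (b \<odot>\<^sub>Y x)" if "b:car \<Lambda>" "x:car Y" for b x
   using homD(3)[OF q(2) that] by simp
  have Qim: "EX x:car Y. y = ?\<pi> x" if "y:car ?Q" for y using that q(3) by (metis imageE)
  have lev: "lev2 ?Q"
   unfolding lev2_def
  proof (intro ballI)
   fix j j' y assume j: "j:J" "j':J" and "y:car ?Q"
   then obtain x where x: "x:car Y" "y = ?\<pi> x" using Qim by blast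
   have "j \<odot>\<^sub>Y (j' \<odot>\<^sub>Y x) = \<zero>\<^sub>Y" using Y(2) j x(1) unfolding lev2_def by blast
   then show "j \<odot>\<^sub>?Q (j' \<odot>\<^sub>?Q y) = \<zero>\<^sub>?Q"
    using pis[OF J_sub[OF j(2)] x(1)] pis[OF J_sub[OF j(1)] Y.smult_closed[OF J_sub[OF j(2)] x(1)]] x(2) hom_zero[OF lY q(1,2)] by simp
  qed
  \<comment> \<open>The radical of \<open>?Q\<close> comes from that of \<open>Y\<close>, which lies
    in the socle of \<open>Y\<close>; by \<open>pure\<close> the radical of \<open>?Q\<close> is its
    whole socle.\<close>
  have LQ: "L ?Q = ?\<pi> ` L Y"
  proof
   have "rad ?Q <= ?\<pi> ` L Y"
   proof (rule rad_least[OF subm_image[OF lY q(1,2) L_subm[OF lY]]])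
    fix j y assume j: "j:J" and "y:car ?Q"
    then obtain x where x: "x:car Y" "y = ?\<pi> x" using Qim by blast
    have "j \<odot>\<^sub>Y x:L Y" using radI[OF lY j x(1)] lev2_rad[OF lY] Y(2) by blast
    then show "j \<odot>\<^sub>?Q y:?\<pi> ` L Y" using pis[OF J_sub[OF j] x(1)] x(2) by blast
   qed
   then show "L ?Q <= ?\<pi> ` L Y" using pure[OF no iQ lev] by simp
  qed (use hom_L[OF lY q(1,2)] in blast)
  \<comment> \<open>Strictness keeps the sequence exact on socles; without it only multiplicities of
    whole modules would add up.\<close>
  have kerL: "{x:L Y. ?\<pi> x = \<zero>\<^sub>?Q} = f ` L X"
  proof (intro equalityI subsetI)
   fix y assume y: "y:{x:L Y. ?\<pi> x = \<zero>\<^sub>?Q}"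
   then have yL: "y:L Y" "?\<pi> y = \<zero>\<^sub>?Q" by auto
   then have "y:?U" using q(4)[OF L_closed[OF yL(1)]] by blast
   then obtain x where "x:car X" "y = f x" by blast
   then show "y:f ` L X" using strict[of x] yL(1) by auto
  next
   fix y assume "y:f ` L X"
   then obtain l where l: "l:L X" "y = f l" by blast
   have "y:L Y" using hom_L[OF lX lY f l(1)] l(2) by simp
   moreover have "y:?U" unfolding l(2) by (rule imageI[OF L_closed[OF l(1)]])
   ultimately show "y:{x:L Y. ?\<pi> x = \<zero>\<^sub>?Q}" using q(4)[of y] L_closed[of y Y] by simp
  qed
  have kerC: "{x:car Y. ?\<pi> x = \<zero>\<^sub>?Q} = ?U" using q(4) Uc by blast
  have cls: "a m j = ca ?Q j + a 0 j & a (m - 1) j = cb ?Q j + a (-1) j" if j: "j < r" for j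
  proof -
   have "dv Y j (car Y) = dv ?Q j (car ?Q) + dv Y j ?U"
    using dv_hom[OF fY q(1,2) Y.carrier_subm j] unfolding q(3) kerC .
   moreover have "dv Y j (L Y) = dv ?Q j (L ?Q) + dv Y j (f ` L X)"
    using dv_hom[OF fY q(1,2) L_subm[OF lY] j] unfolding kerL LQ .
   moreover have "dv Y j ?U = dv X j (car X)" by (rule dv_inj[OF fX lY f X.carrier_subm j]) (rule inj)
   moreover have "dv Y j (f ` L X) = dv X j (L X)"
    by (rule dv_inj[OF fX lY f L_subm[OF lX] j]) (rule inj[OF L_closed])
   ultimately show ?thesis
    using dv_split[OF fX j] dv_split[OF fY j] dv_split[OF inC_fdm[OF iQ] j] Y(3,4)[OF j] a(1,2) by (simp add: cb_def)
  qed
  \<comment> \<open>By \<open>cls\<close> the pair of the cokernel is \<open>(?d 0, ?d 1)\<close>,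
    the difference of the two sequences at distance \<open>m\<close>.\<close>
  let ?d = "%k i. a (m - k) i - a (- k) i"
  \<comment> \<open>A cosyzygy of the cokernel moves \<open>?d\<close> one place further. Its
    existence in \<open>C\<close> includes the inequality by which the next subtraction is genuine,
    and this is the domination one place further to the left.\<close>
  have step: "(ALL i<r. a (- int k) i <= a (m - int k) i & a (- int k - 1) i <= a (m - int k - 1) i)
    & realized (?d (int k)) (?d (int k + 1))" for k
  proof (induction k)
   case 0
   have "realized (%i. ca ?Q i) (%i. cb ?Q i)" by (rule realizedI[OF iQ lev]) auto
   then have "realized (?d 0) (?d 1)" by (rule realized_cong) (use cls in auto)
   then show ?case using cls by auto
  next
   case (Suc k)
   note k = Suc[THEN conjunct1, rule_format] and R = realized_cosyzygy[OF no conjunct2[OF Suc]]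
   have eq: "- (int k + 1) = - int k - 1" "m - (int k + 1) = m - int k - 1" "- int (Suc k) = - int k - 1"
    "m - int (Suc k) = m - int k - 1" "- (int (Suc k) + 1) = - int k - 2" "m - (int (Suc k) + 1) = m - int k - 2"
    "- int k - 1 - 1 = - int k - 2" "m - int k - 1 - 1 = m - int k - 2" "- int k - 1 + 1 = - int k" "m - int k - 1 + 1 = m - int k"
    by simp_all
   have main: "a (- int k - 2) i <= a (m - int k - 2) i &
     Eop (?d (int k + 1)) i - ?d (int k) i = a (m - int k - 2) i - a (- int k - 2) i" if i: "i < r" for i
   proof -
    have "Eop (%j. ?d (int k + 1) j + a (- int k - 1) j) i = Eop (a (m - int k - 1)) i"
     unfolding eq by (rule Eop_cong) (use k in simp)
    then have "Eop (?d (int k + 1)) i + Eop (a (- int k - 1)) i = Eop (a (m - int k - 1)) i"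
     using fun_cong[OF Eop_add] by metis
    moreover have "Eop (a (- int k - 1)) i = a (- int k) i + a (- int k - 2) i"
     using a(4)[OF i, of "- int k - 1", symmetric] unfolding eq .
    moreover have "Eop (a (m - int k - 1)) i = a (m - int k) i + a (m - int k - 2) i"
     using a(4)[OF i, of "m - int k - 1", symmetric] unfolding eq .
    moreover have "?d (int k) i <= Eop (?d (int k + 1)) i" using R i by blast
    ultimately show ?thesis using k[OF i] by linarith
   qed
   have "realized (?d (int k + 1)) (%i. Eop (?d (int k + 1)) i - ?d (int k) i)" using R by blast
   then have "realized (?d (int (Suc k))) (?d (int (Suc k) + 1))"
    unfolding eq by (rule realized_cong) (use main[unfolded eq] in simp_all)
   moreover have "a (- int (Suc k)) i <= a (m - int (Suc k)) i & a (- int (Suc k) - 1) i <= a (m - int (Suc k) - 1) i"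
    if "i < r" for i
    unfolding eq using main[OF that] k[OF that] by blast
   ultimately show ?case by blast
  qed
  obtain k i where "i < r" "a (m - int k) i < a (- int k) i" using W.shift_not_increasing[OF m(1)] by blast
  then show False using step[of k] by (meson leD)
 qed
qed

end

section \<open>Consequences of the spectral radius\<close>

context connected_algebra
begin

text \<open>The moduli of an eigenvector are nonnegative, so replacing extension dimensions by the
  larger arrow counts preserves the inequality; connectedness then makes the vector
  positive.\<close>

lemma spectral_weights:
 assumes "spectral_radius (ext_matrix K \<Lambda> r S) = \<rho>" "r > 0"
 shows "EX w. (ALL i<r. w i > 0) & (ALL i<r. \<rho> * w i <= (\<Sum>j<r. real (E i j) * w j))"
proof -
 interpret Q: adjacency_form r E
  by unfold_locales (use E_sym E_connected in blast)+
 obtain w :: "nat => real" where w: "ALL i<r. w i >= 0" "EX i<r. w i > 0"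
  "ALL i<r. \<rho> * w i <= (\<Sum>j<r. real (vectorspace.dim K (Ext \<Lambda> 1 (S i) (S j))) * w j)"
  using spectral_radius_subeigenvector[OF assms(2) assms(1)[unfolded ext_matrix_def]] by blast
 have "\<rho> * w i <= (\<Sum>j<r. real (E i j) * w j)" if i: "i < r" for i
 proof -
  have "(\<Sum>j<r. real (vectorspace.dim K (Ext \<Lambda> 1 (S i) (S j))) * w j) <= (\<Sum>j<r. real (E i j) * w j)"
   by (intro sum_mono mult_right_mono) (use ext_le[OF i] w(1) in auto)
  then show ?thesis using w(3) i by force
 qed
 then show ?thesis using Q.positive_subeigenvector[of w \<rho>] w(1,2) by blast
qed

text \<open>If the second layer of \<open>Pm i\<close> were zero, its radical would lie in its
  simple socle of type \<open>i\<close>. Row \<open>i\<close> of \<open>E\<close> would be at most a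
  single 1 on the diagonal, and the weight inequality would give \<open>\<rho> <= 1\<close>.\<close>

lemma Rj_eq_L:
 assumes w: "!!i. i < r ==> w i > 0" "!!i. i < r ==> \<rho> * w i <= (\<Sum>j<r. real (E i j) * w j)"
  and \<rho>: "\<rho> > 2" and i: "i < r"
 shows "Rj i = L (Pm i)"
proof (rule ccontr)
 assume "Rj i ~= L (Pm i)"
 then have R0: "rad (Jm i) = {\<zero>}" using Rj_cases[OF i] by (simp add: Rj_def)
 have "Je i <= L (Pm i)"
 proof
  fix x assume x: "x:Je i"
  have "j \<otimes> x = \<zero>" if "j:J" for j using radI[OF lmod_Jm[OF i] that, of x] R0 x by simp
  then show "x:L (Pm i)" using x by (simp add: L_def Je_def)
 qed
 then have "E i j <= (if j = i then 1 else 0)" if j: "j < r" for j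
  using dv_mono[OF fdm_regular Je_lideal[OF i] L_Pm_lideal(1)[OF i] _ j] dv_L_Pm[OF i j] unfolding E_def by auto
 then have "(\<Sum>j<r. real (E i j) * w j) <= (\<Sum>j<r. if j = i then w i else 0)"
  by (intro sum_mono) (use w(1) in \<open>fastforce simp: le_Suc_eq\<close>)
 then have "\<rho> * w i <= 1 * w i" using w(2)[OF i] i by simp
 then have "\<rho> <= 1" using w(1)[OF i] by simp
 then show False using \<rho> by linarith
qed

end

theorem theorem4p5:
  fixes K :: "'k ring"
    and \<Lambda> :: "('k, 'a) module"
    and r :: nat
    and S :: "nat \<Rightarrow> ('a, 'a list) module"
  assumes "field K"
    and "k_algebra K \<Lambda>"
    and "vectorspace.fin_dim K \<Lambda>"
    and "split_algebra K \<Lambda>"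
    and "indecomposable_algebra K \<Lambda>"
    and "weakly_symmetric \<Lambda>"
    and "radical_cube_zero \<Lambda>"
    and "simple_representatives \<Lambda> r S"
    and "spectral_radius (ext_matrix K \<Lambda> r S) > 2"
  shows "{C. thick_subcategory \<Lambda> C \<and> contains_regular \<Lambda> C} = {fg_projectives \<Lambda>, fg_modules \<Lambda>}"
proof -
 have fd: "fd_algebra K \<Lambda>" using assms(2,3) by (intro fd_algebra.intro fd_algebra_axioms.intro)
 have conn: "connected_algebra K \<Lambda> r S"
  using assms fd
  by (intro connected_algebra.intro ws_algebra.intro split_rad3_algebra.intro rad3_algebra.intro
    connected_algebra_axioms.intro ws_algebra_axioms.intro split_rad3_algebra_axioms.intro rad3_algebra_axioms.intro)
 interpret connected_algebra K \<Lambda> r S by (rule conn)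
 have proj: "fg_projectives \<Lambda> \<subseteq> fg_modules \<Lambda>" by (auto simp: fg_projectives_def)
 have "C = fg_projectives \<Lambda> \<or> C = fg_modules \<Lambda>" if C: "thick_subcategory \<Lambda> C" "contains_regular \<Lambda> C" for C
 proof (cases "C \<subseteq> fg_projectives \<Lambda>")
  case True
  interpret thick K \<Lambda> C using C by unfold_locales
  show ?thesis using True fg_projectives_subset by blast
 next
  case False
  then obtain M where M: "M \<in> C" "M \<notin> fg_projectives \<Lambda>" by blast
  have CM: "C \<subseteq> fg_modules \<Lambda>" using C(1) unfolding thick_subcategory_def by blast
  then have fM: "fdm M" using M(1) fg_modules_iff by blast
  then have "carrier M \<noteq> {\<zero>\<^bsub>M\<^esub>}" using projective_zero[OF fdmD(1)[OF fM]] M(2) fg_projectives_iff by blast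
  \<comment> \<open>A nonprojective module is nonzero and contains an atom, whose type is an index
    below \<open>r\<close>; the eigenvector argument needs a nonempty matrix.\<close>
  then have "r > 0"
   using atom_exists[OF fdmD(1)[OF fM] left_module.carrier_subm[OF fdmD(1)[OF fM]]] by force
  then obtain w where w: "\<And>i. i < r ==> w i > 0"
   "\<And>i. i < r ==> spectral_radius (ext_matrix K \<Lambda> r S) * w i \<le> (\<Sum>j<r. real (E i j) * w j)"
   using spectral_weights[OF refl] by blast
  interpret core K \<Lambda> r S C
   using C Rj_eq_L[OF w assms(9)] by unfold_locales
  obtain i where i: "i < r" "inC (S i)" using simple_in_C[OF M w assms(9)] by blast
  have "N \<in> C" if "N \<in> fg_modules \<Lambda>" for N
  proof -
   have fN: "fdm N" using that fg_modules_iff by blast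
   show ?thesis using all_modules[OF i fN] inC_iff[OF fN] by blast
  qed
  then show ?thesis using CM by blast
 qed
 then show ?thesis
  using thick_fg_projectives[OF assms(6)] thick_fg_modules contains_regularI[of "fg_projectives \<Lambda>"]
   contains_regularI[of "fg_modules \<Lambda>"] proj by blast
qed

end
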